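(* Consider the system of $N\ge2$ interacting reinforced stochastic processes described in the context, under assumptions (A1)–(A4) listed there, and let $\mathbf{Y}_n=(\mathbf{Z}_n^\top,\mathbf{N}_n^\top)^\top\in\mathbb{R}^{2N}$. Let $$\gamma_0:=\max\{1/2,\,2\gamma-1\},\qquad \widetilde\Sigma_\gamma:=\widetilde\sigma_\gamma^2\,\mathbf{1}\mathbf{1}^\top\ (2N\times 2N),\qquad \widetilde\sigma_\gamma^2:=\frac{\|\mathbf{v}_1\|^2c^2}{N(2\gamma-1)},$$ and let $S^{(q)}$ be the $N\times N$ matrix with entries $[S^{(q)}]_{j_1j_2}:=\frac{q}{2}\mathbf{v}_{j_1}^\top\mathbf{v}_{j_2}$, $1\le j_1,j_2\le N$. The following hold. (a) If $1/2<\nu<\gamma_0$, then $$n^{\nu/2}(\mathbf{Y}_n-Z_\infty\mathbf{1})\longrightarrow\mathcal{N}\left(\mathbf{0},\,Z_\infty(1-Z_\infty)\begin{pmatrix}\mathbf{0}&\mathbf{0}\\ \mathbf{0}&\widetilde U S^{(q)}\widetilde U^\top\end{pmatrix}\right)\quad\text{stably}.$$ (b) If $\gamma_0<\nu<1$, then $$n^{\gamma-\frac12}(\mathbf{Y}_n-Z_\infty\mathbf{1})\longrightarrow\mathcal{N}\left(\mathbf{0},\,Z_\infty(1-Z_\infty)\widetilde\Sigma_\gamma\right)\quad\text{stably}.$$ (c) If $\nu=\gamma_0<1$, then $$n^{\gamma-\frac12}(\mathbf{Y}_n-Z_\infty\mathbf{1})\longrightarrow\mathcal{N}\left(\mathbf{0},\,Z_\infty(1-Z_\infty)\left(\widetilde\Sigma_\gamma+\begin{pmatrix}\mathbf{0}&\mathbf{0}\\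 \mathbf{0}&\widetilde U S^{(q)}\widetilde U^\top\end{pmatrix}\right)\right)\quad\text{stably}.$$ (d) If $\nu=\gamma_0=1$ (that is $\nu=\gamma=1$), then $$\sqrt n(\mathbf{Y}_n-Z_\infty\mathbf{1})\longrightarrow\mathcal{N}\left(\mathbf{0},\,Z_\infty(1-Z_\infty)\left(\widetilde\Sigma_1+\begin{pmatrix}\widetilde US^{11}\widetilde U^\top&\widetilde US^{12}\widetilde U^\top\\ \widetilde US^{21}\widetilde U^\top&\widetilde US^{22}\widetilde U^\top\end{pmatrix}\right)\right)\quad\text{stably},$$ where $S^{11},S^{12},S^{21},S^{22}$ are the $N\times N$ matrices with $S^{21}=(S^{12})^\top$ and, for $2\le j_1,j_2,j\le N$, $$[S^{11}]_{11}=[S^{11}]_{j_11}=[S^{11}]_{1j_2}:=0,\qquad [S^{11}]_{j_1j_2}:=\frac{c^2}{c(\alpha_{j_1}+\alpha_{j_2})-1}\mathbf{v}_{j_1}^\top\mathbf{v}_{j_2},$$ $$[S^{12}]_{11}=[S^{12}]_{1j_2}:=0,\qquad [S^{12}]_{j_11}:=\frac{c(q-c)}{c\alpha_{j_1}+q-1}\mathbf{v}_{j_1}^\top\mathbf{v}_1,$$ $$[S^{12}]_{j_1j_2}:=\frac{cq(c\alpha_{j_1}+c-1)}{(c\alpha_{j_1}+c\alpha_{j_2}-1)(c\alpha_{j_1}+q-1)}\mathbf{v}_{j_1}^\top\mathbf{v}_{j_2},$$ $$[S^{22}]_{11}:=\frac{(q-c)^2}{2q-1}\|\mathbf{v}_1\|^2,\qquad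 [S^{22}]_{j1}=[S^{22}]_{1j}:=\frac{q(q-c)(c+q-1)}{(c\alpha_j+q-1)(2q-1)}\mathbf{v}_j^\top\mathbf{v}_1,$$ $$[S^{22}]_{j_1j_2}:=q^2\,\frac{A_{j_1j_2}+B_{j_1j_2}}{(2q-1)(c(\alpha_{j_1}+\alpha_{j_2})-1)(c\alpha_{j_1}+q-1)(c\alpha_{j_2}+q-1)}\,\mathbf{v}_{j_1}^\top\mathbf{v}_{j_2},$$ with $A_{j_1j_2}=c^3(\alpha_{j_1}+\alpha_{j_2})+2c^2q(\alpha_{j_1}\alpha_{j_2}+1)-c^2(\alpha_{j_1}\alpha_{j_2}+\alpha_{j_1}+\alpha_{j_2}+2)$ and $B_{j_1j_2}=c(q-1)^2(\alpha_{j_1}+\alpha_{j_2})-(2c+q-1)(q-1)$. (e) If $\gamma_0<\nu=1$, then $$n^{\gamma-\frac12}(\mathbf{Y}_n-Z_\infty\mathbf{1})\longrightarrow\mathcal{N}\left(\mathbf{0},\,Z_\infty(1-Z_\infty)\left(\widetilde\Sigma_\gamma+\frac{\|\mathbf{v}_1\|^2c^2}{N[2q-(2\gamma-1)]}\begin{pmatrix}\mathbf{0}&\mathbf{0}\\ \mathbf{0}&\mathbf{1}\mathbf{1}^\top\end{pmatrix}\right)\right)\quad\text{stably}.$$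
   Context: Model. Let $N\ge 2$, $V=\{1,\dots,N\}$, and let $W=[w_{h,j}]_{h,j\in V}$ be a deterministic matrix with $w_{h,j}\ge 0$ and $\sum_{h=1}^N w_{h,j}=1$ for each $j\in V$ (i.e. $W^\top\mathbf{1}=\mathbf{1}$). Let $(r_n)_{n\ge 0}$ be a sequence of real numbers in $(0,1)$ and $(a_k)_{k\ge1}$ a sequence of strictly positive real numbers; set $q_{n,k}:=a_k/\sum_{l=1}^n a_l$ for $1\le k\le n$. On a probability space $(\Omega,\mathcal{A},P)$, let $Z_{0,j}$ ($j\in V$) be random variables with values in $[0,1]$, let $X_{n,j}$ ($n\ge1$, $j\in V$) be random variables with values in $\{0,1\}$, and let $\mathcal{F}_n:=\sigma(Z_{0,h}:h\in V)\vee\sigma(X_{k,j}:1\le k\le n,\,j\in V)$. For every $n\ge 0$ the variables $\{X_{n+1,j}:j\in V\}$ are conditionally independent given $\mathcal{F}_n$ with $P(X_{n+1,j}=1\mid\mathcal{F}_n)=\sum_{h=1}^N w_{h,j}Z_{n,h}$, where, for $n\ge1$, $Z_{n,h}=(1-r_{n-1})Z_{n-1,h}+r_{n-1}X_{n,h}$. The weighted empirical means are $N_{0,j}:=0$ and $N_{n,j}:=\sum_{k=1}^n q_{n,k}X_{k,j}$ for $n\ge 1$. Set $\mathbf{Z}_n=(Z_{n,1},\dots,Z_{n,N})^\top$, $\mathbf{N}_n=(N_{n,1},\dots,N_{n,N})^\top$. Assumptions. (A1) $W$ is irreducible and diagonalizable over $\mathbb{C}$. (A2) There are $\gamma,\nu\in(1/2,1]$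 and $c,q>0$ with $r_{n-1}=cn^{-\gamma}+O(n^{-2\gamma})$ and $q_{n,n}=qn^{-\nu}+O(n^{-2\nu})$. (A3) Let $\lambda^*$ be an eigenvalue of maximal real part among the eigenvalues of $W$ other than $1$. When $\gamma=1$, assume $c>1/[2(1-\mathrm{Re}(\lambda^* ))]$; when $\nu=1$, assume $q>1/2$. (A4) When $\nu=\gamma$, assume $q\ne c\alpha_j$ for all $j\ge 2$, with $\alpha_j$ defined below. Eigen-structure. Let $\lambda_1,\dots,\lambda_N$ be the eigenvalues of $W$ (with multiplicity), $\lambda_1=1$ (which is simple), and $\alpha_j:=1-\lambda_j$ for $j\ge2$. $\widetilde U=(\mathbf{u}_1\ \cdots\ \mathbf{u}_N)$ is a non-singular matrix such that $\widetilde U^\top W(\widetilde U^\top)^{-1}=\mathrm{diag}(\lambda_1,\dots,\lambda_N)$, i.e. $\mathbf{u}_j$ is a left eigenvector of $W$ for $\lambda_j$, with $\|\mathbf{u}_j\|=1$, with eigenvectors belonging to the same multiple eigenvalue chosen orthogonal, and $\mathbf{u}_1=N^{-1/2}\mathbf{1}$. $\widetilde V=(\mathbf{v}_1\ \cdots\ \mathbf{v}_N):=(\widetilde U^\top)^{-1}$, so $\mathbf{v}_j$ is a right eigenvector for $\lambda_j$, $\mathbf{u}_j^\top\mathbf{v}_j=1$ and $\mathbf{u}_h^\top\mathbf{v}_j=0$ for $h\ne j$. $\|\mathbf{v}\|^2=\overline{\mathbf{v}}^\top\mathbf{v}$. $\mathbf{1}$, $\mathbf{0}$ denote vectors/matrices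 of ones/zeros of the appropriate dimension. $Z_\infty$ is the $[0,1]$-valued random variable such that $\mathbf{Z}_n\to Z_\infty\mathbf{1}$ almost surely (its existence is known under these assumptions). Stable convergence. A random sequence $Y_n$ in $\mathbb{R}^d$ converges stably to a kernel (random probability measure) $K$ on $\mathbb{R}^d$ if, for every $H\in\mathcal{A}$ with $P(H)>0$, $P(Y_n\in\cdot\mid H)\to E[K(\cdot)\mid H]$ weakly. For a random positive semidefinite matrix $\Sigma$, $\mathcal{N}(\mathbf{0},\Sigma)$ denotes the kernel $\omega\mapsto\mathcal{N}(\mathbf{0},\Sigma(\omega))$. *)

theory Defs
  imports "HOL-Probability.Probability" "HOL-Library.Landau_Symbols"
begin

section \<open>Stable convergence and Gaussian kernels\<close>

definition weak_conv_to :: "(nat \<Rightarrow> 'b measure) \<Rightarrow> ('b::metric_space) measure \<Rightarrow> bool" where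
  "weak_conv_to \<mu>s \<mu> \<longleftrightarrow>
    (\<forall>f :: 'b \<Rightarrow> real. continuous_on UNIV f \<longrightarrow> bounded (range f) \<longrightarrow>
       (\<lambda>n. integral\<^sup>L (\<mu>s n) f) \<longlonglongrightarrow> integral\<^sup>L \<mu> f)"

text \<open>For an event \<open>H\<close> of positive probability, \<open>uniform_measure M H\<close> is \<open>P(\<cdot> | H)\<close>, so that
  the monadic bind below is the mixture \<open>E[K(\<cdot>) | H]\<close>.\<close>

definition converges_stably ::
    "'a measure \<Rightarrow> (nat \<Rightarrow> 'a \<Rightarrow> 'b::metric_space) \<Rightarrow> ('a \<Rightarrow> 'b measure) \<Rightarrow> bool" where
  "converges_stably M Y K \<longleftrightarrow>
     (\<forall>n. Y n \<in> borel_measurable M) \<and>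
     K \<in> M \<rightarrow>\<^sub>M prob_algebra borel \<and>
     (\<forall>H \<in> sets M. measure M H > 0 \<longrightarrow>
        weak_conv_to (\<lambda>n. distr (uniform_measure M H) borel (Y n))
                     (uniform_measure M H \<bind> K))"

definition std_mvnormal :: "(real^'d) measure" where
  "std_mvnormal = density lborel (\<lambda>x. ennreal (\<Prod>i\<in>UNIV. std_normal_density (x $ i)))"

text \<open>The centred normal law with covariance \<open>S\<close>, degenerate \<open>S\<close> allowed, as the image of the
  standard one under a square root of \<open>S\<close>.  Such an \<open>A\<close> exists precisely if \<open>S\<close> is symmetric
  positive semidefinite, and the resulting law does not depend on which one is chosen.\<close>

definition mvnormal :: "real^'d^'d \<Rightarrow> (real^'d) measure" where
  "mvnormal S = distr std_mvnormal borel (\<lambda>x. (SOME A :: real^'d^'d. A ** transpose A = S) *v x)"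

definition pos_semidef :: "real^'d^'d \<Rightarrow> bool" where
  "pos_semidef S \<longleftrightarrow> transpose S = S \<and> (\<forall>x. 0 \<le> x \<bullet> (S *v x))"

abbreviation cmat :: "real^'n^'m \<Rightarrow> complex^'n^'m" where
  "cmat \<equiv> map_matrix complex_of_real"

text \<open>The limiting covariances are written with complex eigenvectors, although they are real
  matrices.  Instead of discarding imaginary parts, the following predicate demands that the given
  complex random matrix is real and positive semidefinite.\<close>

definition converges_stably_to_normal ::
    "'a measure \<Rightarrow> (nat \<Rightarrow> 'a \<Rightarrow> real^'d) \<Rightarrow> ('a \<Rightarrow> complex^'d^'d) \<Rightarrow> bool" where
  "converges_stably_to_normal M Y \<Sigma> \<longleftrightarrow>
     (\<exists>S. (\<forall>\<omega>\<in>space M. pos_semidef (S \<omega>) \<and> cmat (S \<omega>) = \<Sigma> \<omega>) \<and>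
          converges_stably M Y (\<lambda>\<omega>. mvnormal (S \<omega>)))"

section \<open>Conditional independence\<close>

definition cond_indep_vars ::
    "'a measure \<Rightarrow> 'a measure \<Rightarrow> 'b measure \<Rightarrow> ('i \<Rightarrow> 'a \<Rightarrow> 'b) \<Rightarrow> 'i set \<Rightarrow> bool" where
  "cond_indep_vars M F N X I \<longleftrightarrow>
     (\<forall>i\<in>I. X i \<in> M \<rightarrow>\<^sub>M N) \<and>
     (\<forall>J A. J \<subseteq> I \<longrightarrow> finite J \<longrightarrow> (\<forall>i\<in>J. A i \<in> sets N) \<longrightarrow>
        (AE \<omega> in M. real_cond_exp M F (indicator {\<omega> \<in> space M. \<forall>i\<in>J. X i \<omega> \<in> A i}) \<omega> =
           (\<Prod>i\<in>J. real_cond_exp M F (indicator {\<omega> \<in> space M. X i \<omega> \<in> A i}) \<omega>)))"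

section \<open>Matrices\<close>

text \<open>Irreducibility as strong connectedness of the weighted graph with adjacency matrix \<open>W\<close>.\<close>

definition irreducible_matrix :: "real^'n^'n \<Rightarrow> bool" where
  "irreducible_matrix W \<longleftrightarrow> (\<forall>i j. (i, j) \<in> {(i, j). W $ i $ j \<noteq> 0}\<^sup>*)"

definition diag_matrix :: "('n \<Rightarrow> 'b::zero) \<Rightarrow> 'b^'n^'n" where
  "diag_matrix d = (\<chi> i j. if i = j then d i else 0)"

definition diagonalizable :: "complex^'n^'n \<Rightarrow> bool" where
  "diagonalizable A \<longleftrightarrow> (\<exists>(P :: complex^'n^'n) d. invertible P \<and> matrix_inv P ** A ** P = diag_matrix d)"

definition is_eigenvalue :: "complex^'n^'n \<Rightarrow> complex \<Rightarrow> bool" where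
  "is_eigenvalue A z \<longleftrightarrow> (\<exists>x. x \<noteq> 0 \<and> A *v x = z *s x)"

text \<open>The index type \<open>'n + 'n\<close> stands for the \<open>2N\<close> coordinates: \<open>Inl\<close> for the first block,
  \<open>Inr\<close> for the second.\<close>

definition stack :: "'b^'n \<Rightarrow> 'b^'m \<Rightarrow> 'b^('n + 'm)" where
  "stack x y = (\<chi> k. case k of Inl i \<Rightarrow> x $ i | Inr i \<Rightarrow> y $ i)"

definition block_matrix ::
    "'b^'n^'n \<Rightarrow> 'b^'m^'n \<Rightarrow> 'b^'n^'m \<Rightarrow> 'b^'m^'m \<Rightarrow> 'b^('n + 'm)^('n + 'm)" where
  "block_matrix A B C D = (\<chi> k. case k of Inl i \<Rightarrow> stack (A $ i) (B $ i)
                                          | Inr i \<Rightarrow> stack (C $ i) (D $ i))"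

definition ones_matrix :: "complex^'n^'m" where
  "ones_matrix = (\<chi> i j. 1)"

section \<open>The model\<close>

definition hist_algebra ::
    "'a measure \<Rightarrow> ('n \<Rightarrow> 'a \<Rightarrow> real) \<Rightarrow> (nat \<Rightarrow> 'n \<Rightarrow> 'a \<Rightarrow> real) \<Rightarrow> nat \<Rightarrow> 'a measure" where
  "hist_algebra M Z0 X n = sigma (space M)
     ({Z0 h -` B \<inter> space M | h B. B \<in> sets borel} \<union>
      {X k j -` B \<inter> space M | k j B. 1 \<le> k \<and> k \<le> n \<and> B \<in> sets borel})"

definition wgt :: "(nat \<Rightarrow> real) \<Rightarrow> nat \<Rightarrow> nat \<Rightarrow> real" where
  "wgt a n k = a k / (\<Sum>l=1..n. a l)"

definition wgt_mean :: "(nat \<Rightarrow> real) \<Rightarrow> (nat \<Rightarrow> 'n \<Rightarrow> 'a \<Rightarrow> real) \<Rightarrow> nat \<Rightarrow> 'n \<Rightarrow> 'a \<Rightarrow> real" where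
  "wgt_mean a X n j \<omega> = (\<Sum>k=1..n. wgt a n k * X k j \<omega>)"

section \<open>The asymptotic covariances\<close>

text \<open>Eigenvalue indices range over the same type \<open>'n\<close> as the vertices; \<open>\<iota>\<close> plays the role of the
  index 1, that is, of the eigenvalue 1, and \<open>column j V\<close> is the right eigenvector \<open>v\<^sub>j\<close>.
  As in \<open>v\<^sub>i\<^sup>T v\<^sub>j\<close>, \<open>scalar_product\<close> involves no complex conjugation.\<close>

abbreviation vprod :: "complex^'n^'n \<Rightarrow> 'n \<Rightarrow> 'n \<Rightarrow> complex" where
  "vprod V i j \<equiv> scalar_product (column i V) (column j V)"

definition sigma_tilde_sq :: "real \<Rightarrow> real \<Rightarrow> complex^'n^'n \<Rightarrow> 'n \<Rightarrow> real" where
  "sigma_tilde_sq \<gamma> c V \<iota> = (norm (column \<iota> V))\<^sup>2 * c\<^sup>2 / (real CARD('n) * (2 * \<gamma> - 1))"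

definition Sigma_tilde :: "real \<Rightarrow> real \<Rightarrow> complex^'n^'n \<Rightarrow> 'n \<Rightarrow> complex^('n + 'n)^('n + 'n)" where
  "Sigma_tilde \<gamma> c V \<iota> = sigma_tilde_sq \<gamma> c V \<iota> *\<^sub>R ones_matrix"

definition Sq :: "real \<Rightarrow> complex^'n^'n \<Rightarrow> complex^'n^'n" where
  "Sq q V = (\<chi> i j. complex_of_real q / 2 * vprod V i j)"

context
  fixes c q :: complex and \<alpha> :: "'n::finite \<Rightarrow> complex" and V :: "complex^'n^'n" and \<iota> :: 'n
begin

definition S11 :: "complex^'n^'n" where
  "S11 = (\<chi> i j.
     if i = \<iota> \<or> j = \<iota> then 0
     else c\<^sup>2 / (c * (\<alpha> i + \<alpha> j) - 1) * vprod V i j)"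

definition S12 :: "complex^'n^'n" where
  "S12 = (\<chi> i j.
     if i = \<iota> then 0
     else if j = \<iota> then c * (q - c) / (c * \<alpha> i + q - 1) * vprod V i \<iota>
     else c * q * (c * \<alpha> i + c - 1) / ((c * \<alpha> i + c * \<alpha> j - 1) * (c * \<alpha> i + q - 1)) * vprod V i j)"

definition A_coeff :: "'n \<Rightarrow> 'n \<Rightarrow> complex" where
  "A_coeff i j = c ^ 3 * (\<alpha> i + \<alpha> j) + 2 * c\<^sup>2 * q * (\<alpha> i * \<alpha> j + 1)
     - c\<^sup>2 * (\<alpha> i * \<alpha> j + \<alpha> i + \<alpha> j + 2)"

definition B_coeff :: "'n \<Rightarrow> 'n \<Rightarrow> complex" where
  "B_coeff i j = c * (q - 1)\<^sup>2 * (\<alpha> i + \<alpha> j) - (2 * c + q - 1) * (q - 1)"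

definition S22 :: "complex^'n^'n" where
  "S22 = (\<chi> i j.
     if i = \<iota> \<and> j = \<iota> then
       (q - c)\<^sup>2 / (2 * q - 1) * complex_of_real ((norm (column \<iota> V))\<^sup>2)
     else if j = \<iota> then
       q * (q - c) * (c + q - 1) / ((c * \<alpha> i + q - 1) * (2 * q - 1)) * vprod V i \<iota>
     else if i = \<iota> then
       q * (q - c) * (c + q - 1) / ((c * \<alpha> j + q - 1) * (2 * q - 1)) * vprod V j \<iota>
     else
       q\<^sup>2 * ((A_coeff i j + B_coeff i j) /
             ((2 * q - 1) * (c * (\<alpha> i + \<alpha> j) - 1) * (c * \<alpha> i + q - 1) * (c * \<alpha> j + q - 1)))
         * vprod V i j)"

end

end

theory Submission
  imports Defs "HOL-Real_Asymp.Real_Asymp"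
begin

text \<open>Let \<open>z\<^sub>n\<close> be the mean of \<open>Z\<^sub>n\<close> with respect to the right eigenvector of \<open>W\<close> for the eigenvalue 1,
  normalised to total mass 1.  It is a martingale with limit \<open>Z\<^sub>\<infinity>\<close>, and \<open>(Z\<^sub>n - z\<^sub>n 1, N\<^sub>n - z\<^sub>n 1)\<close>
  solves a linear recursion driven by the same martingale differences
  \<open>X\<^sub>n\<^sub>+\<^sub>1 - E[X\<^sub>n\<^sub>+\<^sub>1 | F\<^sub>n]\<close>.  Up to a negligible tail, the rescaled vector \<open>Y\<^sub>n - Z\<^sub>\<infinity> 1\<close> is therefore a
  linear combination of martingale differences with small deterministic coefficients.  The increments
  up to time \<open>n\<close> contribute a covariance that satisfies, in eigenvector coordinates, scalar affine
  recursions; those after time \<open>n\<close> contribute a multiple of the all-ones matrix through the tail of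
  the sum of the squared step sizes.  The conditional variances of the martingale differences
  converge to \<open>Z\<^sub>\<infinity> (1 - Z\<^sub>\<infinity>)\<close>, so characteristic functions, tested against an arbitrary event, give
  stable convergence.\<close>

section \<open>Affine recursions\<close>

text \<open>Past and future are not two limits to be combined: both enter one triangular array over
  the same differences. A stable limit then needs only that the largest coefficient vanishes and
  that the sum of squares converges; disjoint time ranges make the two covariances add. The future
  is an infinite series, so it is cut at a deterministic time far beyond \<open>n\<close>, which
  spares any rate for the convergence to \<open>Zinf\<close>. To first order, the recursions for
  pairs of eigenvector coordinates contract at rates \<open>r n * (\<alpha> i + \<alpha> j)\<close>,
  \<open>r n * \<alpha> i + s n\<close> and \<open>2 * s n\<close>. The scale
  \<open>n powr p\<close>, with \<open>p\<close> the smaller of \<nu> and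
  \<open>2 * \<gamma> - 1\<close>, grows by a factor of about \<open>1 + p / n\<close> per step.
  This competes with a contraction only if the step itself is of order \<open>1 / n\<close>, whence
  the \<open>- 1\<close> in the denominators of regime (d) and
  \<open>2 * q - (2 * \<gamma> - 1)\<close> in (e). Products are taken without conjugation, to match
  \<open>vprod\<close>; that the limit matrix is real is read off from its being a limit of real
  ones.\<close>

lemma contraction_recursion_tendsto_zero:
  fixes a e y :: "nat \<Rightarrow> real"
  assumes a0: "\<And>n. 0 \<le> a n"
    and ev: "\<forall>\<^sub>F n in sequentially. a (Suc n) \<le> (1 - \<delta> * e n) * a n + e n * y n"
    and \<delta>: "\<delta> > 0" and e0: "\<And>n. 0 \<le> e n" and e: "e \<longlonglongrightarrow> 0"
    and div: "filterlim (\<lambda>n. \<Sum>k<n. e k) at_top sequentially"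
    and y: "y \<longlonglongrightarrow> 0"
  shows "a \<longlonglongrightarrow> 0"
proof (rule LIMSEQ_I)
  fix \<epsilon> :: real assume "\<epsilon> > 0"
  define \<eta> where "\<eta> = \<epsilon> / 2"
  have \<eta>: "\<eta> > 0" using \<open>\<epsilon> > 0\<close> by (simp add: \<eta>_def)
  have "\<forall>\<^sub>F n in sequentially. y n < \<delta> * \<eta>" using order_tendstoD(2)[OF y, of "\<delta> * \<eta>"] \<delta> \<eta> by simp
  moreover have "\<forall>\<^sub>F n in sequentially. e n < 1 / \<delta>" using order_tendstoD(2)[OF e, of "1/\<delta>"] \<delta> by simp
  ultimately have "\<forall>\<^sub>F n in sequentially. y n < \<delta> * \<eta> \<and> e n < 1 / \<delta> \<and> a (Suc n) \<le> (1 - \<delta> * e n) * a n + e n * y n"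
    using ev by eventually_elim auto
  then obtain N where N: "\<And>n. n \<ge> N \<Longrightarrow> y n < \<delta> * \<eta> \<and> e n < 1 / \<delta> \<and> a (Suc n) \<le> (1 - \<delta> * e n) * a n + e n * y n"
    unfolding eventually_sequentially by blast
  \<comment> \<open>Only an upper bound on \<open>a\<close> is available, so the excess over \<eta>
    is cut at zero. It shrinks by \<open>exp (- (\<delta> * e n))\<close> per step and dies out
    because the steps are not summable.\<close>
  define m where "m n = max 0 (a n - \<eta>)" for n
  have step: "m (Suc n) \<le> exp (- (\<delta> * e n)) * m n" if "n \<ge> N" for n
  proof -
    have "e n * y n \<le> e n * (\<delta> * \<eta>)" using N[OF that] e0 by (intro mult_left_mono) auto
    then have *: "a (Suc n) - \<eta> \<le> (1 - \<delta> * e n) * (a n - \<eta>)" using N[OF that] by (simp add: algebra_simps)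
    have pos: "0 \<le> 1 - \<delta> * e n" using N[OF that] \<delta> by (simp add: field_simps)
    have "(1 - \<delta> * e n) * (a n - \<eta>) \<le> (1 - \<delta> * e n) * m n" using pos by (intro mult_left_mono) (auto simp: m_def)
    moreover have "0 \<le> (1 - \<delta> * e n) * m n" using pos by (auto simp: m_def)
    ultimately have "m (Suc n) \<le> (1 - \<delta> * e n) * m n" using * by (simp add: m_def)
    also have "\<dots> \<le> exp (- (\<delta> * e n)) * m n"
      using exp_ge_add_one_self[of "- (\<delta> * e n)"] by (intro mult_right_mono) (auto simp: m_def)
    finally show ?thesis .
  qed
  have bd: "m (N + k) \<le> exp (- (\<delta> * (\<Sum>i=N..<N+k. e i))) * m N" for k
  proof (induction k)
    case (Suc k)
    have "m (N + Suc k) \<le> exp (- (\<delta> * e (N + k))) * m (N + k)" using step[of "N + k"] by simp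
    also have "\<dots> \<le> exp (- (\<delta> * e (N + k))) * (exp (- (\<delta> * (\<Sum>i=N..<N+k. e i))) * m N)"
      using Suc by (intro mult_left_mono) auto
    also have "\<dots> = exp (- (\<delta> * (\<Sum>i=N..<N+Suc k. e i))) * m N"
      unfolding mult.assoc[symmetric] exp_add[symmetric] by (simp add: algebra_simps)
    finally show ?case .
  qed simp
  have bd': "m n \<le> exp (- (\<delta> * ((\<Sum>i<n. e i) - (\<Sum>i<N. e i)))) * m N" if "n \<ge> N" for n
  proof -
    have "(\<Sum>i<n. e i) = (\<Sum>i<N. e i) + (\<Sum>i=N..<n. e i)"
      using that by (simp add: lessThan_atLeast0 sum.atLeastLessThan_concat)
    then show ?thesis using bd[of "n - N"] that by simp
  qed
  have "filterlim (\<lambda>n. (- \<delta> * (\<Sum>i<N. e i)) + \<delta> * (\<Sum>i<n. e i)) at_top sequentially"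
    by (rule filterlim_tendsto_add_at_top[OF tendsto_const filterlim_tendsto_pos_mult_at_top[OF tendsto_const \<delta> div]])
  then have "filterlim (\<lambda>n. - (\<delta> * ((\<Sum>i<n. e i) - (\<Sum>i<N. e i)))) at_bot sequentially"
    by (subst filterlim_uminus_at_bot) (simp add: algebra_simps)
  then have "(\<lambda>n. exp (- (\<delta> * ((\<Sum>i<n. e i) - (\<Sum>i<N. e i)))) * m N) \<longlonglongrightarrow> 0 * m N"
    by (intro tendsto_mult tendsto_const filterlim_compose[OF exp_at_bot])
  then have "\<forall>\<^sub>F n in sequentially. exp (- (\<delta> * ((\<Sum>i<n. e i) - (\<Sum>i<N. e i)))) * m N < \<eta>"
    using \<eta> by (intro order_tendstoD(2)) auto
  then obtain N' where N': "\<And>n. n \<ge> N' \<Longrightarrow> exp (- (\<delta> * ((\<Sum>i<n. e i) - (\<Sum>i<N. e i)))) * m N < \<eta>"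
    unfolding eventually_sequentially by blast
  show "\<exists>no. \<forall>n\<ge>no. norm (a n - 0) < \<epsilon>"
  proof (intro exI allI impI)
    fix n assume n: "max N N' \<le> n"
    have "m n < \<eta>" using bd'[of n] N'[of n] n by linarith
    moreover have "a n - \<eta> \<le> m n" by (simp add: m_def)
    ultimately have "a n < \<epsilon>" using \<eta>_def by argo
    then show "norm (a n - 0) < \<epsilon>" using a0[of n] by simp
  qed
qed

text \<open>After squaring, the left side is \<open>1 + 2 * t\<close>, which is at most the square
  of \<open>1 + t\<close>. The modulus of a small step enters only to second order, so the real part
  decides whether \<open>1 - w\<close> contracts.\<close>

lemma norm_one_minus_le:
  fixes w :: complex
  shows "norm (1 - w) \<le> 1 - Re w + (norm w)\<^sup>2 / 2"
proof -
  define t where "t = - Re w + (norm w)\<^sup>2 / 2"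
  have *: "(norm (1 - w))\<^sup>2 = 1 + 2 * t"
    by (cases w) (simp add: t_def cmod_power2 power2_diff)
  have "1 + 2 * t \<ge> 0" using * zero_le_power2[of "norm (1-w)"] by linarith
  then have "0 \<le> 1 + t" by linarith
  have "1 + 2 * t \<le> (1 + t)\<^sup>2" by (simp add: power2_sum)
  then have "norm (1 - w) \<le> 1 + t" using * \<open>0 \<le> 1 + t\<close> by (metis power2_le_imp_le)
  then show ?thesis by (simp add: t_def)
qed

text \<open>The quadratic term of the previous bound is of the order of the square of
  \<open>e n\<close>, so every rate below \<open>Re b\<close> is eventually attained. This is why
  the eigenvalues enter through their real parts.\<close>

lemma norm_one_minus_eventually_le:
  fixes \<beta> :: "nat \<Rightarrow> complex" and e :: "nat \<Rightarrow> real"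
  assumes e0: "\<And>n. 0 < e n" and e: "e \<longlonglongrightarrow> 0"
    and b: "(\<lambda>n. \<beta> n / e n) \<longlonglongrightarrow> b" and \<delta>: "\<delta> < Re b"
  shows "\<forall>\<^sub>F n in sequentially. norm (1 - \<beta> n) \<le> 1 - \<delta> * e n"
proof -
  have "(\<lambda>n. Re (\<beta> n / e n) - (norm (\<beta> n / e n))\<^sup>2 * e n / 2) \<longlonglongrightarrow> Re b - (norm b)\<^sup>2 * 0 / 2"
    by (intro tendsto_intros b e) simp
  then have "\<forall>\<^sub>F n in sequentially. \<delta> < Re (\<beta> n / e n) - (norm (\<beta> n / e n))\<^sup>2 * e n / 2"
    using \<delta> by (intro order_tendstoD(1)) auto
  then show ?thesis
  proof eventually_elim
    case (elim n)
    have "\<delta> * e n < (Re (\<beta> n / e n) - (norm (\<beta> n / e n))\<^sup>2 * e n / 2) * e n"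
      using elim e0[of n] by (intro mult_strict_right_mono)
    also have "\<dots> = Re (\<beta> n) - (norm (\<beta> n))\<^sup>2 / 2"
      using e0[of n] by (simp add: norm_divide power_divide left_diff_distrib Re_divide_of_real) (simp add: power2_eq_square)
    finally show ?case using norm_one_minus_le[of "\<beta> n"] by linarith
  qed
qed

text \<open>The fixed point of \<open>x \<mapsto> (1 - \<beta>\<^sub>n) x + d\<^sub>n\<close> tends to \<open>l / b\<close>, and the contraction is strong
  enough to forget the past since the step sizes are not summable.\<close>

lemma affine_recursion_tendsto:
  fixes x \<beta> d :: "nat \<Rightarrow> complex" and e :: "nat \<Rightarrow> real"
  assumes rec: "\<forall>\<^sub>F n in sequentially. x (Suc n) = (1 - \<beta> n) * x n + d n"
    and e0: "\<And>n. 0 < e n" and e: "e \<longlonglongrightarrow> 0"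
    and div: "filterlim (\<lambda>n. \<Sum>k<n. e k) at_top sequentially"
    and b: "(\<lambda>n. \<beta> n / e n) \<longlonglongrightarrow> b" "Re b > 0" and l: "(\<lambda>n. d n / e n) \<longlonglongrightarrow> l"
  shows "x \<longlonglongrightarrow> l / b"
proof -
  have b0: "b \<noteq> 0" using b by auto
  define y where "y n = norm (d n / e n - (\<beta> n / e n) * (l / b))" for n
  have "(\<lambda>n. d n / e n - (\<beta> n / e n) * (l / b)) \<longlonglongrightarrow> l - b * (l / b)"
    by (intro tendsto_intros b l)
  then have y: "y \<longlonglongrightarrow> 0" unfolding y_def using b0 by (auto intro: tendsto_norm_zero)
  have "(\<lambda>n. norm (x n - l / b)) \<longlonglongrightarrow> 0"
  proof (rule contraction_recursion_tendsto_zero[where e=e and y=y and \<delta>="Re b / 2"])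
    have "\<forall>\<^sub>F n in sequentially. norm (1 - \<beta> n) \<le> 1 - (Re b / 2) * e n"
      by (rule norm_one_minus_eventually_le[OF e0 e b(1)]) (use b in auto)
    with rec show "\<forall>\<^sub>F n in sequentially. norm (x (Suc n) - l / b) \<le> (1 - Re b / 2 * e n) * norm (x n - l / b) + e n * y n"
    proof eventually_elim
      case (elim n)
      have "x (Suc n) - l / b = (1 - \<beta> n) * (x n - l / b) + e n * (d n / e n - (\<beta> n / e n) * (l / b))"
      proof -
        have ee: "e n * (d n / e n - (\<beta> n / e n) * (l / b)) = d n - \<beta> n * (l / b)"
          using e0[of n] by (simp add: right_diff_distrib)
        show ?thesis unfolding ee elim(1) by (simp add: algebra_simps)
      qed
      then have "norm (x (Suc n) - l / b) \<le> norm (1 - \<beta> n) * norm (x n - l / b) + e n * y n"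
        using norm_triangle_ineq[of "(1 - \<beta> n) * (x n - l / b)" "e n * (d n / e n - (\<beta> n / e n) * (l / b))"] e0[of n]
        by (simp add: norm_mult y_def)
      then show ?case using mult_right_mono[OF elim(2), of "norm (x n - l / b)"] by auto
    qed
  qed (use b e e0 div y in \<open>simp_all add: less_imp_le\<close>)
  then show ?thesis using LIM_zero_iff tendsto_norm_zero_iff by blast
qed

lemmas tendsto_complex_of_real = tendsto_of_real[where 'a = complex]

lemma Suc_powr_tendsto_0: "x < 0 \<Longrightarrow> (\<lambda>n. real (Suc n) powr x) \<longlonglongrightarrow> 0"
  by real_asymp

lemma Suc_powr_neg:
  fixes \<rho> :: real
  assumes "0 < \<rho>" "\<rho> \<le> 1"
  shows "\<And>n. 0 < real (Suc n) powr (-\<rho>)"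
    and "(\<lambda>n. real (Suc n) powr (-\<rho>)) \<longlonglongrightarrow> 0"
    and "filterlim (\<lambda>n. \<Sum>k<n. real (Suc k) powr (-\<rho>)) at_top sequentially"
proof -
  show "(\<lambda>n. real (Suc n) powr (-\<rho>)) \<longlonglongrightarrow> 0" using assms by real_asymp
  \<comment> \<open>As \<open>\<rho> \<le> 1\<close>, each term lies above the corresponding
    harmonic one.\<close>
  have "(harm n :: real) \<le> (\<Sum>k<n. real (Suc k) powr (-\<rho>))" for n
  proof -
    have "harm n = (\<Sum>k<n. inverse (real (Suc k)))" by (rule harm_altdef)
    also have "\<dots> \<le> (\<Sum>k<n. real (Suc k) powr (-\<rho>))"
    proof (rule sum_mono)
      fix k
      have "real (Suc k) powr (-1) \<le> real (Suc k) powr (-\<rho>)" using assms by (intro powr_mono) auto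
      then show "inverse (real (Suc k)) \<le> real (Suc k) powr (-\<rho>)" by (simp only: powr_neg_one[OF of_nat_0_less_iff[THEN iffD2, OF zero_less_Suc]] inverse_eq_divide)
    qed
    finally show ?thesis .
  qed
  then show "filterlim (\<lambda>n. \<Sum>k<n. real (Suc k) powr (-\<rho>)) at_top sequentially"
    by (intro filterlim_at_top_mono[OF harm_at_top]) auto
qed simp

text \<open>The relative growth of \<open>n powr p\<close> over one step is about
  \<open>p / n\<close>. In units of the step \<open>n powr (-\<rho>)\<close> it survives only at
  \<open>\<rho> = 1\<close>, which is where the shifts by \<open>p\<close> in the limit denominators
  come from.\<close>

lemma powr_ratio_tendsto:
  fixes p \<rho> :: real
  assumes "\<rho> \<le> 1"
  shows "(\<lambda>n. (real (Suc n) powr p / real n powr p - 1) / real (Suc n) powr (-\<rho>)) \<longlonglongrightarrow> (if \<rho> = 1 then p else 0)"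
proof -
  have 1: "(\<lambda>n. (real (Suc n) powr p / real n powr p - 1) * real (Suc n)) \<longlonglongrightarrow> p" by real_asymp
  show ?thesis
  proof (cases "\<rho> = 1")
    case True
    then show ?thesis using 1 by (simp add: powr_minus_divide)
  next
    case False
    then have "\<rho> < 1" using assms by auto
    then have "(\<lambda>n. real (Suc n) powr (\<rho> - 1)) \<longlonglongrightarrow> 0" by real_asymp
    from tendsto_mult[OF 1 this] have "(\<lambda>n. (real (Suc n) powr p / real n powr p - 1) * real (Suc n) * real (Suc n) powr (\<rho> - 1)) \<longlonglongrightarrow> 0" by simp
    moreover have "(real (Suc n) powr p / real n powr p - 1) * real (Suc n) * real (Suc n) powr (\<rho> - 1) = (real (Suc n) powr p / real n powr p - 1) / real (Suc n) powr (-\<rho>)" for n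
      by (simp add: powr_diff powr_minus_divide)
    ultimately show ?thesis using False by simp
  qed
qed

text \<open>First-order bookkeeping: the two contraction rates add, the growth \<open>h\<close> of
  the scale counts against them, and products of small quantities are negligible against
  \<open>e\<close>.\<close>

lemma contraction_factor_tendsto:
  fixes a b :: "nat \<Rightarrow> complex" and \<rho> e :: "nat \<Rightarrow> real"
  assumes "\<And>n. 0 < e n" "e \<longlonglongrightarrow> 0" "(\<lambda>n. a n / e n) \<longlonglongrightarrow> A" "(\<lambda>n. b n / e n) \<longlonglongrightarrow> B"
    "(\<lambda>n. (\<rho> n - 1) / e n) \<longlonglongrightarrow> h"
  shows "(\<lambda>n. (1 - \<rho> n * ((1 - a n) * (1 - b n))) / e n) \<longlonglongrightarrow> A + B - h"
proof -
  have e: "(\<lambda>n. complex_of_real (e n)) \<longlonglongrightarrow> 0" using tendsto_of_real[OF assms(2)] by simp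
  have h: "(\<lambda>n. complex_of_real ((\<rho> n - 1) / e n)) \<longlonglongrightarrow> of_real h" by (rule tendsto_of_real[OF assms(5)])
  have "(\<lambda>n. a n / e n + b n / e n - (a n / e n) * (b n / e n) * e n
      - of_real ((\<rho> n - 1) / e n) * (1 - (a n / e n) * e n) * (1 - (b n / e n) * e n)) \<longlonglongrightarrow>
     A + B - A * B * 0 - h * (1 - A * 0) * (1 - B * 0)"
    by (intro tendsto_intros assms e h)
  moreover have "a n / e n + b n / e n - (a n / e n) * (b n / e n) * e n
      - of_real ((\<rho> n - 1) / e n) * (1 - (a n / e n) * e n) * (1 - (b n / e n) * e n) = (1 - \<rho> n * ((1 - a n) * (1 - b n))) / e n" for n
  proof -
    have 1: "(a n / e n) * e n = a n" "(b n / e n) * e n = b n" using assms(1)[of n] by auto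
    have 2: "(a n / e n) * (b n / e n) * e n = a n * b n / e n" using assms(1)[of n] by simp
    show ?thesis unfolding 1 2 of_real_divide add_divide_distrib[symmetric] times_divide_eq_left diff_divide_distrib[symmetric]
      by (simp add: algebra_simps)
  qed
  ultimately show ?thesis by simp
qed

text \<open>Multiplication by \<open>n powr p\<close> yields an affine recursion again, whose limit
  is forcing over net rate. The hypothesis \<open>pos\<close> says that contraction beats the growth
  of the scale. With \<open>b = 0\<close> the lemma also serves for plain trajectories.\<close>

lemma covariance_recursion_tendsto:
  fixes x a b f :: "nat \<Rightarrow> complex" and A B l :: complex and p \<rho> :: real
  assumes rec: "\<forall>\<^sub>F n in sequentially. x (Suc n) = (1 - a n) * (1 - b n) * x n + f n"
    and \<rho>: "0 < \<rho>" "\<rho> \<le> 1"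
    and a: "(\<lambda>n. a n / real (Suc n) powr (-\<rho>)) \<longlonglongrightarrow> A" and b: "(\<lambda>n. b n / real (Suc n) powr (-\<rho>)) \<longlonglongrightarrow> B"
    and f: "(\<lambda>n. real (Suc n) powr p * f n / real (Suc n) powr (-\<rho>)) \<longlonglongrightarrow> l"
    and pos: "Re (A + B) > (if \<rho> = 1 then p else 0)"
  shows "(\<lambda>n. real n powr p * x n) \<longlonglongrightarrow> l / (A + B - complex_of_real (if \<rho> = 1 then p else 0))"
proof (rule affine_recursion_tendsto[where e="\<lambda>n. real (Suc n) powr (-\<rho>)"
      and \<beta>="\<lambda>n. 1 - complex_of_real (real (Suc n) powr p / real n powr p) * ((1 - a n) * (1 - b n))" and d="\<lambda>n. real (Suc n) powr p * f n"])
  show "\<forall>\<^sub>F n in sequentially. complex_of_real (real (Suc n) powr p) * x (Suc n) =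
       (1 - (1 - complex_of_real (real (Suc n) powr p / real n powr p) * ((1 - a n) * (1 - b n)))) * (complex_of_real (real n powr p) * x n) + real (Suc n) powr p * f n"
    using eventually_gt_at_top[of 0] rec
  proof eventually_elim
    case (elim n)
    have "complex_of_real (real (Suc n) powr p / real n powr p) * complex_of_real (real n powr p) = complex_of_real (real (Suc n) powr p)"
      unfolding of_real_mult[symmetric] using elim by simp
    then have "complex_of_real (real (Suc n) powr p) * ((1 - a n) * (1 - b n) * x n) =
        complex_of_real (real (Suc n) powr p / real n powr p) * ((1 - a n) * (1 - b n)) * (complex_of_real (real n powr p) * x n)"
      by (metis mult.assoc mult.commute)
    then show ?case unfolding elim(2) distrib_left by simp
  qed
  show "(\<lambda>n. (1 - complex_of_real (real (Suc n) powr p / real n powr p) * ((1 - a n) * (1 - b n))) / complex_of_real (real (Suc n) powr (-\<rho>))) \<longlonglongrightarrow>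
      A + B - complex_of_real (if \<rho> = 1 then p else 0)"
    by (rule contraction_factor_tendsto[OF Suc_powr_neg(1,2)[OF \<rho>] a b powr_ratio_tendsto[OF \<rho>(2)]])
  show "0 < Re (A + B - complex_of_real (if \<rho> = 1 then p else 0))" using pos by simp
qed (use Suc_powr_neg[OF \<rho>] f in \<open>simp_all\<close>)

section \<open>Covariances in eigenvector coordinates\<close>

text \<open>\<open>Zc i k l n\<close> and \<open>Nc i k l n\<close> are the eigenvector coordinates, at time \<open>n\<close>, of the response of
  the two blocks to a unit innovation at time \<open>k + 1\<close> and vertex \<open>l\<close>, after removal of the common
  martingale; this is why the coordinate \<open>\<iota>\<close> of \<open>Zc\<close> vanishes.\<close>

locale eigen_filter =
  fixes r s :: "nat \<Rightarrow> real" and \<alpha> :: "'n::finite \<Rightarrow> complex" and \<iota> :: 'n and V :: "complex^'n^'n"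
    and Zc Nc :: "'n \<Rightarrow> nat \<Rightarrow> 'n \<Rightarrow> nat \<Rightarrow> complex"
  assumes Zc_step: "\<And>i k l n. k < n \<Longrightarrow> Zc i k l (Suc n) = (1 - r n * \<alpha> i) * Zc i k l n"
    and Nc_step: "\<And>i k l n. k < n \<Longrightarrow> Nc i k l (Suc n) = (1 - s n) * Nc i k l n + s n * (1 - \<alpha> i) * Zc i k l n"
    and Zc_new: "\<And>i l n. Zc i n l (Suc n) = (if i = \<iota> then 0 else r n * V $ l $ i)"
    and Nc_new: "\<And>i l n. Nc i n l (Suc n) = (s n - (if i = \<iota> then r n else 0)) * V $ l $ i"
begin

text \<open>A bilinear, not a sesquilinear, form: coordinates are multiplied without conjugation, so
  that \<open>U ** S ** transpose U\<close> turns their covariances into those of the real entries.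
  The sum over \<open>k\<close> and \<open>l\<close> treats the innovations as uncorrelated with
  unit variance.\<close>

definition cov :: "(nat \<Rightarrow> 'n \<Rightarrow> nat \<Rightarrow> complex) \<Rightarrow> (nat \<Rightarrow> 'n \<Rightarrow> nat \<Rightarrow> complex) \<Rightarrow> nat \<Rightarrow> complex" where
  "cov f g n = (\<Sum>k<n. \<Sum>l\<in>UNIV. f k l n * g k l n)"

lemma cov_Suc: "cov f g (Suc n) = (\<Sum>k<n. \<Sum>l\<in>UNIV. f k l (Suc n) * g k l (Suc n)) + (\<Sum>l\<in>UNIV. f n l (Suc n) * g n l (Suc n))"
  by (simp add: cov_def)

lemma cov_sym: "cov f g n = cov g f n"
  by (simp add: cov_def mult.commute)

lemma vprod_eq: "vprod V i j = (\<Sum>l\<in>UNIV. V $ l $ i * V $ l $ j)"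
  by (simp add: scalar_product_def column_def)

lemma sum_vprod: "(\<Sum>l\<in>UNIV. (a * V $ l $ i) * (b * V $ l $ j)) = a * b * vprod V i j"
  unfolding vprod_eq sum_distrib_left by (intro sum.cong) auto

lemma Zc_\<iota>: "k < n \<Longrightarrow> Zc \<iota> k l n = 0"
proof (induction n)
  case (Suc n)
  then show ?case by (cases "k = n") (auto simp: Zc_step Zc_new)
qed simp

lemma cov_ZZ_\<iota>: "cov (Zc \<iota>) f n = 0" "cov f (Zc \<iota>) n = 0"
  by (simp_all add: cov_def Zc_\<iota>)

text \<open>Earlier innovations are propagated by the mean dynamics and the newest one adds the last
  term. The three recursions form a triangle: this one is closed, the mixed one is driven by it, and
  that of the second block by both.\<close>

lemma cov_ZZ_Suc:
  assumes "i \<noteq> \<iota>" "j \<noteq> \<iota>"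
  shows "cov (Zc i) (Zc j) (Suc n) = (1 - r n * \<alpha> i) * (1 - r n * \<alpha> j) * cov (Zc i) (Zc j) n + r n * r n * vprod V i j"
proof -
  have "(\<Sum>k<n. \<Sum>l\<in>UNIV. Zc i k l (Suc n) * Zc j k l (Suc n)) = (1 - r n * \<alpha> i) * (1 - r n * \<alpha> j) * cov (Zc i) (Zc j) n"
    unfolding cov_def sum_distrib_left by (intro sum.cong refl) (simp add: Zc_step)
  then show ?thesis unfolding cov_Suc Zc_new using assms by (simp add: sum_vprod)
qed

lemma cov_ZN_Suc:
  assumes "i \<noteq> \<iota>"
  shows "cov (Zc i) (Nc j) (Suc n) = (1 - r n * \<alpha> i) * (1 - s n) * cov (Zc i) (Nc j) n
    + ((1 - r n * \<alpha> i) * (s n * (1 - \<alpha> j)) * cov (Zc i) (Zc j) n + r n * (s n - (if j = \<iota> then r n else 0)) * vprod V i j)"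
proof -
  have "(\<Sum>k<n. \<Sum>l\<in>UNIV. Zc i k l (Suc n) * Nc j k l (Suc n)) = (1 - r n * \<alpha> i) * (1 - s n) * cov (Zc i) (Nc j) n
      + (1 - r n * \<alpha> i) * (s n * (1 - \<alpha> j)) * cov (Zc i) (Zc j) n"
    unfolding cov_def sum_distrib_left sum.distrib[symmetric] by (intro sum.cong refl) (simp add: Zc_step Nc_step algebra_simps)
  then show ?thesis unfolding cov_Suc Zc_new Nc_new using assms by (simp add: sum_vprod)
qed

lemma cov_NN_Suc:
  "cov (Nc i) (Nc j) (Suc n) = (1 - s n) * (1 - s n) * cov (Nc i) (Nc j) n
    + ((1 - s n) * s n * ((1 - \<alpha> i) * cov (Zc i) (Nc j) n + (1 - \<alpha> j) * cov (Zc j) (Nc i) n)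
       + s n * s n * (1 - \<alpha> i) * (1 - \<alpha> j) * cov (Zc i) (Zc j) n
       + (s n - (if i = \<iota> then r n else 0)) * (s n - (if j = \<iota> then r n else 0)) * vprod V i j)"
proof -
  have "(\<Sum>k<n. \<Sum>l\<in>UNIV. Nc i k l (Suc n) * Nc j k l (Suc n)) = (1 - s n) * (1 - s n) * cov (Nc i) (Nc j) n
    + ((1 - s n) * s n * ((1 - \<alpha> i) * cov (Zc i) (Nc j) n + (1 - \<alpha> j) * cov (Zc j) (Nc i) n)
       + s n * s n * (1 - \<alpha> i) * (1 - \<alpha> j) * cov (Zc i) (Zc j) n)"
    unfolding cov_def sum_distrib_left sum.distrib[symmetric] by (intro sum.cong refl) (simp add: Nc_step algebra_simps)
  then show ?thesis unfolding cov_Suc Nc_new by (simp add: sum_vprod)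
qed

end

text \<open>Counting exponents: two noise factors of orders \<open>-g\<close> and \<open>-h\<close>,
  seen at scale \<open>p\<close> and in units of the step, leave \<open>p - g - h + \<rho>\<close>.
  The sign of this number decides whether a noise term survives.\<close>

lemma powr_scaled_product:
  fixes x y p g h \<rho> :: real
  shows "real (Suc n) powr p * (x * y) / real (Suc n) powr (-\<rho>)
    = (x / real (Suc n) powr (-g)) * (y / real (Suc n) powr (-h)) * real (Suc n) powr (p - g - h + \<rho>)"
  by (simp add: powr_add powr_diff powr_minus divide_simps)

lemma powr_scaled_product_tendsto:
  fixes x y :: "nat \<Rightarrow> real"
  assumes "(\<lambda>n. x n / real (Suc n) powr (-g)) \<longlonglongrightarrow> a" "(\<lambda>n. y n / real (Suc n) powr (-h)) \<longlonglongrightarrow> b"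
    "(\<lambda>n. real (Suc n) powr (p - g - h + \<rho>)) \<longlonglongrightarrow> m"
  shows "(\<lambda>n. real (Suc n) powr p * (x n * y n) / real (Suc n) powr (-\<rho>)) \<longlonglongrightarrow> a * b * m"
  unfolding powr_scaled_product[of _ p _ _ \<rho> g h] by (intro tendsto_intros assms)

text \<open>\<open>A\<close>, \<open>B\<close> and \<open>C\<close> are 0 or 1 and record which noise terms survive at the scale \<open>n powr p\<close>,
  so that one computation covers all regimes.\<close>

locale eigen_filter_limit = eigen_filter r s \<alpha> \<iota> V Zc Nc
  for r s :: "nat \<Rightarrow> real" and \<alpha> :: "'n::finite \<Rightarrow> complex" and \<iota> V Zc Nc +
  fixes \<gamma> \<nu> c q p A B C :: real
  assumes range: "0 < \<gamma>" "\<gamma> \<le> 1" "0 < \<nu>" "\<nu> \<le> 1" "0 < c" "0 < q"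
    and r_lim: "(\<lambda>n. r n / real (Suc n) powr (-\<gamma>)) \<longlonglongrightarrow> c"
    and s_lim: "(\<lambda>n. s n / real (Suc n) powr (-\<nu>)) \<longlonglongrightarrow> q"
    and A_lim: "(\<lambda>n. real (Suc n) powr (p - \<gamma>)) \<longlonglongrightarrow> A"
      "(\<lambda>n. real (Suc n) powr (p - max \<gamma> \<nu>)) \<longlonglongrightarrow> A" "(\<lambda>n. real (Suc n) powr (p - 2 * \<gamma> + min \<gamma> \<nu>)) \<longlonglongrightarrow> A"
    and B_lim: "(\<lambda>n. real (Suc n) powr (p - \<nu>)) \<longlonglongrightarrow> B"
    and C_lim: "(\<lambda>n. real (Suc n) powr (p - 2 * \<gamma> + \<nu>)) \<longlonglongrightarrow> C"
    and Re_\<alpha>: "\<And>i. i \<noteq> \<iota> \<Longrightarrow> 0 < Re (\<alpha> i)"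
    and Re_\<alpha>1: "\<And>i. i \<noteq> \<iota> \<Longrightarrow> \<gamma> = 1 \<Longrightarrow> p < 2 * (c * Re (\<alpha> i))"
    and q1: "\<nu> = 1 \<Longrightarrow> p < 2 * q"
    and p: "p < 2 * \<gamma>" "p < 2 * \<nu>"
begin

text \<open>Mixed covariances contract at the slower-decaying of the two steps, of order
  \<open>n powr (- min \<gamma> \<nu>)\<close>. In these units the other step has coefficient zero;
  both count when \<open>\<gamma> = \<nu>\<close>.\<close>

definition "rhat = (if \<gamma> \<le> \<nu> then c else 0)"
definition "shat = (if \<nu> \<le> \<gamma> then q else 0)"
definition "h\<rho> x = (if x = 1 then p else 0)"

text \<open>Fixed points of the three recursions, forcing divided by net rate. The noise exponents
  are \<open>p - \<gamma>\<close> for \<open>r n * r n\<close> here and for \<open>r n * s n\<close>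
  in \<open>LNN\<close>, then \<open>p - max \<gamma> \<nu>\<close> for \<open>r n * s n\<close> and
  \<open>p - 2 * \<gamma> + min \<gamma> \<nu>\<close> for \<open>r n * r n\<close> in
  \<open>LZN\<close>; these share the limit \<open>A\<close>. In \<open>LNN\<close> the noises
  \<open>s n * s n\<close> and \<open>r n * r n\<close> carry \<open>B\<close> and
  \<open>C\<close>.\<close>

definition "LZZ i j = (if i = \<iota> \<or> j = \<iota> then 0 else of_real (c * c * A) * vprod V i j / (of_real c * \<alpha> i + of_real c * \<alpha> j - of_real (h\<rho> \<gamma>)))"
definition "LZN i j = (if i = \<iota> then 0 else
   (of_real shat * (1 - \<alpha> j) * LZZ i j + of_real (if j = \<iota> then c * q * A - c * c * A else c * q * A) * vprod V i j) / (of_real rhat * \<alpha> i + of_real shat - of_real (h\<rho> (min \<gamma> \<nu>))))"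
definition "LNN i j = (of_real q * ((1 - \<alpha> i) * LZN i j + (1 - \<alpha> j) * LZN j i) +
   of_real (q * q * B - (if i = \<iota> then c * q * A else 0) - (if j = \<iota> then c * q * A else 0) + (if i = \<iota> \<and> j = \<iota> then c * c * C else 0)) * vprod V i j) / of_real (2 * q - h\<rho> \<nu>)"

lemma ratio1: "(\<lambda>n. complex_of_real (real (Suc n) powr p / real n powr p)) \<longlonglongrightarrow> 1"
proof -
  have "(\<lambda>n. real (Suc n) powr p / real n powr p) \<longlonglongrightarrow> 1" by real_asymp
  from tendsto_complex_of_real[OF this] show ?thesis by simp
qed

lemma r0: "r \<longlonglongrightarrow> 0" and s0: "s \<longlonglongrightarrow> 0"
proof -
  have "(\<lambda>n. (r n / real (Suc n) powr (-\<gamma>)) * real (Suc n) powr (-\<gamma>)) \<longlonglongrightarrow> c * 0"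
    by (intro tendsto_mult r_lim Suc_powr_neg range)
  then show "r \<longlonglongrightarrow> 0" by simp
  have "(\<lambda>n. (s n / real (Suc n) powr (-\<nu>)) * real (Suc n) powr (-\<nu>)) \<longlonglongrightarrow> q * 0"
    by (intro tendsto_mult s_lim Suc_powr_neg range)
  then show "s \<longlonglongrightarrow> 0" by simp
qed

lemma rhat_lim: "(\<lambda>n. r n / real (Suc n) powr (- (min \<gamma> \<nu>))) \<longlonglongrightarrow> rhat"
proof (cases "\<gamma> \<le> \<nu>")
  case False
  then have "(\<lambda>n. (r n / real (Suc n) powr (-\<gamma>)) * real (Suc n) powr (\<nu> - \<gamma>)) \<longlonglongrightarrow> c * 0"
    by (intro tendsto_mult r_lim Suc_powr_tendsto_0) simp
  moreover have "(r n / real (Suc n) powr (-\<gamma>)) * real (Suc n) powr (\<nu> - \<gamma>) = r n / real (Suc n) powr (-\<nu>)" for n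
    by (simp add: powr_diff powr_minus divide_simps)
  ultimately show ?thesis using False by (simp add: rhat_def min_def)
qed (use r_lim in \<open>simp add: rhat_def\<close>)

lemma shat_lim: "(\<lambda>n. s n / real (Suc n) powr (- (min \<gamma> \<nu>))) \<longlonglongrightarrow> shat"
proof (cases "\<nu> \<le> \<gamma>")
  case False
  then have "(\<lambda>n. (s n / real (Suc n) powr (-\<nu>)) * real (Suc n) powr (\<gamma> - \<nu>)) \<longlonglongrightarrow> q * 0"
    by (intro tendsto_mult s_lim Suc_powr_tendsto_0) simp
  moreover have "(s n / real (Suc n) powr (-\<nu>)) * real (Suc n) powr (\<gamma> - \<nu>) = s n / real (Suc n) powr (-\<gamma>)" for n
    by (simp add: powr_diff powr_minus divide_simps)
  ultimately show ?thesis using False by (simp add: shat_def min_def)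
qed (use s_lim in \<open>simp add: shat_def min_def\<close>)

lemma Re_pos_Z: "i \<noteq> \<iota> \<Longrightarrow> h\<rho> \<gamma> < 2 * (c * Re (\<alpha> i))"
  using Re_\<alpha>[of i] Re_\<alpha>1[of i] range by (auto simp: h\<rho>_def)

lemma Re_pos_N: "h\<rho> \<nu> < 2 * q"
  using q1 range by (auto simp: h\<rho>_def)

text \<open>For equal exponents the mixed rate is the average of the two pure ones, so the bounds
  \<open>Re_pos_Z\<close> and \<open>Re_pos_N\<close> are added and halved. Otherwise one positive
  rate is left and, the smaller exponent being below 1, there is no growth to beat.\<close>

lemma Re_pos_ZN: "i \<noteq> \<iota> \<Longrightarrow> h\<rho> (min \<gamma> \<nu>) < rhat * Re (\<alpha> i) + shat"
  using Re_pos_Z[of i] Re_pos_N Re_\<alpha>[of i] range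
  by (auto simp: h\<rho>_def rhat_def shat_def min_def add_pos_pos not_le split: if_splits)

lemma cov_ZZ_lim: "(\<lambda>n. real n powr p * cov (Zc i) (Zc j) n) \<longlonglongrightarrow> LZZ i j"
proof (cases "i = \<iota> \<or> j = \<iota>")
  case True then show ?thesis by (auto simp: LZZ_def cov_ZZ_\<iota>)
next
  case False
  have *: "(\<lambda>n. real n powr p * cov (Zc i) (Zc j) n) \<longlonglongrightarrow> (of_real (c * c * A) * vprod V i j) / (of_real c * \<alpha> i + of_real c * \<alpha> j - of_real (if \<gamma> = 1 then p else 0))"
  proof (rule covariance_recursion_tendsto[where \<rho>=\<gamma> and a="\<lambda>n. r n * \<alpha> i" and b="\<lambda>n. r n * \<alpha> j" and f="\<lambda>n. r n * r n * vprod V i j"])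
    have r: "(\<lambda>n. r n * \<alpha> i / real (Suc n) powr (-\<gamma>)) \<longlonglongrightarrow> of_real c * \<alpha> i" for i
      using tendsto_mult_right[OF tendsto_complex_of_real[OF r_lim], of "\<alpha> i"] by simp
    show "(\<lambda>n. r n * \<alpha> i / real (Suc n) powr (-\<gamma>)) \<longlonglongrightarrow> of_real c * \<alpha> i"
      "(\<lambda>n. r n * \<alpha> j / real (Suc n) powr (-\<gamma>)) \<longlonglongrightarrow> of_real c * \<alpha> j" by (rule r)+
    have "(\<lambda>n. real (Suc n) powr p * (r n * r n) / real (Suc n) powr (-\<gamma>)) \<longlonglongrightarrow> c * c * A"
      by (rule powr_scaled_product_tendsto[OF r_lim r_lim]) (use A_lim in simp)
    from tendsto_mult_right[OF tendsto_complex_of_real[OF this], of "vprod V i j"]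
    show "(\<lambda>n. real (Suc n) powr p * (r n * r n * vprod V i j) / real (Suc n) powr (-\<gamma>)) \<longlonglongrightarrow> of_real (c * c * A) * vprod V i j"
      by (simp add: mult.assoc)
    show "(if \<gamma> = 1 then p else 0) < Re (of_real c * \<alpha> i + of_real c * \<alpha> j)"
      using Re_pos_Z[of i] Re_pos_Z[of j] False unfolding h\<rho>_def by (simp del: of_real_mult)
  qed (use False range cov_ZZ_Suc in \<open>simp_all add: mult.assoc always_eventually\<close>)
  then show ?thesis using False by (simp add: LZZ_def h\<rho>_def)
qed

text \<open>A driving covariance is known at scale \<open>n\<close>, while the recursion asks for
  scale \<open>n + 1\<close>; the quotient of the two scales tends to 1.\<close>

lemma scaled_forcing:
  fixes X w :: "nat \<Rightarrow> complex" and w0 L :: complex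
  assumes X: "(\<lambda>n. real n powr p * X n) \<longlonglongrightarrow> L" and w: "(\<lambda>n. w n / real (Suc n) powr (-\<rho>)) \<longlonglongrightarrow> w0"
  shows "(\<lambda>n. real (Suc n) powr p * (w n * X n) / real (Suc n) powr (-\<rho>)) \<longlonglongrightarrow> w0 * L"
proof -
  have "(\<lambda>n. complex_of_real (real (Suc n) powr p / real n powr p) * (w n / real (Suc n) powr (-\<rho>)) * (real n powr p * X n)) \<longlonglongrightarrow> 1 * w0 * L"
    by (intro tendsto_mult ratio1 w X)
  moreover have "\<forall>\<^sub>F n in sequentially. complex_of_real (real (Suc n) powr p / real n powr p) * (w n / real (Suc n) powr (-\<rho>)) * (real n powr p * X n) =
     real (Suc n) powr p * (w n * X n) / real (Suc n) powr (-\<rho>)"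
    using eventually_gt_at_top[of 0]
  proof eventually_elim
    case (elim n)
    have "complex_of_real (real (Suc n) powr p / real n powr p) * complex_of_real (real n powr p) = complex_of_real (real (Suc n) powr p)"
      unfolding of_real_mult[symmetric] using elim by simp
    then show ?case using elim by (simp add: field_simps)
  qed
  ultimately show ?thesis by (simp add: filterlim_cong)
qed

lemma cov_ZN_lim: "(\<lambda>n. real n powr p * cov (Zc i) (Nc j) n) \<longlonglongrightarrow> LZN i j"
proof (cases "i = \<iota>")
  case True then show ?thesis by (auto simp: LZN_def cov_ZZ_\<iota>)
next
  case False
  let ?\<rho> = "min \<gamma> \<nu>"
  let ?f = "\<lambda>n. (1 - r n * \<alpha> i) * (s n * (1 - \<alpha> j)) * cov (Zc i) (Zc j) n + r n * (s n - (if j = \<iota> then r n else 0)) * vprod V i j"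
  have *: "(\<lambda>n. real n powr p * cov (Zc i) (Nc j) n) \<longlonglongrightarrow>
     (of_real shat * (1 - \<alpha> j) * LZZ i j + of_real (if j = \<iota> then c * q * A - c * c * A else c * q * A) * vprod V i j) / (of_real rhat * \<alpha> i + of_real shat - of_real (if ?\<rho> = 1 then p else 0))"
  proof (rule covariance_recursion_tendsto[where \<rho>="?\<rho>" and a="\<lambda>n. r n * \<alpha> i" and b="\<lambda>n. s n" and f="?f"])
    show "(\<lambda>n. r n * \<alpha> i / real (Suc n) powr (-?\<rho>)) \<longlonglongrightarrow> of_real rhat * \<alpha> i"
      using tendsto_mult_right[OF tendsto_complex_of_real[OF rhat_lim], of "\<alpha> i"] by simp
    show "(\<lambda>n. s n / complex_of_real (real (Suc n) powr (-?\<rho>))) \<longlonglongrightarrow> of_real shat"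
      using tendsto_complex_of_real[OF shat_lim] by simp
    have 1: "(\<lambda>n. real (Suc n) powr p * (r n * s n) / real (Suc n) powr (-?\<rho>)) \<longlonglongrightarrow> c * q * A"
      by (rule powr_scaled_product_tendsto[OF r_lim s_lim]) (use A_lim(2) in \<open>simp add: min_def max_def split: if_splits\<close>)
    have 2: "(\<lambda>n. real (Suc n) powr p * (r n * r n) / real (Suc n) powr (-?\<rho>)) \<longlonglongrightarrow> c * c * A"
      by (rule powr_scaled_product_tendsto[OF r_lim r_lim]) (use A_lim(3) in \<open>simp add: algebra_simps\<close>)
    have "(\<lambda>n. real (Suc n) powr p * (r n * (s n - (if j = \<iota> then r n else 0))) / real (Suc n) powr (-?\<rho>)) \<longlonglongrightarrow> (if j = \<iota> then c * q * A - c * c * A else c * q * A)"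
      using 1 tendsto_diff[OF 1 2] by (simp add: algebra_simps diff_divide_distrib)
    note noise = tendsto_mult_right[OF tendsto_complex_of_real[OF this], of "vprod V i j"]
    \<comment> \<open>The propagation factor \<open>1 - r n * \<alpha> i\<close> tends to 1, so the
      coupling is governed by \<open>s n * (1 - \<alpha> j)\<close> alone.\<close>
    have "(\<lambda>n. (1 - r n * \<alpha> i) * (s n / real (Suc n) powr (-?\<rho>)) * (1 - \<alpha> j)) \<longlonglongrightarrow> (1 - complex_of_real 0 * \<alpha> i) * of_real shat * (1 - \<alpha> j)"
      by (intro tendsto_intros tendsto_complex_of_real[OF shat_lim] r0)
    then have "(\<lambda>n. ((1 - r n * \<alpha> i) * (s n * (1 - \<alpha> j))) / real (Suc n) powr (-?\<rho>)) \<longlonglongrightarrow> of_real shat * (1 - \<alpha> j)"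
      by (simp add: mult.assoc)
    from scaled_forcing[OF cov_ZZ_lim this, of i j] noise
    show "(\<lambda>n. real (Suc n) powr p * ?f n / real (Suc n) powr (-?\<rho>)) \<longlonglongrightarrow>
       of_real shat * (1 - \<alpha> j) * LZZ i j + of_real (if j = \<iota> then c * q * A - c * c * A else c * q * A) * vprod V i j"
      by (rule tendsto_add[THEN tendsto_eq_rhs, THEN filterlim_cong[THEN iffD1, rotated -1]]) (auto simp: ring_distribs add_divide_distrib mult.assoc)
    show "(if ?\<rho> = 1 then p else 0) < Re (of_real rhat * \<alpha> i + of_real shat)"
      using Re_pos_ZN[of i] False unfolding h\<rho>_def by simp
  qed (use False range cov_ZN_Suc in \<open>simp_all add: mult.assoc always_eventually\<close>)
  then show ?thesis using False by (simp add: LZN_def h\<rho>_def)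
qed

lemma cov_NN_lim: "(\<lambda>n. real n powr p * cov (Nc i) (Nc j) n) \<longlonglongrightarrow> LNN i j"
proof -
  let ?w = "q * q * B - (if i = \<iota> then c * q * A else 0) - (if j = \<iota> then c * q * A else 0) + (if i = \<iota> \<and> j = \<iota> then c * c * C else 0)"
  let ?noise = "\<lambda>n. (s n - (if i = \<iota> then r n else 0)) * (s n - (if j = \<iota> then r n else 0))"
  have *: "(\<lambda>n. real n powr p * cov (Nc i) (Nc j) n) \<longlonglongrightarrow>
    (of_real q * ((1 - \<alpha> i) * LZN i j + (1 - \<alpha> j) * LZN j i) + of_real ?w * vprod V i j) / (of_real q + of_real q - of_real (if \<nu> = 1 then p else 0))"
  proof (rule covariance_recursion_tendsto[where \<rho>=\<nu> and a="\<lambda>n. s n" and b="\<lambda>n. s n" and f="\<lambda>n. (1 - s n) * s n * ((1 - \<alpha> i) * cov (Zc i) (Nc j) n + (1 - \<alpha> j) * cov (Zc j) (Nc i) n)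
       + s n * s n * (1 - \<alpha> i) * (1 - \<alpha> j) * cov (Zc i) (Zc j) n
       + ?noise n * vprod V i j"])
    show "\<forall>\<^sub>F n in sequentially. cov (Nc i) (Nc j) (Suc n) = (1 - complex_of_real (s n)) * (1 - complex_of_real (s n)) * cov (Nc i) (Nc j) n +
      ((1 - s n) * s n * ((1 - \<alpha> i) * cov (Zc i) (Nc j) n + (1 - \<alpha> j) * cov (Zc j) (Nc i) n)
       + s n * s n * (1 - \<alpha> i) * (1 - \<alpha> j) * cov (Zc i) (Zc j) n
       + ?noise n * vprod V i j)"
      unfolding cov_NN_Suc by simp
    show s: "(\<lambda>n. s n / complex_of_real (real (Suc n) powr (-\<nu>))) \<longlonglongrightarrow> of_real q"
      using tendsto_complex_of_real[OF s_lim] by simp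
    then show "(\<lambda>n. s n / complex_of_real (real (Suc n) powr (-\<nu>))) \<longlonglongrightarrow> of_real q" .
    have ss: "(\<lambda>n. real (Suc n) powr p * (s n * s n) / real (Suc n) powr (-\<nu>)) \<longlonglongrightarrow> q * q * B"
      by (rule powr_scaled_product_tendsto[OF s_lim s_lim]) (use B_lim in simp)
    have rs: "(\<lambda>n. real (Suc n) powr p * (r n * s n) / real (Suc n) powr (-\<nu>)) \<longlonglongrightarrow> c * q * A"
      by (rule powr_scaled_product_tendsto[OF r_lim s_lim]) (use A_lim in simp)
    have rr: "(\<lambda>n. real (Suc n) powr p * (r n * r n) / real (Suc n) powr (-\<nu>)) \<longlonglongrightarrow> c * c * C"
      by (rule powr_scaled_product_tendsto[OF r_lim r_lim]) (use C_lim in \<open>simp add: algebra_simps\<close>)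
    have "(\<lambda>n. real (Suc n) powr p * ?noise n / real (Suc n) powr (-\<nu>)) \<longlonglongrightarrow> ?w"
    proof -
      have "(\<lambda>n. real (Suc n) powr p * (s n * s n) / real (Suc n) powr (-\<nu>)
        - (if i = \<iota> then real (Suc n) powr p * (r n * s n) / real (Suc n) powr (-\<nu>) else 0)
        - (if j = \<iota> then real (Suc n) powr p * (r n * s n) / real (Suc n) powr (-\<nu>) else 0)
        + (if i = \<iota> \<and> j = \<iota> then real (Suc n) powr p * (r n * r n) / real (Suc n) powr (-\<nu>) else 0)) \<longlonglongrightarrow> ?w"
        by (intro tendsto_add tendsto_diff ss) (use rs rr in \<open>auto simp del: of_nat_Suc\<close>)
      then show ?thesis by (rule filterlim_cong[THEN iffD1, rotated -1]) (auto simp: algebra_simps diff_divide_distrib add_divide_distrib)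
    qed
    note noise = tendsto_mult_right[OF tendsto_complex_of_real[OF this], of "vprod V i j"]
    have "(\<lambda>n. (1 - complex_of_real (s n)) * complex_of_real (s n / real (Suc n) powr (-\<nu>)) * (1 - \<alpha> i)) \<longlonglongrightarrow> (1 - complex_of_real 0) * of_real q * (1 - \<alpha> i)" for i
      by (intro tendsto_intros tendsto_complex_of_real[OF s_lim] s0)
    then have w1: "(\<lambda>n. ((1 - s n) * (s n * (1 - \<alpha> i))) / real (Suc n) powr (-\<nu>)) \<longlonglongrightarrow> of_real q * (1 - \<alpha> i)" for i
      by (simp add: mult.assoc)
    \<comment> \<open>Two factors \<open>s n\<close> against one unit of step: the direct influence
      of the first block on the square of the second is of second order and leaves no trace in the
      limit.\<close>
    have "(\<lambda>n. complex_of_real (s n) * complex_of_real (s n / real (Suc n) powr (-\<nu>)) * ((1 - \<alpha> i) * (1 - \<alpha> j))) \<longlonglongrightarrow> complex_of_real 0 * of_real q * ((1 - \<alpha> i) * (1 - \<alpha> j))"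
      by (intro tendsto_intros tendsto_complex_of_real[OF s_lim] s0)
    then have w2: "(\<lambda>n. (s n * (s n * ((1 - \<alpha> i) * (1 - \<alpha> j)))) / real (Suc n) powr (-\<nu>)) \<longlonglongrightarrow> 0"
      by (simp add: mult.assoc)
    have "(\<lambda>n. real (Suc n) powr p * ((1 - s n) * (s n * (1 - \<alpha> i)) * cov (Zc i) (Nc j) n) / real (Suc n) powr (-\<nu>)
       + real (Suc n) powr p * ((1 - s n) * (s n * (1 - \<alpha> j)) * cov (Zc j) (Nc i) n) / real (Suc n) powr (-\<nu>)
       + real (Suc n) powr p * (s n * (s n * ((1 - \<alpha> i) * (1 - \<alpha> j))) * cov (Zc i) (Zc j) n) / real (Suc n) powr (-\<nu>)
       + complex_of_real (real (Suc n) powr p * ?noise n / real (Suc n) powr (-\<nu>)) * vprod V i j) \<longlonglongrightarrow>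
       of_real q * (1 - \<alpha> i) * LZN i j + of_real q * (1 - \<alpha> j) * LZN j i + 0 * LZZ i j + of_real ?w * vprod V i j"
      by (intro tendsto_add scaled_forcing[OF cov_ZN_lim w1] scaled_forcing[OF cov_ZZ_lim w2] noise)
    then show "(\<lambda>n. real (Suc n) powr p * ((1 - s n) * s n * ((1 - \<alpha> i) * cov (Zc i) (Nc j) n + (1 - \<alpha> j) * cov (Zc j) (Nc i) n)
       + s n * s n * (1 - \<alpha> i) * (1 - \<alpha> j) * cov (Zc i) (Zc j) n
       + ?noise n * vprod V i j) / real (Suc n) powr (-\<nu>)) \<longlonglongrightarrow>
      of_real q * ((1 - \<alpha> i) * LZN i j + (1 - \<alpha> j) * LZN j i) + of_real ?w * vprod V i j"
      by (rule tendsto_eq_rhs[THEN filterlim_cong[THEN iffD1, rotated -1]]) (auto simp: ring_distribs add_divide_distrib mult.assoc mult.left_commute)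
    show "(if \<nu> = 1 then p else 0) < Re (of_real q + of_real q)"
      using Re_pos_N unfolding h\<rho>_def by simp
  qed (use range in simp_all)
  then show ?thesis by (simp add: LNN_def h\<rho>_def)
qed

section \<open>Trajectories without innovations\<close>

text \<open>Covers the responses to single impulses as well as the evolution of the initial value.
  The coordinate \<iota> comes with no contraction assumption, so its first component is required to
  vanish from the start.\<close>

definition traj :: "'n \<Rightarrow> nat \<Rightarrow> (nat \<Rightarrow> complex) \<Rightarrow> (nat \<Rightarrow> complex) \<Rightarrow> bool" where
  "traj i m z x \<longleftrightarrow> (\<forall>n\<ge>m. z (Suc n) = (1 - r n * \<alpha> i) * z n \<and> x (Suc n) = (1 - complex_of_real (s n)) * x n + s n * (1 - \<alpha> i) * z n)
     \<and> (i = \<iota> \<longrightarrow> (\<forall>n\<ge>m. z n = 0))"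

abbreviation "u n \<equiv> real n powr (p / 2)"

lemma Z_factor_lim: "(\<lambda>n. (1 - complex_of_real (u (Suc n) / u n) * ((1 - r n * \<alpha> i) * (1 - 0))) / real (Suc n) powr (-\<gamma>))
    \<longlonglongrightarrow> of_real c * \<alpha> i + 0 - of_real (if \<gamma> = 1 then p / 2 else 0)"
proof (rule contraction_factor_tendsto[OF Suc_powr_neg(1,2)[OF range(1,2)] _ _ powr_ratio_tendsto[OF range(2)]])
  show "(\<lambda>n. r n * \<alpha> i / real (Suc n) powr (-\<gamma>)) \<longlonglongrightarrow> of_real c * \<alpha> i"
    using tendsto_mult_right[OF tendsto_complex_of_real[OF r_lim], of "\<alpha> i"] by simp
qed simp

lemma N_factor_lim: "(\<lambda>n. (1 - complex_of_real (u (Suc n) / u n) * ((1 - complex_of_real (s n)) * (1 - 0))) / real (Suc n) powr (-\<nu>))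
    \<longlonglongrightarrow> of_real q + 0 - of_real (if \<nu> = 1 then p / 2 else 0)"
proof -
  have "(\<lambda>n. (1 - complex_of_real (u (Suc n) / u n) * ((1 - complex_of_real (s n)) * (1 - 0))) / real (Suc n) powr (-\<nu>))
    \<longlonglongrightarrow> of_real q + 0 - of_real (if \<nu> = 1 then p / 2 else 0)"
  proof (rule contraction_factor_tendsto[OF Suc_powr_neg(1,2)[OF range(3,4)] _ _ powr_ratio_tendsto[OF range(4)]])
    show "(\<lambda>n. s n / complex_of_real (real (Suc n) powr (-\<nu>))) \<longlonglongrightarrow> of_real q"
      using tendsto_complex_of_real[OF s_lim] by simp
  qed simp
  then show ?thesis by simp
qed

lemma Z_contract:
  assumes "i \<noteq> \<iota>"
  shows "\<forall>\<^sub>F n in sequentially. norm (complex_of_real (u (Suc n) / u n) * (1 - r n * \<alpha> i)) \<le> 1"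
proof -
  have "0 < Re (of_real c * \<alpha> i + 0 - of_real (if \<gamma> = 1 then p / 2 else 0))"
    using Re_pos_Z[OF assms] unfolding h\<rho>_def by (simp split: if_splits)
  from norm_one_minus_eventually_le[OF Suc_powr_neg(1,2)[OF range(1,2)] Z_factor_lim this]
  show ?thesis by eventually_elim simp
qed

lemma N_contract: "\<exists>\<delta>>0. \<forall>\<^sub>F n in sequentially. norm (complex_of_real (u (Suc n) / u n) * (1 - complex_of_real (s n))) \<le> 1 - \<delta> * real (Suc n) powr (-\<nu>)"
proof -
  let ?b = "Re (of_real q + 0 - of_real (if \<nu> = 1 then p / 2 else 0))"
  have b: "?b > 0" using Re_pos_N unfolding h\<rho>_def by (simp split: if_splits)
  then have "?b / 2 < ?b" by simp
  from norm_one_minus_eventually_le[OF Suc_powr_neg(1,2)[OF range(3,4)] N_factor_lim this] b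
  show ?thesis by (intro exI[of _ "?b / 2"]) simp
qed

text \<open>The input from the first block has the same order \<open>n powr (-\<nu>)\<close> as the
  contraction in \<open>N_contract\<close>, so the quotient of the two constants bounds the
  amplification.\<close>

lemma N_gain: "\<exists>K\<ge>0. \<forall>\<^sub>F n in sequentially. norm (complex_of_real (u (Suc n) / u n) * (s n * (1 - \<alpha> i))) \<le> K * real (Suc n) powr (-\<nu>)"
proof -
  have 1: "(\<lambda>n. u (Suc n) / u n) \<longlonglongrightarrow> 1" by real_asymp
  have "(\<lambda>n. norm (complex_of_real (u (Suc n) / u n) * complex_of_real (s n / real (Suc n) powr (-\<nu>)) * (1 - \<alpha> i))) \<longlonglongrightarrow> norm (complex_of_real 1 * of_real q * (1 - \<alpha> i))"
    (is "?f \<longlonglongrightarrow> ?l")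
    by (intro tendsto_norm tendsto_mult tendsto_const tendsto_complex_of_real 1 s_lim)
  then have "\<forall>\<^sub>F n in sequentially. ?f n < ?l + 1" by (rule order_tendstoD(2)) simp
  then have "\<forall>\<^sub>F n in sequentially. norm (complex_of_real (u (Suc n) / u n) * (s n * (1 - \<alpha> i))) \<le> (?l + 1) * real (Suc n) powr (-\<nu>)"
  proof eventually_elim
    case (elim n)
    have "norm (complex_of_real (u (Suc n) / u n) * (s n * (1 - \<alpha> i))) = ?f n * real (Suc n) powr (-\<nu>)"
      by (simp add: norm_mult norm_divide del: of_nat_Suc)
    then show ?case using mult_right_mono[OF less_imp_le[OF elim], of "real (Suc n) powr (-\<nu>)"] by simp
  qed
  then show ?thesis by (intro exI[of _ "?l + 1"]) auto
qed

lemma scale_step: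
  "n \<ge> 1 \<Longrightarrow> u (Suc n) * norm (a * y) = norm (complex_of_real (u (Suc n) / u n) * a) * (u n * norm y)"
  by (simp add: norm_mult norm_divide del: of_nat_Suc)

text \<open>The point is uniformity in the starting time \<open>m\<close>. After rescaling, the
  first component does not grow; the second loses a share \<open>\<delta> * e\<close> per step and
  gains at most \<open>K * e\<close> times the first. A bound with
  \<open>K \<le> \<delta> * D\<close> therefore reproduces itself, and
  \<open>D = 1 + K / \<delta>\<close> also covers the start.\<close>

lemma traj_bound:
  "\<exists>n0 D. D \<ge> 0 \<and> (\<forall>m\<ge>n0. \<forall>z x. traj i m z x \<longrightarrow> (\<forall>n\<ge>m.
     u n * norm (z n) \<le> D * (u m * (norm (z m) + norm (x m))) \<and> u n * norm (x n) \<le> D * (u m * (norm (z m) + norm (x m)))))"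
proof -
  obtain \<delta> where \<delta>: "\<delta> > 0" and N: "\<forall>\<^sub>F n in sequentially. norm (complex_of_real (u (Suc n) / u n) * (1 - complex_of_real (s n))) \<le> 1 - \<delta> * real (Suc n) powr (-\<nu>)"
    using N_contract by blast
  obtain K where K: "K \<ge> 0" and G: "\<forall>\<^sub>F n in sequentially. norm (complex_of_real (u (Suc n) / u n) * (s n * (1 - \<alpha> i))) \<le> K * real (Suc n) powr (-\<nu>)"
    using N_gain by blast
  have Z: "\<forall>\<^sub>F n in sequentially. i \<noteq> \<iota> \<longrightarrow> norm (complex_of_real (u (Suc n) / u n) * (1 - r n * \<alpha> i)) \<le> 1"
    using Z_contract[of i] by (cases "i = \<iota>") auto
  from eventually_conj[OF N eventually_conj[OF G eventually_conj[OF Z eventually_ge_at_top[of 1]]]]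
  obtain n0 where n0: "\<And>n. n \<ge> n0 \<Longrightarrow> norm (complex_of_real (u (Suc n) / u n) * (1 - complex_of_real (s n))) \<le> 1 - \<delta> * real (Suc n) powr (-\<nu>)"
     "\<And>n. n \<ge> n0 \<Longrightarrow> norm (complex_of_real (u (Suc n) / u n) * (s n * (1 - \<alpha> i))) \<le> K * real (Suc n) powr (-\<nu>)"
     "\<And>n. n \<ge> n0 \<Longrightarrow> i \<noteq> \<iota> \<Longrightarrow> norm (complex_of_real (u (Suc n) / u n) * (1 - r n * \<alpha> i)) \<le> 1"
     "\<And>n. n \<ge> n0 \<Longrightarrow> n \<ge> 1"
    unfolding eventually_sequentially by blast
  define D where "D = 1 + K / \<delta>"
  have D: "D \<ge> 1" "D \<ge> K / \<delta>" using K \<delta> by (auto simp: D_def)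
  have main: "u n * norm (z n) \<le> u m * norm (z m) \<and> u n * norm (x n) \<le> D * (u m * (norm (z m) + norm (x m)))"
    if m: "m \<ge> n0" and t: "traj i m z x" and "n \<ge> m" for m n z x
    using \<open>n \<ge> m\<close>
  proof (induction n rule: dec_induct)
    case base
    have "1 * (u m * norm (x m)) \<le> D * (u m * (norm (z m) + norm (x m)))"
      using D by (intro mult_mono) auto
    then show ?case by simp
  next
    case (step n)
    have nn: "n \<ge> n0" using step m by simp
    have z: "z (Suc n) = (1 - r n * \<alpha> i) * z n" and x: "x (Suc n) = (1 - complex_of_real (s n)) * x n + (s n * (1 - \<alpha> i)) * z n"
      using t step(1) by (auto simp: traj_def)
    define M where "M = D * (u m * (norm (z m) + norm (x m)))"
    define e where "e = real (Suc n) powr (-\<nu>)"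
    have e: "e \<ge> 0" by (simp add: e_def)
    have "u (Suc n) * norm (z (Suc n)) \<le> u m * norm (z m)"
    proof (cases "i = \<iota>")
      case True
      then have "z (Suc n) = 0" using t step(1) by (auto simp: traj_def)
      then show ?thesis by simp
    next
      case False
      have "u (Suc n) * norm (z (Suc n)) \<le> 1 * (u n * norm (z n))"
        unfolding z scale_step[OF n0(4)[OF nn]] by (intro mult_right_mono n0(3) nn False) auto
      then show ?thesis using step by simp
    qed
    moreover have "u (Suc n) * norm (x (Suc n)) \<le> M"
    proof -
      have f: "norm (complex_of_real (u (Suc n) / u n) * (1 - complex_of_real (s n))) \<le> 1 - \<delta> * e" using n0(1)[OF nn] by (simp add: e_def)
      then have "0 \<le> 1 - \<delta> * e" using norm_ge_zero order_trans by blast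
      have "K * (u m * norm (z m)) \<le> \<delta> * M"
      proof -
        have "K \<le> \<delta> * D" using \<delta> by (simp add: D_def field_simps)
        then have "K * (u m * norm (z m)) \<le> (\<delta> * D) * (u m * (norm (z m) + norm (x m)))" using K by (intro mult_mono) auto
        then show ?thesis by (simp add: M_def mult.assoc)
      qed
      then have KM: "e * (K * (u m * norm (z m))) \<le> e * (\<delta> * M)" using e by (rule mult_left_mono)
      have "u (Suc n) * norm (x (Suc n)) \<le> u (Suc n) * norm ((1 - complex_of_real (s n)) * x n) + u (Suc n) * norm ((s n * (1 - \<alpha> i)) * z n)"
        unfolding x distrib_left[symmetric] by (intro mult_left_mono) (auto simp del: of_real_mult intro!: norm_triangle_le)
      also have "\<dots> \<le> (1 - \<delta> * e) * (u n * norm (x n)) + (K * e) * (u n * norm (z n))"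
        unfolding scale_step[OF n0(4)[OF nn]]
        by (intro add_mono mult_right_mono) (use f n0(2)[OF nn] in \<open>auto simp: e_def\<close>)
      also have "\<dots> \<le> (1 - \<delta> * e) * M + (K * e) * (u m * norm (z m))"
        using step(3) \<open>0 \<le> 1 - \<delta> * e\<close> K e by (intro add_mono mult_left_mono) (auto simp: M_def)
      also have "\<dots> \<le> M" using KM by (simp add: algebra_simps)
      finally show ?thesis .
    qed
    ultimately show ?case by (simp add: M_def)
  qed
  have "u n * norm (z n) \<le> D * (u m * (norm (z m) + norm (x m)))"
    if "m \<ge> n0" "traj i m z x" "n \<ge> m" for m n z x
  proof -
    have "1 * (u m * norm (z m)) \<le> D * (u m * (norm (z m) + norm (x m)))"
      using D by (intro mult_mono) auto
    then show ?thesis using main[OF that] by simp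
  qed
  then show ?thesis using main D by (intro exI[of _ n0] exI[of _ D]) auto
qed

text \<open>The recursion lemma for covariances, used with a single contraction factor and exponent
  \<open>p / 2\<close>; its positivity condition is half of the one for \<open>p\<close>. The first
  component has no forcing, the second a forcing already known to vanish at this scale.\<close>

lemma traj_tendsto_zero:
  fixes z x :: "nat \<Rightarrow> complex"
  assumes "traj i m z x"
  shows "(\<lambda>n. u n * z n) \<longlonglongrightarrow> 0" "(\<lambda>n. u n * x n) \<longlonglongrightarrow> 0"
proof -
  have ev: "\<forall>\<^sub>F n in sequentially. z (Suc n) = (1 - r n * \<alpha> i) * z n \<and> x (Suc n) = (1 - complex_of_real (s n)) * x n + s n * (1 - \<alpha> i) * z n"
    by (rule eventually_mono[OF eventually_ge_at_top[of m]]) (use assms in \<open>auto simp: traj_def\<close>)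
  show z: "(\<lambda>n. u n * z n) \<longlonglongrightarrow> 0"
  proof (cases "i = \<iota>")
    case True
    then have "\<forall>\<^sub>F n in sequentially. u n * z n = 0"
      by (intro eventually_mono[OF eventually_ge_at_top[of m]]) (use assms in \<open>auto simp: traj_def\<close>)
    then show ?thesis by (simp add: tendsto_eventually)
  next
    case False
    have "(\<lambda>n. u n * z n) \<longlonglongrightarrow> 0 / (of_real c * \<alpha> i + 0 - complex_of_real (if \<gamma> = 1 then p / 2 else 0))"
    proof (rule covariance_recursion_tendsto[where \<rho>=\<gamma> and a="\<lambda>n. r n * \<alpha> i" and b="\<lambda>n. 0" and f="\<lambda>n. 0"])
      show "\<forall>\<^sub>F n in sequentially. z (Suc n) = (1 - complex_of_real (r n) * \<alpha> i) * (1 - 0) * z n + 0"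
        using ev by eventually_elim simp
      show "(\<lambda>n. r n * \<alpha> i / real (Suc n) powr (-\<gamma>)) \<longlonglongrightarrow> of_real c * \<alpha> i"
        using tendsto_mult_right[OF tendsto_complex_of_real[OF r_lim], of "\<alpha> i"] by simp
      show "(if \<gamma> = 1 then p / 2 else 0) < Re (of_real c * \<alpha> i + 0)"
        using Re_pos_Z[OF False] unfolding h\<rho>_def by (simp split: if_splits)
    qed (use range in auto)
    then show ?thesis by simp
  qed
  have "(\<lambda>n. u n * x n) \<longlonglongrightarrow> (of_real q * (1 - \<alpha> i) * 0) / (of_real q + 0 - complex_of_real (if \<nu> = 1 then p / 2 else 0))"
  proof (rule covariance_recursion_tendsto[where \<rho>=\<nu> and a="\<lambda>n. s n" and b="\<lambda>n. 0" and f="\<lambda>n. s n * (1 - \<alpha> i) * z n"])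
    show "\<forall>\<^sub>F n in sequentially. x (Suc n) = (1 - complex_of_real (s n)) * (1 - 0) * x n + s n * (1 - \<alpha> i) * z n"
      using ev by eventually_elim simp
    show "(\<lambda>n. complex_of_real (s n) / real (Suc n) powr (-\<nu>)) \<longlonglongrightarrow> of_real q"
      using tendsto_complex_of_real[OF s_lim] by simp
    have 1: "(\<lambda>n. complex_of_real (u (Suc n) / u n)) \<longlonglongrightarrow> complex_of_real 1" by (rule tendsto_complex_of_real) real_asymp
    have "(\<lambda>n. complex_of_real (u (Suc n) / u n) * (complex_of_real (s n / real (Suc n) powr (-\<nu>)) * (1 - \<alpha> i)) * (u n * z n)) \<longlonglongrightarrow> of_real 1 * (of_real q * (1 - \<alpha> i)) * 0"
      by (intro tendsto_mult tendsto_const tendsto_complex_of_real[OF s_lim] z 1)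
    then have "(\<lambda>n. complex_of_real (u (Suc n) / u n) * (complex_of_real (s n / real (Suc n) powr (-\<nu>)) * (1 - \<alpha> i)) * (u n * z n)) \<longlonglongrightarrow> of_real q * (1 - \<alpha> i) * 0" by simp
    then show "(\<lambda>n. complex_of_real (u (Suc n)) * (complex_of_real (s n) * (1 - \<alpha> i) * z n) / real (Suc n) powr (-\<nu>)) \<longlonglongrightarrow> of_real q * (1 - \<alpha> i) * 0"
    proof (rule Lim_transform_eventually)
      show "\<forall>\<^sub>F n in sequentially. complex_of_real (u (Suc n) / u n) * (complex_of_real (s n / real (Suc n) powr (-\<nu>)) * (1 - \<alpha> i)) * (u n * z n) =
        complex_of_real (u (Suc n)) * (complex_of_real (s n) * (1 - \<alpha> i) * z n) / real (Suc n) powr (-\<nu>)"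
        using eventually_gt_at_top[of 0] by eventually_elim simp
    qed
    show "(if \<nu> = 1 then p / 2 else 0) < Re (complex_of_real q + 0)"
      using Re_pos_N unfolding h\<rho>_def by (simp split: if_splits)
  qed (use range in auto)
  then show "(\<lambda>n. u n * x n) \<longlonglongrightarrow> 0" by simp
qed

lemma traj_Zc_Nc: "traj i (Suc k) (Zc i k l) (Nc i k l)"
  unfolding traj_def using Zc_step[of k _ i l] Nc_step[of k _ i l] Zc_\<iota>[of k _ l] by auto

text \<open>Late indices \<open>k\<close> are handled uniformly by assumption; finitely many early
  ones remain, and for these pointwise convergence suffices.\<close>

lemma uniformly_small:
  fixes f :: "nat \<Rightarrow> nat \<Rightarrow> real"
  assumes "\<And>k. f k \<longlonglongrightarrow> 0" and "\<And>\<epsilon>. \<epsilon> > 0 \<Longrightarrow> \<exists>k0. \<forall>k\<ge>k0. \<forall>n>k. f k n \<le> \<epsilon>" and "\<epsilon> > 0"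
  shows "\<forall>\<^sub>F n in sequentially. \<forall>k<n. f k n \<le> \<epsilon>"
proof -
  obtain k0 where k0: "\<And>k n. k \<ge> k0 \<Longrightarrow> n > k \<Longrightarrow> f k n \<le> \<epsilon>" using assms(2)[OF assms(3)] by blast
  have "\<forall>\<^sub>F n in sequentially. f k n < \<epsilon>" for k
    using order_tendstoD(2)[OF assms(1) assms(3)] .
  then have "\<forall>\<^sub>F n in sequentially. \<forall>k\<in>{..<k0}. f k n < \<epsilon>"
    by (intro eventually_ball_finite) auto
  then show ?thesis
    by eventually_elim (use k0 in \<open>metis lessThan_iff less_imp_le not_le\<close>)
qed

text \<open>A fresh impulse has the order of \<open>r k\<close> or \<open>s k\<close>; the
  conditions \<open>p < 2 * \<gamma>\<close> and \<open>p < 2 * \<nu>\<close> keep the scale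
  \<open>u\<close> from compensating this.\<close>

lemma initial_lim: "(\<lambda>k. u (Suc k) * (norm (Zc i k l (Suc k)) + norm (Nc i k l (Suc k)))) \<longlonglongrightarrow> 0"
proof -
  have a: "(\<lambda>k. u (Suc k) * r k) \<longlonglongrightarrow> 0"
  proof -
    have "(\<lambda>k. (r k / real (Suc k) powr (-\<gamma>)) * real (Suc k) powr (p / 2 - \<gamma>)) \<longlonglongrightarrow> c * 0"
      by (intro tendsto_mult r_lim Suc_powr_tendsto_0) (use p in simp)
    moreover have "(r k / real (Suc k) powr (-\<gamma>)) * real (Suc k) powr (p / 2 - \<gamma>) = u (Suc k) * r k" for k
      unfolding diff_conv_add_uminus powr_add by (simp del: of_nat_Suc)
    ultimately show ?thesis by simp
  qed
  have b: "(\<lambda>k. u (Suc k) * s k) \<longlonglongrightarrow> 0"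
  proof -
    have "(\<lambda>k. (s k / real (Suc k) powr (-\<nu>)) * real (Suc k) powr (p / 2 - \<nu>)) \<longlonglongrightarrow> q * 0"
      by (intro tendsto_mult s_lim Suc_powr_tendsto_0) (use p in simp)
    moreover have "(s k / real (Suc k) powr (-\<nu>)) * real (Suc k) powr (p / 2 - \<nu>) = u (Suc k) * s k" for k
      unfolding diff_conv_add_uminus powr_add by (simp del: of_nat_Suc)
    ultimately show ?thesis by simp
  qed
  have "(\<lambda>k. (if i = \<iota> then 0 else \<bar>u (Suc k) * r k\<bar> * norm (V $ l $ i)) + \<bar>u (Suc k) * s k - (if i = \<iota> then u (Suc k) * r k else 0)\<bar> * norm (V $ l $ i)) \<longlonglongrightarrow> 0"
    using tendsto_add[OF tendsto_mult_left_zero[OF tendsto_rabs_zero[OF a], of "norm (V $ l $ i)"] tendsto_mult_left_zero[OF tendsto_rabs_zero[OF b], of "norm (V $ l $ i)"]]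
      tendsto_mult_left_zero[OF tendsto_rabs_zero[OF tendsto_diff[OF b a, unfolded diff_zero]], of "norm (V $ l $ i)"]
    by (cases "i = \<iota>") (simp_all del: of_nat_Suc)
  moreover have "u (Suc k) * (norm (Zc i k l (Suc k)) + norm (Nc i k l (Suc k))) =
     (if i = \<iota> then 0 else \<bar>u (Suc k) * r k\<bar> * norm (V $ l $ i)) + \<bar>u (Suc k) * s k - (if i = \<iota> then u (Suc k) * r k else 0)\<bar> * norm (V $ l $ i)" for k
  proof -
    have "\<bar>u (Suc k) * s k - u (Suc k) * r k\<bar> = u (Suc k) * \<bar>s k - r k\<bar>"
      by (simp add: abs_mult flip: right_diff_distrib)
    then show ?thesis
      by (cases "i = \<iota>") (simp_all add: Zc_new Nc_new norm_mult abs_mult ring_distribs del: of_real_diff of_nat_Suc flip: of_real_diff)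
  qed
  ultimately show ?thesis by simp
qed

text \<open>The negligibility of single coefficients that the central limit theorem requires: late
  impulses start small and are never amplified by more than \<open>D\<close>, early ones have died
  out by time \<open>n\<close>.\<close>

lemma Zc_Nc_small:
  assumes "\<epsilon> > 0"
  shows "\<forall>\<^sub>F n in sequentially. \<forall>k<n. u n * norm (Zc i k l n) \<le> \<epsilon>"
    "\<forall>\<^sub>F n in sequentially. \<forall>k<n. u n * norm (Nc i k l n) \<le> \<epsilon>"
proof -
  obtain n0 D where D: "D \<ge> 0" and B: "\<And>m z x n. m \<ge> n0 \<Longrightarrow> traj i m z x \<Longrightarrow> n \<ge> m \<Longrightarrow>
     u n * norm (z n) \<le> D * (u m * (norm (z m) + norm (x m))) \<and> u n * norm (x n) \<le> D * (u m * (norm (z m) + norm (x m)))"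
    using traj_bound[of i] by blast
  have ex: "\<exists>k0. \<forall>k\<ge>k0. \<forall>n>k. u n * norm (Zc i k l n) \<le> \<epsilon> \<and> u n * norm (Nc i k l n) \<le> \<epsilon>" if "\<epsilon> > 0" for \<epsilon>
  proof -
    have "(\<lambda>k. D * (u (Suc k) * (norm (Zc i k l (Suc k)) + norm (Nc i k l (Suc k))))) \<longlonglongrightarrow> D * 0"
      by (intro tendsto_mult tendsto_const initial_lim)
    then have "\<forall>\<^sub>F k in sequentially. D * (u (Suc k) * (norm (Zc i k l (Suc k)) + norm (Nc i k l (Suc k)))) < \<epsilon>"
      by (rule order_tendstoD(2)) (use that in simp)
    then obtain k1 where k1: "\<And>k. k \<ge> k1 \<Longrightarrow> D * (u (Suc k) * (norm (Zc i k l (Suc k)) + norm (Nc i k l (Suc k)))) < \<epsilon>"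
      unfolding eventually_sequentially by blast
    show ?thesis
    proof (intro exI[of _ "max k1 n0"] allI impI)
      fix k n assume "max k1 n0 \<le> k" "k < n"
      then show "u n * norm (Zc i k l n) \<le> \<epsilon> \<and> u n * norm (Nc i k l n) \<le> \<epsilon>"
        using B[OF _ traj_Zc_Nc[of i k l], of n] k1[of k] by (auto intro: order_trans less_imp_le)
    qed
  qed
  have n: "(\<lambda>n. u n * norm (Zc i k l n)) \<longlonglongrightarrow> 0" "(\<lambda>n. u n * norm (Nc i k l n)) \<longlonglongrightarrow> 0" for k
    using traj_tendsto_zero[OF traj_Zc_Nc[of i k l], THEN tendsto_norm_zero] by (simp_all add: norm_mult)
  show "\<forall>\<^sub>F n in sequentially. \<forall>k<n. u n * norm (Zc i k l n) \<le> \<epsilon>"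
    by (rule uniformly_small[OF n(1) _ assms]) (use ex in meson)
  show "\<forall>\<^sub>F n in sequentially. \<forall>k<n. u n * norm (Nc i k l n) \<le> \<epsilon>"
    by (rule uniformly_small[OF n(2) _ assms]) (use ex in meson)
qed

end

section \<open>Gaussian smoothing and Levy's continuity theorem\<close>

text \<open>Index products are rewritten over \<open>Basis\<close>, where integrals against Lebesgue
  measure factorise; \<open>SOME\<close> recovers the index of a basis vector, which is
  unique.\<close>

lemma std_mvnormal_density_axis:
  fixes f :: "'d::finite \<Rightarrow> real \<Rightarrow> 'b::comm_monoid_mult" and x :: "real^'d"
  shows "(\<Prod>i\<in>UNIV. f i (x $ i)) = (\<Prod>b\<in>Basis. f (SOME i. b = axis i 1) (x \<bullet> b))"
proof -
  have idx: "(SOME j. axis i 1 = (axis j 1 :: real^'d)) = i" for i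
    by (rule some_equality) (auto simp: axis_eq_axis)
  have B: "Basis = range (\<lambda>i. axis i 1 :: real^'d)" by (auto simp: Basis_vec_def)
  have inj: "inj (\<lambda>i. axis i 1 :: real^'d)" by (auto simp: inj_def axis_eq_axis)
  show ?thesis unfolding B prod.reindex[OF inj] by (simp add: idx inner_axis)
qed

lemma prob_space_std_mvnormal: "prob_space (std_mvnormal :: (real^'d::finite) measure)"
proof
  have "emeasure (std_mvnormal :: (real^'d) measure) (space std_mvnormal) = (\<integral>\<^sup>+x. ennreal (\<Prod>i\<in>UNIV. std_normal_density (x $ i)) \<partial>(lborel :: (real^'d) measure))"
    by (simp add: std_mvnormal_def emeasure_density)
  also have "\<dots> = (\<integral>\<^sup>+x. (\<Prod>b\<in>Basis. ennreal (std_normal_density (x \<bullet> b))) \<partial>(lborel :: (real^'d) measure))"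
    unfolding std_mvnormal_density_axis[of "\<lambda>_. std_normal_density"] by (simp add: prod_ennreal)
  also have "\<dots> = (\<Prod>b\<in>(Basis :: (real^'d) set). (\<integral>\<^sup>+x. ennreal (std_normal_density x) \<partial>lborel))"
    by (rule nn_integral_lborel_prod) auto
  also have "(\<integral>\<^sup>+x. ennreal (std_normal_density x) \<partial>lborel) = 1"
    using prob_space.emeasure_space_1[OF prob_space_normal_density[of 1 0]] by (simp add: emeasure_density)
  finally show "emeasure (std_mvnormal :: (real^'d) measure) (space std_mvnormal) = 1" by simp
qed

lemma sets_std_mvnormal [measurable_cong, simp]: "sets std_mvnormal = sets borel"
  and space_std_mvnormal [simp]: "space std_mvnormal = UNIV"
  by (simp_all add: std_mvnormal_def)

lemma std_mvnormal_integral_prod: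
  fixes f :: "'d::finite \<Rightarrow> real \<Rightarrow> complex"
  assumes "\<And>i. integrable std_normal_distribution (f i)"
  shows "(\<integral>x. (\<Prod>i\<in>UNIV. f i (x $ i)) \<partial>std_mvnormal) = (\<Prod>i\<in>UNIV. \<integral>y. f i y \<partial>std_normal_distribution)"
proof -
  let ?I = "\<lambda>b :: real^'d. SOME i. b = axis i 1"
  define h where "h i t = std_normal_density t *\<^sub>R f i t" for i t
  have m[measurable]: "f i \<in> borel_measurable borel" for i
    using borel_measurable_integrable[OF assms[of i]] by simp
  have mh[measurable]: "h i \<in> borel_measurable borel" for i unfolding h_def by measurable
  interpret product_sigma_finite "\<lambda>b :: real^'d. lborel :: real measure" ..
  have ih: "integrable lborel (h i)" for i
  proof -
    have "h i = (\<lambda>t. std_normal_density t *\<^sub>R f i t)" by (simp add: h_def fun_eq_iff)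
    then show ?thesis using assms[of i] by (subst (asm) integrable_density) auto
  qed
  have "(\<integral>x. (\<Prod>i\<in>UNIV. f i (x $ i)) \<partial>std_mvnormal) = (\<integral>x. (\<Prod>i\<in>UNIV. std_normal_density (x $ i)) *\<^sub>R (\<Prod>i\<in>UNIV. f i (x $ i)) \<partial>(lborel :: (real^'d) measure))"
    unfolding std_mvnormal_def by (rule integral_density) (auto intro!: AE_I2 prod_nonneg)
  also have "\<dots> = (\<integral>x. (\<Prod>i\<in>UNIV. h i (x $ i)) \<partial>(lborel :: (real^'d) measure))"
    by (simp add: h_def prod.distrib scaleR_conv_of_real)
  also have "\<dots> = (\<integral>x. (\<Prod>b\<in>Basis. h (?I b) (x \<bullet> b)) \<partial>(lborel :: (real^'d) measure))"
    by (subst std_mvnormal_density_axis) simp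
  also have "\<dots> = (\<integral>x. (\<Prod>b\<in>Basis. h (?I b) ((\<Sum>b\<in>Basis. x b *\<^sub>R b) \<bullet> b)) \<partial>(\<Pi>\<^sub>M b\<in>(Basis :: (real^'d) set). lborel))"
    by (subst lborel_eq, subst integral_distr) auto
  also have "\<dots> = (\<integral>x. (\<Prod>b\<in>Basis. h (?I b) (x b)) \<partial>(\<Pi>\<^sub>M b\<in>(Basis :: (real^'d) set). lborel))"
    by (intro Bochner_Integration.integral_cong refl prod.cong) (simp add: inner_sum_left inner_Basis if_distrib cong: if_cong)
  also have "\<dots> = (\<Prod>b\<in>(Basis :: (real^'d) set). \<integral>t. h (?I b) t \<partial>lborel)"
    by (rule product_integral_prod) (auto intro: ih)
  also have "\<dots> = (\<Prod>i\<in>UNIV. \<integral>t. h i t \<partial>lborel)"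
    using std_mvnormal_density_axis[of "\<lambda>i _. \<integral>t. h i t \<partial>lborel"] by simp
  also have "\<dots> = (\<Prod>i\<in>UNIV. \<integral>y. f i y \<partial>std_normal_distribution)"
    unfolding h_def by (intro prod.cong refl, subst integral_density) auto
  finally show ?thesis .
qed

lemma std_mvnormal_char:
  fixes t :: "real^'d::finite"
  shows "(\<integral>x. iexp (t \<bullet> x) \<partial>std_mvnormal) = exp (- (norm t)\<^sup>2 / 2)"
proof -
  interpret prob_space std_normal_distribution by (simp add: prob_space_normal_density)
  have "iexp (t \<bullet> x) = (\<Prod>i\<in>UNIV. iexp (t $ i * x $ i))" for x :: "real^'d"
    by (simp add: inner_vec_def exp_sum[symmetric] sum_distrib_left)
  then have "(\<integral>x. iexp (t \<bullet> x) \<partial>std_mvnormal) = (\<integral>x. (\<Prod>i\<in>UNIV. iexp (t $ i * x $ i)) \<partial>std_mvnormal)" by simp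
  also have "\<dots> = (\<Prod>i\<in>UNIV. \<integral>y. iexp (t $ i * y) \<partial>std_normal_distribution)"
    by (rule std_mvnormal_integral_prod[of "\<lambda>i y. iexp (t $ i * y)"]) (auto intro!: integrable_iexp)
  also have "\<dots> = (\<Prod>i\<in>UNIV. complex_of_real (exp (- ((t $ i)^2) / 2)))"
    using char_std_normal_distribution by (simp add: char_def fun_eq_iff)
  also have "\<dots> = complex_of_real (exp (\<Sum>i\<in>UNIV. - ((t $ i)^2) / 2))"
    by (simp add: exp_sum)
  also have "(\<Sum>i\<in>UNIV. - ((t $ i)^2) / 2) = - (norm t)\<^sup>2 / 2"
    by (simp add: norm_vec_def L2_set_def sum_nonneg sum_negf sum_divide_distrib)
  finally show ?thesis by simp
qed

lemma std_mvnormal_density_eq: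
  fixes x :: "real^'d::finite"
  shows "(\<Prod>i\<in>UNIV. std_normal_density (x $ i)) = (1 / sqrt (2 * pi)) ^ CARD('d) * exp (- (norm x)\<^sup>2 / 2)"
proof -
  have "(\<Prod>i\<in>UNIV. std_normal_density (x $ i)) = (\<Prod>i\<in>(UNIV::'d set). 1 / sqrt (2 * pi)) * exp (\<Sum>i\<in>UNIV. - ((x $ i)\<^sup>2) / 2)"
    by (simp only: std_normal_density_def prod.distrib exp_sum[OF finite_class.finite_UNIV])
  also have "(\<Sum>i\<in>UNIV. - ((x $ i)\<^sup>2) / 2) = - (norm x)\<^sup>2 / 2"
    by (simp add: norm_vec_def L2_set_def sum_nonneg sum_negf sum_divide_distrib)
  finally show ?thesis by (simp add: power_divide)
qed

lemma integrable_bounded: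
  fixes f :: "'a \<Rightarrow> 'b::{banach, second_countable_topology}"
  assumes "finite_measure M" "f \<in> borel_measurable M" "\<And>x. x \<in> space M \<Longrightarrow> norm (f x) \<le> B"
  shows "integrable M f"
  by (rule finite_measure.integrable_const_bound[OF assms(1), of _ B]) (use assms in auto)

lemma Fubini_bounded:
  fixes f :: "'a \<Rightarrow> 'b \<Rightarrow> 'c::{banach, second_countable_topology}"
  assumes "finite_measure M1" "finite_measure M2" "case_prod f \<in> borel_measurable (M1 \<Otimes>\<^sub>M M2)"
    "\<And>x y. x \<in> space M1 \<Longrightarrow> y \<in> space M2 \<Longrightarrow> norm (f x y) \<le> B"
  shows "(\<integral>y. (\<integral>x. f x y \<partial>M1) \<partial>M2) = (\<integral>x. (\<integral>y. f x y \<partial>M2) \<partial>M1)"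
    and "(\<integral>x. (\<integral>y. f x y \<partial>M2) \<partial>M1) = (\<integral>z. f (fst z) (snd z) \<partial>(M1 \<Otimes>\<^sub>M M2))"
proof -
  interpret M1: finite_measure M1 by fact
  interpret M2: finite_measure M2 by fact
  interpret pair_sigma_finite M1 M2 ..
  have i: "integrable (M1 \<Otimes>\<^sub>M M2) (case_prod f)"
    using assms(4) by (intro integrable_bounded[where B=B] finite_measure_pair_measure assms) (auto simp: space_pair_measure)
  show "(\<integral>y. (\<integral>x. f x y \<partial>M1) \<partial>M2) = (\<integral>x. (\<integral>y. f x y \<partial>M2) \<partial>M1)" by (rule Fubini_integral[OF i])
  show "(\<integral>x. (\<integral>y. f x y \<partial>M2) \<partial>M1) = (\<integral>z. f (fst z) (snd z) \<partial>(M1 \<Otimes>\<^sub>M M2))"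
    using integral_fst[OF i] by (simp add: case_prod_beta')
qed

section \<open>From characteristic functions to test functions\<close>

text \<open>Integrals of characters inherit convergence: Fubini moves the integral over
  \<open>Q\<close> outside, where bounded convergence applies.\<close>

lemma character_mixture_tendsto:
  fixes \<mu> :: "(real^'d::finite) measure" and w :: "'q \<Rightarrow> complex" and \<theta> :: "'q \<Rightarrow> real^'d"
  assumes ps: "prob_space \<mu>" "\<And>n. prob_space (\<mu>s n)" "sets \<mu> = sets borel" "\<And>n. sets (\<mu>s n) = sets borel"
    and char: "\<And>t. (\<lambda>n. \<integral>x. iexp (t \<bullet> x) \<partial>\<mu>s n) \<longlonglongrightarrow> (\<integral>x. iexp (t \<bullet> x) \<partial>\<mu>)"
    and Q: "finite_measure Q" and w[measurable]: "w \<in> borel_measurable Q" "\<theta> \<in> borel_measurable Q"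
    and B: "\<And>q. norm (w q) \<le> B"
  shows "(\<lambda>n. \<integral>x. (\<integral>q. w q * iexp (\<theta> q \<bullet> x) \<partial>Q) \<partial>\<mu>s n) \<longlonglongrightarrow> (\<integral>x. (\<integral>q. w q * iexp (\<theta> q \<bullet> x) \<partial>Q) \<partial>\<mu>)"
proof -
  interpret Q: finite_measure Q by fact
  have *: "(\<integral>x. (\<integral>q. w q * iexp (\<theta> q \<bullet> x) \<partial>Q) \<partial>\<rho>) = (\<integral>q. w q * (\<integral>x. iexp (\<theta> q \<bullet> x) \<partial>\<rho>) \<partial>Q)"
    if "prob_space \<rho>" and s[measurable_cong]: "sets \<rho> = sets borel" for \<rho> :: "(real^'d) measure"
  proof -
    interpret \<rho>: prob_space \<rho> by fact
    have "(\<integral>x. (\<integral>q. w q * iexp (\<theta> q \<bullet> x) \<partial>Q) \<partial>\<rho>) = (\<integral>q. (\<integral>x. w q * iexp (\<theta> q \<bullet> x) \<partial>\<rho>) \<partial>Q)"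
      by (rule Fubini_bounded(1)[where B=B]) (auto simp: norm_mult B intro: \<rho>.finite_measure_axioms Q)
    then show ?thesis by simp
  qed
  have m: "(\<lambda>q. \<integral>x. iexp (\<theta> q \<bullet> x) \<partial>\<rho>) \<in> borel_measurable Q"
    if "prob_space \<rho>" and s[measurable_cong]: "sets \<rho> = sets borel" for \<rho> :: "(real^'d) measure"
  proof -
    interpret \<rho>: prob_space \<rho> by fact
    show ?thesis by measurable
  qed
  have bd: "norm (\<integral>x. iexp (t \<bullet> x) \<partial>\<rho>) \<le> 1" if "prob_space \<rho>" for t and \<rho> :: "(real^'d) measure"
  proof -
    interpret \<rho>: prob_space \<rho> by fact
    have "norm (\<integral>x. iexp (t \<bullet> x) \<partial>\<rho>) \<le> (\<integral>x. norm (iexp (t \<bullet> x)) \<partial>\<rho>)" by (rule integral_norm_bound)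
    also have "\<dots> = 1" by (simp add: \<rho>.prob_space)
    finally show ?thesis .
  qed
  have "B \<ge> 0" using B norm_ge_zero order_trans by blast
  show ?thesis unfolding *[OF ps(1,3)] *[OF ps(2,4)]
  proof (rule integral_dominated_convergence[where w="\<lambda>_. B"])
    show "AE q in Q. norm (w q * (\<integral>x. iexp (\<theta> q \<bullet> x) \<partial>\<mu>s n)) \<le> B" for n
    proof (rule AE_I2)
      fix q
      have "norm (w q) * norm (\<integral>x. iexp (\<theta> q \<bullet> x) \<partial>\<mu>s n) \<le> B * 1"
        using B bd[OF ps(2)] \<open>B \<ge> 0\<close> by (intro mult_mono) auto
      then show "norm (w q * (\<integral>x. iexp (\<theta> q \<bullet> x) \<partial>\<mu>s n)) \<le> B" by (simp add: norm_mult)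
    qed
    show "AE q in Q. (\<lambda>n. w q * (\<integral>x. iexp (\<theta> q \<bullet> x) \<partial>\<mu>s n)) \<longlonglongrightarrow> w q * (\<integral>x. iexp (\<theta> q \<bullet> x) \<partial>\<mu>)"
      by (intro AE_I2 tendsto_intros char)
  qed (use m[OF ps(1,3)] m[OF ps(2,4)] in auto)
qed

text \<open>Smoothing is convolution with a normal density, and that density is itself a Gaussian
  mixture of characters, since the normal characteristic function has Gaussian shape. So
  \<open>Q\<close> is Lebesgue measure on a ball carrying \<open>f\<close> times the standard normal
  law, and \<open>C\<close> is the normalising constant for deviation \<sigma>.\<close>

lemma gaussian_smoothing_mixture:
  fixes f :: "real^'d::finite \<Rightarrow> real" and \<sigma> :: real
  assumes f: "f \<in> borel_measurable borel" and supp: "\<And>x. norm x > R \<Longrightarrow> f x = 0" and \<sigma>: "\<sigma> > 0"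
    and B: "\<And>x. \<bar>f x\<bar> \<le> B"
  obtains Q :: "((real^'d) \<times> (real^'d)) measure" and w \<theta> B' where
    "finite_measure Q" "w \<in> borel_measurable Q" "\<theta> \<in> borel_measurable Q" "\<And>q. norm (w q :: complex) \<le> B'"
    "\<And>x. complex_of_real (\<integral>y. f (x + \<sigma> *\<^sub>R y) \<partial>std_mvnormal) = (\<integral>q. w q * iexp (\<theta> q \<bullet> x) \<partial>Q)"
proof -
  note [measurable] = f
  define \<nu> :: "(real^'d) measure" where "\<nu> = density lborel (indicator (cball 0 R))"
  define C where "C = (1 / sqrt (2 * pi)) ^ CARD('d) / \<sigma> ^ CARD('d)"
  define Q where "Q = \<nu> \<Otimes>\<^sub>M (std_mvnormal :: (real^'d) measure)"
  define w :: "(real^'d) \<times> (real^'d) \<Rightarrow> complex" where "w q = C * f (fst q) * iexp ((fst q \<bullet> snd q) / \<sigma>)" for q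
  define \<theta> :: "(real^'d) \<times> (real^'d) \<Rightarrow> real^'d" where "\<theta> q = - (1 / \<sigma>) *\<^sub>R snd q" for q
  have [measurable_cong]: "sets \<nu> = sets borel" by (simp add: \<nu>_def)
  have fin\<nu>: "finite_measure \<nu>"
  proof
    have "emeasure \<nu> (space \<nu>) = emeasure lborel (cball (0::real^'d) R)"
      unfolding \<nu>_def by (subst emeasure_density) (auto intro!: borel_measurable_indicator)
    then show "emeasure \<nu> (space \<nu>) \<noteq> \<infinity>" using emeasure_lborel_cball_finite[of 0 R] by (auto simp: less_top)
  qed
  interpret G: prob_space "std_mvnormal :: (real^'d) measure" by (rule prob_space_std_mvnormal)
  have C0: "C \<ge> 0" unfolding C_def using \<sigma> by simp
  have B0: "B \<ge> 0" using B[of 0] by linarith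
  have sQ[measurable_cong]: "sets Q = sets (borel \<Otimes>\<^sub>M borel)"
    unfolding Q_def by (intro sets_pair_measure_cong) (simp_all add: \<nu>_def)
  have wb: "norm (w q) \<le> C * B" for q
    unfolding w_def using B[of "fst q"] C0 by (auto simp: norm_mult intro!: mult_left_mono)
  have main: "complex_of_real (\<integral>y. f (x + \<sigma> *\<^sub>R y) \<partial>std_mvnormal) = (\<integral>q. w q * iexp (\<theta> q \<bullet> x) \<partial>Q)" for x
  proof -
    define F where "F u = exp (- (norm ((u - x) /\<^sub>R \<sigma>))\<^sup>2 / 2) * f u" for u
    have [measurable]: "F \<in> borel_measurable borel" unfolding F_def by measurable
    have "(\<integral>q. w q * iexp (\<theta> q \<bullet> x) \<partial>Q) = (\<integral>u. (\<integral>y. w (u, y) * iexp (\<theta> (u, y) \<bullet> x) \<partial>std_mvnormal) \<partial>\<nu>)"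
      unfolding Q_def
      by (subst Fubini_bounded(2)[where B="C * B"]) (use fin\<nu> wb in \<open>auto simp: norm_mult w_def \<theta>_def intro: G.finite_measure_axioms\<close>)
    also have "\<dots> = (\<integral>u. complex_of_real (C * F u) \<partial>\<nu>)"
    proof (intro Bochner_Integration.integral_cong refl)
      fix u
      have "w (u, y) * iexp (\<theta> (u, y) \<bullet> x) = complex_of_real (C * f u) * iexp (((u - x) /\<^sub>R \<sigma>) \<bullet> y)" for y
        by (simp add: w_def \<theta>_def exp_add[symmetric] algebra_simps inner_diff_left divide_inverse inner_commute)
      then have "(\<integral>y. w (u, y) * iexp (\<theta> (u, y) \<bullet> x) \<partial>std_mvnormal) = (\<integral>y. complex_of_real (C * f u) * iexp (((u - x) /\<^sub>R \<sigma>) \<bullet> y) \<partial>std_mvnormal)"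
        by (intro Bochner_Integration.integral_cong refl)
      also have "\<dots> = complex_of_real (C * f u) * complex_of_real (exp (- (norm ((u - x) /\<^sub>R \<sigma>))\<^sup>2 / 2))"
        by (simp only: integral_mult_right_zero std_mvnormal_char)
      finally show "(\<integral>y. w (u, y) * iexp (\<theta> (u, y) \<bullet> x) \<partial>std_mvnormal) = complex_of_real (C * F u)"
        by (simp add: F_def mult_ac del: norm_scaleR)
    qed
    also have "\<dots> = complex_of_real (\<integral>u. C * F u \<partial>\<nu>)" by (rule integral_complex_of_real)
    also have "(\<integral>u. C * F u \<partial>\<nu>) = (\<integral>u. indicator (cball 0 R) u *\<^sub>R (C * F u) \<partial>lborel)"
      unfolding \<nu>_def using integral_density[of "\<lambda>u. C * F u" lborel "indicator (cball 0 R)"] borel_measurable_indicator[of "cball 0 R" lborel] by (simp add: ennreal_indicator)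
    also have "\<dots> = (\<integral>u. C * F u \<partial>lborel)"
      by (intro Bochner_Integration.integral_cong refl) (auto simp: F_def indicator_def supp not_le)
    also have "\<dots> = (\<integral>u. C * F u \<partial>density (distr lborel borel (\<lambda>y. x + \<sigma> *\<^sub>R y)) (\<lambda>_. ennreal (\<bar>\<sigma>\<bar> ^ DIM(real^'d))))"
      using lborel_affine[of \<sigma> x] \<sigma> by simp
    also have "\<dots> = (\<integral>y. \<sigma> ^ CARD('d) * (C * F (x + \<sigma> *\<^sub>R y)) \<partial>lborel)"
      using \<sigma> by (subst integral_density, simp, simp, simp, subst integral_distr) auto
    also have "\<dots> = (\<integral>y. (\<Prod>i\<in>UNIV. std_normal_density (y $ i)) *\<^sub>R f (x + \<sigma> *\<^sub>R y) \<partial>lborel)"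
      using \<sigma> by (intro Bochner_Integration.integral_cong refl) (simp add: C_def F_def std_mvnormal_density_eq)
    also have "\<dots> = (\<integral>y. f (x + \<sigma> *\<^sub>R y) \<partial>std_mvnormal)"
      unfolding std_mvnormal_def by (subst integral_density) (auto intro!: AE_I2 prod_nonneg)
    finally show ?thesis by simp
  qed
  show ?thesis
  proof (rule that[of Q w \<theta> "C * B"])
    show "finite_measure Q" unfolding Q_def by (intro finite_measure_pair_measure fin\<nu> G.finite_measure_axioms)
    show "w \<in> borel_measurable Q" unfolding w_def by measurable
    show "\<theta> \<in> borel_measurable Q" unfolding \<theta>_def by measurable
  qed (use wb main in auto)
qed

lemma uniformly_continuous_compact_support:
  fixes f :: "'a::euclidean_space \<Rightarrow> real"
  assumes f: "continuous_on UNIV f" and supp: "\<And>x. norm x > R \<Longrightarrow> f x = 0" and "\<epsilon> > 0"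
  shows "\<exists>\<delta>>0. \<forall>x y. norm y < \<delta> \<longrightarrow> \<bar>f (x + y) - f x\<bar> < \<epsilon>"
proof -
  \<comment> \<open>The margin 2 gives one unit to \<open>x\<close> beyond the support and one to
    the shift \<open>y\<close>, so that both \<open>x\<close> and \<open>x + y\<close> lie in the
    same compact ball.\<close>
  have "uniformly_continuous_on (cball 0 (R + 2)) f"
    by (intro compact_uniformly_continuous compact_cball continuous_on_subset[OF f]) auto
  then obtain d where d: "d > 0" "\<And>x x'. x \<in> cball 0 (R + 2) \<Longrightarrow> x' \<in> cball 0 (R + 2) \<Longrightarrow> dist x' x < d \<Longrightarrow> dist (f x') (f x) < \<epsilon>"
    unfolding uniformly_continuous_on_def using \<open>\<epsilon> > 0\<close> by meson
  have "\<bar>f (x + y) - f x\<bar> < \<epsilon>" if y: "norm y < min d 1" for x y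
  proof (cases "norm x \<le> R + 1")
    case True
    then have "norm (x + y) \<le> R + 2" using y norm_triangle_ineq[of x y] by auto
    then show ?thesis using d(2)[of x "x + y"] True y unfolding mem_cball_0 by (simp add: dist_norm)
  next
    case False
    then have "norm (x + y) > R" using y norm_triangle_ineq2[of x "- y"] by auto
    then show ?thesis using False supp \<open>\<epsilon> > 0\<close> by auto
  qed
  then show ?thesis using d(1) by (intro exI[of _ "min d 1"]) auto
qed

lemma gaussian_smoothing_approx:
  fixes f :: "real^'d::finite \<Rightarrow> real"
  assumes f: "continuous_on UNIV f" and supp: "\<And>x. norm x > R \<Longrightarrow> f x = 0" and \<epsilon>: "\<epsilon> > 0"
    and B: "\<And>x. \<bar>f x\<bar> \<le> B"
  obtains \<sigma> where "\<sigma> > 0" "\<And>x. \<bar>(\<integral>y. f (x + \<sigma> *\<^sub>R y) \<partial>std_mvnormal) - f x\<bar> \<le> \<epsilon>"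
proof -
  interpret G: prob_space "std_mvnormal :: (real^'d) measure" by (rule prob_space_std_mvnormal)
  have fm[measurable]: "f \<in> borel_measurable borel" using f by (rule borel_measurable_continuous_onI)
  have B0: "B \<ge> 0" using B[of 0] by linarith
  obtain \<delta> where \<delta>: "\<delta> > 0" "\<And>x y. norm y < \<delta> \<Longrightarrow> \<bar>f (x + y) - f x\<bar> < \<epsilon> / 2"
    using uniformly_continuous_compact_support[OF f supp half_gt_zero[OF \<epsilon>]] by blast
  define A where "A m = {y :: real^'d. norm y \<ge> real m}" for m
  have "(\<lambda>m. G.prob (A m)) \<longlonglongrightarrow> G.prob (\<Inter>m. A m)"
    by (rule G.finite_Lim_measure_decseq) (auto simp: A_def decseq_def)
  moreover have "(\<Inter>m. A m) = {}"
  proof -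
    have "\<exists>m. norm y < real m" for y :: "real^'d" by (rule reals_Archimedean2)
    then show ?thesis by (simp add: A_def set_eq_iff not_le)
  qed
  ultimately have "(\<lambda>m. 2 * B * G.prob (A m)) \<longlonglongrightarrow> 2 * B * 0" by (intro tendsto_intros) simp
  then have "\<forall>\<^sub>F m in sequentially. 2 * B * G.prob (A m) < \<epsilon> / 2" by (rule order_tendstoD(2)) (use \<epsilon> in simp)
  then obtain m where m: "2 * B * G.prob (A m) < \<epsilon> / 2" unfolding eventually_sequentially by blast
  \<comment> \<open>Shifts with \<open>norm y < real m\<close> are then scaled below \<delta>; the
    remaining ones have small probability. The summand 1 covers \<open>m = 0\<close>.\<close>
  define \<sigma> where "\<sigma> = \<delta> / (real m + 1)"
  have \<sigma>: "\<sigma> > 0" using \<delta> by (simp add: \<sigma>_def)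
  have Am[measurable]: "A m \<in> sets borel" by (simp add: A_def)
  have "\<bar>(\<integral>y. f (x + \<sigma> *\<^sub>R y) \<partial>std_mvnormal) - f x\<bar> \<le> \<epsilon>" for x
  proof -
    have i: "integrable std_mvnormal (\<lambda>y. f (x + \<sigma> *\<^sub>R y))"
      by (rule integrable_bounded[where B=B]) (use B in \<open>auto intro: G.finite_measure_axioms\<close>)
    have pt: "\<bar>f (x + \<sigma> *\<^sub>R y) - f x\<bar> \<le> \<epsilon> / 2 + 2 * B * indicator (A m) y" for y
    proof (cases "y \<in> A m")
      case True
      have "\<bar>f (x + \<sigma> *\<^sub>R y) - f x\<bar> \<le> 2 * B" using B[of "x + \<sigma> *\<^sub>R y"] B[of x] by linarith
      then show ?thesis using True \<epsilon> by simp
    next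
      case False
      then have "norm y < real m" by (simp add: A_def)
      then have "norm (\<sigma> *\<^sub>R y) \<le> \<sigma> * real m" using \<sigma> by (simp add: mult_left_mono)
      also have "\<dots> < \<delta>" using \<delta> by (simp add: \<sigma>_def field_simps)
      finally show ?thesis using \<delta>(2)[of "\<sigma> *\<^sub>R y" x] False by simp
    qed
    have "\<bar>(\<integral>y. f (x + \<sigma> *\<^sub>R y) \<partial>std_mvnormal) - f x\<bar> = \<bar>\<integral>y. f (x + \<sigma> *\<^sub>R y) - f x \<partial>std_mvnormal\<bar>"
      using i by (simp add: G.prob_space[simplified])
    also have "\<dots> \<le> (\<integral>y. \<bar>f (x + \<sigma> *\<^sub>R y) - f x\<bar> \<partial>std_mvnormal)" by (rule integral_abs_bound)
    also have "\<dots> \<le> (\<integral>y. \<epsilon> / 2 + 2 * B * indicator (A m) y \<partial>std_mvnormal)"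
      using i pt by (intro integral_mono) (auto intro!: Bochner_Integration.integrable_add G.integrable_const integrable_real_indicator simp: less_top[symmetric])
    also have "\<dots> = \<epsilon> / 2 + 2 * B * G.prob (A m)"
      by (subst Bochner_Integration.integral_add) (auto intro!: integrable_real_indicator simp: less_top[symmetric] G.prob_space[simplified])
    also have "\<dots> \<le> \<epsilon>" using m by simp
    finally show ?thesis .
  qed
  then show ?thesis using \<sigma> that by blast
qed

text \<open>Compactly supported functions are uniformly close to their smoothings, which are
  mixtures of characters. Tightness comes for free: the cutoffs \<open>\<phi> m\<close> are
  compactly supported themselves, so the mass they capture under \<open>\<mu>s n\<close> converges
  to the mass captured under \<mu>.\<close>

theorem levy_continuity_multivariate:
  fixes \<mu> :: "(real^'d::finite) measure" and f :: "real^'d \<Rightarrow> real"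
  assumes ps: "prob_space \<mu>" "\<And>n. prob_space (\<mu>s n)" "sets \<mu> = sets borel" "\<And>n. sets (\<mu>s n) = sets borel"
    and char: "\<And>t. (\<lambda>n. \<integral>x. iexp (t \<bullet> x) \<partial>\<mu>s n) \<longlonglongrightarrow> (\<integral>x. iexp (t \<bullet> x) \<partial>\<mu>)"
    and f: "continuous_on UNIV f" and bf: "bounded (range f)"
  shows "(\<lambda>n. integral\<^sup>L (\<mu>s n) f) \<longlonglongrightarrow> integral\<^sup>L \<mu> f"
proof -
  interpret \<mu>: prob_space \<mu> by fact
  interpret \<mu>s: prob_space "\<mu>s n" for n by fact
  note [measurable_cong] = ps(3,4)
  have bounded_integrable: "integrable \<mu> g" "integrable (\<mu>s n) g" if "g \<in> borel_measurable borel" "\<And>x. \<bar>g x\<bar> \<le> B" for g :: "real^'d \<Rightarrow> real" and B n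
    by (rule integrable_bounded[where B=B]; use that in \<open>auto intro: \<mu>.finite_measure_axioms \<mu>s.finite_measure_axioms\<close>)+
  have compact: "(\<lambda>n. integral\<^sup>L (\<mu>s n) g) \<longlonglongrightarrow> integral\<^sup>L \<mu> g"
    if g: "continuous_on UNIV g" and supp: "\<And>x. norm x > R \<Longrightarrow> g x = 0" and B: "\<And>x. \<bar>g x\<bar> \<le> B"
    for g :: "real^'d \<Rightarrow> real" and R B
  proof (rule LIMSEQ_I)
    fix \<epsilon> :: real assume "\<epsilon> > 0"
    then have e4: "\<epsilon> / 4 > 0" by simp
    have gm[measurable]: "g \<in> borel_measurable borel" using g by (rule borel_measurable_continuous_onI)
    obtain \<sigma> where \<sigma>: "\<sigma> > 0" and approx: "\<And>x. \<bar>(\<integral>y. g (x + \<sigma> *\<^sub>R y) \<partial>std_mvnormal) - g x\<bar> \<le> \<epsilon> / 4"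
      using gaussian_smoothing_approx[OF g supp e4 B] by blast
    define h where "h x = (\<integral>y. g (x + \<sigma> *\<^sub>R y) \<partial>std_mvnormal)" for x
    interpret G: prob_space "std_mvnormal :: (real^'d) measure" by (rule prob_space_std_mvnormal)
    have hm[measurable]: "h \<in> borel_measurable borel" unfolding h_def by measurable
    have hB: "\<bar>h x\<bar> \<le> B + \<epsilon> / 4" for x using approx[of x] B[of x] unfolding h_def by linarith
    obtain Q :: "((real^'d) \<times> (real^'d)) measure" and w \<theta> B' where Q: "finite_measure Q" "w \<in> borel_measurable Q" "\<theta> \<in> borel_measurable Q" "\<And>q. norm (w q :: complex) \<le> B'"
      "\<And>x. complex_of_real (h x) = (\<integral>q. w q * iexp (\<theta> q \<bullet> x) \<partial>Q)"
      by (rule gaussian_smoothing_mixture[OF gm supp \<sigma> B, folded h_def], assumption) (rule that)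
    have "(\<lambda>n. \<integral>x. complex_of_real (h x) \<partial>\<mu>s n) \<longlonglongrightarrow> (\<integral>x. complex_of_real (h x) \<partial>\<mu>)"
      unfolding Q(5) by (rule character_mixture_tendsto[OF ps char Q(1-4)])
    then have "(\<lambda>n. integral\<^sup>L (\<mu>s n) h) \<longlonglongrightarrow> integral\<^sup>L \<mu> h"
      unfolding integral_complex_of_real by (simp only: tendsto_of_real_iff)
    from LIMSEQ_D[OF this, of "\<epsilon> / 4"] \<open>\<epsilon> > 0\<close> obtain N where N: "\<And>n. n \<ge> N \<Longrightarrow> \<bar>integral\<^sup>L (\<mu>s n) h - integral\<^sup>L \<mu> h\<bar> < \<epsilon> / 4" by auto
    have close: "\<bar>integral\<^sup>L \<rho> h - integral\<^sup>L \<rho> g\<bar> \<le> \<epsilon> / 4" if "prob_space \<rho>" "integrable \<rho> h" "integrable \<rho> g" for \<rho> :: "(real^'d) measure"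
    proof -
      interpret \<rho>: prob_space \<rho> by fact
      have "\<bar>integral\<^sup>L \<rho> h - integral\<^sup>L \<rho> g\<bar> = \<bar>\<integral>x. h x - g x \<partial>\<rho>\<bar>" using that by simp
      also have "\<dots> \<le> (\<integral>x. \<bar>h x - g x\<bar> \<partial>\<rho>)" by (rule integral_abs_bound)
      also have "\<dots> \<le> (\<integral>x. \<epsilon> / 4 \<partial>\<rho>)" using that approx unfolding h_def[symmetric] by (intro integral_mono integrable_abs) auto
      finally show ?thesis by (simp add: \<rho>.prob_space)
    qed
    have "\<bar>integral\<^sup>L (\<mu>s n) g - integral\<^sup>L \<mu> g\<bar> < \<epsilon>" if "n \<ge> N" for n
      using close[OF ps(1) bounded_integrable(1)[OF hm hB] bounded_integrable(1)[OF gm B]]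
        close[OF ps(2) bounded_integrable(2)[OF hm hB] bounded_integrable(2)[OF gm B], of n] N[OF that] \<open>\<epsilon> > 0\<close> by linarith
    then show "\<exists>N. \<forall>n\<ge>N. norm (integral\<^sup>L (\<mu>s n) g - integral\<^sup>L \<mu> g) < \<epsilon>" by auto
  qed
  have fm[measurable]: "f \<in> borel_measurable borel" using f by (rule borel_measurable_continuous_onI)
  obtain B where B: "\<And>x. \<bar>f x\<bar> \<le> B" and B0: "B > 0" using bf unfolding bounded_pos by auto
  define \<phi> :: "nat \<Rightarrow> real^'d \<Rightarrow> real" where "\<phi> m x = max 0 (min 1 (real m + 1 - norm x))" for m x
  have \<phi>01: "0 \<le> \<phi> m x" "\<phi> m x \<le> 1" for m x by (auto simp: \<phi>_def)
  have \<phi>c: "continuous_on UNIV (\<phi> m)" for m unfolding \<phi>_def by (intro continuous_intros)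
  have \<phi>m[measurable]: "\<phi> m \<in> borel_measurable borel" for m using \<phi>c by (rule borel_measurable_continuous_onI)
  have \<phi>B: "\<bar>\<phi> m x\<bar> \<le> 1" for m x using \<phi>01[of m x] by simp
  have f\<phi>B: "\<bar>f x * \<phi> m x\<bar> \<le> B" for m x
    using mult_mono[OF B[of x] \<phi>B[of m x]] B0 by (simp add: abs_mult)
  have f\<phi>m: "(\<lambda>x. f x * \<phi> m x) \<in> borel_measurable borel" for m by measurable
  have "(\<lambda>m. integral\<^sup>L \<mu> (\<phi> m)) \<longlonglongrightarrow> integral\<^sup>L \<mu> (\<lambda>x. 1)"
  proof (rule integral_dominated_convergence[where w="\<lambda>_. 1"])
    show "AE x in \<mu>. (\<lambda>m. \<phi> m x) \<longlonglongrightarrow> 1"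
    proof (rule AE_I2, rule tendsto_eventually)
      fix x :: "real^'d"
      obtain k where "norm x < real k" using reals_Archimedean2 by blast
      then show "\<forall>\<^sub>F m in sequentially. \<phi> m x = 1"
        by (intro eventually_mono[OF eventually_ge_at_top[of k]]) (auto simp: \<phi>_def)
    qed
  qed (use \<phi>B in auto)
  then have \<phi>lim: "(\<lambda>m. integral\<^sup>L \<mu> (\<phi> m)) \<longlonglongrightarrow> 1" by (simp add: \<mu>.prob_space)
  show ?thesis
  proof (rule LIMSEQ_I)
    fix \<epsilon> :: real assume \<epsilon>: "\<epsilon> > 0"
    \<comment> \<open>The cutoff costs at most \<open>B\<close> times the missing mass; \<eta> turns
      each of the two costs into a quarter of \<epsilon>.\<close>
    define \<eta> where "\<eta> = \<epsilon> / (4 * B)"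
    have \<eta>: "\<eta> > 0" "B * \<eta> = \<epsilon> / 4" using \<epsilon> B0 by (auto simp: \<eta>_def)
    from LIMSEQ_D[OF \<phi>lim, of "\<eta> / 2"] \<eta> obtain m where "\<bar>integral\<^sup>L \<mu> (\<phi> m) - 1\<bar> < \<eta> / 2" by auto
    then have m: "1 - integral\<^sup>L \<mu> (\<phi> m) < \<eta> / 2" by argo
    have "(\<lambda>n. integral\<^sup>L (\<mu>s n) (\<phi> m)) \<longlonglongrightarrow> integral\<^sup>L \<mu> (\<phi> m)"
      by (rule compact[OF \<phi>c, of "real m + 1" m 1]) (use \<phi>B in \<open>auto simp: \<phi>_def\<close>)
    from LIMSEQ_D[OF this, of "\<eta> / 2"] \<eta> obtain N1 where N1: "\<And>n. n \<ge> N1 \<Longrightarrow> \<bar>integral\<^sup>L (\<mu>s n) (\<phi> m) - integral\<^sup>L \<mu> (\<phi> m)\<bar> < \<eta> / 2" by auto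
    have "(\<lambda>n. integral\<^sup>L (\<mu>s n) (\<lambda>x. f x * \<phi> m x)) \<longlonglongrightarrow> integral\<^sup>L \<mu> (\<lambda>x. f x * \<phi> m x)"
      by (rule compact[OF continuous_on_mult[OF f \<phi>c], of "real m + 1" m B]) (use f\<phi>B in \<open>auto simp: \<phi>_def\<close>)
    from LIMSEQ_D[OF this, of "\<epsilon> / 4"] \<epsilon> obtain N2 where N2: "\<And>n. n \<ge> N2 \<Longrightarrow> \<bar>integral\<^sup>L (\<mu>s n) (\<lambda>x. f x * \<phi> m x) - integral\<^sup>L \<mu> (\<lambda>x. f x * \<phi> m x)\<bar> < \<epsilon> / 4" by auto
    have cut: "\<bar>integral\<^sup>L \<rho> f - integral\<^sup>L \<rho> (\<lambda>x. f x * \<phi> m x)\<bar> \<le> B * (1 - integral\<^sup>L \<rho> (\<phi> m))"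
      if "prob_space \<rho>" "integrable \<rho> f" "integrable \<rho> (\<lambda>x. f x * \<phi> m x)" "integrable \<rho> (\<phi> m)" for \<rho> :: "(real^'d) measure"
    proof -
      interpret \<rho>: prob_space \<rho> by fact
      have "\<bar>integral\<^sup>L \<rho> f - integral\<^sup>L \<rho> (\<lambda>x. f x * \<phi> m x)\<bar> = \<bar>\<integral>x. f x - f x * \<phi> m x \<partial>\<rho>\<bar>" using that by simp
      also have "\<dots> \<le> (\<integral>x. \<bar>f x - f x * \<phi> m x\<bar> \<partial>\<rho>)" by (rule integral_abs_bound)
      also have "\<dots> \<le> (\<integral>x. B * (1 - \<phi> m x) \<partial>\<rho>)"
      proof (rule integral_mono)
        fix x
        have "\<bar>f x - f x * \<phi> m x\<bar> = \<bar>f x\<bar> * (1 - \<phi> m x)"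
        proof -
          have "f x - f x * \<phi> m x = f x * (1 - \<phi> m x)" by (simp add: algebra_simps)
          then show ?thesis using \<phi>01(2)[of m x] by (simp add: abs_mult)
        qed
        then show "\<bar>f x - f x * \<phi> m x\<bar> \<le> B * (1 - \<phi> m x)"
          using mult_right_mono[OF B[of x], of "1 - \<phi> m x"] \<phi>01(2)[of m x] by simp
      qed (use that in auto)
      finally show ?thesis using that by (simp add: \<rho>.prob_space)
    qed
    have "\<bar>integral\<^sup>L (\<mu>s n) f - integral\<^sup>L \<mu> f\<bar> < \<epsilon>" if "n \<ge> max N1 N2" for n
    proof -
      have "1 - integral\<^sup>L (\<mu>s n) (\<phi> m) \<le> \<eta>" using N1[of n] m that unfolding max.bounded_iff by argo
      then have 1: "B * (1 - integral\<^sup>L (\<mu>s n) (\<phi> m)) \<le> \<epsilon> / 4" using B0 \<eta> by (metis mult_left_mono less_imp_le)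
      have "1 - integral\<^sup>L \<mu> (\<phi> m) \<le> \<eta>" using m \<eta> by simp
      then have 2: "B * (1 - integral\<^sup>L \<mu> (\<phi> m)) \<le> \<epsilon> / 4" using B0 \<eta> by (metis mult_left_mono less_imp_le)
      show ?thesis
        using cut[OF ps(2) bounded_integrable(2)[OF fm B] bounded_integrable(2)[OF f\<phi>m f\<phi>B] bounded_integrable(2)[OF \<phi>m \<phi>B], of n]
          cut[OF ps(1) bounded_integrable(1)[OF fm B] bounded_integrable(1)[OF f\<phi>m f\<phi>B] bounded_integrable(1)[OF \<phi>m \<phi>B]]
          1 2 N2[of n] that unfolding max.bounded_iff by argo
    qed
    then show "\<exists>N. \<forall>n\<ge>N. norm (integral\<^sup>L (\<mu>s n) f - integral\<^sup>L \<mu> f) < \<epsilon>" by (intro exI[of _ "max N1 N2"]) auto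
  qed
qed

text \<open>Closed sets form an intersection-stable generator, and the indicator of a nonempty
  closed set is the limit of the functions \<open>F A n\<close> built from the distance. The empty
  set, whose \<open>infdist\<close> is zero, is treated apart.\<close>

lemma measure_eqI_bounded_continuous:
  fixes \<mu> \<rho> :: "'a::metric_space measure"
  assumes ps: "prob_space \<mu>" "prob_space \<rho>" "sets \<mu> = sets borel" "sets \<rho> = sets borel"
    and eq: "\<And>f :: 'a \<Rightarrow> real. continuous_on UNIV f \<Longrightarrow> bounded (range f) \<Longrightarrow> integral\<^sup>L \<mu> f = integral\<^sup>L \<rho> f"
  shows "\<mu> = \<rho>"
proof -
  interpret \<mu>: prob_space \<mu> by fact
  interpret \<rho>: prob_space \<rho> by fact
  note [measurable_cong] = ps(3,4)
  define F :: "'a set \<Rightarrow> nat \<Rightarrow> 'a \<Rightarrow> real" where "F A n x = max 0 (1 - real n * infdist x A)" for A n x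
  have Fc: "continuous_on UNIV (F A n)" for A n unfolding F_def by (intro continuous_intros continuous_on_infdist continuous_on_id)
  have F01: "0 \<le> F A n x" "F A n x \<le> 1" for A n x by (auto simp: F_def infdist_nonneg)
  have Fm[measurable]: "F A n \<in> borel_measurable borel" for A n using Fc by (rule borel_measurable_continuous_onI)
  have lim: "(\<lambda>n. integral\<^sup>L \<kappa> (F A n)) \<longlonglongrightarrow> measure \<kappa> A"
    if \<kappa>: "prob_space \<kappa>" and s[measurable_cong]: "sets \<kappa> = sets borel" and A: "closed A" "A \<noteq> {}" for \<kappa> :: "'a measure" and A
  proof -
    interpret \<kappa>: prob_space \<kappa> by fact
    have [measurable]: "A \<in> sets borel" using A by simp
    have "(\<lambda>n. integral\<^sup>L \<kappa> (F A n)) \<longlonglongrightarrow> integral\<^sup>L \<kappa> (indicator A)"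
    proof (rule integral_dominated_convergence[where w="\<lambda>_. 1"])
      show "AE x in \<kappa>. (\<lambda>n. F A n x) \<longlonglongrightarrow> indicator A x"
      proof (rule AE_I2)
        fix x
        show "(\<lambda>n. F A n x) \<longlonglongrightarrow> indicator A x"
        proof (cases "x \<in> A")
          case True then show ?thesis by (simp add: F_def)
        next
          case False
          then have d: "infdist x A > 0" using A in_closed_iff_infdist_zero[of A x] infdist_nonneg[of x A] by auto
          obtain k where k: "1 / infdist x A < real k" using reals_Archimedean2 by blast
          have "F A n x = 0" if "n \<ge> k" for n
          proof -
            have "1 / infdist x A < real n" using k that by simp
            then show ?thesis using d by (simp add: F_def field_simps)
          qed
          then show ?thesis using False by (intro tendsto_eventually) (auto simp: eventually_sequentially)
        qed
      qed
    qed (use F01 in auto)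
    then show ?thesis using sets_eq_imp_space_eq[OF s] by simp
  qed
  have cl: "emeasure \<mu> A = emeasure \<rho> A" if "closed A" for A
  proof (cases "A = {}")
    case False
    have "bounded (range (F A n))" for n by (rule boundedI[where B=1]) (use F01 in auto)
    then have "(\<lambda>n. integral\<^sup>L \<mu> (F A n)) = (\<lambda>n. integral\<^sup>L \<rho> (F A n))" using eq[OF Fc] by auto
    then have "measure \<mu> A = measure \<rho> A"
      using lim[OF ps(1,3) that False] lim[OF ps(2,4) that False] LIMSEQ_unique by fastforce
    then show ?thesis by (simp add: \<mu>.emeasure_eq_measure \<rho>.emeasure_eq_measure)
  qed simp
  show ?thesis
  proof (rule measure_eqI_generator_eq[where E="Collect closed" and \<Omega>=UNIV and A="\<lambda>_. UNIV"])
    show "Int_stable (Collect closed :: 'a set set)" by (auto simp: Int_stable_def)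
    show "sets \<mu> = sigma_sets UNIV (Collect closed)" "sets \<rho> = sigma_sets UNIV (Collect closed)"
      using ps by (simp_all add: borel_eq_closed)
  qed (use cl in auto)
qed

section \<open>Gaussian kernels\<close>

lemma pos_semidef_sym:
  "pos_semidef S \<Longrightarrow> x \<bullet> (S *v y) = y \<bullet> (S *v x)"
  unfolding pos_semidef_def by (metis dot_lmul_matrix inner_commute transpose_matrix_vector)

text \<open>The quadratic form at \<open>x - t *\<^sub>R e\<close> is a nonnegative polynomial in
  \<open>t\<close>, and its minimum gives the bound. If \<open>a = 0\<close> it is affine, which
  forces \<open>b = 0\<close>.\<close>

lemma pos_semidef_Cauchy_Schwarz:
  assumes "pos_semidef S"
  shows "(x \<bullet> (S *v e))\<^sup>2 \<le> (x \<bullet> (S *v x)) * (e \<bullet> (S *v e))"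
proof -
  define a where "a = e \<bullet> (S *v e)"
  define b where "b = x \<bullet> (S *v e)"
  have q: "0 \<le> x \<bullet> (S *v x) - 2 * t * b + t\<^sup>2 * a" for t
  proof -
    have "0 \<le> (x - t *\<^sub>R e) \<bullet> (S *v (x - t *\<^sub>R e))" using assms by (simp add: pos_semidef_def)
    also have "\<dots> = x \<bullet> (S *v x) - 2 * t * b + t\<^sup>2 * a"
      using pos_semidef_sym[OF assms, of e x]
      by (simp add: matrix_vector_mult_diff_distrib matrix_vector_mult_scaleR inner_diff_left inner_diff_right a_def b_def power2_eq_square algebra_simps)
    finally show ?thesis .
  qed
  have a0: "0 \<le> a" "0 \<le> x \<bullet> (S *v x)" using assms by (auto simp: a_def pos_semidef_def)
  show ?thesis
  proof (cases "a = 0")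
    case True
    have "b = 0"
    proof (rule ccontr)
      assume "b \<noteq> 0"
      \<comment> \<open>This value of \<open>t\<close> would make the affine function equal to
        -1.\<close>
      then show False using q[of "(x \<bullet> (S *v x) + 1) / (2 * b)"] True by simp
    qed
    then show ?thesis using True by (simp add: a_def b_def)
  next
    case False
    then have "a > 0" using a0 by simp
    moreover have "0 \<le> x \<bullet> (S *v x) - b\<^sup>2 / a" using q[of "b / a"] False by (simp add: power2_eq_square field_simps)
    ultimately show ?thesis unfolding a_def[symmetric] b_def[symmetric] by (simp add: field_simps)
  qed
qed

text \<open>Cholesky elimination of one coordinate at a time.\<close>

lemma pos_semidef_sum_of_squares:
  fixes S :: "real^'d::finite^'d"
  assumes "finite T" "pos_semidef S" "\<And>i. i \<notin> T \<Longrightarrow> S *v axis i 1 = 0"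
  shows "\<exists>b :: 'd \<Rightarrow> real^'d. \<forall>i j. S $ i $ j = (\<Sum>k\<in>T. b k $ i * b k $ j)"
  using assms
proof (induction T arbitrary: S rule: finite_induct)
  case empty
  have "S $ i $ j = 0" for i j
  proof -
    have "(S *v axis j 1) $ i = 0" using empty by simp
    then show ?thesis by (simp add: matrix_vector_mult_basis column_def)
  qed
  then show ?case by simp
next
  case (insert k T)
  let ?e = "axis k 1 :: real^'d"
  define a where "a = ?e \<bullet> (S *v ?e)"
  have a0: "a \<ge> 0" using insert.prems(1) by (auto simp: a_def pos_semidef_def)
  show ?case
  proof (cases "a = 0")
    case True
    have "(x \<bullet> (S *v ?e))\<^sup>2 \<le> 0" for x using pos_semidef_Cauchy_Schwarz[OF insert.prems(1), of x ?e] True by (simp add: a_def)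
    then have "S *v ?e = 0" by (metis inner_eq_zero_iff power2_less_eq_zero_iff)
    then have "\<And>i. i \<notin> T \<Longrightarrow> S *v axis i 1 = 0" using insert.prems(2) by (metis insert_iff)
    from insert.IH[OF insert.prems(1) this] obtain b :: "'d \<Rightarrow> real^'d" where b: "\<And>i j. S $ i $ j = (\<Sum>k\<in>T. b k $ i * b k $ j)" by blast
    have "S $ i $ j = (\<Sum>l\<in>insert k T. (b(k := 0)) l $ i * (b(k := 0)) l $ j)" for i j
      unfolding b using insert.hyps by (simp add: sum.insert) (intro sum.cong, auto)
    then show ?thesis by blast
  next
    case False
    then have a: "a > 0" using a0 by simp
    \<comment> \<open>Subtracting the rank-one matrix of this \<open>v\<close> kills column
      \<open>k\<close> by the choice of the factor, preserves columns that vanish already, and keeps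
      the matrix positive semidefinite by Cauchy-Schwarz.\<close>
    define v where "v = (1 / sqrt a) *\<^sub>R (S *v ?e)"
    define S' where "S' = S - (\<chi> i j. v $ i * v $ j)"
    have op: "(\<chi> i j. v $ i * v $ j) *v x = (v \<bullet> x) *\<^sub>R v" for x
      by (simp add: vec_eq_iff matrix_vector_mult_def inner_vec_def sum_distrib_left sum_distrib_right mult_ac)
    have S'v: "S' *v x = S *v x - (v \<bullet> x) *\<^sub>R v" for x
      by (simp add: S'_def matrix_vector_mult_diff_rdistrib op)
    have vx: "v \<bullet> x = (x \<bullet> (S *v ?e)) / sqrt a" for x by (simp add: v_def inner_commute)
    have "pos_semidef S'" unfolding pos_semidef_def
    proof (intro conjI allI)
      show "transpose S' = S'" using insert.prems(1)
        by (simp add: S'_def pos_semidef_def transpose_def vec_eq_iff mult.commute)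
      fix x
      have "x \<bullet> (S' *v x) = x \<bullet> (S *v x) - (x \<bullet> (S *v ?e))\<^sup>2 / a"
        using a by (simp add: S'v inner_diff_right inner_commute[of x v] vx power2_eq_square)
      then show "0 \<le> x \<bullet> (S' *v x)"
        using pos_semidef_Cauchy_Schwarz[OF insert.prems(1), of x ?e] a by (simp add: a_def[symmetric] pos_divide_le_eq)
    qed
    moreover have "S' *v axis i 1 = 0" if "i \<notin> T" for i
    proof (cases "i = k")
      case True
      have "S' *v axis i 1 = S *v ?e - (a / sqrt a) *\<^sub>R v" using True by (simp add: S'v vx a_def)
      then show ?thesis using a by (simp add: v_def)
    next
      case False
      then have "S *v axis i 1 = 0" using insert.prems(2) that by simp
      then show ?thesis using pos_semidef_sym[OF insert.prems(1), of "axis i 1" ?e] by (simp add: S'v vx)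
    qed
    ultimately obtain b :: "'d \<Rightarrow> real^'d" where b: "\<And>i j. S' $ i $ j = (\<Sum>k\<in>T. b k $ i * b k $ j)"
      using insert.IH[of S'] by blast
    have "S $ i $ j = (\<Sum>l\<in>insert k T. (b(k := v)) l $ i * (b(k := v)) l $ j)" for i j
    proof -
      have "S $ i $ j = v $ i * v $ j + S' $ i $ j" by (simp add: S'_def)
      also have "S' $ i $ j = (\<Sum>l\<in>T. (b(k := v)) l $ i * (b(k := v)) l $ j)"
        unfolding b using insert.hyps by (intro sum.cong) auto
      finally show ?thesis using insert.hyps by simp
    qed
    then show ?thesis by blast
  qed
qed

lemma pos_semidef_sqrt:
  fixes S :: "real^'d::finite^'d"
  assumes "pos_semidef S"
  obtains A :: "real^'d^'d" where "A ** transpose A = S"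
proof -
  obtain b :: "'d \<Rightarrow> real^'d" where b: "\<And>i j. S $ i $ j = (\<Sum>k\<in>UNIV. b k $ i * b k $ j)"
    using pos_semidef_sum_of_squares[of UNIV S] assms by auto
  have "(\<chi> i k. b k $ i) ** transpose (\<chi> i k. b k $ i) = S"
    by (simp add: vec_eq_iff matrix_matrix_mult_def transpose_def b)
  then show ?thesis by (rule that)
qed

lemma measurable_matrix_vector_mult [measurable]: "(\<lambda>x. (A :: real^'d^'e) *v x) \<in> borel \<rightarrow>\<^sub>M borel"
  by (intro borel_measurable_continuous_onI matrix_vector_mult_linear_continuous_on)

lemma char_linear_image:
  fixes A :: "real^'d::finite^'e::finite"
  shows "(\<integral>x. iexp (t \<bullet> x) \<partial>distr std_mvnormal borel (\<lambda>x. A *v x)) = exp (- (t \<bullet> ((A ** transpose A) *v t)) / 2)"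
proof -
  have "(\<integral>x. iexp (t \<bullet> x) \<partial>distr std_mvnormal borel (\<lambda>x. A *v x)) = (\<integral>x. iexp (t \<bullet> (A *v x)) \<partial>std_mvnormal)"
    by (intro integral_distr) auto
  also have "\<dots> = (\<integral>x. iexp ((transpose A *v t) \<bullet> x) \<partial>std_mvnormal)"
    by (simp add: dot_lmul_matrix transpose_matrix_vector)
  also have "\<dots> = exp (- (norm (transpose A *v t))\<^sup>2 / 2)" by (rule std_mvnormal_char)
  also have "(norm (transpose A *v t))\<^sup>2 = t \<bullet> ((A ** transpose A) *v t)"
    unfolding power2_norm_eq_inner by (metis dot_lmul_matrix matrix_vector_mul_assoc transpose_matrix_vector)
  finally show ?thesis .
qed

text \<open>The characteristic function depends on a root only through
  \<open>A ** transpose A\<close>, so the root picked by \<open>SOME\<close> may be exchanged for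
  any other. That characteristic functions determine the law is obtained from the continuity theorem
  for a constant sequence.\<close>

lemma mvnormal_eq_distr:
  fixes A S :: "real^'d::finite^'d"
  assumes "A ** transpose A = S"
  shows "mvnormal S = distr std_mvnormal borel (\<lambda>x. A *v x)"
proof -
  define B :: "real^'d^'d" where "B = (SOME A. A ** transpose A = S)"
  have B: "B ** transpose B = S" unfolding B_def by (rule someI[where P="\<lambda>A. A ** transpose A = S"]) fact
  have mv: "mvnormal S = distr std_mvnormal borel (\<lambda>x. B *v x)" by (simp add: mvnormal_def B_def)
  have ps: "prob_space (distr std_mvnormal borel (\<lambda>x. C *v x))" for C :: "real^'d^'d"
    by (intro prob_space.prob_space_distr prob_space_std_mvnormal) measurable
  show ?thesis unfolding mv
  proof (rule measure_eqI_bounded_continuous)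
    fix f :: "real^'d \<Rightarrow> real" assume f: "continuous_on UNIV f" "bounded (range f)"
    have "(\<lambda>n::nat. integral\<^sup>L (distr std_mvnormal borel (\<lambda>x. B *v x)) f) \<longlonglongrightarrow> integral\<^sup>L (distr std_mvnormal borel (\<lambda>x. A *v x)) f"
      by (rule levy_continuity_multivariate[OF ps ps _ _ _ f]) (auto simp: char_linear_image B assms)
    then show "integral\<^sup>L (distr std_mvnormal borel (\<lambda>x. B *v x)) f = integral\<^sup>L (distr std_mvnormal borel (\<lambda>x. A *v x)) f"
      by (simp add: LIMSEQ_const_iff)
  qed (use ps in auto)
qed

lemma sqrt_scaleR_matrix:
  fixes A S :: "real^'d::finite^'d"
  assumes "A ** transpose A = S" "0 \<le> v"
  shows "(sqrt v *\<^sub>R A) ** transpose (sqrt v *\<^sub>R A) = v *\<^sub>R S"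
  using assms by (simp add: transpose_scalar matrix_scalar_ac scalar_matrix_assoc[symmetric])

lemma mvnormal_scaleR:
  fixes A S :: "real^'d::finite^'d"
  assumes "A ** transpose A = S" "0 \<le> v"
  shows "mvnormal (v *\<^sub>R S) = distr std_mvnormal borel (\<lambda>x. sqrt v *\<^sub>R (A *v x))"
  using mvnormal_eq_distr[OF sqrt_scaleR_matrix[OF assms]] by (simp add: scaleR_matrix_vector_assoc)

text \<open>With one root \<open>A\<close> of \<open>S\<close> fixed, the kernel is the image of a
  fixed law under a map depending measurably on \<omega>; the separate choices inside
  \<open>mvnormal\<close> show no such regularity.\<close>

lemma mvnormal_kernel_measurable:
  fixes S :: "real^'d::finite^'d"
  assumes S: "pos_semidef S" and v[measurable]: "v \<in> borel_measurable M" and v0: "\<And>\<omega>. \<omega> \<in> space M \<Longrightarrow> 0 \<le> v \<omega>"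
  shows "(\<lambda>\<omega>. mvnormal (v \<omega> *\<^sub>R S)) \<in> M \<rightarrow>\<^sub>M prob_algebra borel"
proof -
  obtain A :: "real^'d^'d" where A: "A ** transpose A = S" using pos_semidef_sqrt[OF S] .
  have "(\<lambda>\<omega>. distr std_mvnormal borel (\<lambda>x. sqrt (v \<omega>) *\<^sub>R (A *v x))) \<in> M \<rightarrow>\<^sub>M prob_algebra borel"
  proof (rule measurable_distr_prob_space2[where M=borel])
    show "(\<lambda>\<omega>. std_mvnormal) \<in> M \<rightarrow>\<^sub>M prob_algebra borel"
      by (intro measurable_const) (simp add: space_prob_algebra prob_space_std_mvnormal)
  qed measurable
  then show ?thesis
    by (rule measurable_cong[THEN iffD1, rotated]) (simp add: mvnormal_scaleR[OF A v0])
qed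

lemma (in prob_space) integral_uniform_measure_complex:
  fixes f :: "'a \<Rightarrow> 'b::{banach, second_countable_topology}"
  assumes [measurable]: "f \<in> borel_measurable M" "H \<in> sets M" and "prob H > 0"
  shows "integral\<^sup>L (uniform_measure M H) f = (\<integral>\<omega>. indicator H \<omega> *\<^sub>R f \<omega> \<partial>M) /\<^sub>R prob H"
proof -
  have *: "indicator H x / emeasure M H = ennreal (indicator H x / prob H)" for x
    using assms by (auto simp: emeasure_eq_measure divide_ennreal indicator_def split: if_splits simp flip: ennreal_1)
  have "integral\<^sup>L (uniform_measure M H) f = (\<integral>\<omega>. (indicator H \<omega> / prob H) *\<^sub>R f \<omega> \<partial>M)"
    unfolding uniform_measure_def * using assms by (intro integral_density) auto
  also have "\<dots> = (\<integral>\<omega>. (1 / prob H) *\<^sub>R (indicator H \<omega> *\<^sub>R f \<omega>) \<partial>M)"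
    by (simp add: mult.commute)
  also have "\<dots> = (1 / prob H) *\<^sub>R (\<integral>\<omega>. indicator H \<omega> *\<^sub>R f \<omega> \<partial>M)" by (rule integral_scaleR_right)
  finally show ?thesis by (simp add: inverse_eq_divide)
qed

text \<open>By the continuity theorem it suffices to compare characteristic functions under each
  conditional law. As the covariance is a random multiple of a fixed matrix, that of the mixture is
  the mean of a Gaussian exponential.\<close>

theorem converges_stably_mvnormalI:
  fixes Y :: "nat \<Rightarrow> 'a \<Rightarrow> real^'d::finite" and S :: "real^'d^'d"
  assumes M: "prob_space M" and Y: "\<And>n. Y n \<in> borel_measurable M"
    and S: "pos_semidef S" and v: "v \<in> borel_measurable M" and v0: "\<And>\<omega>. \<omega> \<in> space M \<Longrightarrow> 0 \<le> v \<omega>"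
    and lim: "\<And>H t. H \<in> sets M \<Longrightarrow> (\<lambda>n. \<integral>\<omega>. indicator H \<omega> *\<^sub>R iexp (t \<bullet> Y n \<omega>) \<partial>M)
       \<longlonglongrightarrow> (\<integral>\<omega>. indicator H \<omega> *\<^sub>R complex_of_real (exp (- (v \<omega> * (t \<bullet> (S *v t))) / 2)) \<partial>M)"
  shows "converges_stably M Y (\<lambda>\<omega>. mvnormal (v \<omega> *\<^sub>R S))"
proof -
  interpret prob_space M by fact
  note [measurable] = Y v
  let ?K = "\<lambda>\<omega>. mvnormal (v \<omega> *\<^sub>R S)"
  obtain A :: "real^'d^'d" where A: "A ** transpose A = S" using pos_semidef_sqrt[OF S] .
  have K: "?K \<in> M \<rightarrow>\<^sub>M prob_algebra borel" by (rule mvnormal_kernel_measurable[OF S v v0])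
  have Kprob: "prob_space (?K \<omega>)" "sets (?K \<omega>) = sets borel" if "\<omega> \<in> space M" for \<omega>
    using measurable_space[OF K that] by (auto simp: space_prob_algebra)
  have charK: "(\<integral>x. iexp (t \<bullet> x) \<partial>?K \<omega>) = complex_of_real (exp (- (v \<omega> * (t \<bullet> (S *v t))) / 2))" if "\<omega> \<in> space M" for \<omega> t
  proof -
    note * = sqrt_scaleR_matrix[OF A v0[OF that]]
    show ?thesis unfolding mvnormal_eq_distr[OF *] char_linear_image *
      by (simp add: scaleR_matrix_vector_assoc[symmetric])
  qed
  have weak: "weak_conv_to (\<lambda>n. distr (uniform_measure M H) borel (Y n)) (uniform_measure M H \<bind> ?K)"
    if H[measurable]: "H \<in> sets M" and H0: "prob H > 0" for H
  proof -
    let ?U = "uniform_measure M H"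
    have psU: "prob_space ?U" using H0 by (intro prob_space_uniform_measure) (auto simp: emeasure_eq_measure)
    interpret U: prob_space ?U by fact
    have KU: "?K \<in> ?U \<rightarrow>\<^sub>M prob_algebra borel" using K by (simp cong: measurable_cong_sets)
    have KU': "?K \<in> ?U \<rightarrow>\<^sub>M subprob_algebra borel" using KU by (rule measurable_prob_algebraD)
    have psB: "prob_space (?U \<bind> ?K)"
      using KU psU prob_space_bind'[of ?U ?U ?K borel] by (auto simp: space_prob_algebra)
    have sB: "sets (?U \<bind> ?K) = sets borel"
      by (rule sets_bind[OF _ U.not_empty]) (use sets_kernel[OF KU'] in auto)
    show ?thesis unfolding weak_conv_to_def
    proof (intro allI impI)
      fix f :: "real^'d \<Rightarrow> real" assume f: "continuous_on UNIV f" "bounded (range f)"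
      show "(\<lambda>n. integral\<^sup>L (distr ?U borel (Y n)) f) \<longlonglongrightarrow> integral\<^sup>L (?U \<bind> ?K) f"
      proof (rule levy_continuity_multivariate[OF psB _ sB _ _ f])
        show "prob_space (distr ?U borel (Y n))" for n by (rule U.prob_space_distr) simp
        fix t :: "real^'d"
        let ?E = "\<lambda>\<omega>. exp (- (v \<omega> * (t \<bullet> (S *v t))) / 2)"
        have r: "integral\<^sup>L (?U \<bind> ?K) g = (\<integral>\<omega>. integral\<^sup>L (?K \<omega>) g \<partial>?U)"
          if g: "g \<in> borel_measurable borel" and g1: "\<And>x. \<bar>g x\<bar> \<le> 1" for g :: "real^'d \<Rightarrow> real"
          by (rule integral_bind[where K=borel and B=1 and B'=1, OF g g1 KU' U.finite_measure_axioms])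
             (use Kprob in \<open>auto intro!: AE_I2 simp: prob_space.emeasure_space_1\<close>)
        \<comment> \<open>The mixture formula \<open>r\<close> is stated for real integrands, so
          characters are split into cosine and sine; the sine part vanishes under every single
          kernel.\<close>
        have c: "integral\<^sup>L \<rho> (\<lambda>x. iexp (t \<bullet> x)) = Complex (\<integral>x. cos (t \<bullet> x) \<partial>\<rho>) (\<integral>x. sin (t \<bullet> x) \<partial>\<rho>)"
          if "prob_space \<rho>" and s: "sets \<rho> = sets borel" for \<rho> :: "(real^'d) measure"
        proof -
          interpret \<rho>: prob_space \<rho> by fact
          note [measurable_cong] = s
          have "integrable \<rho> (\<lambda>x. iexp (t \<bullet> x))"
            by (rule integrable_bounded[where B=1]) (auto intro: \<rho>.finite_measure_axioms)
          then show ?thesis by (simp add: complex_eq_iff integral_Re[symmetric] integral_Im[symmetric] Re_exp Im_exp)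
        qed
        have cK: "(\<integral>x. cos (t \<bullet> x) \<partial>?K \<omega>) = ?E \<omega>" "(\<integral>x. sin (t \<bullet> x) \<partial>?K \<omega>) = 0" if "\<omega> \<in> space M" for \<omega>
          using c[OF Kprob[OF that]] charK[OF that, of t] by (auto simp: complex_eq_iff)
        have "(\<integral>x. iexp (t \<bullet> x) \<partial>(?U \<bind> ?K)) = Complex (\<integral>\<omega>. (\<integral>x. cos (t \<bullet> x) \<partial>?K \<omega>) \<partial>?U) (\<integral>\<omega>. (\<integral>x. sin (t \<bullet> x) \<partial>?K \<omega>) \<partial>?U)"
          unfolding c[OF psB sB] by (subst (1 2) r) auto
        also have "\<dots> = Complex (\<integral>\<omega>. ?E \<omega> \<partial>?U) (\<integral>\<omega>. 0 \<partial>?U)"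
          by (intro arg_cong2[where f=Complex] Bochner_Integration.integral_cong refl cK) simp_all
        also have "\<dots> = (\<integral>\<omega>. complex_of_real (?E \<omega>) \<partial>?U)" by (simp add: complex_eq_iff)
        also have "\<dots> = (\<integral>\<omega>. indicator H \<omega> *\<^sub>R complex_of_real (exp (- (v \<omega> * (t \<bullet> (S *v t))) / 2)) \<partial>M) /\<^sub>R prob H"
          by (rule integral_uniform_measure_complex[OF _ H H0]) measurable
        finally have 1: "(\<integral>x. iexp (t \<bullet> x) \<partial>(?U \<bind> ?K)) = \<dots>" .
        have 2: "(\<integral>x. iexp (t \<bullet> x) \<partial>distr ?U borel (Y n)) = (\<integral>\<omega>. indicator H \<omega> *\<^sub>R iexp (t \<bullet> Y n \<omega>) \<partial>M) /\<^sub>R prob H" for n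
          by (subst integral_distr) (auto intro!: integral_uniform_measure_complex[OF _ H H0])
        show "(\<lambda>n. \<integral>x. iexp (t \<bullet> x) \<partial>distr ?U borel (Y n)) \<longlonglongrightarrow> (\<integral>x. iexp (t \<bullet> x) \<partial>(?U \<bind> ?K))"
          unfolding 1 2 by (intro tendsto_scaleR tendsto_const lim H)
      qed auto
    qed
  qed
  then show ?thesis unfolding converges_stably_def using Y K by auto
qed

section \<open>A stable central limit theorem\<close>

text \<open>Conditional moments are encoded by integrals against bounded functions of the past. By
  \<open>cond_cov\<close>, different vertices are uncorrelated given the past and vertex
  \<open>j\<close> has variance \<open>\<Gamma> k j\<close>. The limit \<open>v\<close> is the same
  for all vertices, which makes it a scalar factor of the limiting covariance.\<close>

locale martingale_differences = prob_space M
  for M :: "'a measure" +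
  fixes F :: "nat \<Rightarrow> 'a measure" and \<xi> \<Gamma> :: "nat \<Rightarrow> 'n::finite \<Rightarrow> 'a \<Rightarrow> real" and v :: "'a \<Rightarrow> real"
  assumes sub: "\<And>k. subalgebra M (F k)" and mono_F: "\<And>k m. k \<le> m \<Longrightarrow> sets (F k) \<subseteq> sets (F m)"
    and \<xi>_meas: "\<And>k j. \<xi> k j \<in> borel_measurable (F (Suc k))"
    and \<xi>_bound: "\<And>k j \<omega>. \<omega> \<in> space M \<Longrightarrow> \<bar>\<xi> k j \<omega>\<bar> \<le> 1"
    and \<Gamma>_meas: "\<And>k j. \<Gamma> k j \<in> borel_measurable (F k)"
    and \<Gamma>_bound: "\<And>k j \<omega>. \<omega> \<in> space M \<Longrightarrow> 0 \<le> \<Gamma> k j \<omega> \<and> \<Gamma> k j \<omega> \<le> 1"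
    and orth: "\<And>k j G B. G \<in> borel_measurable (F k) \<Longrightarrow> (\<And>\<omega>. \<omega> \<in> space M \<Longrightarrow> \<bar>G \<omega>\<bar> \<le> B)
       \<Longrightarrow> (\<integral>\<omega>. G \<omega> * \<xi> k j \<omega> \<partial>M) = 0"
    and cond_cov: "\<And>k i j G B. G \<in> borel_measurable (F k) \<Longrightarrow> (\<And>\<omega>. \<omega> \<in> space M \<Longrightarrow> \<bar>G \<omega>\<bar> \<le> B)
       \<Longrightarrow> (\<integral>\<omega>. G \<omega> * (\<xi> k i \<omega> * \<xi> k j \<omega>) \<partial>M) = (if i = j then \<integral>\<omega>. G \<omega> * \<Gamma> k j \<omega> \<partial>M else 0)"
    and v_meas: "v \<in> borel_measurable M" and v_bound: "\<And>\<omega>. \<omega> \<in> space M \<Longrightarrow> 0 \<le> v \<omega> \<and> v \<omega> \<le> 1"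
    and \<Gamma>_lim: "\<And>j. AE \<omega> in M. (\<lambda>k. \<Gamma> k j \<omega>) \<longlonglongrightarrow> v \<omega>"
begin

lemma space_F [simp]: "space (F k) = space M"
  using sub[of k] by (simp add: subalgebra_def)

lemma measurable_F_mono: "k \<le> m \<Longrightarrow> f \<in> borel_measurable (F k) \<Longrightarrow> f \<in> borel_measurable (F m)"
  using mono_F[of k m] by (auto simp: measurable_def)

lemma measurable_F_M: "f \<in> borel_measurable (F k) \<Longrightarrow> f \<in> borel_measurable M"
  by (rule measurable_from_subalg[OF sub])

lemma \<xi>_M [measurable]: "\<xi> k j \<in> borel_measurable M" and \<Gamma>_M [measurable]: "\<Gamma> k j \<in> borel_measurable M"
  by (rule measurable_F_M[OF \<xi>_meas], rule measurable_F_M[OF \<Gamma>_meas])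

lemma \<xi>_F: "k < m \<Longrightarrow> \<xi> k j \<in> borel_measurable (F m)"
  by (rule measurable_F_mono[OF _ \<xi>_meas]) simp

lemma integrable_bdd:
  fixes f :: "'a \<Rightarrow> 'b::{banach, second_countable_topology}"
  shows "f \<in> borel_measurable M \<Longrightarrow> (\<And>\<omega>. \<omega> \<in> space M \<Longrightarrow> norm (f \<omega>) \<le> B) \<Longrightarrow> integrable M f"
  by (rule integrable_bounded[OF finite_measure_axioms])

lemma expectation_le:
  fixes f :: "'a \<Rightarrow> 'b::{banach, second_countable_topology}" and g :: "'a \<Rightarrow> real"
  assumes "\<And>\<omega>. \<omega> \<in> space M \<Longrightarrow> norm (f \<omega>) \<le> g \<omega>" and "integrable M g" and "integrable M f"
  shows "norm (expectation f) \<le> expectation g"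
  using assms by (intro integral_norm_bound[THEN order_trans] integral_mono) auto

lemma norm_mult_le_right:
  fixes x y :: "'b::real_normed_div_algebra"
  shows "norm x \<le> 1 \<Longrightarrow> norm y \<le> C \<Longrightarrow> norm (x * y) \<le> C"
  using mult_left_le_one_le[of "norm y" "norm x"] by (simp add: norm_mult)

definition inc :: "(nat \<Rightarrow> 'n \<Rightarrow> real) \<Rightarrow> nat \<Rightarrow> 'a \<Rightarrow> real" where
  "inc a k \<omega> = (\<Sum>j\<in>UNIV. a k j * \<xi> k j \<omega>)"

abbreviation "wt a k \<equiv> (\<Sum>j\<in>UNIV. (a k j)\<^sup>2)" for a :: "nat \<Rightarrow> 'n \<Rightarrow> real"

lemma inc_meas: "inc a k \<in> borel_measurable (F (Suc k))"
  unfolding inc_def using \<xi>_meas by measurable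

lemma inc_M [measurable]: "inc a k \<in> borel_measurable M"
  by (rule measurable_F_M[OF inc_meas])

lemma inc_bound:
  fixes \<delta> :: real
  assumes "\<And>j. \<bar>a k j\<bar> \<le> \<delta>" "\<omega> \<in> space M"
  shows "\<bar>inc a k \<omega>\<bar> \<le> real CARD('n) * \<delta>"
proof -
  have "\<bar>inc a k \<omega>\<bar> \<le> (\<Sum>j\<in>UNIV. \<bar>a k j * \<xi> k j \<omega>\<bar>)" unfolding inc_def by (rule sum_abs)
  also have "\<dots> \<le> (\<Sum>j\<in>(UNIV::'n set). \<delta> * 1)"
    unfolding abs_mult using assms \<xi>_bound[of \<omega> k] by (intro sum_mono mult_mono) (auto intro: order_trans[OF abs_ge_zero])
  finally show ?thesis by simp
qed

lemma orth_inc: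
  fixes G :: "'a \<Rightarrow> complex"
  assumes G: "G \<in> borel_measurable (F k)" and G1: "\<And>\<omega>. \<omega> \<in> space M \<Longrightarrow> norm (G \<omega>) \<le> 1"
  shows "expectation (\<lambda>\<omega>. G \<omega> * inc a k \<omega>) = 0"
    and "expectation (\<lambda>\<omega>. G \<omega> * of_real ((inc a k \<omega>)\<^sup>2)) = expectation (\<lambda>\<omega>. G \<omega> * of_real (\<Sum>j\<in>UNIV. (a k j)\<^sup>2 * \<Gamma> k j \<omega>))"
proof -
  note [measurable] = measurable_F_M[OF G]
  have real1: "(\<integral>\<omega>. g \<omega> * inc a k \<omega> \<partial>M) = 0"
    and real2: "(\<integral>\<omega>. g \<omega> * (inc a k \<omega>)\<^sup>2 \<partial>M) = (\<integral>\<omega>. g \<omega> * (\<Sum>j\<in>UNIV. (a k j)\<^sup>2 * \<Gamma> k j \<omega>) \<partial>M)"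
    if g: "g \<in> borel_measurable (F k)" and g1: "\<And>\<omega>. \<omega> \<in> space M \<Longrightarrow> \<bar>g \<omega>\<bar> \<le> 1" for g :: "'a \<Rightarrow> real"
  proof -
    note [measurable] = measurable_F_M[OF g]
    have i: "integrable M (\<lambda>\<omega>. g \<omega> * \<xi> k j \<omega>)" for j
      using g1 \<xi>_bound by (intro integrable_bdd[where B=1] norm_mult_le_right) auto
    have ii: "integrable M (\<lambda>\<omega>. g \<omega> * (\<xi> k i \<omega> * \<xi> k j \<omega>))" for i j
      using g1 \<xi>_bound by (intro integrable_bdd[where B=1] norm_mult_le_right) auto
    have i\<Gamma>: "integrable M (\<lambda>\<omega>. g \<omega> * \<Gamma> k j \<omega>)" for j
      using g1 \<Gamma>_bound by (intro integrable_bdd[where B=1] norm_mult_le_right) auto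
    have "(\<integral>\<omega>. g \<omega> * inc a k \<omega> \<partial>M) = (\<integral>\<omega>. (\<Sum>j\<in>UNIV. a k j * (g \<omega> * \<xi> k j \<omega>)) \<partial>M)"
      by (simp add: inc_def sum_distrib_left mult.left_commute)
    also have "\<dots> = (\<Sum>j\<in>UNIV. a k j * (\<integral>\<omega>. g \<omega> * \<xi> k j \<omega> \<partial>M))"
      by (subst Bochner_Integration.integral_sum) (auto intro: i)
    also have "\<dots> = 0" using orth[OF g g1] by simp
    finally show "(\<integral>\<omega>. g \<omega> * inc a k \<omega> \<partial>M) = 0" .
    have "(\<integral>\<omega>. g \<omega> * (inc a k \<omega>)\<^sup>2 \<partial>M) = (\<integral>\<omega>. (\<Sum>i\<in>UNIV. \<Sum>j\<in>UNIV. a k i * a k j * (g \<omega> * (\<xi> k i \<omega> * \<xi> k j \<omega>))) \<partial>M)"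
      by (simp add: inc_def power2_eq_square sum_product sum_distrib_left mult_ac)
    also have "\<dots> = (\<Sum>i\<in>UNIV. \<Sum>j\<in>UNIV. a k i * a k j * (\<integral>\<omega>. g \<omega> * (\<xi> k i \<omega> * \<xi> k j \<omega>) \<partial>M))"
      by (subst Bochner_Integration.integral_sum, use ii in force, subst Bochner_Integration.integral_sum) (auto intro: ii)
    also have "\<dots> = (\<Sum>i\<in>UNIV. \<Sum>j\<in>UNIV. if i = j then a k i * a k j * (\<integral>\<omega>. g \<omega> * \<Gamma> k j \<omega> \<partial>M) else 0)"
      by (intro sum.cong refl) (simp add: cond_cov[OF g g1])
    also have "\<dots> = (\<Sum>i\<in>UNIV. (a k i)\<^sup>2 * (\<integral>\<omega>. g \<omega> * \<Gamma> k i \<omega> \<partial>M))"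
      by (simp add: power2_eq_square)
    also have "\<dots> = (\<integral>\<omega>. (\<Sum>i\<in>UNIV. (a k i)\<^sup>2 * (g \<omega> * \<Gamma> k i \<omega>)) \<partial>M)"
      by (subst Bochner_Integration.integral_sum) (auto intro: i\<Gamma>)
    also have "\<dots> = (\<integral>\<omega>. g \<omega> * (\<Sum>j\<in>UNIV. (a k j)\<^sup>2 * \<Gamma> k j \<omega>) \<partial>M)"
      by (simp add: sum_distrib_left mult.left_commute)
    finally show "(\<integral>\<omega>. g \<omega> * (inc a k \<omega>)\<^sup>2 \<partial>M) = (\<integral>\<omega>. g \<omega> * (\<Sum>j\<in>UNIV. (a k j)\<^sup>2 * \<Gamma> k j \<omega>) \<partial>M)" .
  qed
  have gRe: "(\<lambda>\<omega>. Re (G \<omega>)) \<in> borel_measurable (F k)" "(\<lambda>\<omega>. Im (G \<omega>)) \<in> borel_measurable (F k)"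
    using G by measurable
  have g1: "\<bar>Re (G \<omega>)\<bar> \<le> 1" "\<bar>Im (G \<omega>)\<bar> \<le> 1" if "\<omega> \<in> space M" for \<omega>
    using G1[OF that] abs_Re_le_cmod[of "G \<omega>"] abs_Im_le_cmod[of "G \<omega>"] by linarith+
  have cplx: "expectation (\<lambda>\<omega>. G \<omega> * of_real (X \<omega>)) = Complex (\<integral>\<omega>. Re (G \<omega>) * X \<omega> \<partial>M) (\<integral>\<omega>. Im (G \<omega>) * X \<omega> \<partial>M)"
    if [measurable]: "X \<in> borel_measurable M" and X: "\<And>\<omega>. \<omega> \<in> space M \<Longrightarrow> \<bar>X \<omega>\<bar> \<le> C" for X C
  proof -
    have "integrable M (\<lambda>\<omega>. G \<omega> * of_real (X \<omega>))"
      using G1 X by (intro integrable_bdd[where B=C] norm_mult_le_right) auto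
    then show ?thesis by (simp add: complex_eq_iff integral_Re[symmetric] integral_Im[symmetric])
  qed
  define \<delta> where "\<delta> = (\<Sum>j\<in>UNIV. \<bar>a k j\<bar>)"
  have \<delta>: "\<bar>a k j\<bar> \<le> \<delta>" for j unfolding \<delta>_def by (rule member_le_sum) auto
  have b1: "\<bar>inc a k \<omega>\<bar> \<le> real CARD('n) * \<delta>" if "\<omega> \<in> space M" for \<omega> by (rule inc_bound[where a=a and k=k, OF \<delta> that])
  have b2: "\<bar>(inc a k \<omega>)\<^sup>2\<bar> \<le> (real CARD('n) * \<delta>)\<^sup>2" if "\<omega> \<in> space M" for \<omega>
    using power_mono[OF b1[OF that], of 2] by simp
  have b3: "\<bar>\<Sum>j\<in>UNIV. (a k j)\<^sup>2 * \<Gamma> k j \<omega>\<bar> \<le> (\<Sum>j\<in>UNIV. (a k j)\<^sup>2)" if "\<omega> \<in> space M" for \<omega>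
    using \<Gamma>_bound[OF that] by (subst abs_of_nonneg) (auto intro!: sum_nonneg sum_mono mult_left_le)
  show "expectation (\<lambda>\<omega>. G \<omega> * inc a k \<omega>) = 0"
    by (subst cplx[OF _ b1]) (auto simp: real1 gRe g1 complex_eq_iff)
  show "expectation (\<lambda>\<omega>. G \<omega> * of_real ((inc a k \<omega>)\<^sup>2)) = expectation (\<lambda>\<omega>. G \<omega> * of_real (\<Sum>j\<in>UNIV. (a k j)\<^sup>2 * \<Gamma> k j \<omega>))"
    using cplx[of "\<lambda>\<omega>. (inc a k \<omega>)\<^sup>2", OF _ b2] cplx[of "\<lambda>\<omega>. \<Sum>j\<in>UNIV. (a k j)\<^sup>2 * \<Gamma> k j \<omega>", OF _ b3]
      real2[OF gRe(1) g1(1)] real2[OF gRe(2) g1(2)] by (simp del: of_real_power of_real_sum)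
qed

lemma exp_neg_approx: "0 \<le> u \<Longrightarrow> \<bar>exp (- u) - (1 - u)\<bar> \<le> u\<^sup>2 / 2" for u :: real
proof -
  assume u: "0 \<le> u"
  have 1: "exp (- u) \<ge> 1 - u" using exp_ge_add_one_self[of "- u"] by simp
  have "exp (- u) \<le> 1 - u + u\<^sup>2 / 2"
  proof -
    have d: "((\<lambda>u. 1 - u + u\<^sup>2 / 2 - exp (- u)) has_real_derivative (-1 + x + exp (- x))) (at x)" for x :: real
      by (auto intro!: derivative_eq_intros)
    have "1 - 0 + 0\<^sup>2 / 2 - exp (- 0) \<le> 1 - u + u\<^sup>2 / 2 - exp (- u)"
    proof (rule DERIV_nonneg_imp_nondecreasing[OF u])
      fix x :: real
      show "\<exists>y. ((\<lambda>u. 1 - u + u\<^sup>2 / 2 - exp (- u)) has_real_derivative y) (at x) \<and> 0 \<le> y"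
        using d[of x] exp_ge_add_one_self[of "- x"] by (intro exI[of _ "- 1 + x + exp (- x)"]) auto
    qed
    then show ?thesis by simp
  qed
  then show ?thesis using 1 by simp
qed

text \<open>Taylor expansion of both exponentials. The linear term has mean zero, the quadratic one
  may be replaced by its conditional mean, and exchanging \<Gamma> for \<open>V\<close> costs
  \<open>e\<close>; the remainders carry an extra factor of order \<delta>.\<close>

lemma one_step:
  fixes G :: "'a \<Rightarrow> complex" and e \<delta> :: real
  assumes G: "G \<in> borel_measurable (F k)" and G1: "\<And>\<omega>. \<omega> \<in> space M \<Longrightarrow> norm (G \<omega>) \<le> 1"
    and V: "V \<in> borel_measurable (F k)" and V01: "\<And>\<omega>. \<omega> \<in> space M \<Longrightarrow> 0 \<le> V \<omega> \<and> V \<omega> \<le> 1"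
    and e: "\<And>j. expectation (\<lambda>\<omega>. \<bar>\<Gamma> k j \<omega> - V \<omega>\<bar>) \<le> e"
    and \<delta>: "\<And>j. \<bar>a k j\<bar> \<le> \<delta>" "\<delta> \<le> 1"
  shows "norm (expectation (\<lambda>\<omega>. G \<omega> * (iexp (inc a k \<omega>) - exp (- (V \<omega> * wt a k) / 2)))) \<le> wt a k * (e + real CARD('n) * \<delta>)"
proof -
  note [measurable] = measurable_F_M[OF G] measurable_F_M[OF V]
  let ?x = "inc a k" and ?N = "real CARD('n)"
  let ?w = "\<lambda>\<omega>. \<Sum>j\<in>UNIV. (a k j)\<^sup>2 * \<Gamma> k j \<omega>"
  have \<delta>0: "0 \<le> \<delta>" using \<delta>(1) abs_ge_zero order_trans by blast
  have x: "\<bar>?x \<omega>\<bar> \<le> ?N * \<delta>" if "\<omega> \<in> space M" for \<omega> by (rule inc_bound[where a=a and k=k, OF \<delta>(1) that])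
  have wt0: "0 \<le> wt a k" by (intro sum_nonneg) auto
  have wtN: "wt a k \<le> ?N * \<delta>"
  proof -
    have "wt a k \<le> (\<Sum>j\<in>(UNIV::'n set). \<delta>)"
    proof (rule sum_mono)
      fix j
      have "(a k j)\<^sup>2 = \<bar>a k j\<bar> * \<bar>a k j\<bar>" by (simp add: power2_eq_square)
      also have "\<dots> \<le> \<delta> * 1" using \<delta>(1)[of j] \<delta>(2) by (intro mult_mono) auto
      finally show "(a k j)\<^sup>2 \<le> \<delta>" by simp
    qed
    then show ?thesis by simp
  qed
  have w0: "0 \<le> ?w \<omega>" "?w \<omega> \<le> wt a k" if "\<omega> \<in> space M" for \<omega>
    using \<Gamma>_bound[OF that] by (auto intro!: sum_nonneg sum_mono mult_left_le)
  let ?R = "\<lambda>\<omega>. iexp (?x \<omega>) - (1 + \<i> * ?x \<omega> - (?x \<omega>)\<^sup>2 / 2)"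
  let ?u = "\<lambda>\<omega>. V \<omega> * wt a k / 2"
  have R: "norm (?R \<omega>) \<le> ?N * \<delta> / 6 * (?x \<omega>)\<^sup>2" if "\<omega> \<in> space M" for \<omega>
  proof -
    have "norm (?R \<omega>) \<le> \<bar>?x \<omega>\<bar> ^ 3 / 6"
      using iexp_approx1[of "?x \<omega>" 2] by (simp add: numeral_eq_Suc power2_eq_square algebra_simps)
    also have "\<bar>?x \<omega>\<bar> ^ 3 = \<bar>?x \<omega>\<bar> * (?x \<omega>)\<^sup>2" by (simp add: power3_eq_cube power2_eq_square)
    also have "\<dots> \<le> (?N * \<delta>) * (?x \<omega>)\<^sup>2" using x[OF that] by (intro mult_right_mono) auto
    finally show ?thesis by simp
  qed
  have u: "\<bar>exp (- ?u \<omega>) - (1 - ?u \<omega>)\<bar> \<le> wt a k * (?N * \<delta>) / 8" if "\<omega> \<in> space M" for \<omega>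
  proof -
    have "0 \<le> ?u \<omega>" using V01[OF that] wt0 by simp
    then have "\<bar>exp (- ?u \<omega>) - (1 - ?u \<omega>)\<bar> \<le> (?u \<omega>)\<^sup>2 / 2" by (rule exp_neg_approx)
    also have "(?u \<omega>)\<^sup>2 = (V \<omega>)\<^sup>2 * (wt a k * wt a k) / 4" by (simp add: power2_eq_square)
    also have "(V \<omega>)\<^sup>2 * (wt a k * wt a k) \<le> 1 * (wt a k * (?N * \<delta>))"
      using V01[OF that] wt0 wtN by (intro mult_mono mult_left_mono) (auto simp: power_le_one_iff)
    finally show ?thesis by simp
  qed
  have xx: "(?x \<omega>)\<^sup>2 \<le> (?N * \<delta>)\<^sup>2" if "\<omega> \<in> space M" for \<omega>
    using power_mono[OF x[OF that], of 2] by simp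
  have ix: "integrable M (\<lambda>\<omega>. (?x \<omega>)\<^sup>2)" using xx by (intro integrable_bdd[where B="(?N * \<delta>)\<^sup>2"]) auto
  have iw: "integrable M ?w" using w0 by (intro integrable_bdd[where B="wt a k"]) (auto simp: abs_of_nonneg)
  have Ex2: "expectation (\<lambda>\<omega>. (?x \<omega>)\<^sup>2) \<le> wt a k"
  proof -
    have "complex_of_real (expectation (\<lambda>\<omega>. (?x \<omega>)\<^sup>2)) = complex_of_real (expectation ?w)"
      using orth_inc(2)[of "\<lambda>_. 1" k a] by (simp del: of_real_power of_real_sum)
    then have "expectation (\<lambda>\<omega>. (?x \<omega>)\<^sup>2) = expectation ?w" by (simp only: of_real_eq_iff)
    also have "\<dots> \<le> expectation (\<lambda>_. wt a k)" using w0 iw by (intro integral_mono) auto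
    finally show ?thesis by (simp add: prob_space)
  qed
  have wV: "expectation (\<lambda>\<omega>. \<bar>?w \<omega> - V \<omega> * wt a k\<bar>) \<le> wt a k * e"
  proof -
    have i: "integrable M (\<lambda>\<omega>. \<bar>\<Gamma> k j \<omega> - V \<omega>\<bar>)" for j
    proof (rule integrable_bdd[where B=1])
      fix \<omega> assume "\<omega> \<in> space M"
      then show "norm \<bar>\<Gamma> k j \<omega> - V \<omega>\<bar> \<le> 1" using \<Gamma>_bound[of \<omega> k j] V01[of \<omega>] by auto
    qed measurable
    have "expectation (\<lambda>\<omega>. \<bar>?w \<omega> - V \<omega> * wt a k\<bar>) \<le> expectation (\<lambda>\<omega>. \<Sum>j\<in>UNIV. (a k j)\<^sup>2 * \<bar>\<Gamma> k j \<omega> - V \<omega>\<bar>)"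
    proof (rule integral_mono)
      show "integrable M (\<lambda>\<omega>. \<bar>?w \<omega> - V \<omega> * wt a k\<bar>)"
        using w0 V01 wt0 by (intro integrable_abs Bochner_Integration.integrable_diff iw integrable_bdd[where B="wt a k"]) (auto simp: abs_mult intro!: mult_left_le_one_le)
      show "integrable M (\<lambda>\<omega>. \<Sum>j\<in>UNIV. (a k j)\<^sup>2 * \<bar>\<Gamma> k j \<omega> - V \<omega>\<bar>)" using i by (intro Bochner_Integration.integrable_sum) auto
      fix \<omega>
      have "?w \<omega> - V \<omega> * wt a k = (\<Sum>j\<in>UNIV. (a k j)\<^sup>2 * (\<Gamma> k j \<omega> - V \<omega>))"
        unfolding sum_distrib_left sum_subtractf[symmetric] by (intro sum.cong refl) (simp add: algebra_simps)
      then show "\<bar>?w \<omega> - V \<omega> * wt a k\<bar> \<le> (\<Sum>j\<in>UNIV. (a k j)\<^sup>2 * \<bar>\<Gamma> k j \<omega> - V \<omega>\<bar>)"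
        using sum_abs[of "\<lambda>j. (a k j)\<^sup>2 * (\<Gamma> k j \<omega> - V \<omega>)" UNIV] by (simp add: abs_mult)
    qed
    also have "\<dots> = (\<Sum>j\<in>UNIV. (a k j)\<^sup>2 * expectation (\<lambda>\<omega>. \<bar>\<Gamma> k j \<omega> - V \<omega>\<bar>))"
      using i by (subst Bochner_Integration.integral_sum) auto
    also have "\<dots> \<le> (\<Sum>j\<in>UNIV. (a k j)\<^sup>2 * e)" by (intro sum_mono mult_left_mono e) auto
    finally show ?thesis by (simp add: sum_distrib_right)
  qed
  have iV: "integrable M (\<lambda>\<omega>. \<bar>?w \<omega> - V \<omega> * wt a k\<bar>)"
    using w0 V01 wt0 by (intro integrable_abs Bochner_Integration.integrable_diff iw integrable_bdd[where B="wt a k"]) (auto simp: abs_mult intro!: mult_left_le_one_le)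
  \<comment> \<open>Everything outside the first bracket integrates to zero by
    \<open>orth_inc\<close>; the first bracket is bounded pointwise.\<close>
  have dec: "G \<omega> * (iexp (?x \<omega>) - exp (- (V \<omega> * wt a k) / 2)) =
     (G \<omega> * ?R \<omega> - G \<omega> * of_real ((?w \<omega> - V \<omega> * wt a k) / 2) - G \<omega> * of_real (exp (- ?u \<omega>) - (1 - ?u \<omega>)))
     + (\<i> * (G \<omega> * ?x \<omega>) - (G \<omega> * of_real ((?x \<omega>)\<^sup>2) - G \<omega> * of_real (?w \<omega>)) / 2)" for \<omega>
    by (simp add: field_simps)
  let ?D = "\<lambda>\<omega>. G \<omega> * ?R \<omega> - G \<omega> * of_real ((?w \<omega> - V \<omega> * wt a k) / 2) - G \<omega> * of_real (exp (- ?u \<omega>) - (1 - ?u \<omega>))"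
  let ?B = "\<lambda>\<omega>. ?N * \<delta> / 6 * (?x \<omega>)\<^sup>2 + \<bar>?w \<omega> - V \<omega> * wt a k\<bar> / 2 + wt a k * (?N * \<delta>) / 8"
  have iB: "integrable M ?B" using ix iV by simp
  have DB: "norm (?D \<omega>) \<le> ?B \<omega>" if "\<omega> \<in> space M" for \<omega>
  proof -
    have g: "norm (G \<omega> * y) \<le> norm y" for y using G1[OF that] by (simp add: norm_mult mult_left_le_one_le)
    have "norm (?D \<omega>) \<le> norm (G \<omega> * ?R \<omega>) + norm (G \<omega> * of_real ((?w \<omega> - V \<omega> * wt a k) / 2)) + norm (G \<omega> * of_real (exp (- ?u \<omega>) - (1 - ?u \<omega>)))"
      by (intro order_trans[OF norm_triangle_ineq4] add_mono order_refl norm_triangle_ineq4)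
    also have "\<dots> \<le> norm (?R \<omega>) + norm (complex_of_real ((?w \<omega> - V \<omega> * wt a k) / 2)) + norm (complex_of_real (exp (- ?u \<omega>) - (1 - ?u \<omega>)))"
      by (intro add_mono g)
    also have "\<dots> \<le> ?B \<omega>" unfolding norm_of_real using R[OF that] u[OF that] by (intro add_mono) auto
    finally show ?thesis .
  qed
  have Dm: "?D \<in> borel_measurable M" by measurable
  have iD: "integrable M ?D" by (rule Bochner_Integration.integrable_bound[OF iB Dm]) (use DB in \<open>force intro!: AE_I2 intro: order_trans[OF _ abs_ge_self]\<close>)
  have iGx: "integrable M (\<lambda>\<omega>. G \<omega> * ?x \<omega>)"
    using G1 x by (intro integrable_bdd[where B="?N * \<delta>"] norm_mult_le_right) auto
  have iGxx: "integrable M (\<lambda>\<omega>. G \<omega> * of_real ((?x \<omega>)\<^sup>2))"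
    using G1 xx by (intro integrable_bdd[where B="(?N * \<delta>)\<^sup>2"] norm_mult_le_right) (auto simp del: of_real_power)
  have iGw: "integrable M (\<lambda>\<omega>. G \<omega> * of_real (?w \<omega>))"
    using G1 w0 by (intro integrable_bdd[where B="wt a k"] norm_mult_le_right) (auto simp: abs_of_nonneg simp del: of_real_sum)
  have "expectation (\<lambda>\<omega>. G \<omega> * (iexp (?x \<omega>) - exp (- (V \<omega> * wt a k) / 2)))
     = expectation ?D + (\<i> * expectation (\<lambda>\<omega>. G \<omega> * ?x \<omega>) - (expectation (\<lambda>\<omega>. G \<omega> * of_real ((?x \<omega>)\<^sup>2)) - expectation (\<lambda>\<omega>. G \<omega> * of_real (?w \<omega>))) / 2)"
    unfolding dec using iD iGx iGxx iGw by (simp del: of_real_power of_real_sum)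
  also have "\<dots> = expectation ?D"
    using orth_inc(1)[OF G G1, of a] orth_inc(2)[OF G G1, of a] by (simp del: of_real_power of_real_sum)
  finally have "norm (expectation (\<lambda>\<omega>. G \<omega> * (iexp (?x \<omega>) - exp (- (V \<omega> * wt a k) / 2)))) = norm (expectation ?D)" by simp
  also have "\<dots> \<le> expectation ?B" by (rule expectation_le[OF DB iB iD])
  also have "\<dots> = ?N * \<delta> / 6 * expectation (\<lambda>\<omega>. (?x \<omega>)\<^sup>2) + expectation (\<lambda>\<omega>. \<bar>?w \<omega> - V \<omega> * wt a k\<bar>) / 2 + wt a k * (?N * \<delta>) / 8"
    using ix iV by (simp add: prob_space)
  also have "\<dots> \<le> ?N * \<delta> / 6 * wt a k + (wt a k * e) / 2 + wt a k * (?N * \<delta>) / 8"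
    using Ex2 wV \<delta>0 wt0 by (intro add_mono mult_left_mono divide_right_mono) auto
  also have "\<dots> \<le> wt a k * (e + ?N * \<delta>)"
  proof -
    have "0 \<le> e" using e order_trans[OF integral_nonneg_AE] by (metis (no_types, lifting) AE_I2 abs_ge_zero)
    then have "0 \<le> wt a k * e" "0 \<le> wt a k * (?N * \<delta>)" using wt0 \<delta>0 by auto
    then show ?thesis by (simp add: algebra_simps)
  qed
  finally show ?thesis .
qed

lemma norm_iexp_minus_le_2: "norm (iexp x - complex_of_real y) \<le> 2" if "\<bar>y\<bar> \<le> 1"
  using norm_triangle_ineq4[of "iexp x" "complex_of_real y"] that by simp

text \<open>Increments are exchanged for Gaussian factors one at a time, the last one first. The
  factor \<open>exp (- (V \<omega> * wt a m) / 2)\<close> is absorbed into the test function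
  \<open>g\<close>, which stays measurable for \<open>F K\<close> because \<open>V\<close> is; hence
  \<open>g\<close> is arbitrary in the induction.\<close>

lemma telescope:
  fixes g :: "'a \<Rightarrow> real" and e \<delta> :: real
  assumes V: "V \<in> borel_measurable (F K)" and V01: "\<And>\<omega>. \<omega> \<in> space M \<Longrightarrow> 0 \<le> V \<omega> \<and> V \<omega> \<le> 1"
    and e: "\<And>k j. K \<le> k \<Longrightarrow> expectation (\<lambda>\<omega>. \<bar>\<Gamma> k j \<omega> - V \<omega>\<bar>) \<le> e"
    and \<delta>: "\<And>k j. K \<le> k \<Longrightarrow> k < m \<Longrightarrow> \<bar>a k j\<bar> \<le> \<delta>" "\<delta> \<le> 1" and "K \<le> m"
    and g: "g \<in> borel_measurable (F K)" and g1: "\<And>\<omega>. \<omega> \<in> space M \<Longrightarrow> \<bar>g \<omega>\<bar> \<le> 1"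
  shows "norm (expectation (\<lambda>\<omega>. g \<omega> * (iexp (\<Sum>k=K..<m. inc a k \<omega>) - exp (- (V \<omega> * (\<Sum>k=K..<m. wt a k)) / 2))))
    \<le> (\<Sum>k=K..<m. wt a k) * (e + real CARD('n) * \<delta>)"
  using \<open>K \<le> m\<close> \<delta>(1) g g1
proof (induction m arbitrary: g rule: dec_induct)
  case base
  then show ?case by simp
next
  case (step m)
  let ?S = "\<lambda>\<omega>. \<Sum>k=K..<m. inc a k \<omega>" and ?B = "\<Sum>k=K..<m. wt a k"
  have VF[measurable]: "V \<in> borel_measurable M" and gF[measurable]: "g \<in> borel_measurable M"
    using V step.prems by (auto intro: measurable_F_M)
  have SF: "?S \<in> borel_measurable (F m)"
  proof (rule borel_measurable_sum)
    fix k assume "k \<in> {K..<m}"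
    then show "inc a k \<in> borel_measurable (F m)" by (intro measurable_F_mono[OF _ inc_meas]) auto
  qed
  have gm: "g \<in> borel_measurable (F m)" using step.prems step.hyps by (intro measurable_F_mono[of K m]) auto
  have Vm: "V \<in> borel_measurable (F m)" using V step.hyps by (intro measurable_F_mono[of K m]) auto
  have wt0: "0 \<le> wt a k" for k by (intro sum_nonneg) auto
  have B0: "0 \<le> ?B" by (intro sum_nonneg wt0)
  define G :: "'a \<Rightarrow> complex" where "G \<omega> = g \<omega> * iexp (?S \<omega>)" for \<omega>
  define g' where "g' \<omega> = g \<omega> * exp (- (V \<omega> * wt a m) / 2)" for \<omega>
  have G: "G \<in> borel_measurable (F m)" unfolding G_def using gm SF by measurable
  have G1: "norm (G \<omega>) \<le> 1" if "\<omega> \<in> space M" for \<omega> using step.prems(3)[OF that] by (simp add: G_def norm_mult)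
  have g': "g' \<in> borel_measurable (F K)" unfolding g'_def using step.prems V by measurable
  have ex1: "\<bar>exp (- (V \<omega> * wt a m) / 2)\<bar> \<le> 1" "\<bar>exp (- (V \<omega> * ?B) / 2)\<bar> \<le> 1" if "\<omega> \<in> space M" for \<omega>
    using V01[OF that] wt0 B0 by auto
  have g'1: "\<bar>g' \<omega>\<bar> \<le> 1" if "\<omega> \<in> space M" for \<omega>
    unfolding g'_def abs_mult using step.prems(3)[OF that] ex1[OF that] by (intro mult_le_one) auto
  have IH: "norm (expectation (\<lambda>\<omega>. g' \<omega> * (iexp (?S \<omega>) - exp (- (V \<omega> * ?B) / 2)))) \<le> ?B * (e + real CARD('n) * \<delta>)"
    by (rule step.IH[OF _ g' g'1]) (use step.prems in auto)
  have one: "norm (expectation (\<lambda>\<omega>. G \<omega> * (iexp (inc a m \<omega>) - exp (- (V \<omega> * wt a m) / 2)))) \<le> wt a m * (e + real CARD('n) * \<delta>)"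
    by (rule one_step[OF G G1 Vm V01 _ _ \<delta>(2)]) (use e step in auto)
  have eq: "g \<omega> * (iexp (\<Sum>k=K..<Suc m. inc a k \<omega>) - exp (- (V \<omega> * (\<Sum>k=K..<Suc m. wt a k)) / 2))
    = G \<omega> * (iexp (inc a m \<omega>) - exp (- (V \<omega> * wt a m) / 2)) + g' \<omega> * (iexp (?S \<omega>) - exp (- (V \<omega> * ?B) / 2))" for \<omega>
  proof -
    have 1: "iexp (\<Sum>k=K..<Suc m. inc a k \<omega>) = iexp (?S \<omega>) * iexp (inc a m \<omega>)"
      using step.hyps by (simp add: exp_add[symmetric] distrib_left)
    have 2: "exp (- (V \<omega> * (\<Sum>k=K..<Suc m. wt a k)) / 2) = exp (- (V \<omega> * ?B) / 2) * exp (- (V \<omega> * wt a m) / 2)"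
      using step.hyps by (simp add: exp_add[symmetric] distrib_left add_divide_distrib)
    show ?thesis unfolding 1 2 G_def g'_def by (simp add: algebra_simps)
  qed
  have i1: "integrable M (\<lambda>\<omega>. G \<omega> * (iexp (inc a m \<omega>) - exp (- (V \<omega> * wt a m) / 2)))"
  proof (rule integrable_bdd[where B=2], use measurable_F_M[OF G] in measurable, rule norm_mult_le_right[OF G1])
    fix \<omega> assume w: "\<omega> \<in> space M"
    show "norm (iexp (inc a m \<omega>) - complex_of_real (exp (- (V \<omega> * wt a m) / 2))) \<le> 2"
      by (rule norm_iexp_minus_le_2[OF ex1(1)[OF w]])
  qed
  have i2: "integrable M (\<lambda>\<omega>. complex_of_real (g' \<omega>) * (iexp (?S \<omega>) - exp (- (V \<omega> * ?B) / 2)))"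
  proof (rule integrable_bdd[where B=2], use measurable_F_M[OF g'] in measurable, rule norm_mult_le_right)
    fix \<omega> assume w: "\<omega> \<in> space M"
    show "norm (complex_of_real (g' \<omega>)) \<le> 1" using g'1[OF w] by simp
    show "norm (iexp (?S \<omega>) - complex_of_real (exp (- (V \<omega> * ?B) / 2))) \<le> 2"
      by (rule norm_iexp_minus_le_2[OF ex1(2)[OF w]])
  qed
  have "expectation (\<lambda>\<omega>. g \<omega> * (iexp (\<Sum>k=K..<Suc m. inc a k \<omega>) - exp (- (V \<omega> * (\<Sum>k=K..<Suc m. wt a k)) / 2)))
    = expectation (\<lambda>\<omega>. G \<omega> * (iexp (inc a m \<omega>) - exp (- (V \<omega> * wt a m) / 2))) + expectation (\<lambda>\<omega>. g' \<omega> * (iexp (?S \<omega>) - exp (- (V \<omega> * ?B) / 2)))"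
    unfolding eq by (rule Bochner_Integration.integral_add[OF i1 i2])
  then have "norm (expectation (\<lambda>\<omega>. g \<omega> * (iexp (\<Sum>k=K..<Suc m. inc a k \<omega>) - exp (- (V \<omega> * (\<Sum>k=K..<Suc m. wt a k)) / 2))))
     \<le> wt a m * (e + real CARD('n) * \<delta>) + ?B * (e + real CARD('n) * \<delta>)"
    by (simp only: norm_triangle_le[OF add_mono[OF one IH]])
  also have "\<dots> = (\<Sum>k=K..<Suc m. wt a k) * (e + real CARD('n) * \<delta>)"
    using step.hyps by (simp add: algebra_simps)
  finally show ?case .
qed

lemma \<Gamma>_L1: "(\<lambda>k. expectation (\<lambda>\<omega>. \<bar>\<Gamma> k j \<omega> - v \<omega>\<bar>)) \<longlonglongrightarrow> 0"
proof -
  note [measurable] = v_meas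
  have "(\<lambda>k. expectation (\<lambda>\<omega>. \<bar>\<Gamma> k j \<omega> - v \<omega>\<bar>)) \<longlonglongrightarrow> expectation (\<lambda>\<omega>. 0)"
  proof (rule integral_dominated_convergence[where w="\<lambda>_. 1"])
    show "AE \<omega> in M. (\<lambda>k. \<bar>\<Gamma> k j \<omega> - v \<omega>\<bar>) \<longlonglongrightarrow> 0"
      using \<Gamma>_lim[of j] by eventually_elim (intro tendsto_rabs_zero, simp add: LIM_zero)
    show "AE \<omega> in M. norm \<bar>\<Gamma> k j \<omega> - v \<omega>\<bar> \<le> 1" for k
    proof (rule AE_I2)
      fix \<omega> assume "\<omega> \<in> space M"
      then show "norm \<bar>\<Gamma> k j \<omega> - v \<omega>\<bar> \<le> 1" using \<Gamma>_bound[of \<omega> k j] v_bound[of \<omega>] by auto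
    qed
  qed auto
  then show ?thesis by simp
qed

lemma abs_exp_neg_diff_le: "0 \<le> x \<Longrightarrow> 0 \<le> y \<Longrightarrow> \<bar>exp (- x) - exp (- y)\<bar> \<le> \<bar>x - y\<bar>" for x y :: real
proof (induction x y rule: linorder_wlog)
  case (le x y)
  have "exp (- x) - exp (- y) = exp (- x) * (1 - exp (- (y - x)))" by (simp add: algebra_simps exp_add[symmetric])
  also have "\<dots> \<le> 1 * (y - x)"
  proof (rule mult_mono)
    show "1 - exp (- (y - x)) \<le> y - x" using exp_ge_add_one_self[of "- (y - x)"] by linarith
  qed (use le in auto)
  finally show ?case using le by simp
qed (simp add: abs_minus_commute)

lemma norm_iexp_diff_le: "norm (iexp x - iexp y) \<le> \<bar>x - y\<bar>"
proof -
  have "iexp x - iexp y = iexp y * (iexp (x - y) - 1)" by (simp add: algebra_simps exp_add[symmetric])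
  then show ?thesis using iexp_approx1[of "x - y" 0] by (simp add: norm_mult)
qed

section \<open>Stable convergence of a triangular array\<close>

context
  fixes b :: "nat \<Rightarrow> nat \<Rightarrow> 'n \<Rightarrow> real" and L :: "nat \<Rightarrow> nat" and s :: real
  assumes small: "\<And>\<epsilon>. \<epsilon> > 0 \<Longrightarrow> \<forall>\<^sub>F n in sequentially. \<forall>k<L n. \<forall>j. \<bar>b n k j\<bar> \<le> \<epsilon>"
    and total: "(\<lambda>n. \<Sum>k<L n. wt (b n) k) \<longlonglongrightarrow> s"
begin

definition "T n \<omega> = iexp (\<Sum>k<L n. inc (b n) k \<omega>)"
definition "Tlim \<omega> = complex_of_real (exp (- (v \<omega> * s) / 2))"

lemma s_nonneg: "0 \<le> s"
  by (rule LIMSEQ_le_const[OF total]) (auto intro!: sum_nonneg)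

lemma T_meas [measurable]: "T n \<in> borel_measurable M" unfolding T_def by measurable
lemma Tlim_meas [measurable]: "Tlim \<in> borel_measurable M" unfolding Tlim_def using v_meas by measurable
lemma T_norm: "norm (T n \<omega>) \<le> 1" by (simp add: T_def)
lemma Tlim_norm: "\<omega> \<in> space M \<Longrightarrow> norm (Tlim \<omega>) \<le> 1" using v_bound[of \<omega>] s_nonneg by (simp add: Tlim_def)

text \<open>Since \<open>v\<close> is only a limit, it is replaced by \<open>V = \<Gamma> K j\<close>, which is measurable before the
  increments with index at least \<open>K\<close>; the first \<open>K\<close> increments are negligible.\<close>

lemma conv_F:
  assumes H: "H \<in> sets (F m)"
  shows "(\<lambda>n. expectation (\<lambda>\<omega>. indicator H \<omega> *\<^sub>R T n \<omega>)) \<longlonglongrightarrow> expectation (\<lambda>\<omega>. indicator H \<omega> *\<^sub>R Tlim \<omega>)"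
proof (rule LIMSEQ_I)
  fix \<epsilon> :: real assume \<epsilon>: "\<epsilon> > 0"
  let ?N = "real CARD('n)"
  note [measurable] = v_meas
  have HM[measurable]: "H \<in> sets M" using H sub[of m] by (auto simp: subalgebra_def)
  \<comment> \<open>The error \<open>e\<close> is met three times with the factor
    \<open>s + 1\<close>, twice through \<open>\<Gamma>V\<close> and once through \<open>Vv\<close>;
    together this costs three eighths of \<epsilon>.\<close>
  define e where "e = \<epsilon> / 8 / (s + 1)"
  have e: "e > 0" using \<epsilon> s_nonneg by (simp add: e_def)
  have ev: "\<forall>\<^sub>F k in sequentially. \<forall>j\<in>(UNIV::'n set). expectation (\<lambda>\<omega>. \<bar>\<Gamma> k j \<omega> - v \<omega>\<bar>) < e"
    by (intro eventually_ball_finite ballI order_tendstoD(2)[OF \<Gamma>_L1 e]) simp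
  then obtain K0 where K0: "\<And>k j. k \<ge> K0 \<Longrightarrow> expectation (\<lambda>\<omega>. \<bar>\<Gamma> k j \<omega> - v \<omega>\<bar>) < e"
    unfolding eventually_sequentially by blast
  define K where "K = max K0 m"
  \<comment> \<open>The conditional variances of all vertices have the same limit, so any vertex may
    supply the approximation \<open>V\<close>.\<close>
  define j0 :: 'n where "j0 = undefined"
  define V where "V = \<Gamma> K j0"
  have VF: "V \<in> borel_measurable (F K)" unfolding V_def by (rule \<Gamma>_meas)
  have VM[measurable]: "V \<in> borel_measurable M" unfolding V_def by measurable
  have V01: "0 \<le> V \<omega> \<and> V \<omega> \<le> 1" if "\<omega> \<in> space M" for \<omega> unfolding V_def by (rule \<Gamma>_bound[OF that])
  have iv: "integrable M (\<lambda>\<omega>. \<bar>\<Gamma> k j \<omega> - v \<omega>\<bar>)" for k j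
  proof (rule integrable_bdd[where B=1])
    fix \<omega> assume "\<omega> \<in> space M"
    then show "norm \<bar>\<Gamma> k j \<omega> - v \<omega>\<bar> \<le> 1" using \<Gamma>_bound[of \<omega> k j] v_bound[of \<omega>] by auto
  qed measurable
  have Vv: "expectation (\<lambda>\<omega>. \<bar>V \<omega> - v \<omega>\<bar>) \<le> e" unfolding V_def using K0[of K j0] by (simp add: K_def)
  have \<Gamma>V: "expectation (\<lambda>\<omega>. \<bar>\<Gamma> k j \<omega> - V \<omega>\<bar>) \<le> 2 * e" if "K \<le> k" for k j
  proof -
    have "expectation (\<lambda>\<omega>. \<bar>\<Gamma> k j \<omega> - V \<omega>\<bar>) \<le> expectation (\<lambda>\<omega>. \<bar>\<Gamma> k j \<omega> - v \<omega>\<bar> + \<bar>V \<omega> - v \<omega>\<bar>)"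
    proof (rule integral_mono')
      show "integrable M (\<lambda>\<omega>. \<bar>\<Gamma> k j \<omega> - v \<omega>\<bar> + \<bar>V \<omega> - v \<omega>\<bar>)"
        unfolding V_def by (intro Bochner_Integration.integrable_add iv)
    qed auto
    also have "\<dots> = expectation (\<lambda>\<omega>. \<bar>\<Gamma> k j \<omega> - v \<omega>\<bar>) + expectation (\<lambda>\<omega>. \<bar>V \<omega> - v \<omega>\<bar>)"
      unfolding V_def by (intro Bochner_Integration.integral_add iv)
    also have "\<dots> \<le> 2 * e" using Vv K0[of k j] that by (simp add: K_def)
    finally show ?thesis .
  qed
  have gF: "(indicator H :: 'a \<Rightarrow> real) \<in> borel_measurable (F K)"
    using H mono_F[of m K] by (intro borel_measurable_indicator) (auto simp: K_def)
  \<comment> \<open>Each of the first \<open>K\<close> increments may cost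
    \<open>?N * \<delta>\<close>, and so may each unit of the remaining weight, which is at most
    \<open>s + 1\<close>.\<close>
  define C where "C = ?N * (real K + s + 1)"
  have C: "C > 0" unfolding C_def using s_nonneg by (intro mult_pos_pos) auto
  define \<delta> where "\<delta> = min 1 (\<epsilon> / (8 * C))"
  have \<delta>: "\<delta> > 0" "\<delta> \<le> 1" using \<epsilon> C by (auto simp: \<delta>_def)
  have \<delta>K: "(real K + s + 1) * (?N * \<delta>) \<le> \<epsilon> / 8"
  proof -
    have "C * \<delta> \<le> C * (\<epsilon> / (8 * C))"
      using C by (intro mult_left_mono) (auto simp: \<delta>_def)
    also have "\<dots> = \<epsilon> / 8" using C by simp
    finally show ?thesis by (simp add: C_def mult_ac)
  qed
  have "\<forall>\<^sub>F n in sequentially. \<bar>(\<Sum>k<L n. wt (b n) k) - s\<bar> < min 1 (\<epsilon> / 8)"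
    using total[THEN tendstoD, of "min 1 (\<epsilon> / 8)"] \<epsilon> by (simp add: dist_real_def)
  moreover note small[OF \<delta>(1)]
  ultimately have "\<forall>\<^sub>F n in sequentially. norm (expectation (\<lambda>\<omega>. indicator H \<omega> *\<^sub>R T n \<omega>) - expectation (\<lambda>\<omega>. indicator H \<omega> *\<^sub>R Tlim \<omega>)) < \<epsilon>"
  proof eventually_elim
    case (elim n)
    \<comment> \<open>Row \<open>n\<close> may be shorter than \<open>K\<close>; its head is then
      the whole row.\<close>
    define K' where "K' = min K (L n)"
    define \<beta> where "\<beta> = (\<Sum>k=K..<L n. wt (b n) k)"
    define X where "X \<omega> = (\<Sum>k=K..<L n. inc (b n) k \<omega>)" for \<omega>
    have split: "(\<Sum>k<L n. f k) = (\<Sum>k<K'. f k) + (\<Sum>k=K..<L n. f k)" for f :: "nat \<Rightarrow> real"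
    proof (cases "K \<le> L n")
      case True
      then show ?thesis by (simp add: K'_def lessThan_atLeast0 sum.atLeastLessThan_concat)
    qed (simp add: K'_def)
    have K'K: "real K' \<le> real K" by (simp add: K'_def)
    have bd: "\<bar>b n k j\<bar> \<le> \<delta>" if "k < L n" for k j using elim(2) that by auto
    have wt0: "0 \<le> wt (b n) k" for k by (intro sum_nonneg) auto
    have \<beta>0: "0 \<le> \<beta>" unfolding \<beta>_def by (intro sum_nonneg wt0)
    have head: "(\<Sum>k<K'. wt (b n) k) \<le> real K * (?N * \<delta>)"
    proof -
      have "wt (b n) k \<le> ?N * \<delta>" if "k < K'" for k
      proof -
        have "(b n k j)\<^sup>2 \<le> \<delta>" for j
        proof -
          have "\<bar>b n k j\<bar> * \<bar>b n k j\<bar> \<le> \<delta> * 1" using bd[of k j] that \<delta> by (intro mult_mono) (auto simp: K'_def)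
          then show ?thesis by (simp add: power2_eq_square)
        qed
        then show ?thesis using sum_bounded_above[of UNIV "\<lambda>j. (b n k j)\<^sup>2" \<delta>] by simp
      qed
      then have "(\<Sum>k<K'. wt (b n) k) \<le> real K' * (?N * \<delta>)" using sum_bounded_above[of "{..<K'}" "wt (b n)" "?N * \<delta>"] by simp
      also have "\<dots> \<le> real K * (?N * \<delta>)" using K'K \<delta> by (intro mult_right_mono) auto
      finally show ?thesis .
    qed
    have head0: "0 \<le> (\<Sum>k<K'. wt (b n) k)" by (intro sum_nonneg wt0)
    have tot: "(\<Sum>k<L n. wt (b n) k) = (\<Sum>k<K'. wt (b n) k) + \<beta>" unfolding \<beta>_def by (rule split)
    have \<beta>s: "\<beta> \<le> s + 1" using elim(1) tot head0 by linarith
    have \<beta>s': "\<bar>\<beta> - s\<bar> \<le> \<epsilon> / 8 + real K * (?N * \<delta>)" using elim(1) tot head head0 by linarith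
    have im[measurable]: "X \<in> borel_measurable M" unfolding X_def by measurable
    have 1: "norm (expectation (\<lambda>\<omega>. indicator H \<omega> *\<^sub>R (T n \<omega> - iexp (X \<omega>)))) \<le> expectation (\<lambda>\<omega>. real K * (?N * \<delta>))"
    proof (rule expectation_le)
      fix \<omega> assume w: "\<omega> \<in> space M"
      have "norm (T n \<omega> - iexp (X \<omega>)) \<le> \<bar>\<Sum>k<K'. inc (b n) k \<omega>\<bar>"
        unfolding T_def X_def split by (rule order_trans[OF norm_iexp_diff_le]) simp
      also have "\<dots> \<le> (\<Sum>k<K'. \<bar>inc (b n) k \<omega>\<bar>)" by (rule sum_abs)
      also have "\<dots> \<le> real K' * (?N * \<delta>)"
        using sum_bounded_above[of "{..<K'}" "\<lambda>k. \<bar>inc (b n) k \<omega>\<bar>" "?N * \<delta>"] inc_bound[where a="b n", OF bd w] by (simp add: K'_def)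
      also have "\<dots> \<le> real K * (?N * \<delta>)" using K'K \<delta> by (intro mult_right_mono) auto
      finally have "norm (T n \<omega> - iexp (X \<omega>)) \<le> real K * (?N * \<delta>)" .
      moreover have "0 \<le> real K * (?N * \<delta>)" using \<delta> by auto
      ultimately show "norm (indicator H \<omega> *\<^sub>R (T n \<omega> - iexp (X \<omega>))) \<le> real K * (?N * \<delta>)" by (simp add: indicator_def)
    next
      show "integrable M (\<lambda>\<omega>. indicator H \<omega> *\<^sub>R (T n \<omega> - iexp (X \<omega>)))"
      proof (rule integrable_bdd[where B=2])
        fix \<omega>
        show "norm (indicator H \<omega> *\<^sub>R (T n \<omega> - iexp (X \<omega>))) \<le> 2"
          using norm_triangle_ineq4[of "T n \<omega>" "iexp (X \<omega>)"] T_norm[of n \<omega>] by (auto simp: indicator_def)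
      qed measurable
    qed simp
    have 2: "norm (expectation (\<lambda>\<omega>. indicator H \<omega> *\<^sub>R (iexp (X \<omega>) - exp (- (V \<omega> * \<beta>) / 2)))) \<le> (s + 1) * (2 * e + ?N * \<delta>)"
    proof (cases "K \<le> L n")
      case True
      have "norm (expectation (\<lambda>\<omega>. (indicator H \<omega> :: real) * (iexp (X \<omega>) - exp (- (V \<omega> * \<beta>) / 2)))) \<le> \<beta> * (2 * e + ?N * \<delta>)"
        unfolding X_def \<beta>_def
        by (rule telescope[OF VF V01 \<Gamma>V _ \<delta>(2) True gF]) (use bd in \<open>auto simp: indicator_def\<close>)
      also have "\<dots> \<le> (s + 1) * (2 * e + ?N * \<delta>)" using \<beta>s e \<delta> by (intro mult_right_mono) auto
      finally show ?thesis by (simp add: scaleR_conv_of_real)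
    next
      case False
      then show ?thesis using s_nonneg e \<delta> by (simp add: X_def \<beta>_def)
    qed
    have 3: "norm (expectation (\<lambda>\<omega>. indicator H \<omega> *\<^sub>R (complex_of_real (exp (- (V \<omega> * \<beta>) / 2)) - Tlim \<omega>))) \<le> expectation (\<lambda>\<omega>. \<bar>V \<omega> - v \<omega>\<bar> * (s + 1) + \<bar>\<beta> - s\<bar>)"
    proof (rule expectation_le)
      fix \<omega> assume w: "\<omega> \<in> space M"
      have "norm (complex_of_real (exp (- (V \<omega> * \<beta>) / 2)) - Tlim \<omega>) = \<bar>exp (- (V \<omega> * \<beta> / 2)) - exp (- (v \<omega> * s / 2))\<bar>"
        unfolding Tlim_def of_real_diff[symmetric] norm_of_real by simp
      also have "\<dots> \<le> \<bar>V \<omega> * \<beta> / 2 - v \<omega> * s / 2\<bar>"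
        using V01[OF w] v_bound[OF w] \<beta>0 s_nonneg by (intro abs_exp_neg_diff_le) auto
      also have "\<dots> \<le> \<bar>V \<omega> * \<beta> - v \<omega> * s\<bar>" by (simp add: diff_divide_distrib[symmetric])
      also have "V \<omega> * \<beta> - v \<omega> * s = (V \<omega> - v \<omega>) * \<beta> + v \<omega> * (\<beta> - s)" by (simp add: algebra_simps)
      also have "\<bar>\<dots>\<bar> \<le> \<bar>V \<omega> - v \<omega>\<bar> * \<beta> + v \<omega> * \<bar>\<beta> - s\<bar>"
        using \<beta>0 v_bound[OF w] by (intro order_trans[OF abs_triangle_ineq]) (simp add: abs_mult)
      also have "\<dots> \<le> \<bar>V \<omega> - v \<omega>\<bar> * (s + 1) + 1 * \<bar>\<beta> - s\<bar>"
        using \<beta>s v_bound[OF w] by (intro add_mono mult_left_mono mult_right_mono) auto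
      finally have *: "norm (complex_of_real (exp (- (V \<omega> * \<beta>) / 2)) - Tlim \<omega>) \<le> \<bar>V \<omega> - v \<omega>\<bar> * (s + 1) + \<bar>\<beta> - s\<bar>" by simp
      then show "norm (indicator H \<omega> *\<^sub>R (complex_of_real (exp (- (V \<omega> * \<beta>) / 2)) - Tlim \<omega>)) \<le> \<bar>V \<omega> - v \<omega>\<bar> * (s + 1) + \<bar>\<beta> - s\<bar>"
        using s_nonneg by (cases "\<omega> \<in> H") auto
    next
      show "integrable M (\<lambda>\<omega>. \<bar>V \<omega> - v \<omega>\<bar> * (s + 1) + \<bar>\<beta> - s\<bar>)" unfolding V_def using iv by auto
      show "integrable M (\<lambda>\<omega>. indicator H \<omega> *\<^sub>R (complex_of_real (exp (- (V \<omega> * \<beta>) / 2)) - Tlim \<omega>))"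
      proof (rule integrable_bdd[where B=2])
        fix \<omega> assume w: "\<omega> \<in> space M"
        have "norm (complex_of_real (exp (- (V \<omega> * \<beta>) / 2))) \<le> 1" unfolding norm_of_real using V01[OF w] \<beta>0 by simp
        then have "norm (complex_of_real (exp (- (V \<omega> * \<beta>) / 2)) - Tlim \<omega>) \<le> 2"
          using norm_triangle_ineq4[of "complex_of_real (exp (- (V \<omega> * \<beta>) / 2))" "Tlim \<omega>"] Tlim_norm[OF w] by linarith
        then show "norm (indicator H \<omega> *\<^sub>R (complex_of_real (exp (- (V \<omega> * \<beta>) / 2)) - Tlim \<omega>)) \<le> 2"
          by (cases "\<omega> \<in> H") auto
      qed measurable
    qed
    have 4: "expectation (\<lambda>\<omega>. \<bar>V \<omega> - v \<omega>\<bar> * (s + 1) + \<bar>\<beta> - s\<bar>) \<le> e * (s + 1) + (\<epsilon> / 8 + real K * (?N * \<delta>))"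
    proof -
      have "expectation (\<lambda>\<omega>. \<bar>V \<omega> - v \<omega>\<bar> * (s + 1) + \<bar>\<beta> - s\<bar>) = expectation (\<lambda>\<omega>. \<bar>V \<omega> - v \<omega>\<bar>) * (s + 1) + \<bar>\<beta> - s\<bar>"
        using iv[of K j0] by (simp add: V_def prob_space)
      also have "\<dots> \<le> e * (s + 1) + (\<epsilon> / 8 + real K * (?N * \<delta>))"
        using Vv s_nonneg \<beta>s' by (intro add_mono mult_right_mono) auto
      finally show ?thesis .
    qed
    have iT: "integrable M (\<lambda>\<omega>. indicator H \<omega> *\<^sub>R T n \<omega>)" "integrable M (\<lambda>\<omega>. indicator H \<omega> *\<^sub>R Tlim \<omega>)"
      "integrable M (\<lambda>\<omega>. indicator H \<omega> *\<^sub>R iexp (X \<omega>))" "integrable M (\<lambda>\<omega>. indicator H \<omega> *\<^sub>R complex_of_real (exp (- (V \<omega> * \<beta>) / 2)))"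
      using T_norm Tlim_norm V01 \<beta>0 by (auto intro!: integrable_bdd[where B=1] simp: indicator_def)
    have "expectation (\<lambda>\<omega>. indicator H \<omega> *\<^sub>R T n \<omega>) - expectation (\<lambda>\<omega>. indicator H \<omega> *\<^sub>R Tlim \<omega>)
      = expectation (\<lambda>\<omega>. indicator H \<omega> *\<^sub>R (T n \<omega> - iexp (X \<omega>))) + expectation (\<lambda>\<omega>. indicator H \<omega> *\<^sub>R (iexp (X \<omega>) - exp (- (V \<omega> * \<beta>) / 2)))
       + expectation (\<lambda>\<omega>. indicator H \<omega> *\<^sub>R (complex_of_real (exp (- (V \<omega> * \<beta>) / 2)) - Tlim \<omega>))"
      unfolding scaleR_diff_right Bochner_Integration.integral_diff[OF iT(1) iT(3)] Bochner_Integration.integral_diff[OF iT(3) iT(4)] Bochner_Integration.integral_diff[OF iT(4) iT(2)]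
      by simp
    then have "norm (expectation (\<lambda>\<omega>. indicator H \<omega> *\<^sub>R T n \<omega>) - expectation (\<lambda>\<omega>. indicator H \<omega> *\<^sub>R Tlim \<omega>))
      \<le> (real K * (?N * \<delta>) + (s + 1) * (2 * e + ?N * \<delta>)) + (e * (s + 1) + (\<epsilon> / 8 + real K * (?N * \<delta>)))"
      using norm_triangle_le[OF add_mono[OF norm_triangle_le[OF add_mono[OF 1 2]] order_trans[OF 3 4]]] by (simp add: prob_space)
    also have "\<dots> < \<epsilon>"
    proof -
      have "s + 1 \<noteq> 0" using s_nonneg by simp
      then have "(s + 1) * e = \<epsilon> / 8" using e_def by (metis nonzero_eq_divide_eq mult.commute)
      moreover have "0 \<le> (s + 1) * (?N * \<delta>)" using s_nonneg \<delta> by simp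
      moreover have "real K * (?N * \<delta>) + (s + 1) * (?N * \<delta>) \<le> \<epsilon> / 8" using \<delta>K by (simp add: algebra_simps)
      ultimately show ?thesis using \<epsilon> by (simp add: algebra_simps)
    qed
    finally show ?case .
  qed
  then show "\<exists>no. \<forall>n\<ge>no. norm (expectation (\<lambda>\<omega>. indicator H \<omega> *\<^sub>R T n \<omega>) - expectation (\<lambda>\<omega>. indicator H \<omega> *\<^sub>R Tlim \<omega>)) < \<epsilon>"
    unfolding eventually_sequentially .
qed

section \<open>Extension to arbitrary events\<close>

definition conv :: "('a \<Rightarrow> real) \<Rightarrow> bool" where
  "conv g \<longleftrightarrow> (\<lambda>n. expectation (\<lambda>\<omega>. g \<omega> *\<^sub>R T n \<omega>)) \<longlonglongrightarrow> expectation (\<lambda>\<omega>. g \<omega> *\<^sub>R Tlim \<omega>)"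

lemma integrable_scaleR_T:
  assumes g: "integrable M g"
  shows "integrable M (\<lambda>\<omega>. g \<omega> *\<^sub>R T n \<omega>)" "integrable M (\<lambda>\<omega>. g \<omega> *\<^sub>R Tlim \<omega>)"
proof -
  have [measurable]: "g \<in> borel_measurable M" using g by simp
  show "integrable M (\<lambda>\<omega>. g \<omega> *\<^sub>R T n \<omega>)"
    by (rule Bochner_Integration.integrable_bound[OF g]) (auto simp: T_norm mult_left_le)
  show "integrable M (\<lambda>\<omega>. g \<omega> *\<^sub>R Tlim \<omega>)"
    by (rule Bochner_Integration.integrable_bound[OF g]) (auto simp: Tlim_norm mult_left_le)
qed

lemma norm_expectation_scaleR_le:
  assumes g: "integrable M g"
  shows "norm (expectation (\<lambda>\<omega>. g \<omega> *\<^sub>R T n \<omega>)) \<le> expectation (\<lambda>\<omega>. \<bar>g \<omega>\<bar>)"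
    "norm (expectation (\<lambda>\<omega>. g \<omega> *\<^sub>R Tlim \<omega>)) \<le> expectation (\<lambda>\<omega>. \<bar>g \<omega>\<bar>)"
  using g by (auto intro!: expectation_le integrable_scaleR_T simp: T_norm Tlim_norm mult_left_le)

lemma conv_add: "integrable M g \<Longrightarrow> integrable M h \<Longrightarrow> conv g \<Longrightarrow> conv h \<Longrightarrow> conv (\<lambda>\<omega>. g \<omega> + h \<omega>)"
  unfolding conv_def scaleR_add_left by (simp add: integrable_scaleR_T tendsto_add)

lemma conv_scale: "conv g \<Longrightarrow> conv (\<lambda>\<omega>. c * g \<omega>)"
  unfolding conv_def scaleR_scaleR[symmetric] integral_scaleR_right by (intro tendsto_intros)

lemma conv_cong: "(\<And>\<omega>. \<omega> \<in> space M \<Longrightarrow> g \<omega> = h \<omega>) \<Longrightarrow> conv g \<longleftrightarrow> conv h"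
  unfolding conv_def by (simp cong: Bochner_Integration.integral_cong)

lemma conv_sum: "(\<And>i. i \<in> I \<Longrightarrow> integrable M (g i)) \<Longrightarrow> (\<And>i. i \<in> I \<Longrightarrow> conv (g i)) \<Longrightarrow> conv (\<lambda>\<omega>. \<Sum>i\<in>I. g i \<omega>)"
proof (induction I rule: infinite_finite_induct)
  case (insert i I)
  then show ?case by (simp add: conv_add)
qed (simp_all add: conv_def)

text \<open>\<open>T n\<close> and \<open>Tlim\<close> are bounded by 1, so exchanging
  \<open>g\<close> for \<open>h\<close> changes both sides by at most their L1 distance, uniformly
  in \<open>n\<close>.\<close>

lemma conv_closure:
  assumes g: "integrable M g" and ap: "\<And>\<epsilon>. \<epsilon> > 0 \<Longrightarrow> \<exists>h. integrable M h \<and> conv h \<and> expectation (\<lambda>\<omega>. \<bar>g \<omega> - h \<omega>\<bar>) \<le> \<epsilon>"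
  shows "conv g"
  unfolding conv_def
proof (rule LIMSEQ_I)
  fix \<epsilon> :: real assume \<epsilon>: "\<epsilon> > 0"
  then obtain h where h: "integrable M h" "conv h" "expectation (\<lambda>\<omega>. \<bar>g \<omega> - h \<omega>\<bar>) \<le> \<epsilon> / 4"
    using ap[of "\<epsilon> / 4"] by auto
  from LIMSEQ_D[OF h(2)[unfolded conv_def], of "\<epsilon> / 4"] \<epsilon> obtain N where
    N: "\<And>n. n \<ge> N \<Longrightarrow> norm (expectation (\<lambda>\<omega>. h \<omega> *\<^sub>R T n \<omega>) - expectation (\<lambda>\<omega>. h \<omega> *\<^sub>R Tlim \<omega>)) < \<epsilon> / 4" by auto
  have gh: "integrable M (\<lambda>\<omega>. g \<omega> - h \<omega>)" using g h by auto
  show "\<exists>no. \<forall>n\<ge>no. norm (expectation (\<lambda>\<omega>. g \<omega> *\<^sub>R T n \<omega>) - expectation (\<lambda>\<omega>. g \<omega> *\<^sub>R Tlim \<omega>)) < \<epsilon>"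
  proof (intro exI allI impI)
    fix n assume n: "n \<ge> N"
    have eq: "expectation (\<lambda>\<omega>. g \<omega> *\<^sub>R T n \<omega>) - expectation (\<lambda>\<omega>. g \<omega> *\<^sub>R Tlim \<omega>) =
      (expectation (\<lambda>\<omega>. (g \<omega> - h \<omega>) *\<^sub>R T n \<omega>) - expectation (\<lambda>\<omega>. (g \<omega> - h \<omega>) *\<^sub>R Tlim \<omega>)) + (expectation (\<lambda>\<omega>. h \<omega> *\<^sub>R T n \<omega>) - expectation (\<lambda>\<omega>. h \<omega> *\<^sub>R Tlim \<omega>))"
      using g h by (simp add: scaleR_diff_left integrable_scaleR_T)
    have "norm (expectation (\<lambda>\<omega>. g \<omega> *\<^sub>R T n \<omega>) - expectation (\<lambda>\<omega>. g \<omega> *\<^sub>R Tlim \<omega>)) \<le> (\<epsilon> / 4 + \<epsilon> / 4) + \<epsilon> / 4"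
    proof -
      have n1: "norm (expectation (\<lambda>\<omega>. (g \<omega> - h \<omega>) *\<^sub>R T n \<omega>)) \<le> \<epsilon> / 4" by (rule order_trans[OF norm_expectation_scaleR_le(1)[OF gh] h(3)])
      have n2: "norm (expectation (\<lambda>\<omega>. (g \<omega> - h \<omega>) *\<^sub>R Tlim \<omega>)) \<le> \<epsilon> / 4" by (rule order_trans[OF norm_expectation_scaleR_le(2)[OF gh] h(3)])
      have n12: "norm (expectation (\<lambda>\<omega>. (g \<omega> - h \<omega>) *\<^sub>R T n \<omega>) - expectation (\<lambda>\<omega>. (g \<omega> - h \<omega>) *\<^sub>R Tlim \<omega>)) \<le> \<epsilon> / 4 + \<epsilon> / 4"
        by (rule order_trans[OF norm_triangle_ineq4 add_mono[OF n1 n2]])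
      show ?thesis unfolding eq by (rule order_trans[OF norm_triangle_ineq add_mono[OF n12 less_imp_le[OF N[OF n]]]])
    qed
    then show "norm (expectation (\<lambda>\<omega>. g \<omega> *\<^sub>R T n \<omega>) - expectation (\<lambda>\<omega>. g \<omega> *\<^sub>R Tlim \<omega>)) < \<epsilon>" using \<epsilon> by simp
  qed
qed

definition Finf :: "'a measure" where "Finf = sigma (space M) (\<Union>m. sets (F m))"

lemma F_sets_M: "sets (F m) \<subseteq> sets M"
  using sub[of m] by (simp add: subalgebra_def)

lemma F_Pow: "(\<Union>m. sets (F m)) \<subseteq> Pow (space M)"
  using F_sets_M sets.sets_into_space by blast

lemma sets_Finf: "sets Finf = sigma_sets (space M) (\<Union>m. sets (F m))"
  unfolding Finf_def by (rule sets_measure_of[OF F_Pow])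

lemma space_Finf [simp]: "space Finf = space M"
  by (simp add: Finf_def space_measure_of_conv)

lemma subalgebra_Finf: "subalgebra M Finf"
proof -
  have "(\<Union>m. sets (F m)) \<subseteq> sets M" using F_sets_M by auto
  then show ?thesis unfolding subalgebra_def sets_Finf by (simp add: sets.sigma_sets_subset)
qed

lemma measurable_Finf: "f \<in> borel_measurable (F m) \<Longrightarrow> f \<in> borel_measurable Finf"
  by (rule measurable_from_subalg[of Finf "F m"]) (auto simp: subalgebra_def sets_Finf)

text \<open>Dynkin's argument, starting from the events of the single \<open>F m\<close>, whose
  union is stable under intersection. Countable disjoint unions are L1 limits of finite ones, so
  \<open>conv_closure\<close> applies.\<close>

lemma conv_indicator_Finf:
  assumes "A \<in> sets Finf" shows "conv (indicator A)"
proof -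
  have MF: "A \<in> sets M" if "A \<in> sigma_sets (space M) (\<Union>m. sets (F m))" for A
    using subalgebra_Finf that by (auto simp: subalgebra_def sets_Finf)
  have ind: "integrable M (indicator A :: 'a \<Rightarrow> real)" if "A \<in> sigma_sets (space M) (\<Union>m. sets (F m))" for A
    using MF[OF that] by (auto intro!: integrable_real_indicator simp: emeasure_eq_measure)
  have stable: "Int_stable (\<Union>m. sets (F m))"
  proof (rule Int_stableI)
    fix a b assume "a \<in> (\<Union>m. sets (F m))" "b \<in> (\<Union>m. sets (F m))"
    then obtain m m' where "a \<in> sets (F m)" "b \<in> sets (F m')" by auto
    then have "a \<in> sets (F (max m m'))" "b \<in> sets (F (max m m'))" using mono_F[of m "max m m'"] mono_F[of m' "max m m'"] by auto
    then show "a \<inter> b \<in> (\<Union>m. sets (F m))" by auto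
  qed
  show ?thesis
    using stable F_Pow assms[unfolded sets_Finf]
  proof (induction A rule: sigma_sets_induct_disjoint)
    case (basic A)
    then show ?case using conv_F unfolding conv_def by blast
  next
    case empty
    then show ?case by (simp add: conv_def)
  next
    case (compl A)
    have "space M \<in> sets (F 0)" using sets.top[of "F 0"] by simp
    then have "conv (indicator (space M))" unfolding conv_def by (rule conv_F)
    moreover have "integrable M (indicator (space M) :: 'a \<Rightarrow> real)" by (auto intro!: integrable_real_indicator simp: emeasure_eq_measure)
    ultimately have "conv (\<lambda>\<omega>. indicator (space M) \<omega> + (- 1) * indicator A \<omega>)"
      using compl ind[OF compl(1)] by (intro conv_add conv_scale) auto
    then show ?case by (subst conv_cong) (auto simp: indicator_def)
  next
    case (union A)
    have Ai: "A i \<in> sigma_sets (space M) (\<Union>m. sets (F m))" for i using union by auto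
    have AM: "range A \<subseteq> sets M" using MF[OF Ai] by auto
    show ?case
    proof (rule conv_closure)
      show "integrable M (indicator (\<Union>i. A i) :: 'a \<Rightarrow> real)" by (rule ind) (auto intro: sigma_sets.Union Ai)
      fix \<epsilon> :: real assume "\<epsilon> > 0"
      have sums: "(\<lambda>i. prob (A i)) sums prob (\<Union>i. A i)" by (rule finite_measure_UNION[OF AM union(1)])
      from LIMSEQ_D[OF sums[unfolded sums_def] \<open>\<epsilon> > 0\<close>] obtain k where k: "\<bar>(\<Sum>i<k. prob (A i)) - prob (\<Union>i. A i)\<bar> < \<epsilon>" by auto
      have fin: "(\<Sum>i<k. indicator (A i) \<omega>) = (indicator (\<Union>i<k. A i) \<omega> :: real)" for \<omega>
        by (rule indicator_UN_disjoint[symmetric]) (use union(1) in \<open>auto simp: disjoint_family_on_def\<close>)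
      have "expectation (\<lambda>\<omega>. \<bar>indicator (\<Union>i. A i) \<omega> - (\<Sum>i<k. indicator (A i) \<omega>)\<bar>) = (expectation (\<lambda>\<omega>. indicator (\<Union>i. A i) \<omega> - (\<Sum>i<k. indicator (A i) \<omega>)) :: real)"
      proof -
        have "\<bar>indicator (\<Union>i. A i) \<omega> - (\<Sum>i<k. indicator (A i) \<omega>)\<bar> = (indicator (\<Union>i. A i) \<omega> - (\<Sum>i<k. indicator (A i) \<omega>) :: real)" for \<omega>
        proof -
          have "(indicator (\<Union>i<k. A i) \<omega> :: real) \<le> indicator (\<Union>i. A i) \<omega>" by (rule indicator_leI) auto
          then show ?thesis unfolding fin by simp
        qed
        then show ?thesis by simp
      qed
      also have "\<dots> = prob (\<Union>i. A i) - (\<Sum>i<k. prob (A i))"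
      proof -
        have "integrable M (indicator (\<Union>i. A i) :: 'a \<Rightarrow> real)" by (rule ind) (auto intro: sigma_sets.Union Ai)
        moreover have "A i \<inter> space M = A i" "(\<Union>i. A i) \<inter> space M = (\<Union>i. A i)" for i using AM sets.sets_into_space by blast+
        ultimately show ?thesis using ind[OF Ai] by simp
      qed
      also have "\<dots> \<le> \<epsilon>" using k by argo
      finally show "\<exists>h. integrable M h \<and> conv h \<and> expectation (\<lambda>\<omega>. \<bar>indicator (\<Union>i. A i) \<omega> - h \<omega>\<bar>) \<le> \<epsilon>"
        using ind[OF Ai] union(3) by (intro exI[of _ "\<lambda>\<omega>. \<Sum>i<k. indicator (A i) \<omega>"]) (auto intro!: conv_sum)
    qed
  qed
qed

lemma conv_integrable_Finf:
  assumes "integrable (restr_to_subalg M Finf) g" shows "conv g"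
proof -
  note sp = space_restr_to_subalg[of M Finf] and st = sets_restr_to_subalg[OF subalgebra_Finf]
  note im = integrable_from_subalg[OF subalgebra_Finf]
  show ?thesis using assms
  proof (induction g rule: integrable_induct)
    case (base A c)
    then have "conv (\<lambda>\<omega>. c * indicator A \<omega>)" by (intro conv_scale conv_indicator_Finf) (simp add: st)
    then show ?case by (simp add: mult.commute)
  next
    case (add f g)
    then show ?case by (intro conv_add im)
  next
    case (lim f s)
    show ?case
    proof (rule conv_closure[OF im[OF lim.hyps(4)]])
      fix \<epsilon> :: real assume "\<epsilon> > 0"
      have fi: "integrable M f" "\<And>i. integrable M (s i)" using im lim.hyps by auto
      have [measurable]: "f \<in> borel_measurable M" "\<And>i. s i \<in> borel_measurable M" using fi by auto
      have "(\<lambda>i. expectation (\<lambda>\<omega>. \<bar>f \<omega> - s i \<omega>\<bar>)) \<longlonglongrightarrow> expectation (\<lambda>\<omega>. 0)"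
      proof (rule integral_dominated_convergence[where w="\<lambda>\<omega>. 3 * \<bar>f \<omega>\<bar>"])
        show "AE \<omega> in M. (\<lambda>i. \<bar>f \<omega> - s i \<omega>\<bar>) \<longlonglongrightarrow> 0"
        proof (rule AE_I2)
          fix \<omega> assume "\<omega> \<in> space M"
          then have "(\<lambda>i. f \<omega> - s i \<omega>) \<longlonglongrightarrow> f \<omega> - f \<omega>" using lim.hyps(2)[of \<omega>] sp by (intro tendsto_intros) auto
          then show "(\<lambda>i. \<bar>f \<omega> - s i \<omega>\<bar>) \<longlonglongrightarrow> 0" by (intro tendsto_rabs_zero) simp
        qed
        show "AE \<omega> in M. norm \<bar>f \<omega> - s i \<omega>\<bar> \<le> 3 * \<bar>f \<omega>\<bar>" for i
        proof (rule AE_I2)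
          fix \<omega> assume "\<omega> \<in> space M"
          then have "\<bar>s i \<omega>\<bar> \<le> 2 * \<bar>f \<omega>\<bar>" using lim.hyps(3)[of \<omega> i] sp by auto
          then show "norm \<bar>f \<omega> - s i \<omega>\<bar> \<le> 3 * \<bar>f \<omega>\<bar>" by auto
        qed
      qed (use fi in auto)
      then have "\<forall>\<^sub>F i in sequentially. expectation (\<lambda>\<omega>. \<bar>f \<omega> - s i \<omega>\<bar>) < \<epsilon>"
        using \<open>\<epsilon> > 0\<close> by (intro order_tendstoD(2)) auto
      then obtain i where "expectation (\<lambda>\<omega>. \<bar>f \<omega> - s i \<omega>\<bar>) < \<epsilon>" unfolding eventually_sequentially by blast
      then show "\<exists>h. integrable M h \<and> conv h \<and> expectation (\<lambda>\<omega>. \<bar>f \<omega> - h \<omega>\<bar>) \<le> \<epsilon>"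
        using fi lim.IH by (intro exI[of _ "s i"]) auto
    qed
  qed
qed

text \<open>\<open>T n\<close> is a function of the differences, so an arbitrary event may be
  replaced by its conditional probability \<open>g\<close> given \<open>Finf\<close>. For the limit
  this takes a version of \<open>v\<close> measurable for \<open>Finf\<close>, which the sequence
  \<Gamma> supplies.\<close>

theorem stable_clt:
  assumes H[measurable]: "H \<in> sets M"
  shows "(\<lambda>n. expectation (\<lambda>\<omega>. indicator H \<omega> *\<^sub>R T n \<omega>)) \<longlonglongrightarrow> expectation (\<lambda>\<omega>. indicator H \<omega> *\<^sub>R Tlim \<omega>)"
proof -
  interpret S: finite_measure_subalgebra M Finf by unfold_locales (rule subalgebra_Finf)
  define g where "g = real_cond_exp M Finf (indicator H)"
  have iH: "integrable M (indicator H :: 'a \<Rightarrow> real)" by (auto intro!: integrable_real_indicator simp: emeasure_eq_measure)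
  have gF[measurable]: "g \<in> borel_measurable Finf" unfolding g_def by (rule borel_measurable_cond_exp)
  have gM: "integrable M g" unfolding g_def by (rule S.real_cond_exp_int(1)[OF iH])
  have gm[measurable]: "g \<in> borel_measurable M" using gM by simp
  have conv_g: "conv g" by (rule conv_integrable_Finf[OF integrable_in_subalg[OF subalgebra_Finf gF gM]])
  have proj: "expectation (\<lambda>\<omega>. indicator H \<omega> *\<^sub>R f \<omega>) = expectation (\<lambda>\<omega>. g \<omega> *\<^sub>R f \<omega>)"
    if f: "f \<in> borel_measurable Finf" and f1: "\<And>\<omega>. \<omega> \<in> space M \<Longrightarrow> norm (f \<omega>) \<le> B" for f :: "'a \<Rightarrow> complex" and B
  proof -
    have fM[measurable]: "f \<in> borel_measurable M" by (rule measurable_from_subalg[OF subalgebra_Finf f])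
    have i: "integrable M (\<lambda>\<omega>. h \<omega> *\<^sub>R f \<omega>)" if h: "integrable M h" for h :: "'a \<Rightarrow> real"
    proof -
      have [measurable]: "h \<in> borel_measurable M" using h by simp
      have "integrable M (\<lambda>\<omega>. \<bar>B\<bar> * h \<omega>)" using h by simp
      then show ?thesis
      proof (rule Bochner_Integration.integrable_bound)
        show "AE \<omega> in M. norm (h \<omega> *\<^sub>R f \<omega>) \<le> norm (\<bar>B\<bar> * h \<omega>)"
        proof (rule AE_I2)
          fix \<omega> assume "\<omega> \<in> space M"
          then have "norm (f \<omega>) \<le> \<bar>B\<bar>" using f1[of \<omega>] by linarith
          then show "norm (h \<omega> *\<^sub>R f \<omega>) \<le> norm (\<bar>B\<bar> * h \<omega>)" using mult_left_mono[of "norm (f \<omega>)" "\<bar>B\<bar>" "\<bar>h \<omega>\<bar>"] by (simp add: abs_mult mult.commute)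
        qed
      qed measurable
    qed
    have r: "expectation (\<lambda>\<omega>. h \<omega> * g \<omega>) = expectation (\<lambda>\<omega>. h \<omega> * indicator H \<omega>)"
      if h: "h \<in> borel_measurable Finf" and hB: "\<And>\<omega>. \<omega> \<in> space M \<Longrightarrow> \<bar>h \<omega>\<bar> \<le> \<bar>B\<bar>" for h :: "'a \<Rightarrow> real"
      unfolding g_def
    proof (rule S.real_cond_exp_intg(2)[OF _ h])
      have [measurable]: "h \<in> borel_measurable M" by (rule measurable_from_subalg[OF subalgebra_Finf h])
      show "integrable M (\<lambda>\<omega>. h \<omega> * indicator H \<omega>)"
        using hB by (intro integrable_bdd[where B="\<bar>B\<bar>"]) (auto simp: indicator_def)
    qed simp
    have RI: "(\<lambda>\<omega>. Re (f \<omega>)) \<in> borel_measurable Finf" "(\<lambda>\<omega>. Im (f \<omega>)) \<in> borel_measurable Finf" using f by measurable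
    have RIb: "\<bar>Re (f \<omega>)\<bar> \<le> \<bar>B\<bar>" "\<bar>Im (f \<omega>)\<bar> \<le> \<bar>B\<bar>" if "\<omega> \<in> space M" for \<omega>
      using f1[OF that] abs_Re_le_cmod[of "f \<omega>"] abs_Im_le_cmod[of "f \<omega>"] by linarith+
    show ?thesis
      using r[OF RI(1) RIb(1)] r[OF RI(2) RIb(2)] i[OF iH] i[OF gM]
      by (simp add: complex_eq_iff integral_Re[symmetric] integral_Im[symmetric] mult.commute)
  qed
  have TF: "T n \<in> borel_measurable Finf" for n
    unfolding T_def using measurable_Finf[OF inc_meas] by measurable
  define j0 :: 'n where "j0 = undefined"
  \<comment> \<open>\<open>lim\<close> yields a measurable function even where the sequence
    diverges. Cutting it at zero afterwards keeps \<open>Tl\<close> bounded by 1 everywhere and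
    changes nothing where the sequence converges to \<open>v\<close>.\<close>
  define v' where "v' \<omega> = lim (\<lambda>k. \<Gamma> k j0 \<omega>)" for \<omega>
  have [measurable]: "\<Gamma> k j0 \<in> borel_measurable Finf" for k by (rule measurable_Finf[OF \<Gamma>_meas])
  have v'F[measurable]: "v' \<in> borel_measurable Finf" unfolding v'_def by measurable
  define v'' where "v'' \<omega> = max 0 (v' \<omega>)" for \<omega>
  have v''F[measurable]: "v'' \<in> borel_measurable Finf" unfolding v''_def by measurable
  define Tl where "Tl \<omega> = complex_of_real (exp (- (v'' \<omega> * s) / 2))" for \<omega>
  have TlF[measurable]: "Tl \<in> borel_measurable Finf" unfolding Tl_def by measurable
  have TlM[measurable]: "Tl \<in> borel_measurable M" by (rule measurable_from_subalg[OF subalgebra_Finf TlF])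
  have Tl1: "norm (Tl \<omega>) \<le> 1" for \<omega> unfolding Tl_def norm_of_real using s_nonneg by (simp add: v''_def)
  have AE: "AE \<omega> in M. Tlim \<omega> = Tl \<omega>"
    using \<Gamma>_lim[of j0] AE_space
  proof eventually_elim
    case (elim \<omega>)
    then have "v' \<omega> = v \<omega>" unfolding v'_def by (intro limI)
    then show ?case using v_bound[OF elim(2)] by (simp add: Tlim_def Tl_def v''_def)
  qed
  have eqT: "expectation (\<lambda>\<omega>. indicator H \<omega> *\<^sub>R Tlim \<omega>) = expectation (\<lambda>\<omega>. g \<omega> *\<^sub>R Tlim \<omega>)"
  proof -
    have "expectation (\<lambda>\<omega>. indicator H \<omega> *\<^sub>R Tlim \<omega>) = expectation (\<lambda>\<omega>. indicator H \<omega> *\<^sub>R Tl \<omega>)"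
      by (intro integral_cong_AE) (use AE in auto)
    also have "\<dots> = expectation (\<lambda>\<omega>. g \<omega> *\<^sub>R Tl \<omega>)" by (rule proj[OF TlF Tl1])
    also have "\<dots> = expectation (\<lambda>\<omega>. g \<omega> *\<^sub>R Tlim \<omega>)" by (intro integral_cong_AE) (use AE in auto)
    finally show ?thesis .
  qed
  show ?thesis unfolding eqT using conv_g unfolding conv_def proj[OF TF T_norm] .
qed

end

end

section \<open>Spectral data\<close>

lemma matrix_matrix_mult_nth: "(A ** B) $ i $ j = (\<Sum>k\<in>UNIV. A $ i $ k * B $ k $ j)"
  by (simp add: matrix_matrix_mult_def)

locale spectral_data =
  fixes W :: "real^'n::finite^'n" and lam :: "'n \<Rightarrow> complex" and U V :: "complex^'n^'n" and \<iota> :: 'n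
  assumes W_nonneg: "\<And>h j. W $ h $ j \<ge> 0"
    and W_sum: "\<And>j. (\<Sum>h\<in>UNIV. W $ h $ j) = 1"
    and irreducible: "irreducible_matrix W"
    and U_inv: "invertible U"
    and U_diag: "transpose U ** cmat W ** matrix_inv (transpose U) = diag_matrix lam"
    and U_norm: "\<And>j. norm (column j U) = 1"
    and U_orth: "\<And>i j. i \<noteq> j \<Longrightarrow> lam i = lam j \<Longrightarrow> (\<Sum>k\<in>UNIV. cnj (column i U $ k) * column j U $ k) = 0"
    and lam_\<iota>: "lam \<iota> = 1"
    and U_\<iota>: "column \<iota> U = vec (complex_of_real (1 / sqrt (real CARD('n))))"
    and V_def: "V = matrix_inv (transpose U)"
begin

lemma UV: "transpose U ** V = mat 1" and VU: "V ** transpose U = mat 1"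
proof -
  have "invertible (transpose U)" using U_inv unfolding invertible_def by (metis matrix_transpose_mul transpose_mat)
  then show "transpose U ** V = mat 1" "V ** transpose U = mat 1"
    unfolding V_def matrix_inv_def invertible_def by (rule someI2_ex, simp)+
qed

lemma sum_UV: "(\<Sum>h\<in>UNIV. U $ h $ i * V $ h $ j) = (if i = j then 1 else 0)"
  using arg_cong[OF UV, of "\<lambda>A. A $ i $ j"] by (simp add: matrix_matrix_mult_nth transpose_def mat_def)

lemma sum_VU: "(\<Sum>i\<in>UNIV. V $ h $ i * U $ l $ i) = (if h = l then 1 else 0)"
  using arg_cong[OF VU, of "\<lambda>A. A $ h $ l"] by (simp add: matrix_matrix_mult_nth transpose_def mat_def)

lemma right_eigenvector: "(\<Sum>l\<in>UNIV. W $ h $ l * V $ l $ i) = lam i * V $ h $ i"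
proof -
  have "cmat W ** V = (V ** transpose U) ** (cmat W ** V)" by (simp add: VU)
  also have "\<dots> = V ** diag_matrix lam" using U_diag[folded V_def] by (metis matrix_mul_assoc)
  finally have "(cmat W ** V) $ h $ i = (V ** diag_matrix lam) $ h $ i" by simp
  then show ?thesis by (simp add: matrix_matrix_mult_nth map_matrix_def diag_matrix_def if_distrib mult.commute cong: if_cong)
qed

lemma left_eigenvector: "(\<Sum>h\<in>UNIV. W $ h $ j * U $ h $ i) = lam i * U $ j $ i"
proof -
  have "transpose U ** cmat W = (transpose U ** cmat W) ** (V ** transpose U)" by (simp add: VU)
  also have "\<dots> = diag_matrix lam ** transpose U" using U_diag[folded V_def] by (metis matrix_mul_assoc)
  finally have "(transpose U ** cmat W) $ i $ j = (diag_matrix lam ** transpose U) $ i $ j" by simp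
  then have "(\<Sum>k\<in>UNIV. U $ k $ i * complex_of_real (W $ k $ j)) = lam i * U $ j $ i"
    by (simp add: matrix_matrix_mult_nth map_matrix_def diag_matrix_def transpose_def if_distrib[of "\<lambda>x. x * _"] cong: if_cong)
  then show ?thesis by (simp add: mult.commute)
qed

lemma U_\<iota>_nth: "U $ h $ \<iota> = complex_of_real (1 / sqrt (real CARD('n)))"
  using arg_cong[OF U_\<iota>, of "\<lambda>x. x $ h"] by (simp add: column_def)

text \<open>Maximum principle. Columns of \<open>W\<close> sum to 1, so \<open>x j\<close> is an
  average over the \<open>h\<close> with \<open>W $ h $ j \<noteq> 0\<close>. At a maximum all of
  these values are maximal, and irreducibility spreads this backwards along paths to every
  vertex.\<close>

lemma harmonic_constant:
  fixes x :: "'n \<Rightarrow> real"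
  assumes "\<And>j. (\<Sum>h\<in>UNIV. W $ h $ j * x h) = x j"
  shows "x i = x j"
proof -
  define m where "m = Max (range x)"
  have le: "x h \<le> m" for h unfolding m_def by (intro Max_ge) auto
  have "m \<in> range x" unfolding m_def by (intro Max_in) auto
  then obtain j0 where j0: "x j0 = m" by auto
  have max: "x i = m" for i
  proof -
    have "(i, j0) \<in> {(i, j). W $ i $ j \<noteq> 0}\<^sup>*" using irreducible by (simp add: irreducible_matrix_def)
    then show ?thesis
    proof (induction rule: converse_rtrancl_induct)
      case (step i k)
      have "(\<Sum>h\<in>UNIV. W $ h $ k * (m - x h)) = 0"
        using assms[of k] W_sum[of k] step by (simp add: right_diff_distrib sum_subtractf sum_distrib_right[symmetric])
      then have "W $ i $ k * (m - x i) = 0"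
        using W_nonneg le by (subst (asm) sum_nonneg_eq_0_iff) auto
      then show ?case using step by auto
    qed (rule j0)
  qed
  show ?thesis using max by simp
qed

text \<open>Simplicity of the eigenvalue 1: another left eigenvector would be constant by the
  maximum principle, applied to real and imaginary parts, yet orthogonal to the constant vector
  \<open>column \<iota> U\<close>.\<close>

lemma lam_eq_1: assumes "lam i = 1" shows "i = \<iota>"
proof (rule ccontr)
  assume i: "i \<noteq> \<iota>"
  have h: "(\<Sum>h\<in>UNIV. W $ h $ j * U $ h $ i) = U $ j $ i" for j using left_eigenvector[of j i] assms by simp
  have "(\<Sum>h\<in>UNIV. W $ h $ j * Re (U $ h $ i)) = Re (U $ j $ i)" "(\<Sum>h\<in>UNIV. W $ h $ j * Im (U $ h $ i)) = Im (U $ j $ i)" for j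
    using arg_cong[OF h[of j], of Re] arg_cong[OF h[of j], of Im] by simp_all
  from harmonic_constant[OF this(1)] harmonic_constant[OF this(2)]
  have const: "U $ h $ i = U $ \<iota> $ i" for h by (simp add: complex_eq_iff)
  have "(\<Sum>k\<in>UNIV. cnj (U $ k $ i) * U $ k $ \<iota>) = 0" using U_orth[OF i] assms lam_\<iota> by (simp add: column_def)
  moreover have "(\<Sum>k\<in>(UNIV :: 'n set). cnj (U $ \<iota> $ i) * complex_of_real (1 / sqrt (real CARD('n)))) = (\<Sum>k\<in>UNIV. cnj (U $ k $ i) * U $ k $ \<iota>)"
    by (intro sum.cong refl) (metis const U_\<iota>_nth)
  ultimately have "U $ \<iota> $ i = 0" by simp
  then have "column i U = 0" using const by (simp add: vec_eq_iff column_def)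
  then show False using U_norm[of i] by simp
qed

text \<open>The left eigenvector equation is read at an entry of largest modulus \<open>m\<close>;
  one side is then an average of numbers of modulus at most \<open>m\<close>.\<close>

lemma norm_lam_le_1: "norm (lam i) \<le> 1"
proof -
  define m where "m = Max (range (\<lambda>h. norm (U $ h $ i)))"
  have le: "norm (U $ h $ i) \<le> m" for h unfolding m_def by (intro Max_ge) auto
  have "m \<in> range (\<lambda>h. norm (U $ h $ i))" unfolding m_def by (intro Max_in) auto
  then obtain j where j: "norm (U $ j $ i) = m" by auto
  have "m \<noteq> 0"
  proof
    assume "m = 0"
    then have "column i U = 0" using le by (simp add: vec_eq_iff column_def)
    then show False using U_norm[of i] by simp
  qed
  then have m: "m > 0" using j by auto
  have "norm (lam i) * m = norm (\<Sum>h\<in>UNIV. W $ h $ j * U $ h $ i)" unfolding left_eigenvector by (simp add: norm_mult j)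
  also have "\<dots> \<le> (\<Sum>h\<in>UNIV. W $ h $ j * m)"
    using W_nonneg le by (intro sum_norm_le) (simp add: norm_mult mult_left_mono)
  also have "\<dots> = m" using W_sum[of j] by (simp add: sum_distrib_right[symmetric])
  finally show ?thesis using m by simp
qed

text \<open>In the closed unit disc the real part 1 is attained only at 1 itself.\<close>

lemma Re_lam_less_1: assumes "i \<noteq> \<iota>" shows "Re (lam i) < 1"
proof (rule ccontr)
  assume "\<not> Re (lam i) < 1"
  then have "Re (lam i) = 1" using norm_lam_le_1[of i] complex_Re_le_cmod[of "lam i"] by linarith
  moreover have "(Re (lam i))\<^sup>2 + (Im (lam i))\<^sup>2 \<le> 1"
    using norm_lam_le_1[of i] by (simp add: cmod_power2[symmetric] power_le_one)
  ultimately have "lam i = 1" by (simp add: complex_eq_iff)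
  then show False using lam_eq_1 assms by blast
qed

lemma lam_eigenvalue: "is_eigenvalue (cmat W) (lam i)"
  unfolding is_eigenvalue_def
proof (intro exI conjI)
  show "cmat W *v column i V = lam i *s column i V"
    using right_eigenvector by (simp add: vec_eq_iff matrix_vector_mult_def map_matrix_def column_def)
  show "column i V \<noteq> 0"
  proof
    assume "column i V = 0"
    then have "V $ h $ i = 0" for h by (simp add: vec_eq_iff column_def)
    then show False using sum_UV[of i i] by simp
  qed
qed

text \<open>As \<open>W\<close> is real, the conjugate \<open>c\<close> of this column solves the
  same eigenvector equation. Its coordinates \<open>x\<close> vanish off \<iota> by simplicity of
  the eigenvalue, and \<open>x \<iota> = 1\<close> since \<open>column \<iota> U\<close> is
  real.\<close>

lemma V_\<iota>_real: "V $ h $ \<iota> = complex_of_real (Re (V $ h $ \<iota>))"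
proof -
  define c where "c l = cnj (V $ l $ \<iota>)" for l
  define x where "x i = (\<Sum>l\<in>UNIV. U $ l $ i * c l)" for i
  have Wc: "(\<Sum>l\<in>UNIV. W $ h $ l * c l) = c h" for h
    using arg_cong[OF right_eigenvector[of h \<iota>], of cnj] by (simp add: c_def lam_\<iota>)
  have "lam i * x i = x i" for i
  proof -
    have "lam i * x i = (\<Sum>l\<in>UNIV. (\<Sum>h\<in>UNIV. W $ h $ l * U $ h $ i) * c l)"
      unfolding left_eigenvector x_def sum_distrib_left by (simp add: mult.assoc)
    also have "\<dots> = (\<Sum>h\<in>UNIV. U $ h $ i * (\<Sum>l\<in>UNIV. W $ h $ l * c l))"
      unfolding sum_distrib_left sum_distrib_right by (subst sum.swap) (simp add: mult_ac)
    finally show ?thesis unfolding Wc x_def .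
  qed
  then have x0: "x i = 0" if "i \<noteq> \<iota>" for i using lam_eq_1[of i] that by (metis mult_cancel_right1)
  have x1: "x \<iota> = 1"
  proof -
    have "x \<iota> = cnj (\<Sum>l\<in>UNIV. U $ l $ \<iota> * V $ l $ \<iota>)" by (simp add: x_def c_def U_\<iota>_nth)
    then show ?thesis by (simp add: sum_UV)
  qed
  have "c h = (\<Sum>l\<in>UNIV. (\<Sum>i\<in>UNIV. V $ h $ i * U $ l $ i) * c l)" by (simp add: sum_VU if_distrib[of "\<lambda>x. x * _"] cong: if_cong)
  also have "\<dots> = (\<Sum>i\<in>UNIV. V $ h $ i * x i)"
    unfolding x_def sum_distrib_left sum_distrib_right by (subst sum.swap) (simp add: mult_ac)
  also have "\<dots> = (\<Sum>i\<in>UNIV. if i = \<iota> then V $ h $ \<iota> else 0)" using x0 x1 by (intro sum.cong) auto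
  finally have "c h = V $ h $ \<iota>" by simp
  then show ?thesis by (simp add: c_def complex_eq_iff)
qed

lemma sum_V: "(\<Sum>l\<in>UNIV. V $ l $ i) = (if i = \<iota> then complex_of_real (sqrt (real CARD('n))) else 0)"
proof -
  have n: "sqrt (real CARD('n)) > 0" by simp
  have "(\<Sum>l\<in>UNIV. V $ l $ i) = sqrt (real CARD('n)) * (\<Sum>l\<in>UNIV. U $ l $ \<iota> * V $ l $ i)"
    unfolding U_\<iota>_nth sum_distrib_left using n by simp
  then show ?thesis unfolding sum_UV by auto
qed

text \<open>The division accounts for \<open>column \<iota> U\<close> having entries
  \<open>1 / sqrt (real CARD('n))\<close> instead of 1.\<close>

definition vr :: "real^'n" where "vr = (\<chi> j. Re (V $ j $ \<iota>) / sqrt (real CARD('n)))"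

lemma V_\<iota>: "V $ h $ \<iota> = complex_of_real (sqrt (real CARD('n)) * vr $ h)"
  using V_\<iota>_real[of h] by (simp add: vr_def)

lemma sum_vr: "(\<Sum>j\<in>UNIV. vr $ j) = 1"
proof -
  have "complex_of_real (sqrt (real CARD('n)) * (\<Sum>j\<in>UNIV. vr $ j)) = complex_of_real (sqrt (real CARD('n)))"
    using sum_V[of \<iota>] unfolding V_\<iota> by (simp add: sum_distrib_left)
  then show ?thesis by (simp only: of_real_eq_iff) simp
qed

lemma W_vr: "(\<Sum>l\<in>UNIV. W $ h $ l * vr $ l) = vr $ h"
proof -
  have "complex_of_real (sqrt (real CARD('n)) * (\<Sum>l\<in>UNIV. W $ h $ l * vr $ l)) = complex_of_real (sqrt (real CARD('n)) * vr $ h)"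
    using right_eigenvector[of h \<iota>] unfolding V_\<iota> lam_\<iota> by (simp add: sum_distrib_left mult.left_commute)
  then show ?thesis by (simp only: of_real_eq_iff) simp
qed

text \<open>Origin of the factor \<open>1 / CARD('n)\<close> in \<open>sigma_tilde_sq\<close>: the
  noise of the common martingale is weighted by \<open>vr\<close>, while the covariance is stated
  with \<open>column \<iota> V\<close>.\<close>

lemma norm_V_\<iota>: "(norm (column \<iota> V))\<^sup>2 = real CARD('n) * (norm vr)\<^sup>2"
  by (simp add: norm_vec_def L2_set_def sum_nonneg column_def V_\<iota> norm_mult power_mult_distrib sum_distrib_left)

text \<open>The bilinear and the Hermitian square agree because this column is real.\<close>

lemma vprod_\<iota>\<iota>: "vprod V \<iota> \<iota> = complex_of_real ((norm (column \<iota> V))\<^sup>2)"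
proof -
  have "vprod V \<iota> \<iota> = complex_of_real (\<Sum>h\<in>UNIV. (sqrt (real CARD('n)) * vr $ h)\<^sup>2)"
    by (simp add: scalar_product_def column_def V_\<iota> power2_eq_square)
  also have "(\<Sum>h\<in>UNIV. (sqrt (real CARD('n)) * vr $ h)\<^sup>2) = (norm (column \<iota> V))\<^sup>2"
    unfolding norm_V_\<iota> by (simp add: power_mult_distrib norm_vec_def L2_set_def sum_nonneg sum_distrib_left)
  finally show ?thesis .
qed

end

section \<open>The martingale differences\<close>

lemma vec_nth_matrix_vector_mult: "(A *v x) $ i = (\<Sum>j\<in>UNIV. A $ i $ j * x $ j)"
  by (simp add: matrix_vector_mult_def)

lemma cond_prob_integral:
  fixes g G :: "'a \<Rightarrow> real"
  assumes M: "prob_space M" and F: "subalgebra M F" and G: "G \<in> borel_measurable F" and GB: "\<And>\<omega>. \<omega> \<in> space M \<Longrightarrow> \<bar>G \<omega>\<bar> \<le> B"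
    and H: "H \<in> sets M" and g: "g \<in> borel_measurable M" and ce: "AE \<omega> in M. real_cond_exp M F (indicator H) \<omega> = g \<omega>"
  shows "(\<integral>\<omega>. G \<omega> * indicator H \<omega> \<partial>M) = (\<integral>\<omega>. G \<omega> * g \<omega> \<partial>M)"
proof -
  interpret prob_space M by fact
  interpret S: finite_measure_subalgebra M F by unfold_locales (rule F)
  have GM[measurable]: "G \<in> borel_measurable M" by (rule measurable_from_subalg[OF F G])
  note [measurable] = H g
  have "integrable M (\<lambda>\<omega>. G \<omega> * indicator H \<omega>)"
    by (rule integrable_bounded[where B="\<bar>B\<bar>"]) (use GB finite_measure_axioms in \<open>auto simp: indicator_def intro: order_trans[OF _ abs_ge_self]\<close>)
  then have "(\<integral>\<omega>. G \<omega> * indicator H \<omega> \<partial>M) = (\<integral>\<omega>. G \<omega> * real_cond_exp M F (indicator H) \<omega> \<partial>M)"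
    using S.real_cond_exp_intg(2)[OF _ G, of "indicator H"] by simp
  also have "\<dots> = (\<integral>\<omega>. G \<omega> * g \<omega> \<partial>M)"
    using ce by (intro integral_cong_AE) auto
  finally show ?thesis .
qed

locale reinforced_processes = prob_space M + spectral_data W lam U V \<iota>
  for M :: "'a measure" and W :: "real^'n::finite^'n" and lam :: "'n \<Rightarrow> complex" and U V :: "complex^'n^'n" and \<iota> :: 'n +
  fixes r a :: "nat \<Rightarrow> real" and X Z :: "nat \<Rightarrow> 'n \<Rightarrow> 'a \<Rightarrow> real" and Zinf :: "'a \<Rightarrow> real"
  assumes r_range: "\<And>n. 0 < r n \<and> r n < 1"
    and a_pos: "\<And>k. k \<ge> 1 \<Longrightarrow> a k > 0"
    and Z0_meas: "\<And>h. Z 0 h \<in> borel_measurable M"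
    and Z0_range: "\<And>h \<omega>. \<omega> \<in> space M \<Longrightarrow> Z 0 h \<omega> \<in> {0..1}"
    and X_meas: "\<And>n j. n \<ge> 1 \<Longrightarrow> X n j \<in> borel_measurable M"
    and X_range: "\<And>n j \<omega>. n \<ge> 1 \<Longrightarrow> \<omega> \<in> space M \<Longrightarrow> X n j \<omega> \<in> {0, 1}"
    and Z_rec: "\<And>n h \<omega>. n \<ge> 1 \<Longrightarrow> \<omega> \<in> space M \<Longrightarrow> Z n h \<omega> = (1 - r (n - 1)) * Z (n - 1) h \<omega> + r (n - 1) * X n h \<omega>"
    and X_indep: "\<And>n. cond_indep_vars M (hist_algebra M (Z 0) X n) borel (X (n + 1)) UNIV"
    and X_prob: "\<And>n j. AE \<omega> in M. real_cond_exp M (hist_algebra M (Z 0) X n) (indicator {\<omega> \<in> space M. X (n + 1) j \<omega> = 1}) \<omega>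
            = (\<Sum>h\<in>UNIV. W $ h $ j * Z n h \<omega>)"
    and Zinf_meas: "Zinf \<in> borel_measurable M"
    and Zinf_range: "\<And>\<omega>. \<omega> \<in> space M \<Longrightarrow> Zinf \<omega> \<in> {0..1}"
    and Zinf_lim: "AE \<omega> in M. \<forall>h. (\<lambda>n. Z n h \<omega>) \<longlonglongrightarrow> Zinf \<omega>"
begin

definition "\<F> n = hist_algebra M (Z 0) X n"
definition "gen n = {Z 0 h -` B \<inter> space M | h B. B \<in> sets borel} \<union> {X k j -` B \<inter> space M | k j B. 1 \<le> k \<and> k \<le> n \<and> B \<in> sets borel}"

lemma gen_Pow: "gen n \<subseteq> Pow (space M)"
  by (auto simp: gen_def)

lemma sets_\<F>: "sets (\<F> n) = sigma_sets (space M) (gen n)"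
  unfolding \<F>_def hist_algebra_def gen_def[symmetric] by (rule sets_measure_of[OF gen_Pow])

lemma space_\<F>: "space (\<F> n) = space M"
  unfolding \<F>_def hist_algebra_def by (simp add: space_measure_of_conv)

lemma subalgebra_\<F>: "subalgebra M (\<F> n)"
proof -
  have "gen n \<subseteq> sets M"
  proof
    fix A assume "A \<in> gen n"
    then consider h B where "A = Z 0 h -` B \<inter> space M" "B \<in> sets borel"
      | k j B where "A = X k j -` B \<inter> space M" "1 \<le> k" "B \<in> sets borel" unfolding gen_def by blast
    then show "A \<in> sets M" by cases (simp_all add: measurable_sets[OF Z0_meas] measurable_sets[OF X_meas])
  qed
  then show ?thesis unfolding subalgebra_def sets_\<F> space_\<F> by (simp add: sets.sigma_sets_subset)
qed

lemma mono_\<F>: "k \<le> m \<Longrightarrow> sets (\<F> k) \<subseteq> sets (\<F> m)"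
  unfolding sets_\<F> by (rule sigma_sets_mono') (unfold gen_def, use order_trans in blast)

lemma Z0_\<F>: "Z 0 h \<in> borel_measurable (\<F> n)"
proof (rule measurableI)
  fix B :: "real set" assume "B \<in> sets borel"
  then have "Z 0 h -` B \<inter> space M \<in> gen n" unfolding gen_def by blast
  then show "Z 0 h -` B \<inter> space (\<F> n) \<in> sets (\<F> n)"
    unfolding sets_\<F> space_\<F> by (rule sigma_sets.Basic)
qed simp

lemma X_\<F>:
  assumes "1 \<le> k" "k \<le> n" shows "X k j \<in> borel_measurable (\<F> n)"
proof (rule measurableI)
  fix B :: "real set" assume "B \<in> sets borel"
  then have "X k j -` B \<inter> space M \<in> gen n" unfolding gen_def using assms by blast
  then show "X k j -` B \<inter> space (\<F> n) \<in> sets (\<F> n)"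
    unfolding sets_\<F> space_\<F> by (rule sigma_sets.Basic)
qed simp

lemma Z_Suc: "\<omega> \<in> space M \<Longrightarrow> Z (Suc n) h \<omega> = (1 - r n) * Z n h \<omega> + r n * X (Suc n) h \<omega>"
  using Z_rec[of "Suc n"] by simp

lemma Z_\<F>: "k \<le> n \<Longrightarrow> Z k h \<in> borel_measurable (\<F> n)"
proof (induction k)
  case (Suc k)
  have "(\<lambda>\<omega>. (1 - r k) * Z k h \<omega> + r k * X (Suc k) h \<omega>) \<in> borel_measurable (\<F> n)"
  proof -
    have [measurable]: "Z k h \<in> borel_measurable (\<F> n)" "X (Suc k) h \<in> borel_measurable (\<F> n)"
      using Suc X_\<F>[of "Suc k" n h] by auto
    show ?thesis by measurable
  qed
  then show ?case by (rule measurable_cong[THEN iffD1, rotated]) (simp add: space_\<F> Z_Suc)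
qed (simp add: Z0_\<F>)

lemma Z_meas [measurable]: "Z n h \<in> borel_measurable M"
  by (rule measurable_from_subalg[OF subalgebra_\<F> Z_\<F>[OF order_refl]])

lemma Z_range: "\<omega> \<in> space M \<Longrightarrow> 0 \<le> Z n h \<omega> \<and> Z n h \<omega> \<le> 1"
proof (induction n)
  case (Suc n)
  have "0 \<le> X (Suc n) h \<omega>" "X (Suc n) h \<omega> \<le> 1" using X_range[of "Suc n" \<omega> h] Suc by auto
  moreover have "0 \<le> Z n h \<omega>" "Z n h \<omega> \<le> 1" using Suc by auto
  ultimately have "0 \<le> (1 - r n) * Z n h \<omega>" "(1 - r n) * Z n h \<omega> \<le> 1 - r n"
    "0 \<le> r n * X (Suc n) h \<omega>" "r n * X (Suc n) h \<omega> \<le> r n"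
    using r_range[of n] by (auto intro: mult_left_le)
  then show ?case using Suc by (simp add: Z_Suc)
qed (use Z0_range in auto)

definition "pr n j \<omega> = (\<Sum>h\<in>UNIV. W $ h $ j * Z n h \<omega>)"
definition "\<xi> n j \<omega> = X (Suc n) j \<omega> - pr n j \<omega>"
definition "\<Gamma> n j \<omega> = pr n j \<omega> * (1 - pr n j \<omega>)"
definition "v \<omega> = Zinf \<omega> * (1 - Zinf \<omega>)"

lemma pr_\<F>: "pr n j \<in> borel_measurable (\<F> n)"
  unfolding pr_def using Z_\<F>[of n n] by measurable

lemma pr_meas [measurable]: "pr n j \<in> borel_measurable M"
  by (rule measurable_from_subalg[where F="\<F> n"]) (rule subalgebra_\<F>, rule pr_\<F>)

lemma X_Suc_meas [measurable]: "X (Suc n) j \<in> borel_measurable M"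
  using X_meas[of "Suc n"] by simp

lemma pr_range: assumes "\<omega> \<in> space M" shows "0 \<le> pr n j \<omega> \<and> pr n j \<omega> \<le> 1"
proof -
  have "pr n j \<omega> \<le> (\<Sum>h\<in>UNIV. W $ h $ j * 1)"
    unfolding pr_def using W_nonneg Z_range[OF assms] by (intro sum_mono mult_left_mono) auto
  then show ?thesis using W_sum[of j] W_nonneg Z_range[OF assms] by (auto simp: pr_def intro!: sum_nonneg)
qed

lemma pr_lim: "AE \<omega> in M. (\<lambda>n. pr n j \<omega>) \<longlonglongrightarrow> Zinf \<omega>"
  using Zinf_lim
proof eventually_elim
  case (elim \<omega>)
  have "(\<lambda>n. \<Sum>h\<in>UNIV. W $ h $ j * Z n h \<omega>) \<longlonglongrightarrow> (\<Sum>h\<in>UNIV. W $ h $ j * Zinf \<omega>)"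
    using elim by (intro tendsto_intros) auto
  then show ?case using W_sum[of j] by (simp add: pr_def sum_distrib_right[symmetric])
qed

lemma X_indicator: "\<omega> \<in> space M \<Longrightarrow> X (Suc n) j \<omega> = indicator {\<omega> \<in> space M. X (Suc n) j \<omega> = 1} \<omega>"
  using X_range[of "Suc n" \<omega> j] by (auto simp: indicator_def)

lemma X_cond1:
  assumes "G \<in> borel_measurable (\<F> n)" "\<And>\<omega>. \<omega> \<in> space M \<Longrightarrow> \<bar>G \<omega>\<bar> \<le> B"
  shows "(\<integral>\<omega>. G \<omega> * X (Suc n) j \<omega> \<partial>M) = (\<integral>\<omega>. G \<omega> * pr n j \<omega> \<partial>M)"
proof -
  have "(\<integral>\<omega>. G \<omega> * X (Suc n) j \<omega> \<partial>M) = (\<integral>\<omega>. G \<omega> * indicator {\<omega> \<in> space M. X (Suc n) j \<omega> = 1} \<omega> \<partial>M)"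
    by (intro Bochner_Integration.integral_cong refl) (simp add: X_indicator[symmetric])
  also have "\<dots> = (\<integral>\<omega>. G \<omega> * pr n j \<omega> \<partial>M)"
    by (rule cond_prob_integral[OF prob_space_axioms subalgebra_\<F> assms]) (use X_prob[of n j] in \<open>auto simp: \<F>_def pr_def\<close>)
  finally show ?thesis .
qed

text \<open>A product of two indicators is the indicator of joint success, to which conditional
  independence is applied with both sets equal to \<open>{1}\<close>.\<close>

lemma X_cond2:
  assumes "G \<in> borel_measurable (\<F> n)" "\<And>\<omega>. \<omega> \<in> space M \<Longrightarrow> \<bar>G \<omega>\<bar> \<le> B" and ij: "i \<noteq> j"
  shows "(\<integral>\<omega>. G \<omega> * (X (Suc n) i \<omega> * X (Suc n) j \<omega>) \<partial>M) = (\<integral>\<omega>. G \<omega> * (pr n i \<omega> * pr n j \<omega>) \<partial>M)"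
proof -
  let ?H = "{\<omega> \<in> space M. \<forall>k\<in>{i, j}. X (n + 1) k \<omega> \<in> {1}}"
  have "AE \<omega> in M. real_cond_exp M (\<F> n) (indicator ?H) \<omega> = (\<Prod>k\<in>{i, j}. real_cond_exp M (\<F> n) (indicator {\<omega> \<in> space M. X (n + 1) k \<omega> \<in> {1}}) \<omega>)"
    using X_indep[of n, unfolded cond_indep_vars_def \<F>_def[symmetric]] by (elim conjE allE[of _ "{i, j}"] allE[of _ "\<lambda>_. {1}"]) auto
  then have ce: "AE \<omega> in M. real_cond_exp M (\<F> n) (indicator ?H) \<omega> = pr n i \<omega> * pr n j \<omega>"
    using X_prob[of n i] X_prob[of n j] by eventually_elim (use ij in \<open>simp add: \<F>_def pr_def\<close>)
  have "(\<integral>\<omega>. G \<omega> * (X (Suc n) i \<omega> * X (Suc n) j \<omega>) \<partial>M) = (\<integral>\<omega>. G \<omega> * indicator ?H \<omega> \<partial>M)"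
  proof (intro Bochner_Integration.integral_cong refl)
    fix \<omega> assume "\<omega> \<in> space M"
    then show "G \<omega> * (X (Suc n) i \<omega> * X (Suc n) j \<omega>) = G \<omega> * indicator ?H \<omega>"
      using X_range[of "Suc n" \<omega> i] X_range[of "Suc n" \<omega> j] by (auto simp: indicator_def)
  qed
  also have "\<dots> = (\<integral>\<omega>. G \<omega> * (pr n i \<omega> * pr n j \<omega>) \<partial>M)"
    by (rule cond_prob_integral[OF prob_space_axioms subalgebra_\<F> assms(1,2) _ _ ce]) auto
  finally show ?thesis .
qed

sublocale martingale_differences M \<F> \<xi> \<Gamma> v
proof
  show "subalgebra M (\<F> k)" for k by (rule subalgebra_\<F>)
  show "sets (\<F> k) \<subseteq> sets (\<F> m)" if "k \<le> m" for k m using that by (rule mono_\<F>)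
  show "\<xi> k j \<in> borel_measurable (\<F> (Suc k))" for k j
  proof -
    have "pr k j \<in> borel_measurable (\<F> (Suc k))"
      unfolding pr_def using Z_\<F>[of k "Suc k"] by measurable
    then show ?thesis unfolding \<xi>_def using X_\<F>[of "Suc k" "Suc k" j] by measurable
  qed
  show "\<bar>\<xi> k j \<omega>\<bar> \<le> 1" if "\<omega> \<in> space M" for k j \<omega>
    using pr_range[OF that, of k j] X_range[of "Suc k" \<omega> j] that by (auto simp: \<xi>_def)
  show "\<Gamma> k j \<in> borel_measurable (\<F> k)" for k j
    unfolding \<Gamma>_def using pr_\<F>[of k j] by measurable
  show "0 \<le> \<Gamma> k j \<omega> \<and> \<Gamma> k j \<omega> \<le> 1" if "\<omega> \<in> space M" for k j \<omega>
    using pr_range[OF that, of k j] by (auto simp: \<Gamma>_def intro: mult_le_one)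
  show "v \<in> borel_measurable M" unfolding v_def using Zinf_meas by measurable
  show "0 \<le> v \<omega> \<and> v \<omega> \<le> 1" if "\<omega> \<in> space M" for \<omega>
    using Zinf_range[OF that] by (auto simp: v_def intro: mult_le_one)
  show "AE \<omega> in M. (\<lambda>k. \<Gamma> k j \<omega>) \<longlonglongrightarrow> v \<omega>" for j
    using pr_lim[of j] by eventually_elim (auto simp: \<Gamma>_def v_def intro!: tendsto_intros)
  fix k i j B and G :: "'a \<Rightarrow> real"
  assume G: "G \<in> borel_measurable (\<F> k)" and B: "\<And>\<omega>. \<omega> \<in> space M \<Longrightarrow> \<bar>G \<omega>\<bar> \<le> B"
  have GM[measurable]: "G \<in> borel_measurable M" by (rule measurable_from_subalg[OF subalgebra_\<F> G])
  have int: "integrable M (\<lambda>\<omega>. G \<omega> * y \<omega>)" if [measurable]: "y \<in> borel_measurable M" and y: "\<And>\<omega>. \<omega> \<in> space M \<Longrightarrow> \<bar>y \<omega>\<bar> \<le> 1" for y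
  proof (rule integrable_bounded[OF finite_measure_axioms, where B=B])
    fix \<omega> assume w: "\<omega> \<in> space M"
    have "\<bar>G \<omega>\<bar> * \<bar>y \<omega>\<bar> \<le> \<bar>G \<omega>\<bar> * 1" using y[OF w] by (intro mult_left_mono) auto
    then show "norm (G \<omega> * y \<omega>) \<le> B" using B[OF w] by (simp add: abs_mult)
  qed measurable
  have X1: "\<bar>X (Suc k) i \<omega>\<bar> \<le> 1" if "\<omega> \<in> space M" for \<omega> i using X_range[of "Suc k" \<omega> i] that by auto
  have p1: "\<bar>pr k i \<omega>\<bar> \<le> 1" if "\<omega> \<in> space M" for \<omega> i using pr_range[OF that, of k i] by auto
  have m1: "\<bar>x * y\<bar> \<le> 1" if "\<bar>x\<bar> \<le> 1" "\<bar>y\<bar> \<le> 1" for x y :: real using that by (simp add: abs_mult mult_le_one)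
  show "(\<integral>\<omega>. G \<omega> * \<xi> k j \<omega> \<partial>M) = 0"
    unfolding \<xi>_def right_diff_distrib using X_cond1[OF G B, of j]
    by (subst Bochner_Integration.integral_diff) (auto intro!: int X1 p1)
  \<comment> \<open>The products \<open>G \<omega> * pr k i \<omega>\<close> are again bounded
    functions of the past, so the cross terms reduce to the first-order identity
    \<open>X_cond1\<close>.\<close>
  have pG: "(\<lambda>\<omega>. G \<omega> * pr k i \<omega>) \<in> borel_measurable (\<F> k)" for i using G pr_\<F>[of k i] by measurable
  have pB: "\<bar>G \<omega> * pr k i \<omega>\<bar> \<le> B" if "\<omega> \<in> space M" for \<omega> i
    using B[OF that] mult_left_mono[OF p1[OF that, of i], of "\<bar>G \<omega>\<bar>"] by (simp add: abs_mult)
  have i2: "integrable M (\<lambda>\<omega>. G \<omega> * (X (Suc k) i \<omega> * X (Suc k) j \<omega>))"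
    and ip12: "integrable M (\<lambda>\<omega>. G \<omega> * (pr k i \<omega> * X (Suc k) j \<omega>))"
    and ip21: "integrable M (\<lambda>\<omega>. G \<omega> * (pr k j \<omega> * X (Suc k) i \<omega>))"
    and ipp: "integrable M (\<lambda>\<omega>. G \<omega> * (pr k i \<omega> * pr k j \<omega>))"
    by (rule int, measurable, rule m1, (rule X1 p1, assumption)+)+
  have "(\<integral>\<omega>. G \<omega> * (\<xi> k i \<omega> * \<xi> k j \<omega>) \<partial>M) = (\<integral>\<omega>. G \<omega> * (X (Suc k) i \<omega> * X (Suc k) j \<omega>) - G \<omega> * (pr k i \<omega> * X (Suc k) j \<omega>)
     - G \<omega> * (pr k j \<omega> * X (Suc k) i \<omega>) + G \<omega> * (pr k i \<omega> * pr k j \<omega>) \<partial>M)"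
    by (simp add: \<xi>_def algebra_simps)
  also have "\<dots> = (\<integral>\<omega>. G \<omega> * (X (Suc k) i \<omega> * X (Suc k) j \<omega>) \<partial>M) - (\<integral>\<omega>. G \<omega> * (pr k i \<omega> * X (Suc k) j \<omega>) \<partial>M)
     - (\<integral>\<omega>. G \<omega> * (pr k j \<omega> * X (Suc k) i \<omega>) \<partial>M) + (\<integral>\<omega>. G \<omega> * (pr k i \<omega> * pr k j \<omega>) \<partial>M)"
    using i2 ip12 ip21 ipp by simp
  also have "(\<integral>\<omega>. G \<omega> * (pr k i \<omega> * X (Suc k) j \<omega>) \<partial>M) = (\<integral>\<omega>. G \<omega> * (pr k i \<omega> * pr k j \<omega>) \<partial>M)"
    using X_cond1[OF pG pB, of i j] by (simp add: mult.assoc)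
  also have "(\<integral>\<omega>. G \<omega> * (pr k j \<omega> * X (Suc k) i \<omega>) \<partial>M) = (\<integral>\<omega>. G \<omega> * (pr k i \<omega> * pr k j \<omega>) \<partial>M)"
    using X_cond1[OF pG pB, of j i] by (simp add: mult.assoc mult.left_commute mult.commute)
  finally have eq: "(\<integral>\<omega>. G \<omega> * (\<xi> k i \<omega> * \<xi> k j \<omega>) \<partial>M) = (\<integral>\<omega>. G \<omega> * (X (Suc k) i \<omega> * X (Suc k) j \<omega>) \<partial>M) - (\<integral>\<omega>. G \<omega> * (pr k i \<omega> * pr k j \<omega>) \<partial>M)" by simp
  show "(\<integral>\<omega>. G \<omega> * (\<xi> k i \<omega> * \<xi> k j \<omega>) \<partial>M) = (if i = j then \<integral>\<omega>. G \<omega> * \<Gamma> k j \<omega> \<partial>M else 0)"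
  proof (cases "i = j")
    case True
    \<comment> \<open>A variable with values 0 and 1 equals its square, so the conditional variance
      comes out as \<open>pr k j \<omega> * (1 - pr k j \<omega>)\<close>.\<close>
    have "(\<integral>\<omega>. G \<omega> * (X (Suc k) j \<omega> * X (Suc k) j \<omega>) \<partial>M) = (\<integral>\<omega>. G \<omega> * X (Suc k) j \<omega> \<partial>M)"
    proof (intro Bochner_Integration.integral_cong refl)
      fix \<omega> assume "\<omega> \<in> space M"
      then show "G \<omega> * (X (Suc k) j \<omega> * X (Suc k) j \<omega>) = G \<omega> * X (Suc k) j \<omega>" using X_range[of "Suc k" \<omega> j] by auto
    qed
    also have "\<dots> = (\<integral>\<omega>. G \<omega> * pr k j \<omega> \<partial>M)" by (rule X_cond1[OF G B])
    also have "\<dots> - (\<integral>\<omega>. G \<omega> * (pr k j \<omega> * pr k j \<omega>) \<partial>M) = (\<integral>\<omega>. G \<omega> * \<Gamma> k j \<omega> \<partial>M)"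
      by (subst Bochner_Integration.integral_diff[symmetric]) (auto intro!: int p1 m1 simp: \<Gamma>_def algebra_simps)
    finally show ?thesis using eq True by simp
  next
    case False
    then show ?thesis using eq X_cond2[OF G B False] by simp
  qed
qed

end

section \<open>Expansion in the martingale differences\<close>

text \<open>Propagation of a value \<open>x\<close> present at time \<open>k\<close>. Freezing it at
  earlier times keeps the function total and linear in \<open>x\<close> for every
  \<open>n\<close>.\<close>

primrec resp :: "(nat \<Rightarrow> 'v \<Rightarrow> 'v) \<Rightarrow> nat \<Rightarrow> 'v \<Rightarrow> nat \<Rightarrow> 'v" where
  "resp A k x 0 = x"
| "resp A k x (Suc n) = (if n < k then x else A n (resp A k x n))"

lemma resp_start: "n \<le> k \<Longrightarrow> resp A k x n = x"
  by (induction n) auto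

lemma linear_resp: "(\<And>n. linear (A n)) \<Longrightarrow> linear (\<lambda>x. resp A k x n)"
proof (induction n)
  case (Suc n)
  then have "linear (\<lambda>x. A n (resp A k x n))"
    using linear_compose[of "\<lambda>x. resp A k x n" "A n"] by (simp add: comp_def)
  then show ?case by (cases "n < k") (simp_all add: linear_id[unfolded id_def])
qed (simp add: linear_id[unfolded id_def])

text \<open>Variation of constants: the input \<open>G k\<close> first shows at time
  \<open>k + 1\<close>, hence the start at \<open>Suc k\<close>.\<close>

lemma resp_expansion:
  fixes A :: "nat \<Rightarrow> 'v::real_vector \<Rightarrow> 'v"
  assumes "\<And>n. linear (A n)" "\<And>n. D (Suc n) = A n (D n) + G n"
  shows "D n = resp A 0 (D 0) n + (\<Sum>k<n. resp A (Suc k) (G k) n)"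
proof (induction n)
  case (Suc n)
  have "D (Suc n) = A n (resp A 0 (D 0) n + (\<Sum>k<n. resp A (Suc k) (G k) n)) + G n"
    using assms(2) Suc by simp
  also have "\<dots> = A n (resp A 0 (D 0) n) + (\<Sum>k<n. A n (resp A (Suc k) (G k) n)) + G n"
    by (simp add: linear_add[OF assms(1)] linear_sum[OF assms(1)])
  finally show ?case by (simp add: resp_start)
qed simp

context reinforced_processes
begin

text \<open>The index is shifted so that \<open>s n\<close> drives the step from \<open>n\<close> to
  \<open>n + 1\<close>, as \<open>r n\<close> does.\<close>

definition "s n = wgt a (Suc n) (Suc n)"

definition step :: "nat \<Rightarrow> (real^'n) \<times> (real^'n) \<Rightarrow> (real^'n) \<times> (real^'n)" where
  "step n y = (fst y + r n *\<^sub>R (transpose W *v fst y - fst y), (1 - s n) *\<^sub>R snd y + s n *\<^sub>R (transpose W *v fst y))"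

text \<open>A unit difference at vertex \<open>l\<close> moves \<open>Z\<close> by
  \<open>r n\<close> and the weighted mean by \<open>s n\<close> there, and the common martingale by
  \<open>r n * vr $ l\<close>; the latter is subtracted from both blocks.\<close>

definition impulse :: "nat \<Rightarrow> 'n \<Rightarrow> (real^'n) \<times> (real^'n)" where
  "impulse n l = (r n *\<^sub>R (axis l 1 - vr $ l *\<^sub>R 1), s n *\<^sub>R axis l 1 - (r n * vr $ l) *\<^sub>R 1)"

definition "zt n \<omega> = (\<Sum>h\<in>UNIV. vr $ h * Z n h \<omega>)"

definition D :: "nat \<Rightarrow> 'a \<Rightarrow> (real^'n) \<times> (real^'n)" where
  "D n \<omega> = (\<chi> h. Z n h \<omega> - zt n \<omega>, \<chi> h. wgt_mean a X n h \<omega> - zt n \<omega>)"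

definition "d k l n = resp step (Suc k) (impulse k l) n"

lemma linear_step: "linear (step n)"
  by (intro linearI) (simp_all add: step_def matrix_vector_right_distrib matrix_vector_mult_scaleR scaleR_add_right scaleR_diff_right algebra_simps)

text \<open>Passing from \<open>n\<close> to \<open>n + 1\<close> changes the old weights through
  the normalising sum only, so all of them are multiplied by the same factor
  \<open>1 - s n\<close>.\<close>

lemma wgt_mean_Suc: "wgt_mean a X (Suc n) h \<omega> = (1 - s n) * wgt_mean a X n h \<omega> + s n * X (Suc n) h \<omega>"
proof -
  have pos: "0 < (\<Sum>l=1..Suc n. a l)" using a_pos by (intro sum_pos) auto
  have w: "wgt a (Suc n) k = (1 - s n) * wgt a n k" if "k \<in> {1..n}" for k
  proof -
    have n: "0 < (\<Sum>l=1..n. a l)" using a_pos that by (intro sum_pos) auto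
    have "1 - s n = (\<Sum>l=1..n. a l) / (\<Sum>l=1..Suc n. a l)" using pos by (simp add: s_def wgt_def field_simps)
    then show ?thesis using n by (simp add: wgt_def)
  qed
  have "wgt_mean a X (Suc n) h \<omega> = (\<Sum>k=1..n. wgt a (Suc n) k * X k h \<omega>) + s n * X (Suc n) h \<omega>"
    by (simp add: wgt_mean_def s_def)
  also have "(\<Sum>k=1..n. wgt a (Suc n) k * X k h \<omega>) = (1 - s n) * wgt_mean a X n h \<omega>"
    unfolding wgt_mean_def sum_distrib_left by (intro sum.cong refl) (simp add: w)
  finally show ?thesis .
qed

lemma zt_Suc:
  assumes "\<omega> \<in> space M"
  shows "zt (Suc n) \<omega> = zt n \<omega> + r n * (\<Sum>l\<in>UNIV. vr $ l * \<xi> n l \<omega>)"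
proof -
  \<comment> \<open>\<open>vr\<close> being a right eigenvector for the eigenvalue 1 is what makes
    the drift of \<open>zt\<close> vanish.\<close>
  have p: "(\<Sum>l\<in>UNIV. vr $ l * pr n l \<omega>) = zt n \<omega>"
  proof -
    have "(\<Sum>l\<in>UNIV. vr $ l * pr n l \<omega>) = (\<Sum>h\<in>UNIV. (\<Sum>l\<in>UNIV. W $ h $ l * vr $ l) * Z n h \<omega>)"
      unfolding pr_def sum_distrib_left sum_distrib_right by (subst sum.swap) (simp add: mult_ac)
    then show ?thesis by (simp add: W_vr zt_def)
  qed
  have "zt (Suc n) \<omega> = (1 - r n) * zt n \<omega> + r n * (\<Sum>l\<in>UNIV. vr $ l * X (Suc n) l \<omega>)"
    unfolding zt_def Z_Suc[OF assms] sum_distrib_left sum.distrib[symmetric] by (intro sum.cong refl) (simp add: algebra_simps)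
  also have "(\<Sum>l\<in>UNIV. vr $ l * X (Suc n) l \<omega>) = (\<Sum>l\<in>UNIV. vr $ l * \<xi> n l \<omega>) + zt n \<omega>"
    unfolding p[symmetric] sum.distrib[symmetric] by (intro sum.cong refl) (simp add: \<xi>_def algebra_simps)
  finally show ?thesis by (simp add: algebra_simps)
qed

lemma D_Suc:
  assumes w: "\<omega> \<in> space M"
  shows "D (Suc n) \<omega> = step n (D n \<omega>) + (\<Sum>l\<in>UNIV. \<xi> n l \<omega> *\<^sub>R impulse n l)"
proof -
  have WZ: "(transpose W *v (\<chi> h. Z n h \<omega> - zt n \<omega>)) $ h = pr n h \<omega> - zt n \<omega>" for h
    using W_sum[of h] by (simp add: matrix_vector_mult_def transpose_def pr_def right_diff_distrib sum_subtractf sum_distrib_right[symmetric])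
  let ?v = "\<Sum>l\<in>UNIV. vr $ l * \<xi> n l \<omega>"
  have e1: "\<xi> n l \<omega> * fst (impulse n l) $ h = (if h = l then r n * \<xi> n h \<omega> else 0) - r n * (vr $ l * \<xi> n l \<omega>)"
    and e2: "\<xi> n l \<omega> * snd (impulse n l) $ h = (if h = l then s n * \<xi> n h \<omega> else 0) - r n * (vr $ l * \<xi> n l \<omega>)" for l h
    by (auto simp: impulse_def axis_def algebra_simps)
  have i1: "fst (\<Sum>l\<in>UNIV. \<xi> n l \<omega> *\<^sub>R impulse n l) $ h = r n * (\<xi> n h \<omega> - ?v)"
    and i2: "snd (\<Sum>l\<in>UNIV. \<xi> n l \<omega> *\<^sub>R impulse n l) $ h = s n * \<xi> n h \<omega> - r n * ?v" for h
    by (simp_all add: fst_sum snd_sum e1 e2 sum_subtractf sum_distrib_left[symmetric] right_diff_distrib)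
  have "fst (D (Suc n) \<omega>) $ h = fst (step n (D n \<omega>) + (\<Sum>l\<in>UNIV. \<xi> n l \<omega> *\<^sub>R impulse n l)) $ h" for h
    by (simp add: D_def step_def WZ i1 Z_Suc[OF w] zt_Suc[OF w] \<xi>_def[of n h] algebra_simps del: transpose_matrix_vector)
  moreover have "snd (D (Suc n) \<omega>) $ h = snd (step n (D n \<omega>) + (\<Sum>l\<in>UNIV. \<xi> n l \<omega> *\<^sub>R impulse n l)) $ h" for h
    by (simp add: D_def step_def WZ i2 wgt_mean_Suc zt_Suc[OF w] \<xi>_def[of n h] algebra_simps del: transpose_matrix_vector)
  ultimately show ?thesis by (simp add: prod_eq_iff vec_eq_iff)
qed

lemma D_expansion:
  assumes w: "\<omega> \<in> space M"
  shows "D n \<omega> = resp step 0 (D 0 \<omega>) n + (\<Sum>k<n. \<Sum>l\<in>UNIV. \<xi> k l \<omega> *\<^sub>R d k l n)"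
proof -
  have "D n \<omega> = resp step 0 (D 0 \<omega>) n + (\<Sum>k<n. resp step (Suc k) (\<Sum>l\<in>UNIV. \<xi> k l \<omega> *\<^sub>R impulse k l) n)"
    by (rule resp_expansion[where D="\<lambda>n. D n \<omega>" and G="\<lambda>n. \<Sum>l\<in>UNIV. \<xi> n l \<omega> *\<^sub>R impulse n l"]) (rule linear_step, rule D_Suc[OF w])
  also have "(\<lambda>k. resp step (Suc k) (\<Sum>l\<in>UNIV. \<xi> k l \<omega> *\<^sub>R impulse k l) n) = (\<lambda>k. \<Sum>l\<in>UNIV. \<xi> k l \<omega> *\<^sub>R d k l n)"
  proof
    fix k
    have L: "linear (\<lambda>x. resp step (Suc k) x n)" by (rule linear_resp[OF linear_step])
    show "resp step (Suc k) (\<Sum>l\<in>UNIV. \<xi> k l \<omega> *\<^sub>R impulse k l) n = (\<Sum>l\<in>UNIV. \<xi> k l \<omega> *\<^sub>R d k l n)"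
      unfolding linear_sum[OF L] linear_scale[OF L] d_def ..
  qed
  finally show ?thesis .
qed

text \<open>Coordinates along the columns of \<open>U\<close>; the columns of \<open>V\<close> form
  the dual basis, which is why \<open>V\<close> appears here and \<open>U\<close> in
  \<open>ec_inverse\<close>.\<close>

definition ec :: "'n \<Rightarrow> real^'n \<Rightarrow> complex" where "ec i x = (\<Sum>h\<in>UNIV. V $ h $ i * of_real (x $ h))"

lemma ec_add: "ec i (x + y) = ec i x + ec i y" and ec_diff: "ec i (x - y) = ec i x - ec i y"
  and ec_scale: "ec i (c *\<^sub>R x) = of_real c * ec i x"
  by (simp_all add: ec_def distrib_left right_diff_distrib sum.distrib sum_subtractf sum_distrib_left mult.left_commute)

lemma ec_W: "ec i (transpose W *v x) = lam i * ec i x"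
proof -
  have "ec i (transpose W *v x) = (\<Sum>h\<in>UNIV. (\<Sum>l\<in>UNIV. W $ h $ l * V $ l $ i) * of_real (x $ h))"
    unfolding ec_def vec_nth_matrix_vector_mult of_real_sum sum_distrib_left sum_distrib_right
    by (subst sum.swap) (simp add: transpose_def mult_ac)
  then show ?thesis unfolding right_eigenvector ec_def by (simp add: sum_distrib_left mult_ac)
qed

lemma ec_axis: "ec i (axis l 1) = V $ l $ i"
  by (simp add: ec_def axis_def if_distrib cong: if_cong)

lemma ec_one: "ec i 1 = (if i = \<iota> then complex_of_real (sqrt (real CARD('n))) else 0)"
  using sum_V[of i] by (simp add: ec_def)

lemma ec_inverse: "complex_of_real (x $ h) = (\<Sum>i\<in>UNIV. U $ h $ i * ec i x)"
proof -
  have "(\<Sum>i\<in>UNIV. U $ h $ i * ec i x) = (\<Sum>l\<in>UNIV. (\<Sum>i\<in>UNIV. V $ l $ i * U $ h $ i) * of_real (x $ l))"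
    unfolding ec_def sum_distrib_left sum_distrib_right by (subst sum.swap) (simp add: mult_ac)
  also have "\<dots> = of_real (x $ h)" unfolding sum_VU by (simp add: if_distrib[of "\<lambda>x. x * _"] cong: if_cong)
  finally show ?thesis ..
qed

definition "\<alpha> i = 1 - lam i"
definition "Zc i k l n = ec i (fst (d k l n))"
definition "Nc i k l n = ec i (snd (d k l n))"

lemma ec_step:
  "ec i (fst (step n y)) = (1 - r n * \<alpha> i) * ec i (fst y)"
  "ec i (snd (step n y)) = (1 - s n) * ec i (snd y) + s n * (1 - \<alpha> i) * ec i (fst y)"
  by (simp_all add: step_def ec_add ec_diff ec_scale ec_W \<alpha>_def algebra_simps del: transpose_matrix_vector)

lemma d_Suc: "k < n \<Longrightarrow> d k l (Suc n) = step n (d k l n)" and d_new: "d n l (Suc n) = impulse n l"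
  by (simp_all add: d_def resp_start)

sublocale eigen_filter r s \<alpha> \<iota> V Zc Nc
proof
  fix i l and k n :: nat
  assume "k < n"
  then show "Zc i k l (Suc n) = (1 - r n * \<alpha> i) * Zc i k l n" "Nc i k l (Suc n) = (1 - s n) * Nc i k l n + s n * (1 - \<alpha> i) * Zc i k l n"
    by (simp_all add: Zc_def Nc_def d_Suc ec_step)
next
  fix i l and n :: nat
  \<comment> \<open>Subtracting a multiple of the constant vector removes the \<iota>-coordinate and
    leaves the others untouched, since the constant vector has no component there.\<close>
  show "Zc i n l (Suc n) = (if i = \<iota> then 0 else r n * V $ l $ i)"
    by (simp add: Zc_def d_new impulse_def ec_diff ec_scale ec_axis ec_one V_\<iota>)
  show "Nc i n l (Suc n) = (s n - (if i = \<iota> then r n else 0)) * V $ l $ i"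
    by (simp add: Nc_def d_new impulse_def ec_diff ec_scale ec_axis ec_one V_\<iota> algebra_simps)
qed

definition ds :: "nat \<Rightarrow> 'n \<Rightarrow> nat \<Rightarrow> real^('n + 'n)" where "ds k l n = stack (fst (d k l n)) (snd (d k l n))"

text \<open>The covariance that the differences up to time \<open>n\<close> would produce if they
  all had unit variance; the true variance enters later as the factor \<open>v\<close>.\<close>

definition Cn :: "nat \<Rightarrow> real^('n + 'n)^('n + 'n)" where
  "Cn n = (\<chi> i j. \<Sum>k<n. \<Sum>l\<in>UNIV. ds k l n $ i * ds k l n $ j)"

lemma sum_sum_swap4:
  fixes u :: "'n \<Rightarrow> complex" and w :: "'n \<Rightarrow> complex" and f g :: "'n \<Rightarrow> nat \<Rightarrow> 'n \<Rightarrow> complex"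
  shows "(\<Sum>k<n. \<Sum>l\<in>UNIV. (\<Sum>i\<in>UNIV. u i * f i k l) * (\<Sum>j\<in>UNIV. w j * g j k l))
    = (\<Sum>i\<in>UNIV. \<Sum>j\<in>UNIV. u i * w j * (\<Sum>k<n. \<Sum>l\<in>UNIV. f i k l * g j k l))"
proof -
  have "(\<Sum>k<n. \<Sum>l\<in>UNIV. (\<Sum>i\<in>UNIV. u i * f i k l) * (\<Sum>j\<in>UNIV. w j * g j k l))
    = (\<Sum>k<n. \<Sum>l\<in>UNIV. \<Sum>i\<in>UNIV. \<Sum>j\<in>UNIV. u i * w j * (f i k l * g j k l))"
    by (simp add: sum_product mult_ac)
  also have "\<dots> = (\<Sum>k<n. \<Sum>i\<in>UNIV. \<Sum>l\<in>UNIV. \<Sum>j\<in>UNIV. u i * w j * (f i k l * g j k l))"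
    by (intro sum.cong refl sum.swap)
  also have "\<dots> = (\<Sum>i\<in>UNIV. \<Sum>k<n. \<Sum>l\<in>UNIV. \<Sum>j\<in>UNIV. u i * w j * (f i k l * g j k l))"
    by (rule sum.swap)
  also have "\<dots> = (\<Sum>i\<in>UNIV. \<Sum>k<n. \<Sum>j\<in>UNIV. \<Sum>l\<in>UNIV. u i * w j * (f i k l * g j k l))"
    by (intro sum.cong refl sum.swap)
  also have "\<dots> = (\<Sum>i\<in>UNIV. \<Sum>j\<in>UNIV. \<Sum>k<n. \<Sum>l\<in>UNIV. u i * w j * (f i k l * g j k l))"
    by (intro sum.cong refl sum.swap)
  finally show ?thesis by (simp add: sum_distrib_left)
qed

lemma Cn_blocks:
  "complex_of_real (Cn n $ Inl h $ Inl h') = (\<Sum>i\<in>UNIV. \<Sum>j\<in>UNIV. U $ h $ i * U $ h' $ j * cov (Zc i) (Zc j) n)"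
  "complex_of_real (Cn n $ Inl h $ Inr h') = (\<Sum>i\<in>UNIV. \<Sum>j\<in>UNIV. U $ h $ i * U $ h' $ j * cov (Zc i) (Nc j) n)"
  "complex_of_real (Cn n $ Inr h $ Inl h') = (\<Sum>i\<in>UNIV. \<Sum>j\<in>UNIV. U $ h $ i * U $ h' $ j * cov (Nc i) (Zc j) n)"
  "complex_of_real (Cn n $ Inr h $ Inr h') = (\<Sum>i\<in>UNIV. \<Sum>j\<in>UNIV. U $ h $ i * U $ h' $ j * cov (Nc i) (Nc j) n)"
  by (simp_all add: Cn_def ds_def stack_def ec_inverse cov_def Zc_def[symmetric] Nc_def[symmetric] sum_sum_swap4[of _ "\<lambda>i k l. _ i k l n" _ "\<lambda>i k l. _ i k l n"])

lemma block_entry: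
  "(U ** S ** transpose U) $ h $ h' = (\<Sum>i\<in>UNIV. \<Sum>j\<in>UNIV. U $ h $ i * U $ h' $ j * S $ i $ j)"
  unfolding matrix_matrix_mult_nth sum_distrib_right by (subst sum.swap) (simp add: transpose_def mult_ac)

lemma norm_U_le_1: "norm (U $ h $ i) \<le> 1"
proof -
  have "norm (column i U $ h) \<le> norm (column i U)" by (rule Finite_Cartesian_Product.norm_nth_le)
  then show ?thesis using U_norm[of i] by (simp add: column_def)
qed

lemma ds_bound:
  assumes "\<And>i. norm (Zc i k l n) \<le> e" "\<And>i. norm (Nc i k l n) \<le> e"
  shows "\<bar>ds k l n $ x\<bar> \<le> real CARD('n) * e"
proof -
  have *: "\<bar>y $ h\<bar> \<le> real CARD('n) * e" if "\<And>i. norm (ec i y) \<le> e" for y h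
  proof -
    have "\<bar>y $ h\<bar> = norm (\<Sum>i\<in>UNIV. U $ h $ i * ec i y)" unfolding ec_inverse[symmetric] by simp
    also have "\<dots> \<le> (\<Sum>i\<in>(UNIV::'n set). e)"
      by (intro sum_norm_le norm_mult_le_right norm_U_le_1 that)
    finally show ?thesis by simp
  qed
  show ?thesis
    using assms *[of "fst (d k l n)"] *[of "snd (d k l n)"] by (cases x) (auto simp: ds_def stack_def Zc_def Nc_def)
qed

lemma ds_small:
  assumes "eigen_filter_limit r s \<alpha> \<iota> V Zc Nc \<gamma> \<nu> c q p A B C" and \<epsilon>: "\<epsilon> > 0"
  shows "\<forall>\<^sub>F n in sequentially. \<forall>k<n. \<forall>l x. real n powr (p / 2) * \<bar>ds k l n $ x\<bar> \<le> \<epsilon>"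
proof -
  interpret L: eigen_filter_limit r s \<alpha> \<iota> V Zc Nc \<gamma> \<nu> c q p A B C by fact
  define e where "e = \<epsilon> / real CARD('n)"
  have e: "e > 0" "real CARD('n) * e = \<epsilon>" using \<epsilon> by (simp_all add: e_def)
  have "\<forall>\<^sub>F n in sequentially. \<forall>l\<in>UNIV. \<forall>i\<in>UNIV. (\<forall>k<n. real n powr (p / 2) * norm (Zc i k l n) \<le> e) \<and> (\<forall>k<n. real n powr (p / 2) * norm (Nc i k l n) \<le> e)"
    by (intro eventually_ball_finite ballI finite_class.finite_UNIV eventually_conj L.Zc_Nc_small e(1))
  then show ?thesis using eventually_gt_at_top[of 0]
  proof eventually_elim
    case (elim n)
    show ?case
    proof (intro allI impI)
      fix k l x assume k: "k < n"
      have u: "real n powr (p / 2) > 0" using elim by simp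
      have "\<bar>ds k l n $ x\<bar> \<le> real CARD('n) * (e / real n powr (p / 2))"
        using elim(1) k u by (intro ds_bound) (auto simp: pos_le_divide_eq mult.commute)
      then show "real n powr (p / 2) * \<bar>ds k l n $ x\<bar> \<le> \<epsilon>"
        using u e by (simp add: pos_le_divide_eq mult.commute)
    qed
  qed
qed

lemma ec_D0: "ec \<iota> (fst (D 0 \<omega>)) = 0"
proof -
  have "ec \<iota> (fst (D 0 \<omega>)) = (\<Sum>h\<in>UNIV. V $ h $ \<iota> * of_real (Z 0 h \<omega>)) - zt 0 \<omega> * (\<Sum>h\<in>UNIV. V $ h $ \<iota>)"
    by (simp add: ec_def D_def right_diff_distrib sum_subtractf sum_distrib_left mult.commute)
  also have "\<dots> = 0" unfolding sum_V by (simp add: V_\<iota> zt_def sum_distrib_left mult_ac)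
  finally show ?thesis .
qed

text \<open>The initial value evolves without innovations, and centring by \<open>zt\<close> removes
  its \<iota>-coordinate, so its coordinates form trajectories in the sense of
  \<open>traj\<close>.\<close>

lemma initial_negligible:
  assumes "eigen_filter_limit r s \<alpha> \<iota> V Zc Nc \<gamma> \<nu> c q p A B C"
  shows "(\<lambda>n. real n powr (p / 2) * (t \<bullet> stack (fst (resp step 0 (D 0 \<omega>) n)) (snd (resp step 0 (D 0 \<omega>) n)))) \<longlonglongrightarrow> 0"
proof -
  interpret L: eigen_filter_limit r s \<alpha> \<iota> V Zc Nc \<gamma> \<nu> c q p A B C by fact
  let ?y = "\<lambda>n. resp step 0 (D 0 \<omega>) n"
  have iota: "ec \<iota> (fst (?y n)) = 0" for n
    by (induction n) (simp_all add: ec_D0 ec_step)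
  have "L.traj i 0 (\<lambda>n. ec i (fst (?y n))) (\<lambda>n. ec i (snd (?y n)))" for i
    unfolding L.traj_def using iota by (auto simp: ec_step)
  note tr = L.traj_tendsto_zero[OF this]
  have c: "(\<lambda>n. real n powr (p / 2) * y n $ h) \<longlonglongrightarrow> 0" if "\<And>i. (\<lambda>n. complex_of_real (real n powr (p / 2)) * ec i (y n)) \<longlonglongrightarrow> 0" for y :: "nat \<Rightarrow> real^'n" and h
  proof -
    have "(\<lambda>n. \<Sum>i\<in>UNIV. U $ h $ i * (complex_of_real (real n powr (p / 2)) * ec i (y n))) \<longlonglongrightarrow> (\<Sum>i\<in>UNIV. U $ h $ i * 0)"
      by (intro tendsto_intros that)
    moreover have "(\<Sum>i\<in>UNIV. U $ h $ i * (complex_of_real (real n powr (p / 2)) * ec i (y n))) = complex_of_real (real n powr (p / 2) * y n $ h)" for n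
      by (simp add: ec_inverse sum_distrib_left mult.left_commute)
    ultimately have "(\<lambda>n. complex_of_real (real n powr (p / 2) * y n $ h)) \<longlonglongrightarrow> complex_of_real 0" by simp
    then show ?thesis by (simp only: tendsto_of_real_iff)
  qed
  have comp: "(\<lambda>n. real n powr (p / 2) * stack (fst (?y n)) (snd (?y n)) $ x) \<longlonglongrightarrow> 0" for x
    by (cases x) (auto simp: stack_def intro!: c tr)
  have "(\<lambda>n. \<Sum>x\<in>UNIV. t $ x * (real n powr (p / 2) * stack (fst (?y n)) (snd (?y n)) $ x)) \<longlonglongrightarrow> (\<Sum>x\<in>UNIV. t $ x * 0)"
    by (intro tendsto_intros comp)
  then show ?thesis by (simp add: inner_vec_def sum_distrib_left mult.left_commute)
qed

lemma zt_meas [measurable]: "zt n \<in> borel_measurable M"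
  unfolding zt_def by measurable

lemma zt_bound: "\<omega> \<in> space M \<Longrightarrow> \<bar>zt n \<omega>\<bar> \<le> (\<Sum>h\<in>UNIV. \<bar>vr $ h\<bar>)"
  unfolding zt_def using Z_range by (intro order_trans[OF sum_abs] sum_mono) (auto simp: abs_mult intro!: mult_left_le)

lemma zt_L1: "(\<lambda>n. expectation (\<lambda>\<omega>. \<bar>zt n \<omega> - Zinf \<omega>\<bar>)) \<longlonglongrightarrow> 0"
proof -
  note [measurable] = Zinf_meas
  have "(\<lambda>n. expectation (\<lambda>\<omega>. \<bar>zt n \<omega> - Zinf \<omega>\<bar>)) \<longlonglongrightarrow> expectation (\<lambda>\<omega>. 0)"
  proof (rule integral_dominated_convergence[where w="\<lambda>_. (\<Sum>h\<in>UNIV. \<bar>vr $ h\<bar>) + 1"])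
    show "AE \<omega> in M. (\<lambda>n. \<bar>zt n \<omega> - Zinf \<omega>\<bar>) \<longlonglongrightarrow> 0"
      using Zinf_lim
    proof eventually_elim
      case (elim \<omega>)
      have "(\<lambda>n. zt n \<omega>) \<longlonglongrightarrow> (\<Sum>h\<in>UNIV. vr $ h * Zinf \<omega>)"
        unfolding zt_def using elim by (intro tendsto_intros) auto
      then have "(\<lambda>n. zt n \<omega>) \<longlonglongrightarrow> Zinf \<omega>" by (simp add: sum_distrib_right[symmetric] sum_vr)
      then show ?case by (intro tendsto_rabs_zero LIM_zero)
    qed
    show "AE \<omega> in M. norm \<bar>zt n \<omega> - Zinf \<omega>\<bar> \<le> (\<Sum>h\<in>UNIV. \<bar>vr $ h\<bar>) + 1" for n
    proof (rule AE_I2)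
      fix \<omega> assume "\<omega> \<in> space M"
      then show "norm \<bar>zt n \<omega> - Zinf \<omega>\<bar> \<le> (\<Sum>h\<in>UNIV. \<bar>vr $ h\<bar>) + 1"
        using zt_bound[of \<omega> n] Zinf_range[of \<omega>] by auto
    qed
  qed auto
  then show ?thesis by simp
qed

lemma zt_add:
  assumes "\<omega> \<in> space M" "n \<le> m"
  shows "zt m \<omega> = zt n \<omega> + (\<Sum>k=n..<m. r k * (\<Sum>l\<in>UNIV. vr $ l * \<xi> k l \<omega>))"
  using assms(2) by (induction m rule: dec_induct) (simp_all add: zt_Suc[OF assms(1)])

definition "Y n \<omega> = stack (\<chi> j. Z n j \<omega>) (\<chi> j. wgt_mean a X n j \<omega>)"

lemma wgt_mean_meas [measurable]: "wgt_mean a X n j \<in> borel_measurable M"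
  unfolding wgt_mean_def using X_meas by (intro borel_measurable_sum borel_measurable_times) auto

lemma Y_meas [measurable]: "Y n \<in> borel_measurable M"
proof -
  have "(\<lambda>\<omega>. Y n \<omega> $ x) \<in> borel_measurable M" for x
    by (cases x) (simp_all add: Y_def stack_def)
  then show ?thesis
    by (subst borel_measurable_euclidean_space) (auto simp: Basis_vec_def inner_axis)
qed

text \<open>The deviation of \<open>zt n\<close> from its limit is minus the sum of all later
  martingale increments, whence the sign of the coefficients from \<open>n\<close> on. Summation
  stops at \<open>L\<close>, and the last term records what is left.\<close>

lemma scaled_difference:
  assumes w: "\<omega> \<in> space M" and "n \<le> L"
  shows "t \<bullet> (c *\<^sub>R (Y n \<omega> - vec (Zinf \<omega>)))
    = (\<Sum>k<L. \<Sum>j\<in>UNIV. (if k < n then c * (t \<bullet> ds k j n) else - ((\<Sum>x\<in>UNIV. t $ x) * c * r k * vr $ j)) * \<xi> k j \<omega>)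
      + c * (t \<bullet> stack (fst (resp step 0 (D 0 \<omega>) n)) (snd (resp step 0 (D 0 \<omega>) n))) + (\<Sum>x\<in>UNIV. t $ x) * c * (zt L \<omega> - Zinf \<omega>)"
proof -
  let ?t = "\<Sum>x\<in>UNIV. t $ x"
  let ?y = "resp step 0 (D 0 \<omega>) n"
  have st: "Y n \<omega> - vec (Zinf \<omega>) = stack (fst ?y) (snd ?y) + (\<Sum>k<n. \<Sum>j\<in>UNIV. \<xi> k j \<omega> *\<^sub>R ds k j n) + vec (zt n \<omega> - Zinf \<omega>)"
  proof (rule vec_eq_iff[THEN iffD2], rule allI)
    fix x
    have f: "fst (D n \<omega>) $ h = fst ?y $ h + (\<Sum>k<n. \<Sum>j\<in>UNIV. \<xi> k j \<omega> * fst (d k j n) $ h)"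
      and g: "snd (D n \<omega>) $ h = snd ?y $ h + (\<Sum>k<n. \<Sum>j\<in>UNIV. \<xi> k j \<omega> * snd (d k j n) $ h)" for h
      unfolding D_expansion[OF w, of n] by (simp_all add: fst_sum snd_sum)
    show "(Y n \<omega> - vec (Zinf \<omega>)) $ x = (stack (fst ?y) (snd ?y) + (\<Sum>k<n. \<Sum>j\<in>UNIV. \<xi> k j \<omega> *\<^sub>R ds k j n) + vec (zt n \<omega> - Zinf \<omega>)) $ x"
    proof (cases x)
      case (Inl h)
      then show ?thesis using f[of h] by (simp add: Y_def stack_def D_def ds_def)
    next
      case (Inr h)
      then show ?thesis using g[of h] by (simp add: Y_def stack_def D_def ds_def)
    qed
  qed
  have tv: "t \<bullet> vec z = ?t * z" for z by (simp add: inner_vec_def sum_distrib_right)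
  have "t \<bullet> (c *\<^sub>R (Y n \<omega> - vec (Zinf \<omega>))) = c * (t \<bullet> stack (fst ?y) (snd ?y)) + (\<Sum>k<n. \<Sum>j\<in>UNIV. c * (t \<bullet> ds k j n) * \<xi> k j \<omega>) + c * (?t * (zt n \<omega> - Zinf \<omega>))"
    unfolding st by (simp add: inner_add_right inner_sum_right tv sum_distrib_left distrib_left mult_ac)
  moreover have "(\<Sum>k<L. \<Sum>j\<in>UNIV. (if k < n then c * (t \<bullet> ds k j n) else - (?t * c * r k * vr $ j)) * \<xi> k j \<omega>)
     = (\<Sum>k<n. \<Sum>j\<in>UNIV. c * (t \<bullet> ds k j n) * \<xi> k j \<omega>) + (\<Sum>k=n..<L. \<Sum>j\<in>UNIV. - (?t * c * r k * vr $ j) * \<xi> k j \<omega>)"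
    using \<open>n \<le> L\<close> by (simp add: lessThan_atLeast0 sum.atLeastLessThan_concat[of 0 n L, symmetric])
  moreover have "(\<Sum>k=n..<L. \<Sum>j\<in>UNIV. - (?t * c * r k * vr $ j) * \<xi> k j \<omega>) = - (?t * c * (zt L \<omega> - zt n \<omega>))"
    unfolding zt_add[OF assms] by (simp add: sum_distrib_left sum_negf mult_ac)
  ultimately show ?thesis by (simp add: algebra_simps)
qed

lemma Cn_quadratic: "(\<Sum>k<n. \<Sum>j\<in>UNIV. (t \<bullet> ds k j n)\<^sup>2) = t \<bullet> (Cn n *v t)"
proof -
  have "(\<Sum>k<n. \<Sum>j\<in>UNIV. (t \<bullet> ds k j n)\<^sup>2) = (\<Sum>k<n. \<Sum>j\<in>UNIV. \<Sum>x\<in>UNIV. \<Sum>y\<in>UNIV. t $ x * t $ y * (ds k j n $ x * ds k j n $ y))"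
    by (simp add: inner_vec_def power2_eq_square sum_product mult_ac)
  also have "\<dots> = (\<Sum>x\<in>UNIV. \<Sum>y\<in>UNIV. \<Sum>k<n. \<Sum>j\<in>UNIV. t $ x * t $ y * (ds k j n $ x * ds k j n $ y))"
    by (simp only: sum.swap[of _ UNIV "{..<n}"] sum.swap[of _ "UNIV :: 'n set" "UNIV :: ('n + 'n) set"])
  also have "\<dots> = t \<bullet> (Cn n *v t)"
    by (simp add: inner_vec_def matrix_vector_mult_def Cn_def sum_distrib_left sum_distrib_right mult_ac)
  finally show ?thesis .
qed

end

section \<open>Convergence to the Gaussian kernel\<close>

context reinforced_processes
begin

lemma pos_semidef_limit:
  fixes C :: "nat \<Rightarrow> real^'d::finite^'d" and S :: "real^'d^'d"
  assumes lim: "\<And>i j. (\<lambda>n. u n * C n $ i $ j) \<longlonglongrightarrow> S $ i $ j" and u: "\<And>n. 0 \<le> u n"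
    and sym: "\<And>n i j. C n $ i $ j = C n $ j $ i" and pos: "\<And>n x. 0 \<le> x \<bullet> (C n *v x)"
  shows "pos_semidef S" and "\<And>x. (\<lambda>n. u n * (x \<bullet> (C n *v x))) \<longlonglongrightarrow> x \<bullet> (S *v x)"
proof -
  show q: "(\<lambda>n. u n * (x \<bullet> (C n *v x))) \<longlonglongrightarrow> x \<bullet> (S *v x)" for x
  proof -
    have "(\<lambda>n. \<Sum>i\<in>UNIV. x $ i * (\<Sum>j\<in>UNIV. (u n * C n $ i $ j) * x $ j)) \<longlonglongrightarrow> (\<Sum>i\<in>UNIV. x $ i * (\<Sum>j\<in>UNIV. S $ i $ j * x $ j))"
      by (intro tendsto_intros lim)
    then show ?thesis by (simp add: inner_vec_def matrix_vector_mult_def sum_distrib_left mult_ac)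
  qed
  have "0 \<le> x \<bullet> (S *v x)" for x
    by (rule LIMSEQ_le_const[OF q]) (use u pos in auto)
  moreover have "S $ i $ j = S $ j $ i" for i j
    using LIMSEQ_unique[OF lim[of i j]] lim[of j i] sym[of _ i j] by simp
  ultimately show "pos_semidef S" by (simp add: pos_semidef_def vec_eq_iff transpose_def)
qed

lemma norm_iexp_add_le: "norm (iexp (S + y + z) - iexp S) \<le> norm (iexp y - 1) + \<bar>z\<bar>"
proof -
  have "iexp (S + y + z) - iexp S = iexp S * ((iexp y - 1) + iexp y * (iexp z - 1))"
    by (simp add: algebra_simps exp_add)
  then have "norm (iexp (S + y + z) - iexp S) \<le> norm (iexp y - 1) + norm (iexp z - 1)"
    using norm_triangle_ineq[of "iexp y - 1" "iexp y * (iexp z - 1)"] by (simp add: norm_mult)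
  then show ?thesis using norm_iexp_diff_le[of z 0] by simp
qed

lemma norm_indicator_iexp_le: "norm (indicator H \<omega> *\<^sub>R iexp x) \<le> 1"
  by (simp add: indicator_def)

text \<open>\<open>zt\<close> converges in L1 and the squared steps are summable, so a late enough
  cut makes both errors small even after multiplication by a constant \<open>c\<close>, which will
  be the scale at time \<open>n\<close>.\<close>

lemma truncation:
  assumes summ: "summable (\<lambda>k. (r k)\<^sup>2)"
  shows "\<exists>L\<ge>n. c * ((\<Sum>k. (r k)\<^sup>2) - (\<Sum>k<L. (r k)\<^sup>2)) \<le> inverse (real (Suc n))
     \<and> c * expectation (\<lambda>\<omega>. \<bar>zt L \<omega> - Zinf \<omega>\<bar>) \<le> inverse (real (Suc n))"
proof -
  have 1: "(\<lambda>L. c * ((\<Sum>k. (r k)\<^sup>2) - (\<Sum>k<L. (r k)\<^sup>2))) \<longlonglongrightarrow> c * ((\<Sum>k. (r k)\<^sup>2) - (\<Sum>k. (r k)\<^sup>2))"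
    by (intro tendsto_intros summable_LIMSEQ[OF summ])
  have 2: "(\<lambda>L. c * expectation (\<lambda>\<omega>. \<bar>zt L \<omega> - Zinf \<omega>\<bar>)) \<longlonglongrightarrow> c * 0"
    by (intro tendsto_intros zt_L1)
  have "\<forall>\<^sub>F L in sequentially. c * ((\<Sum>k. (r k)\<^sup>2) - (\<Sum>k<L. (r k)\<^sup>2)) < inverse (real (Suc n))"
    by (rule order_tendstoD(2)[OF 1]) simp
  moreover have "\<forall>\<^sub>F L in sequentially. c * expectation (\<lambda>\<omega>. \<bar>zt L \<omega> - Zinf \<omega>\<bar>) < inverse (real (Suc n))"
    by (rule order_tendstoD(2)[OF 2]) simp
  ultimately have "\<forall>\<^sub>F L in sequentially. L \<ge> n \<and> c * ((\<Sum>k. (r k)\<^sup>2) - (\<Sum>k<L. (r k)\<^sup>2)) < inverse (real (Suc n))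
    \<and> c * expectation (\<lambda>\<omega>. \<bar>zt L \<omega> - Zinf \<omega>\<bar>) < inverse (real (Suc n))"
    using eventually_ge_at_top[of n] by eventually_elim simp
  then obtain L where "L \<ge> n" "c * ((\<Sum>k. (r k)\<^sup>2) - (\<Sum>k<L. (r k)\<^sup>2)) < inverse (real (Suc n))"
    "c * expectation (\<lambda>\<omega>. \<bar>zt L \<omega> - Zinf \<omega>\<bar>) < inverse (real (Suc n))" unfolding eventually_sequentially by blast
  then show ?thesis by (intro exI[of _ L]) auto
qed

context
  fixes \<gamma> \<nu> c q p A B C \<tau> :: real and S :: "real^('n + 'n)^('n + 'n)"
  assumes EL: "eigen_filter_limit r s \<alpha> \<iota> V Zc Nc \<gamma> \<nu> c q p A B C"
    and S: "\<And>i j. (\<lambda>n. real n powr p * Cn n $ i $ j) \<longlonglongrightarrow> S $ i $ j"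
    and summ: "summable (\<lambda>k. (r k)\<^sup>2)"
    and tail: "(\<lambda>n. real n powr p * ((\<Sum>k. (r k)\<^sup>2) - (\<Sum>k<n. (r k)\<^sup>2))) \<longlonglongrightarrow> \<tau>"
    and r_small: "\<And>\<epsilon>. \<epsilon> > 0 \<Longrightarrow> \<forall>\<^sub>F n in sequentially. \<forall>k\<ge>n. real n powr (p / 2) * r k \<le> \<epsilon>"
begin

abbreviation "u n \<equiv> real n powr (p / 2)"

text \<open>The future contributes the same random amount to every coordinate, hence the all-ones
  matrix. The rescaled tail of squared steps is \<tau>, and the squared norm of \<open>vr\<close> is
  the variance of a weighted difference when single differences have unit variance.\<close>

definition "Stot = S + (\<tau> * (norm vr)\<^sup>2) *\<^sub>R (\<chi> i j. 1)"

lemma u_sq: "u n * u n = real n powr p"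
  by (simp add: powr_add[symmetric])

lemma \<tau>_nonneg: "0 \<le> \<tau>"
proof (rule LIMSEQ_le_const[OF tail])
  have "0 \<le> (\<Sum>k. (r k)\<^sup>2) - (\<Sum>k<n. (r k)\<^sup>2)" for n using sum_le_suminf[OF summ, of "{..<n}"] by simp
  then show "\<exists>N. \<forall>n\<ge>N. 0 \<le> real n powr p * ((\<Sum>k. (r k)\<^sup>2) - (\<Sum>k<n. (r k)\<^sup>2))"
    by (intro exI allI impI mult_nonneg_nonneg powr_ge_zero)
qed

lemma Cn_sym: "Cn n $ i $ j = Cn n $ j $ i"
  by (simp add: Cn_def mult.commute)

lemma Cn_pos: "0 \<le> x \<bullet> (Cn n *v x)"
  unfolding Cn_quadratic[symmetric] by (intro sum_nonneg) auto

lemmas S_psd = pos_semidef_limit[where u="\<lambda>n. real n powr p" and C=Cn, OF S powr_ge_zero Cn_sym Cn_pos]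

lemma Stot_quadratic: "x \<bullet> (Stot *v x) = x \<bullet> (S *v x) + \<tau> * (norm vr)\<^sup>2 * (\<Sum>i\<in>UNIV. x $ i)\<^sup>2"
proof -
  have "((\<chi> i j. 1) :: real^('n + 'n)^('n + 'n)) *v x = (\<Sum>i\<in>UNIV. x $ i) *\<^sub>R 1"
    by (simp add: vec_eq_iff matrix_vector_mult_def)
  moreover have "x \<bullet> 1 = (\<Sum>i\<in>UNIV. x $ i)" by (simp add: inner_vec_def)
  ultimately show ?thesis
    by (simp add: Stot_def matrix_vector_mult_add_rdistrib scaleR_matrix_vector_assoc[symmetric] inner_add_right power2_eq_square)
qed

lemma Stot_psd: "pos_semidef Stot"
  unfolding pos_semidef_def
proof (intro conjI allI)
  show "transpose Stot = Stot" using S_psd(1) by (simp add: Stot_def pos_semidef_def transpose_def vec_eq_iff)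
  show "0 \<le> x \<bullet> (Stot *v x)" for x
    using S_psd(1) \<tau>_nonneg unfolding Stot_quadratic by (auto simp: pos_semidef_def)
qed

lemma characters_converge:
  assumes H: "H \<in> sets M"
  shows "(\<lambda>n. \<integral>\<omega>. indicator H \<omega> *\<^sub>R iexp (t \<bullet> (u n *\<^sub>R (Y n \<omega> - vec (Zinf \<omega>)))) \<partial>M)
       \<longlonglongrightarrow> (\<integral>\<omega>. indicator H \<omega> *\<^sub>R complex_of_real (exp (- (v \<omega> * (t \<bullet> (Stot *v t))) / 2)) \<partial>M)"
proof -
  note [measurable] = H Zinf_meas
  define R where "R L = (\<Sum>k. (r k)\<^sup>2) - (\<Sum>k<L. (r k)\<^sup>2)" for L
  define tt where "tt = (\<Sum>x\<in>UNIV. t $ x)"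
  \<comment> \<open>The maximum of both scales lets a single cut control the variance beyond it, at
    scale \<open>n powr p\<close>, and the L1 error, at scale \<open>u n\<close>.\<close>
  define P where "P n L \<longleftrightarrow> n \<le> L \<and> max (u n) (real n powr p) * R L \<le> inverse (real (Suc n))
    \<and> max (u n) (real n powr p) * expectation (\<lambda>\<omega>. \<bar>zt L \<omega> - Zinf \<omega>\<bar>) \<le> inverse (real (Suc n))" for n L
  define L where "L n = (SOME L. P n L)" for n
  have "P n (L n)" for n
    unfolding L_def by (rule someI_ex) (use truncation[OF summ, of n "max (u n) (real n powr p)"] in \<open>auto simp: P_def R_def\<close>)
  then have L: "\<And>n. n \<le> L n"
    and L1: "\<And>n. max (u n) (real n powr p) * R (L n) \<le> inverse (real (Suc n))"
    and L2: "\<And>n. max (u n) (real n powr p) * expectation (\<lambda>\<omega>. \<bar>zt (L n) \<omega> - Zinf \<omega>\<bar>) \<le> inverse (real (Suc n))"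
    by (auto simp: P_def)
  have R0: "0 \<le> R m" for m unfolding R_def using sum_le_suminf[OF summ, of "{..<m}"] by simp
  have L1': "real n powr p * R (L n) \<le> inverse (real (Suc n))" for n
    by (rule order_trans[OF mult_right_mono L1]) (use R0 in auto)
  have L2': "u n * expectation (\<lambda>\<omega>. \<bar>zt (L n) \<omega> - Zinf \<omega>\<bar>) \<le> inverse (real (Suc n))" for n
    by (rule order_trans[OF mult_right_mono L2]) (auto intro!: integral_nonneg)
  \<comment> \<open>One array for all times: rescaled responses before \<open>n\<close>, and from
    \<open>n\<close> on the increments of the common martingale, which the test vector sees through
    its total mass \<open>tt\<close>.\<close>
  define b where "b n k j = (if k < n then u n * (t \<bullet> ds k j n) else - (tt * u n * r k * vr $ j))" for n k j
  have small: "\<forall>\<^sub>F n in sequentially. \<forall>k<L n. \<forall>j. \<bar>b n k j\<bar> \<le> \<epsilon>" if \<epsilon>: "\<epsilon> > 0" for \<epsilon>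
  proof -
    \<comment> \<open>\<open>K\<close> dominates the factors arising in both ranges of
      \<open>k\<close>; being at least 1, it may be divided by.\<close>
    define K where "K = 1 + (\<Sum>x\<in>UNIV. \<bar>t $ x\<bar>) + \<bar>tt\<bar> * (\<Sum>j\<in>UNIV. \<bar>vr $ j\<bar>)"
    have K1: "K \<ge> 1" by (auto simp: K_def intro!: add_nonneg_nonneg sum_nonneg)
    have e: "\<epsilon> / K > 0" using \<epsilon> K1 by simp
    have eK: "K * (\<epsilon> / K) = \<epsilon>" using K1 by simp
    show ?thesis using ds_small[OF EL e] r_small[OF e]
    proof eventually_elim
      case (elim n)
      show ?case
      proof (intro allI impI)
        fix k j
        show "\<bar>b n k j\<bar> \<le> \<epsilon>"
        proof (cases "k < n")
          case True
          have "\<bar>b n k j\<bar> = u n * \<bar>t \<bullet> ds k j n\<bar>" using True by (simp add: b_def abs_mult)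
          also have "\<dots> \<le> u n * (\<Sum>x\<in>UNIV. \<bar>t $ x\<bar> * \<bar>ds k j n $ x\<bar>)"
            by (intro mult_left_mono) (auto simp: inner_vec_def abs_mult[symmetric] intro: sum_abs)
          also have "\<dots> = (\<Sum>x\<in>UNIV. \<bar>t $ x\<bar> * (u n * \<bar>ds k j n $ x\<bar>))" by (simp add: sum_distrib_left mult.left_commute)
          also have "\<dots> \<le> (\<Sum>x\<in>UNIV. \<bar>t $ x\<bar> * (\<epsilon> / K))" using elim(1) True by (intro sum_mono mult_left_mono) auto
          also have "\<dots> = (\<Sum>x\<in>UNIV. \<bar>t $ x\<bar>) * (\<epsilon> / K)" by (simp only: sum_distrib_right)
          also have "\<dots> \<le> K * (\<epsilon> / K)" using e by (intro mult_right_mono) (auto simp: K_def intro!: mult_nonneg_nonneg sum_nonneg)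
          finally show ?thesis unfolding eK .
        next
          case False
          have rk: "0 \<le> u n * r k" "u n * r k \<le> \<epsilon> / K" using elim(2) False r_range[of k] by (auto simp: less_imp_le)
          have "\<bar>b n k j\<bar> = (\<bar>tt\<bar> * \<bar>vr $ j\<bar>) * (u n * r k)" using False r_range[of k] by (simp add: b_def abs_mult less_imp_le mult_ac)
          also have "\<dots> \<le> (\<bar>tt\<bar> * (\<Sum>j\<in>UNIV. \<bar>vr $ j\<bar>)) * (\<epsilon> / K)"
            using rk by (intro mult_mono mult_left_mono member_le_sum) (auto intro!: mult_nonneg_nonneg sum_nonneg)
          also have "\<dots> \<le> K * (\<epsilon> / K)" using e by (intro mult_right_mono) (auto simp: K_def intro!: add_nonneg_nonneg sum_nonneg)
          finally show ?thesis unfolding eK .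
        qed
      qed
    qed
  qed
  have total: "(\<lambda>n. \<Sum>k<L n. \<Sum>j\<in>UNIV. (b n k j)\<^sup>2) \<longlonglongrightarrow> t \<bullet> (Stot *v t)"
  proof -
    have eq: "(\<Sum>k<L n. \<Sum>j\<in>UNIV. (b n k j)\<^sup>2) = real n powr p * (t \<bullet> (Cn n *v t)) + tt\<^sup>2 * (norm vr)\<^sup>2 * (real n powr p * R n - real n powr p * R (L n))" for n
    proof -
      have "(\<Sum>k<L n. \<Sum>j\<in>UNIV. (b n k j)\<^sup>2) = (\<Sum>k<n. \<Sum>j\<in>UNIV. (b n k j)\<^sup>2) + (\<Sum>k=n..<L n. \<Sum>j\<in>UNIV. (b n k j)\<^sup>2)"
        using L[of n] by (simp add: lessThan_atLeast0 sum.atLeastLessThan_concat)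
      also have "(\<Sum>k<n. \<Sum>j\<in>UNIV. (b n k j)\<^sup>2) = real n powr p * (t \<bullet> (Cn n *v t))"
        unfolding Cn_quadratic[symmetric] sum_distrib_left
        by (intro sum.cong refl) (simp add: b_def power_mult_distrib power2_eq_square[of "u n"] u_sq)
      also have "(\<Sum>k=n..<L n. \<Sum>j\<in>UNIV. (b n k j)\<^sup>2) = (\<Sum>k=n..<L n. tt\<^sup>2 * (norm vr)\<^sup>2 * (real n powr p * (r k)\<^sup>2))"
      proof (intro sum.cong refl)
        fix k assume k: "k \<in> {n..<L n}"
        have "(b n k j)\<^sup>2 = (tt\<^sup>2 * (real n powr p * (r k)\<^sup>2)) * (vr $ j)\<^sup>2" for j
          using k by (simp add: b_def power_mult_distrib power2_eq_square[of "u n"] u_sq mult_ac)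
        then show "(\<Sum>j\<in>UNIV. (b n k j)\<^sup>2) = tt\<^sup>2 * (norm vr)\<^sup>2 * (real n powr p * (r k)\<^sup>2)"
          by (simp add: norm_vec_def L2_set_def sum_nonneg sum_distrib_left[symmetric] mult_ac)
      qed
      also have "\<dots> = tt\<^sup>2 * (norm vr)\<^sup>2 * (real n powr p * (\<Sum>k=n..<L n. (r k)\<^sup>2))" by (simp only: sum_distrib_left)
      also have "(\<Sum>k=n..<L n. (r k)\<^sup>2) = R n - R (L n)"
        using L[of n] sum.atLeastLessThan_concat[of 0 n "L n" "\<lambda>k. (r k)\<^sup>2"] by (simp add: R_def lessThan_atLeast0)
      finally show ?thesis by (simp add: right_diff_distrib)
    qed
    have RL: "(\<lambda>n. real n powr p * R (L n)) \<longlonglongrightarrow> 0"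
      by (rule tendsto_sandwich[OF _ _ tendsto_const LIMSEQ_inverse_real_of_nat]) (use L1' R0 in \<open>auto intro!: always_eventually\<close>)
    have "(\<lambda>n. real n powr p * (t \<bullet> (Cn n *v t)) + tt\<^sup>2 * (norm vr)\<^sup>2 * (real n powr p * R n - real n powr p * R (L n)))
      \<longlonglongrightarrow> t \<bullet> (S *v t) + tt\<^sup>2 * (norm vr)\<^sup>2 * (\<tau> - 0)"
      by (intro tendsto_intros S_psd(2) RL tail[folded R_def])
    then show ?thesis unfolding eq Stot_quadratic by (simp add: tt_def mult_ac)
  qed
  let ?T = "\<lambda>n \<omega>. iexp (\<Sum>k<L n. inc (b n) k \<omega>)"
  have clt: "(\<lambda>n. expectation (\<lambda>\<omega>. indicator H \<omega> *\<^sub>R ?T n \<omega>)) \<longlonglongrightarrow> expectation (\<lambda>\<omega>. indicator H \<omega> *\<^sub>R complex_of_real (exp (- (v \<omega> * (t \<bullet> (Stot *v t))) / 2)))"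
  proof -
    have T: "T b L n \<omega> = ?T n \<omega>" for n \<omega>
      by (rule T_def[OF _ total]) (rule small)
    have Tlim: "Tlim (t \<bullet> (Stot *v t)) \<omega> = complex_of_real (exp (- (v \<omega> * (t \<bullet> (Stot *v t))) / 2))" for \<omega>
      by (rule Tlim_def[OF _ total]) (rule small)
    have "(\<lambda>n. expectation (\<lambda>\<omega>. indicator H \<omega> *\<^sub>R T b L n \<omega>)) \<longlonglongrightarrow> expectation (\<lambda>\<omega>. indicator H \<omega> *\<^sub>R Tlim (t \<bullet> (Stot *v t)) \<omega>)"
      by (rule stable_clt[OF _ total H]) (rule small)
    then show ?thesis by (simp only: T Tlim)
  qed
  define Q where "Q n \<omega> = t \<bullet> (u n *\<^sub>R (Y n \<omega> - vec (Zinf \<omega>)))" for n \<omega>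
  have vecm: "(\<lambda>\<omega>. vec (Zinf \<omega>) :: real^('n + 'n)) \<in> borel_measurable M"
    by (subst borel_measurable_euclidean_space) (auto simp: Basis_vec_def inner_axis)
  have Qm[measurable]: "Q n \<in> borel_measurable M" for n
    unfolding Q_def by (intro borel_measurable_inner borel_measurable_const borel_measurable_scaleR borel_measurable_diff Y_meas vecm)
  \<comment> \<open>Subtracting the array and the error of the cut leaves the contribution of the
    initial value, which tends to zero pointwise.\<close>
  define y where "y n \<omega> = Q n \<omega> - (\<Sum>k<L n. inc (b n) k \<omega>) - tt * u n * (zt (L n) \<omega> - Zinf \<omega>)" for n \<omega>
  have ym[measurable]: "y n \<in> borel_measurable M" for n unfolding y_def by measurable
  have y0: "(\<lambda>n. y n \<omega>) \<longlonglongrightarrow> 0" if w: "\<omega> \<in> space M" for \<omega>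
  proof -
    have "y n \<omega> = u n * (t \<bullet> stack (fst (resp step 0 (D 0 \<omega>) n)) (snd (resp step 0 (D 0 \<omega>) n)))" for n
      unfolding y_def Q_def scaled_difference[OF w L[of n]] inc_def b_def tt_def by simp
    then show ?thesis using initial_negligible[OF EL] by simp
  qed
  define E where "E n = expectation (\<lambda>\<omega>. norm (iexp (y n \<omega>) - 1)) + \<bar>tt\<bar> * inverse (real (Suc n))" for n
  have "(\<lambda>n. expectation (\<lambda>\<omega>. norm (iexp (y n \<omega>) - 1))) \<longlonglongrightarrow> expectation (\<lambda>\<omega>. 0)"
  proof (rule integral_dominated_convergence[where w="\<lambda>_. 2"])
    show "AE \<omega> in M. (\<lambda>n. norm (iexp (y n \<omega>) - 1)) \<longlonglongrightarrow> 0"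
    proof (rule AE_I2)
      fix \<omega> assume "\<omega> \<in> space M"
      then have "(\<lambda>n. norm (iexp (y n \<omega>) - 1)) \<longlonglongrightarrow> norm (iexp 0 - 1)" by (intro tendsto_intros y0)
      then show "(\<lambda>n. norm (iexp (y n \<omega>) - 1)) \<longlonglongrightarrow> 0" by simp
    qed
    show "AE \<omega> in M. norm (norm (iexp (y n \<omega>) - 1)) \<le> 2" for n
      using norm_iexp_minus_le_2[of 1] by simp
  qed auto
  then have "E \<longlonglongrightarrow> 0 + \<bar>tt\<bar> * 0" unfolding E_def by (intro tendsto_intros LIMSEQ_inverse_real_of_nat) simp
  then have E0: "E \<longlonglongrightarrow> 0" by simp
  have diff: "norm (expectation (\<lambda>\<omega>. indicator H \<omega> *\<^sub>R iexp (Q n \<omega>)) - expectation (\<lambda>\<omega>. indicator H \<omega> *\<^sub>R ?T n \<omega>)) \<le> E n" for n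
  proof -
    have iz: "integrable M (\<lambda>\<omega>. \<bar>zt (L n) \<omega> - Zinf \<omega>\<bar>)"
    proof (rule integrable_bdd[where B="(\<Sum>h\<in>UNIV. \<bar>vr $ h\<bar>) + 1"])
      fix \<omega> assume "\<omega> \<in> space M"
      then show "norm \<bar>zt (L n) \<omega> - Zinf \<omega>\<bar> \<le> (\<Sum>h\<in>UNIV. \<bar>vr $ h\<bar>) + 1" using zt_bound[of \<omega> "L n"] Zinf_range[of \<omega>] by auto
    qed measurable
    have iy: "integrable M (\<lambda>\<omega>. norm (iexp (y n \<omega>) - 1))"
      using norm_iexp_minus_le_2[of 1] by (intro integrable_bdd[where B=2]) auto
    have i1: "integrable M (\<lambda>\<omega>. indicator H \<omega> *\<^sub>R iexp (Q n \<omega>))"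
    proof (rule integrable_bdd[where B=1])
      show "norm (indicator H \<omega> *\<^sub>R iexp (Q n \<omega>)) \<le> 1" for \<omega> by (rule norm_indicator_iexp_le)
    qed measurable
    have i2: "integrable M (\<lambda>\<omega>. indicator H \<omega> *\<^sub>R ?T n \<omega>)"
    proof (rule integrable_bdd[where B=1])
      show "norm (indicator H \<omega> *\<^sub>R ?T n \<omega>) \<le> 1" for \<omega> by (rule norm_indicator_iexp_le)
    qed measurable
    have "norm (expectation (\<lambda>\<omega>. indicator H \<omega> *\<^sub>R iexp (Q n \<omega>) - indicator H \<omega> *\<^sub>R ?T n \<omega>))
      \<le> expectation (\<lambda>\<omega>. norm (iexp (y n \<omega>) - 1) + \<bar>tt\<bar> * u n * \<bar>zt (L n) \<omega> - Zinf \<omega>\<bar>)"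
    proof (rule expectation_le)
      fix \<omega>
      have eq: "Q n \<omega> = (\<Sum>k<L n. inc (b n) k \<omega>) + y n \<omega> + tt * u n * (zt (L n) \<omega> - Zinf \<omega>)" by (simp add: y_def)
      have "norm (iexp (Q n \<omega>) - ?T n \<omega>) \<le> norm (iexp (y n \<omega>) - 1) + \<bar>tt * u n * (zt (L n) \<omega> - Zinf \<omega>)\<bar>"
        unfolding eq by (rule norm_iexp_add_le)
      then show "norm (indicator H \<omega> *\<^sub>R iexp (Q n \<omega>) - indicator H \<omega> *\<^sub>R ?T n \<omega>) \<le> norm (iexp (y n \<omega>) - 1) + \<bar>tt\<bar> * u n * \<bar>zt (L n) \<omega> - Zinf \<omega>\<bar>"
        by (cases "\<omega> \<in> H") (auto simp: abs_mult)
    next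
      show "integrable M (\<lambda>\<omega>. norm (iexp (y n \<omega>) - 1) + \<bar>tt\<bar> * u n * \<bar>zt (L n) \<omega> - Zinf \<omega>\<bar>)"
        by (intro Bochner_Integration.integrable_add iy integrable_mult_right iz)
      show "integrable M (\<lambda>\<omega>. indicator H \<omega> *\<^sub>R iexp (Q n \<omega>) - indicator H \<omega> *\<^sub>R ?T n \<omega>)"
        by (rule Bochner_Integration.integrable_diff[OF i1 i2])
    qed
    also have "\<dots> = expectation (\<lambda>\<omega>. norm (iexp (y n \<omega>) - 1)) + \<bar>tt\<bar> * (u n * expectation (\<lambda>\<omega>. \<bar>zt (L n) \<omega> - Zinf \<omega>\<bar>))"
      using iy iz by (simp add: mult.assoc)
    also have "\<dots> \<le> E n" unfolding E_def by (intro add_left_mono mult_left_mono L2') simp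
    finally show ?thesis unfolding Bochner_Integration.integral_diff[OF i1 i2] .
  qed
  have "(\<lambda>n. expectation (\<lambda>\<omega>. indicator H \<omega> *\<^sub>R iexp (Q n \<omega>)) - expectation (\<lambda>\<omega>. indicator H \<omega> *\<^sub>R ?T n \<omega>)) \<longlonglongrightarrow> 0"
    by (rule Lim_null_comparison[OF _ E0]) (use diff in auto)
  from tendsto_add[OF this clt] show ?thesis unfolding Q_def by simp
qed

theorem converges_stably_to_normalI:
  "converges_stably_to_normal M (\<lambda>n \<omega>. u n *\<^sub>R (Y n \<omega> - vec (Zinf \<omega>)))
    (\<lambda>\<omega>. v \<omega> *\<^sub>R (cmat S + (\<tau> * (norm vr)\<^sup>2) *\<^sub>R ones_matrix))"
  unfolding converges_stably_to_normal_def
proof (intro exI[of _ "\<lambda>\<omega>. v \<omega> *\<^sub>R Stot"] conjI ballI)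
  fix \<omega> assume "\<omega> \<in> space M"
  then have v0: "0 \<le> v \<omega>" using v_bound by auto
  show "pos_semidef (v \<omega> *\<^sub>R Stot)"
    using Stot_psd v0 by (auto simp: pos_semidef_def transpose_scalar scaleR_matrix_vector_assoc[symmetric])
  show "cmat (v \<omega> *\<^sub>R Stot) = v \<omega> *\<^sub>R (cmat S + (\<tau> * (norm vr)\<^sup>2) *\<^sub>R ones_matrix)"
    by (simp add: vec_eq_iff map_matrix_def complex_eq_iff Stot_def ones_matrix_def)
next
  have "(\<lambda>\<omega>. vec (Zinf \<omega>) :: real^('n + 'n)) \<in> borel_measurable M"
    by (subst borel_measurable_euclidean_space) (auto simp: Basis_vec_def inner_axis Zinf_meas)
  then show "converges_stably M (\<lambda>n \<omega>. u n *\<^sub>R (Y n \<omega> - vec (Zinf \<omega>))) (\<lambda>\<omega>. mvnormal (v \<omega> *\<^sub>R Stot))"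
    by (intro converges_stably_mvnormalI prob_space_axioms Stot_psd characters_converge v_meas) (use v_bound in auto)
qed

end

end

section \<open>Tails of the step sizes\<close>

text \<open>A Stolz-Cesaro argument for tails: \<open>g n\<close> is the telescoping tail sum of
  \<delta>, and termwise ratios close to \<open>l\<close> force the ratio of the tails close to
  \<open>l\<close>.\<close>

lemma tail_sum_asymptotics:
  fixes f \<delta> g :: "nat \<Rightarrow> real"
  assumes ratio: "(\<lambda>k. f k / \<delta> k) \<longlonglongrightarrow> l" and \<delta>: "\<And>k. \<delta> k = g k - g (Suc k)" "\<And>k. 0 < \<delta> k" and g: "g \<longlonglongrightarrow> 0" "\<And>k. 0 < g k"
  shows "summable f" and "(\<lambda>n. (suminf f - (\<Sum>k<n. f k)) / g n) \<longlonglongrightarrow> l"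
proof -
  have near: "\<exists>N. \<forall>k\<ge>N. \<bar>f k - l * \<delta> k\<bar> \<le> \<epsilon> * \<delta> k" if "\<epsilon> > 0" for \<epsilon>
  proof -
    from LIMSEQ_D[OF ratio that] obtain N where N: "\<And>k. k \<ge> N \<Longrightarrow> \<bar>f k / \<delta> k - l\<bar> < \<epsilon>" by auto
    have "\<bar>f k - l * \<delta> k\<bar> \<le> \<epsilon> * \<delta> k" if "k \<ge> N" for k
    proof -
      have "f k - l * \<delta> k = (f k / \<delta> k - l) * \<delta> k" using \<delta>(2)[of k] by (simp add: left_diff_distrib)
      then show ?thesis using mult_right_mono[OF less_imp_le[OF N[OF that]], of "\<delta> k"] \<delta>(2)[of k] by (simp add: abs_mult)
    qed
    then show ?thesis by blast
  qed
  have \<delta>sums: "(\<lambda>k. \<delta> (k + n)) sums g n" for n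
    using telescope_sums'[of "\<lambda>k. g (k + n)" 0] LIMSEQ_ignore_initial_segment[OF g(1), of n] by (simp add: \<delta>(1))
  show sf: "summable f"
  proof -
    obtain N where N: "\<And>k. k \<ge> N \<Longrightarrow> \<bar>f k - l * \<delta> k\<bar> \<le> 1 * \<delta> k" using near[of 1] by auto
    show ?thesis
    proof (rule summable_comparison_test)
      show "\<exists>N. \<forall>n\<ge>N. norm (f n) \<le> (\<bar>l\<bar> + 1) * \<delta> n"
      proof (intro exI allI impI)
        fix k assume "N \<le> k"
        have "\<bar>l * \<delta> k\<bar> = \<bar>l\<bar> * \<delta> k" using \<delta>(2)[of k] by (simp add: abs_mult)
        then show "norm (f k) \<le> (\<bar>l\<bar> + 1) * \<delta> k" using N[OF \<open>N \<le> k\<close>] by (simp add: distrib_right)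
      qed
      show "summable (\<lambda>n. (\<bar>l\<bar> + 1) * \<delta> n)" using \<delta>sums[of 0] by (intro summable_mult) (simp add: sums_iff)
    qed
  qed
  show "(\<lambda>n. (suminf f - (\<Sum>k<n. f k)) / g n) \<longlonglongrightarrow> l"
  proof (rule LIMSEQ_I)
    fix \<epsilon> :: real assume \<epsilon>: "\<epsilon> > 0"
    obtain N where N: "\<And>k. k \<ge> N \<Longrightarrow> \<bar>f k - l * \<delta> k\<bar> \<le> \<epsilon> / 2 * \<delta> k" using near[of "\<epsilon> / 2"] \<epsilon> by auto
    have "norm ((suminf f - (\<Sum>k<n. f k)) / g n - l) < \<epsilon>" if "n \<ge> N" for n
    proof -
      have R: "suminf f - (\<Sum>k<n. f k) = (\<Sum>k. f (k + n))" using suminf_minus_initial_segment[OF sf, of n] by simp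
      have s1: "summable (\<lambda>k. f (k + n))" using sf by (rule summable_ignore_initial_segment)
      have s2: "summable (\<lambda>k. \<delta> (k + n))" "(\<Sum>k. \<delta> (k + n)) = g n" using \<delta>sums[of n] by (simp_all add: sums_iff)
      have s3: "summable (\<lambda>k. f (k + n) - l * \<delta> (k + n))" using s1 s2 by (intro summable_diff summable_mult)
      have le: "\<bar>f (k + n) - l * \<delta> (k + n)\<bar> \<le> \<epsilon> / 2 * \<delta> (k + n)" for k using N[of "k + n"] that by simp
      have sa: "summable (\<lambda>k. \<bar>f (k + n) - l * \<delta> (k + n)\<bar>)"
        by (rule summable_comparison_test'[where g="\<lambda>k. \<epsilon> / 2 * \<delta> (k + n)" and N=0]) (use le s2 in \<open>auto intro!: summable_mult\<close>)
      have "\<bar>(\<Sum>k. f (k + n)) - l * g n\<bar> = \<bar>\<Sum>k. f (k + n) - l * \<delta> (k + n)\<bar>"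
        by (simp only: suminf_diff[OF s1 summable_mult[OF s2(1)], symmetric] suminf_mult[OF s2(1)] s2(2))
      also have "\<dots> \<le> (\<Sum>k. \<bar>f (k + n) - l * \<delta> (k + n)\<bar>)" by (rule summable_rabs[OF sa])
      also have "\<dots> \<le> (\<Sum>k. \<epsilon> / 2 * \<delta> (k + n))" using le s2 by (intro suminf_le sa summable_mult) auto
      also have "\<dots> = \<epsilon> / 2 * g n" using suminf_mult[OF s2(1), of "\<epsilon> / 2"] s2(2) by simp
      finally have *: "\<bar>(\<Sum>k. f (k + n)) - l * g n\<bar> \<le> \<epsilon> / 2 * g n" .
      have "norm ((suminf f - (\<Sum>k<n. f k)) / g n - l) = \<bar>(\<Sum>k. f (k + n)) - l * g n\<bar> / g n"
      proof -
        have "(\<Sum>k. f (k + n)) / g n - l = ((\<Sum>k. f (k + n)) - l * g n) / g n"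
          using g(2)[of n] by (simp add: diff_divide_distrib)
        then show ?thesis unfolding R real_norm_def using abs_of_pos[OF g(2)[of n]] by (simp only: abs_divide)
      qed
      also have "\<dots> \<le> \<epsilon> / 2" using * g(2)[of n] by (simp add: pos_divide_le_eq)
      finally show ?thesis using \<epsilon> by simp
    qed
    then show "\<exists>no. \<forall>n\<ge>no. norm ((suminf f - (\<Sum>k<n. f k)) / g n - l) < \<epsilon>" by blast
  qed
qed

lemma power_tail_sum:
  fixes r :: "nat \<Rightarrow> real"
  assumes r: "(\<lambda>n. r n / real (Suc n) powr (-\<gamma>)) \<longlonglongrightarrow> c" and \<gamma>: "1/2 < \<gamma>"
  shows "summable (\<lambda>k. (r k)\<^sup>2)"
    and "(\<lambda>n. real n powr (2 * \<gamma> - 1) * ((\<Sum>k. (r k)\<^sup>2) - (\<Sum>k<n. (r k)\<^sup>2))) \<longlonglongrightarrow> c\<^sup>2 / (2 * \<gamma> - 1)"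
proof -
  define Q where "Q = 2 * \<gamma> - 1"
  have Q: "Q > 0" using \<gamma> by (simp add: Q_def)
  \<comment> \<open>Its differences behave like \<open>Q * n powr (-Q - 1)\<close>, and
    \<open>Q + 1 = 2 * \<gamma>\<close> matches the order of the squared steps.\<close>
  define g where "g n = real (Suc n) powr (-Q)" for n
  define \<delta> where "\<delta> n = g n - g (Suc n)" for n
  have g: "g \<longlonglongrightarrow> 0" "0 < g k" for k unfolding g_def using Q Suc_powr_tendsto_0[of "-Q"] by simp_all
  have \<delta>: "0 < \<delta> k" for k using Q by (simp add: \<delta>_def g_def powr_less_mono2_neg)
  have dl: "(\<lambda>n. \<delta> n * real (Suc n) powr (Q + 1)) \<longlonglongrightarrow> Q" unfolding \<delta>_def g_def by real_asymp
  have "(\<lambda>n. (r n / real (Suc n) powr (-\<gamma>))\<^sup>2 / (\<delta> n * real (Suc n) powr (Q + 1))) \<longlonglongrightarrow> c\<^sup>2 / Q"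
    using Q by (intro tendsto_intros r dl) auto
  moreover have "(r n / real (Suc n) powr (-\<gamma>))\<^sup>2 / (\<delta> n * real (Suc n) powr (Q + 1)) = (r n)\<^sup>2 / \<delta> n" for n
  proof -
    have "(real (Suc n) powr (-\<gamma>))\<^sup>2 * real (Suc n) powr (Q + 1) = 1"
      by (simp add: power2_eq_square powr_add[symmetric] Q_def del: of_nat_Suc)
    then have "(real (Suc n) powr (-\<gamma>))\<^sup>2 * (\<delta> n * real (Suc n) powr (Q + 1)) = \<delta> n"
      by (metis mult.left_commute mult.right_neutral)
    then show ?thesis by (simp only: power_divide divide_divide_eq_left)
  qed
  ultimately have ratio: "(\<lambda>n. (r n)\<^sup>2 / \<delta> n) \<longlonglongrightarrow> c\<^sup>2 / Q" by simp
  note T = tail_sum_asymptotics[OF ratio \<delta>_def \<delta> g]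
  show "summable (\<lambda>k. (r k)\<^sup>2)" by (rule T(1))
  have 1: "(\<lambda>n. real n powr Q / real (Suc n) powr Q) \<longlonglongrightarrow> 1" by real_asymp
  have "(\<lambda>n. (real n powr Q / real (Suc n) powr Q) * (((\<Sum>k. (r k)\<^sup>2) - (\<Sum>k<n. (r k)\<^sup>2)) / g n)) \<longlonglongrightarrow> 1 * (c\<^sup>2 / Q)"
    by (intro tendsto_mult 1 T(2))
  moreover have "(real n powr Q / real (Suc n) powr Q) * (X / g n) = real n powr Q * X" for n X
    by (simp add: g_def powr_minus divide_simps del: of_nat_Suc)
  ultimately show "(\<lambda>n. real n powr (2 * \<gamma> - 1) * ((\<Sum>k. (r k)\<^sup>2) - (\<Sum>k<n. (r k)\<^sup>2))) \<longlonglongrightarrow> c\<^sup>2 / (2 * \<gamma> - 1)"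
    by (simp add: Q_def)
qed

text \<open>Only the leading coefficient is kept: after division by the main order the error is of
  order \<open>n powr (-\<gamma>)\<close>.\<close>

lemma bigo_powr_imp_tendsto:
  fixes f :: "nat \<Rightarrow> real"
  assumes "(\<lambda>n. f n - c * real n powr (-\<gamma>)) \<in> O(\<lambda>n. real n powr (-2 * \<gamma>))" and "\<gamma> > 0"
  shows "(\<lambda>n. f (Suc n) / real (Suc n) powr (-\<gamma>)) \<longlonglongrightarrow> c"
proof -
  obtain K where "\<forall>\<^sub>F n in sequentially. norm (f n - c * real n powr (-\<gamma>)) \<le> K * norm (real n powr (-2 * \<gamma>))"
    using landau_o.bigE[OF assms(1)] by blast
  then have "\<forall>\<^sub>F n in sequentially. norm (f (Suc n) - c * real (Suc n) powr (-\<gamma>)) \<le> K * norm (real (Suc n) powr (-2 * \<gamma>))"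
    by (subst eventually_sequentially_Suc)
  then have ev: "\<forall>\<^sub>F n in sequentially. norm (f (Suc n) / real (Suc n) powr (-\<gamma>) - c) \<le> K * real (Suc n) powr (-\<gamma>)"
  proof eventually_elim
    case (elim n)
    let ?e = "real (Suc n) powr (-\<gamma>)"
    have e: "?e > 0" by simp
    have ee: "real (Suc n) powr (-2 * \<gamma>) = ?e * ?e" by (simp add: powr_add[symmetric] del: of_nat_Suc)
    have "norm (f (Suc n) / ?e - c) = norm (f (Suc n) - c * ?e) / ?e"
    proof -
      have "f (Suc n) / ?e - c = (f (Suc n) - c * ?e) / ?e" using e by (simp add: diff_divide_distrib)
      then show ?thesis unfolding real_norm_def using abs_of_pos[OF e] by (simp only: abs_divide)
    qed
    also have "\<dots> \<le> K * (?e * ?e) / ?e" using elim e unfolding ee by (intro divide_right_mono) (auto simp: abs_mult simp del: of_nat_Suc)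
    also have "\<dots> = K * ?e" using e by simp
    finally show ?case .
  qed
  have "(\<lambda>n. K * real (Suc n) powr (-\<gamma>)) \<longlonglongrightarrow> K * 0" by (intro tendsto_intros Suc_powr_tendsto_0) (use assms in auto)
  then have "(\<lambda>n. f (Suc n) / real (Suc n) powr (-\<gamma>) - c) \<longlonglongrightarrow> 0" by (intro Lim_null_comparison[OF ev]) simp
  then show ?thesis by (simp add: LIM_zero_iff)
qed

text \<open>For \<open>k \<ge> n\<close> the scale at \<open>n\<close> is at most the scale at
  \<open>k + 1\<close>, where smallness of \<open>r k\<close> is already known.\<close>

lemma scaled_uniformly_small:
  fixes r :: "nat \<Rightarrow> real"
  assumes r: "(\<lambda>n. r n / real (Suc n) powr (-\<gamma>)) \<longlonglongrightarrow> c" and r0: "\<And>n. 0 \<le> r n" and \<kappa>: "0 \<le> \<kappa>" "\<kappa> < \<gamma>" and "\<epsilon> > 0"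
  shows "\<forall>\<^sub>F n in sequentially. \<forall>k\<ge>n. real n powr \<kappa> * r k \<le> \<epsilon>"
proof -
  have "(\<lambda>n. (r n / real (Suc n) powr (-\<gamma>)) * real (Suc n) powr (\<kappa> - \<gamma>)) \<longlonglongrightarrow> c * 0"
    by (intro tendsto_mult r Suc_powr_tendsto_0) (use \<kappa> in simp)
  moreover have "(r n / real (Suc n) powr (-\<gamma>)) * real (Suc n) powr (\<kappa> - \<gamma>) = real (Suc n) powr \<kappa> * r n" for n
    unfolding diff_conv_add_uminus powr_add by (simp del: of_nat_Suc)
  ultimately have "(\<lambda>n. real (Suc n) powr \<kappa> * r n) \<longlonglongrightarrow> 0" by simp
  from LIMSEQ_D[OF this \<open>\<epsilon> > 0\<close>] obtain N where N: "\<And>k. k \<ge> N \<Longrightarrow> \<bar>real (Suc k) powr \<kappa> * r k\<bar> < \<epsilon>" by auto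
  have "\<forall>k\<ge>n. real n powr \<kappa> * r k \<le> \<epsilon>" if "n \<ge> N" for n
  proof (intro allI impI)
    fix k assume "n \<le> k"
    have "real n powr \<kappa> * r k \<le> real (Suc k) powr \<kappa> * r k"
      using \<open>n \<le> k\<close> \<kappa> by (intro mult_right_mono powr_mono2 r0) auto
    then show "real n powr \<kappa> * r k \<le> \<epsilon>" using N[of k] \<open>n \<ge> N\<close> \<open>n \<le> k\<close> by linarith
  qed
  then show ?thesis unfolding eventually_sequentially by blast
qed

section \<open>Algebra of the limiting covariances\<close>

text \<open>On the left is the fixed point of the mixed recursion with that of the first block
  inserted, on the right the closed form of \<open>S12\<close>. Over a common denominator the
  numerator collapses by \<open>(1 - y) * c + d = c * x + c - 1\<close>.\<close>

lemma S12_identity: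
  fixes c q x y g :: complex
  assumes "c * x + c * y - 1 \<noteq> 0" "c * x + q - 1 \<noteq> 0"
  shows "(q * (1 - y) * (c * c * g / (c * x + c * y - 1)) + c * q * g) / (c * x + q - 1)
    = c * q * (c * x + c - 1) / ((c * x + c * y - 1) * (c * x + q - 1)) * g"
proof -
  define d where "d = c * x + c * y - 1"
  have d: "d \<noteq> 0" using assms(1) by (simp add: d_def)
  have "q * (1 - y) * (c * c * g / d) + c * q * g = c * q * g * ((1 - y) * c / d + 1)"
    by (simp add: algebra_simps)
  also have "(1 - y) * c / d + 1 = ((1 - y) * c + d) / d" using d by (simp add: add_divide_distrib)
  also have "(1 - y) * c + d = c * x + c - 1" by (simp add: d_def algebra_simps)
  finally have "q * (1 - y) * (c * c * g / d) + c * q * g = c * q * (c * x + c - 1) * g / d" by (simp add: mult_ac)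
  then show ?thesis unfolding d_def[symmetric] by (simp only: times_divide_eq_left divide_divide_eq_left)
qed

lemma S22_identity:
  fixes c q x y g :: complex
  assumes "c * x + c * y - 1 \<noteq> 0" "c * x + q - 1 \<noteq> 0" "c * y + q - 1 \<noteq> 0" "2 * q - 1 \<noteq> 0"
  shows "(q * ((1 - x) * (c * q * (c * x + c - 1) / ((c * x + c * y - 1) * (c * x + q - 1)) * g)
      + (1 - y) * (c * q * (c * y + c - 1) / ((c * x + c * y - 1) * (c * y + q - 1)) * g)) + q * q * g) / (2 * q - 1)
    = q\<^sup>2 * ((c ^ 3 * (x + y) + 2 * c\<^sup>2 * q * (x * y + 1) - c\<^sup>2 * (x * y + x + y + 2)
         + (c * (q - 1)\<^sup>2 * (x + y) - (2 * c + q - 1) * (q - 1)))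
        / ((2 * q - 1) * (c * (x + y) - 1) * (c * x + q - 1) * (c * y + q - 1))) * g"
proof -
  define d1 where "d1 = c * x + c * y - 1"
  define d2 where "d2 = c * x + q - 1"
  define d3 where "d3 = c * y + q - 1"
  define d4 where "d4 = 2 * q - 1"
  have d: "d1 \<noteq> 0" "d2 \<noteq> 0" "d3 \<noteq> 0" "d4 \<noteq> 0" using assms by (simp_all add: d1_def d2_def d3_def d4_def)
  have e: "c * (x + y) - 1 = d1" by (simp add: d1_def algebra_simps)
  \<comment> \<open>Bringing the three fractions to one denominator leaves this polynomial identity;
    it is where \<open>A_coeff\<close> and \<open>B_coeff\<close> come from.\<close>
  have key: "(1 - x) * c * (c * x + c - 1) * d3 + (1 - y) * c * (c * y + c - 1) * d2 + d1 * d2 * d3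
     = c ^ 3 * (x + y) + 2 * c\<^sup>2 * q * (x * y + 1) - c\<^sup>2 * (x * y + x + y + 2) + (c * (q - 1)\<^sup>2 * (x + y) - (2 * c + q - 1) * (q - 1))"
    unfolding d1_def d2_def d3_def by (simp add: algebra_simps power2_eq_square power3_eq_cube)
  define N1 where "N1 = (1 - x) * c * (c * x + c - 1)"
  define N2 where "N2 = (1 - y) * c * (c * y + c - 1)"
  define P where "P = d1 * d2 * d3"
  have P: "P \<noteq> 0" using d by (simp add: P_def)
  have h: "N1 / (d1 * d2) = N1 * d3 / P" "N2 / (d1 * d3) = N2 * d2 / P" using d by (simp_all add: P_def)
  have "q * ((1 - x) * (c * q * (c * x + c - 1) / (d1 * d2) * g) + (1 - y) * (c * q * (c * y + c - 1) / (d1 * d3) * g)) + q * q * g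
    = q * q * g * (N1 / (d1 * d2) + N2 / (d1 * d3) + 1)"
    by (simp add: N1_def N2_def distrib_left mult_ac)
  also have "N1 / (d1 * d2) + N2 / (d1 * d3) + 1 = (N1 * d3 + N2 * d2 + P) / P"
    unfolding h using P by (simp add: add_divide_distrib)
  finally have "(q * ((1 - x) * (c * q * (c * x + c - 1) / (d1 * d2) * g) + (1 - y) * (c * q * (c * y + c - 1) / (d1 * d3) * g)) + q * q * g) / d4
     = q\<^sup>2 * ((N1 * d3 + N2 * d2 + P) / (d4 * d1 * d2 * d3)) * g"
    by (simp add: power2_eq_square P_def mult_ac)
  then have "(q * ((1 - x) * (c * q * (c * x + c - 1) / (d1 * d2) * g) + (1 - y) * (c * q * (c * y + c - 1) / (d1 * d3) * g)) + q * q * g) / d4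
     = q\<^sup>2 * (((1 - x) * c * (c * x + c - 1) * d3 + (1 - y) * c * (c * y + c - 1) * d2 + d1 * d2 * d3) / (d4 * d1 * d2 * d3)) * g"
    unfolding N1_def N2_def P_def .
  then show ?thesis unfolding key e d1_def[symmetric] d2_def[symmetric] d3_def[symmetric] d4_def[symmetric] .
qed

text \<open>Entries with exactly one index \<iota>: one of the two mixed covariances vanishes, and
  the fresh noise is \<open>s n * (s n - r n)\<close>, which explains
  \<open>q * q - c * q\<close>.\<close>

lemma S22_identity_first:
  fixes c q x g :: complex
  assumes "c * x + q - 1 \<noteq> 0" "2 * q - 1 \<noteq> 0"
  shows "(q * ((1 - x) * (c * (q - c) / (c * x + q - 1) * g)) + (q * q - c * q) * g) / (2 * q - 1)
    = q * (q - c) * (c + q - 1) / ((c * x + q - 1) * (2 * q - 1)) * g"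
proof -
  define d where "d = c * x + q - 1"
  have d0: "d \<noteq> 0" using assms by (simp add: d_def)
  have "q * ((1 - x) * (c * (q - c) / d * g)) + (q * q - c * q) * g = q * (q - c) * ((1 - x) * c + d) * g / d"
  proof -
    have "q * ((1 - x) * (c * (q - c) / d * g)) + (q * q - c * q) * g = q * (q - c) * g * ((1 - x) * c / d + 1)"
      unfolding divide_inverse by algebra
    also have "(1 - x) * c / d + 1 = ((1 - x) * c + d) / d" using d0 by (simp add: add_divide_distrib)
    also have "k * g * (E / d) = k * E * g / d" for k E by simp
    finally show ?thesis .
  qed
  also have "(1 - x) * c + d = c + q - 1" by (simp add: d_def algebra_simps)
  finally show ?thesis unfolding d_def[symmetric] by (simp only: times_divide_eq_left divide_divide_eq_left)
qed

section \<open>The five regimes\<close>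

context spectral_data begin

text \<open>The \<open>lam i\<close> exhaust the spectrum: an eigenvector has a nonzero pairing with
  some left eigenvector, whose eigenvalue it must share. The extremal eigenvalue of the hypothesis
  is thus one of them.\<close>

lemma eigenvalue_imp_lam:
  assumes "is_eigenvalue (cmat W) z"
  obtains i where "z = lam i"
proof -
  obtain x where x: "x \<noteq> 0" "cmat W *v x = z *s x" using assms by (auto simp: is_eigenvalue_def)
  define y where "y = transpose U *v x"
  have "V *v y = x" by (simp add: y_def matrix_vector_mul_assoc VU del: transpose_matrix_vector)
  then obtain i where i: "y $ i \<noteq> 0" using x(1) by (metis matrix_vector_mult_0_right vec_eq_iff zero_index)
  have y: "y $ i = (\<Sum>h\<in>UNIV. U $ h $ i * x $ h)" by (simp add: y_def matrix_vector_mult_def transpose_def del: transpose_matrix_vector)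
  have wx: "(\<Sum>j\<in>UNIV. W $ h $ j * x $ j) = z * x $ h" for h
    using arg_cong[OF x(2), of "\<lambda>x. x $ h"] by (simp add: matrix_vector_mult_def map_matrix_def)
  have "z * y $ i = (\<Sum>h\<in>UNIV. U $ h $ i * (\<Sum>j\<in>UNIV. W $ h $ j * x $ j))"
    unfolding wx y sum_distrib_left by (simp add: mult.left_commute)
  also have "\<dots> = (\<Sum>j\<in>UNIV. (\<Sum>h\<in>UNIV. W $ h $ j * U $ h $ i) * x $ j)"
    unfolding sum_distrib_left sum_distrib_right by (subst sum.swap) (simp add: mult_ac)
  also have "\<dots> = lam i * y $ i" unfolding left_eigenvector y by (simp add: sum_distrib_left mult.assoc)
  finally show ?thesis using i that by simp
qed

text \<open>At \<open>\<gamma> = 1\<close> this beats the growth of every scale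
  \<open>n powr p\<close> with \<open>p \<le> 1\<close>, as covariances contract at the sum of two
  such rates.\<close>

lemma spectral_gap:
  assumes "is_eigenvalue (cmat W) z" "z \<noteq> 1" "\<And>z'. is_eigenvalue (cmat W) z' \<Longrightarrow> z' \<noteq> 1 \<Longrightarrow> Re z' \<le> Re z"
    and c: "c > 1 / (2 * (1 - Re z))" and i: "i \<noteq> \<iota>"
  shows "1 / 2 < c * Re (1 - lam i)"
proof -
  obtain k where k: "z = lam k" using eigenvalue_imp_lam[OF assms(1)] .
  then have "k \<noteq> \<iota>" using assms(2) lam_\<iota> by auto
  then have g: "0 < 1 - Re z" using Re_lam_less_1 k by simp
  have "1 / 2 < c * (1 - Re z)" using c g by (simp add: field_simps)
  moreover have "Re (lam i) \<le> Re z" using i by (intro assms lam_eigenvalue) (use lam_eq_1 in auto)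
  moreover have "0 < c" using c g by (meson divide_pos_pos less_trans mult_pos_pos zero_less_numeral zero_less_one)
  ultimately have "1 / 2 < c * (1 - Re z)" "c * (1 - Re z) \<le> c * (1 - Re (lam i))" by (auto intro: mult_left_mono)
  then show ?thesis by simp
qed

end

context reinforced_processes begin

text \<open>The complex matrix \<open>T\<close> is a limit of rescaled real matrices
  \<open>Cn n\<close>, so its imaginary part vanishes, whatever complex eigenvectors are used to
  write it.\<close>

theorem normal_limit_of_blocks:
  assumes EL: "eigen_filter_limit r s \<alpha> \<iota> V Zc Nc \<gamma> \<nu> c q p A B C"
    and summ: "summable (\<lambda>k. (r k)\<^sup>2)"
    and tail: "(\<lambda>n. real n powr p * ((\<Sum>k. (r k)\<^sup>2) - (\<Sum>k<n. (r k)\<^sup>2))) \<longlonglongrightarrow> \<tau>"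
    and small: "\<And>\<epsilon>. \<epsilon> > 0 \<Longrightarrow> \<forall>\<^sub>F n in sequentially. \<forall>k\<ge>n. real n powr (p / 2) * r k \<le> \<epsilon>"
    and ZZ: "\<And>i j. (\<lambda>n. real n powr p * cov (Zc i) (Zc j) n) \<longlonglongrightarrow> S1 $ i $ j"
    and ZN: "\<And>i j. (\<lambda>n. real n powr p * cov (Zc i) (Nc j) n) \<longlonglongrightarrow> S2 $ i $ j"
    and NN: "\<And>i j. (\<lambda>n. real n powr p * cov (Nc i) (Nc j) n) \<longlonglongrightarrow> S4 $ i $ j"
  shows "converges_stably_to_normal M (\<lambda>n \<omega>. (real n powr (p / 2)) *\<^sub>R (Y n \<omega> - vec (Zinf \<omega>)))
    (\<lambda>\<omega>. v \<omega> *\<^sub>R (block_matrix (U ** S1 ** transpose U) (U ** S2 ** transpose U) (U ** transpose S2 ** transpose U) (U ** S4 ** transpose U)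
       + (\<tau> * (norm vr)\<^sup>2) *\<^sub>R ones_matrix))"
proof -
  define T where "T = block_matrix (U ** S1 ** transpose U) (U ** S2 ** transpose U) (U ** transpose S2 ** transpose U) (U ** S4 ** transpose U)"
  have NZ: "(\<lambda>n. real n powr p * cov (Nc i) (Zc j) n) \<longlonglongrightarrow> transpose S2 $ i $ j" for i j
    using ZN[of j i] by (subst cov_sym) (simp add: transpose_def)
  have gen: "(\<lambda>n. complex_of_real (real n powr p) * (\<Sum>i\<in>UNIV. \<Sum>j\<in>UNIV. U $ h $ i * U $ h' $ j * f i j n)) \<longlonglongrightarrow> (U ** S ** transpose U) $ h $ h'"
    if "\<And>i j. (\<lambda>n. real n powr p * f i j n) \<longlonglongrightarrow> S $ i $ j" for f :: "'n \<Rightarrow> 'n \<Rightarrow> nat \<Rightarrow> complex" and S h h'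
  proof -
    have "(\<lambda>n. \<Sum>i\<in>UNIV. \<Sum>j\<in>UNIV. U $ h $ i * U $ h' $ j * (real n powr p * f i j n)) \<longlonglongrightarrow> (U ** S ** transpose U) $ h $ h'"
      unfolding block_entry by (intro tendsto_intros that)
    then show ?thesis by (simp add: sum_distrib_left mult_ac)
  qed
  have T: "(\<lambda>n. complex_of_real (real n powr p * Cn n $ x $ y)) \<longlonglongrightarrow> T $ x $ y" for x y
    by (cases x; cases y) (auto simp: Cn_blocks T_def block_matrix_def stack_def intro!: gen ZZ ZN NN NZ)
  define S where "S = (\<chi> x y. Re (T $ x $ y))"
  have S: "(\<lambda>n. real n powr p * Cn n $ x $ y) \<longlonglongrightarrow> S $ x $ y" for x y
    using tendsto_Re[OF T[of x y]] by (simp add: S_def)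
  have "Im (T $ x $ y) = 0" for x y
    using LIMSEQ_unique[OF tendsto_Im[OF T[of x y]]] by simp
  then have "cmat S = T" by (simp add: S_def vec_eq_iff map_matrix_def complex_eq_iff)
  then show ?thesis using converges_stably_to_normalI[OF EL S summ tail small] unfolding T_def by simp
qed

text \<open>Only the entry with both indices \<iota> is nonzero, and the constant column \<iota> of
  \<open>U\<close> spreads it as the all-ones matrix divided by \<open>CARD('n)\<close>. The factors
  0 and 1 are values of \<open>B\<close> and \<open>C\<close>, kept to match an instance of
  \<open>normal_limit_separated\<close>.\<close>

lemma first_block:
  fixes c e q :: real
  shows "block_matrix 0 0 0 (U ** (\<chi> i j. of_real (q * q * 0 + (if i = \<iota> \<and> j = \<iota> then c * c * 1 else 0)) * vprod V i j / of_real e) ** transpose U)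
    = ((norm (column \<iota> V))\<^sup>2 * c\<^sup>2 / (real CARD('n) * e)) *\<^sub>R block_matrix 0 0 0 (ones_matrix :: complex^'n^'n)"
proof -
  have "(\<Sum>i\<in>UNIV. \<Sum>j\<in>UNIV. U $ h $ i * U $ h' $ j * (of_real (if i = \<iota> \<and> j = \<iota> then c * c else 0) * vprod V i j / of_real e))
    = U $ h $ \<iota> * U $ h' $ \<iota> * (of_real (c * c) * vprod V \<iota> \<iota> / of_real e)" for h h'
  proof -
    have "(\<Sum>j\<in>UNIV. U $ h $ i * U $ h' $ j * (of_real (if i = \<iota> \<and> j = \<iota> then c * c else 0) * vprod V i j / of_real e))
      = (if i = \<iota> then U $ h $ \<iota> * U $ h' $ \<iota> * (of_real (c * c) * vprod V \<iota> \<iota> / of_real e) else 0)" for i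
      by (subst sum.remove[of _ \<iota>]) (auto intro!: sum.neutral)
    then show ?thesis by simp
  qed
  moreover have "U $ h $ \<iota> * U $ h' $ \<iota> * (of_real (c * c) * vprod V \<iota> \<iota> / of_real e)
    = complex_of_real ((norm (column \<iota> V))\<^sup>2 * c\<^sup>2 / (real CARD('n) * e))" for h h'
  proof -
    have "1 / sqrt (real CARD('n)) * (1 / sqrt (real CARD('n))) * (c * c * (norm (column \<iota> V))\<^sup>2 / e)
      = (norm (column \<iota> V))\<^sup>2 * c\<^sup>2 / (real CARD('n) * e)"
      by (simp add: power2_eq_square mult_ac)
    then show ?thesis unfolding U_\<iota>_nth vprod_\<iota>\<iota> by (simp only: of_real_mult[symmetric] of_real_divide[symmetric])
  qed
  ultimately show ?thesis unfolding mult_1_right mult_zero_right add_0_left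
    by (simp add: vec_eq_iff block_matrix_def stack_def block_entry ones_matrix_def scaleR_conv_of_real[symmetric] split: sum.split)
      (simp add: scaleR_conv_of_real)
qed

context
  fixes \<gamma> \<nu> c q :: real
  assumes range: "1 / 2 < \<gamma>" "\<gamma> \<le> 1" "1 / 2 < \<nu>" "\<nu> \<le> 1" "0 < c" "0 < q"
    and r_lim: "(\<lambda>n. r n / real (Suc n) powr (-\<gamma>)) \<longlonglongrightarrow> c"
    and s_lim: "(\<lambda>n. s n / real (Suc n) powr (-\<nu>)) \<longlonglongrightarrow> q"
    and gap: "\<And>i. i \<noteq> \<iota> \<Longrightarrow> \<gamma> = 1 \<Longrightarrow> 1 / 2 < c * Re (\<alpha> i)"
    and q_half: "\<nu> = 1 \<Longrightarrow> 1 / 2 < q"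
begin

lemma eigen_filter_limitI:
  assumes p: "p \<le> 1" "p < 2 * \<nu>"
    and A: "(\<lambda>n. real (Suc n) powr (p - \<gamma>)) \<longlonglongrightarrow> A"
      "(\<lambda>n. real (Suc n) powr (p - max \<gamma> \<nu>)) \<longlonglongrightarrow> A" "(\<lambda>n. real (Suc n) powr (p - 2 * \<gamma> + min \<gamma> \<nu>)) \<longlonglongrightarrow> A"
    and B: "(\<lambda>n. real (Suc n) powr (p - \<nu>)) \<longlonglongrightarrow> B"
    and C: "(\<lambda>n. real (Suc n) powr (p - 2 * \<gamma> + \<nu>)) \<longlonglongrightarrow> C"
  shows "eigen_filter_limit r s \<alpha> \<iota> V Zc Nc \<gamma> \<nu> c q p A B C"
proof
  show "0 < Re (\<alpha> i)" if "i \<noteq> \<iota>" for i using Re_lam_less_1[OF that] by (simp add: \<alpha>_def)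
  show "p < 2 * (c * Re (\<alpha> i))" if "i \<noteq> \<iota>" "\<gamma> = 1" for i using gap[OF that] p by simp
  show "p < 2 * q" if "\<nu> = 1" using q_half[OF that] p by simp
qed (use range p r_lim s_lim A B C in simp_all)

lemma tail_limit:
  assumes "(\<lambda>n. real n powr (p - (2 * \<gamma> - 1))) \<longlonglongrightarrow> t"
  shows "(\<lambda>n. real n powr p * ((\<Sum>k. (r k)\<^sup>2) - (\<Sum>k<n. (r k)\<^sup>2))) \<longlonglongrightarrow> t * (c\<^sup>2 / (2 * \<gamma> - 1))"
proof -
  have "real n powr (p - (2 * \<gamma> - 1)) * (real n powr (2 * \<gamma> - 1) * x) = real n powr p * x" for n x
    by (simp only: mult.assoc[symmetric] powr_add[symmetric]) simp
  with tendsto_mult[OF assms power_tail_sum(2)[OF r_lim range(1)]] show ?thesis by simp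
qed

lemma r_uniformly_small:
  assumes "0 \<le> p" "p \<le> 1" "\<epsilon> > 0"
  shows "\<forall>\<^sub>F n in sequentially. \<forall>k\<ge>n. real n powr (p / 2) * r k \<le> \<epsilon>"
  by (rule scaled_uniformly_small[OF r_lim]) (use assms range r_range less_imp_le in auto)

text \<open>With \<open>A = 0\<close> every covariance involving the first block vanishes in the
  limit. What remains is the second block with noise weights \<open>B\<close> and \<open>C\<close>,
  and the future with weight \<open>t\<close>; the regimes (a), (b), (c) and (e) are distinguished
  by \<open>p\<close> and these three values.\<close>

theorem normal_limit_separated:
  assumes p: "0 \<le> p" "p \<le> 1" "p < 2 * \<nu>"
    and A: "p < \<gamma>" "p - 2 * \<gamma> + min \<gamma> \<nu> < 0"
    and B: "(\<lambda>n. real (Suc n) powr (p - \<nu>)) \<longlonglongrightarrow> B"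
    and C: "(\<lambda>n. real (Suc n) powr (p - 2 * \<gamma> + \<nu>)) \<longlonglongrightarrow> C"
    and t: "(\<lambda>n. real n powr (p - (2 * \<gamma> - 1))) \<longlonglongrightarrow> t"
  shows "converges_stably_to_normal M (\<lambda>n \<omega>. (real n powr (p / 2)) *\<^sub>R (Y n \<omega> - vec (Zinf \<omega>)))
    (\<lambda>\<omega>. v \<omega> *\<^sub>R (block_matrix 0 0 0 (U ** (\<chi> i j. of_real (q * q * B + (if i = \<iota> \<and> j = \<iota> then c * c * C else 0)) * vprod V i j
          / of_real (2 * q - (if \<nu> = 1 then p else 0))) ** transpose U)
       + t *\<^sub>R Sigma_tilde \<gamma> c V \<iota>))"
proof -
  have EL: "eigen_filter_limit r s \<alpha> \<iota> V Zc Nc \<gamma> \<nu> c q p 0 B C"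
    by (intro eigen_filter_limitI Suc_powr_tendsto_0 p B C) (use A in auto)
  interpret L: eigen_filter_limit r s \<alpha> \<iota> V Zc Nc \<gamma> \<nu> c q p 0 B C by (rule EL)
  have 0: "L.LZZ i j = 0" "L.LZN i j = 0" for i j by (simp_all add: L.LZZ_def L.LZN_def)
  have NN: "L.LNN i j = (\<chi> i j. of_real (q * q * B + (if i = \<iota> \<and> j = \<iota> then c * c * C else 0)) * vprod V i j
          / of_real (2 * q - (if \<nu> = 1 then p else 0))) $ i $ j" for i j
    by (simp add: L.LNN_def 0 L.h\<rho>_def)
  have z: "block_matrix (U ** 0 ** transpose U) (U ** 0 ** transpose U) (U ** transpose 0 ** transpose U) X = block_matrix 0 0 0 X" for X
    by (simp add: vec_eq_iff block_matrix_def stack_def matrix_matrix_mult_def transpose_def split: sum.split)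
  have T: "(t * (c\<^sup>2 / (2 * \<gamma> - 1)) * (norm vr)\<^sup>2) *\<^sub>R ones_matrix = t *\<^sub>R Sigma_tilde \<gamma> c V \<iota>"
    by (simp add: Sigma_tilde_def sigma_tilde_sq_def norm_V_\<iota> mult_ac)
  show ?thesis
    using normal_limit_of_blocks[OF EL power_tail_sum(1)[OF r_lim range(1)] tail_limit[OF t] r_uniformly_small[OF p(1,2)], of 0 0,
        OF _ _ _ L.cov_NN_lim[unfolded NN]]
      L.cov_ZZ_lim L.cov_ZN_lim unfolding z T 0 by simp
qed

text \<open>All noise exponents vanish at \<open>p = 1\<close>, so every noise term survives, and
  all net rates are shifted by 1.\<close>

theorem normal_limit_critical:
  assumes eq: "\<gamma> = 1" "\<nu> = 1"
  shows "converges_stably_to_normal M (\<lambda>n \<omega>. (real n powr (1 / 2)) *\<^sub>R (Y n \<omega> - vec (Zinf \<omega>)))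
    (\<lambda>\<omega>. v \<omega> *\<^sub>R (block_matrix
       (U ** S11 (of_real c) \<alpha> V \<iota> ** transpose U)
       (U ** S12 (of_real c) (of_real q) \<alpha> V \<iota> ** transpose U)
       (U ** transpose (S12 (of_real c) (of_real q) \<alpha> V \<iota>) ** transpose U)
       (U ** S22 (of_real c) (of_real q) \<alpha> V \<iota> ** transpose U)
       + Sigma_tilde 1 c V \<iota>))"
proof -
  have EL: "eigen_filter_limit r s \<alpha> \<iota> V Zc Nc \<gamma> \<nu> c q 1 1 1 1"
    by (rule eigen_filter_limitI) (use eq in simp_all)
  interpret L: eigen_filter_limit r s \<alpha> \<iota> V Zc Nc \<gamma> \<nu> c q 1 1 1 1 by (rule EL)
  let ?c = "complex_of_real c" and ?q = "complex_of_real q"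
  have ca: "1 / 2 < c * Re (\<alpha> i)" if "i \<noteq> \<iota>" for i using gap that eq by simp
  have q: "1 / 2 < q" using q_half eq by simp
  \<comment> \<open>Each of the two summands has real part above one half, so their sum cannot be 1;
    the same reason serves for the next two denominators.\<close>
  have d1: "?c * \<alpha> i + ?c * \<alpha> j - 1 \<noteq> 0" if "i \<noteq> \<iota>" "j \<noteq> \<iota>" for i j
    using ca[OF that(1)] ca[OF that(2)] by (auto simp: complex_eq_iff)
  have d2: "?c * \<alpha> i + ?q - 1 \<noteq> 0" if "i \<noteq> \<iota>" for i
    using ca[OF that(1)] q by (auto simp: complex_eq_iff)
  have d4: "2 * ?q - 1 \<noteq> 0" using q by (auto simp: complex_eq_iff)
  have a\<iota>: "\<alpha> \<iota> = 0" by (simp add: \<alpha>_def lam_\<iota>)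
  have vsym: "vprod V i j = vprod V j i" for i j by (simp add: scalar_product_def mult.commute)
  have ZZ: "L.LZZ i j = S11 ?c \<alpha> V \<iota> $ i $ j" for i j
    unfolding L.LZZ_def S11_def L.h\<rho>_def by (simp add: eq power2_eq_square distrib_left)
  have ZN: "L.LZN i j = S12 ?c ?q \<alpha> V \<iota> $ i $ j" for i j
  proof (cases "i = \<iota> \<or> j = \<iota>")
    case True
    then show ?thesis
      unfolding L.LZN_def L.LZZ_def S12_def L.h\<rho>_def L.rhat_def L.shat_def by (auto simp: eq right_diff_distrib)
  next
    case False
    then show ?thesis using S12_identity[OF d1[of i j] d2[of i], of "vprod V i j"]
      unfolding L.LZN_def L.LZZ_def S12_def L.h\<rho>_def L.rhat_def L.shat_def by (simp add: eq)
  qed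
  have NN: "L.LNN i j = S22 ?c ?q \<alpha> V \<iota> $ i $ j" for i j
  proof -
    have f: "L.LNN i j = (?q * ((1 - \<alpha> i) * S12 ?c ?q \<alpha> V \<iota> $ i $ j + (1 - \<alpha> j) * S12 ?c ?q \<alpha> V \<iota> $ j $ i) +
      of_real (q * q - (if i = \<iota> then c * q else 0) - (if j = \<iota> then c * q else 0) + (if i = \<iota> \<and> j = \<iota> then c * c else 0)) * vprod V i j) / (2 * ?q - 1)"
      unfolding L.LNN_def ZN L.h\<rho>_def by (simp add: eq)
    consider "i = \<iota>" "j = \<iota>" | "i \<noteq> \<iota>" "j = \<iota>" | "i = \<iota>" "j \<noteq> \<iota>" | "i \<noteq> \<iota>" "j \<noteq> \<iota>" by auto
    then show ?thesis
    proof cases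
      case 1
      then show ?thesis unfolding f by (simp add: S12_def S22_def vprod_\<iota>\<iota> power2_eq_square algebra_simps)
    next
      case 2
      then show ?thesis using S22_identity_first[OF d2[of i] d4, of "vprod V i \<iota>"] unfolding f by (simp add: S12_def S22_def)
    next
      case 3
      then show ?thesis using S22_identity_first[OF d2[of j] d4, of "vprod V j \<iota>"] unfolding f by (simp add: S12_def S22_def vsym[of \<iota>])
    next
      case 4
      then show ?thesis using S22_identity[OF d1[of i j] d2[of i] d2[of j] d4, of "vprod V i j"] unfolding f
        by (simp add: S12_def S22_def A_coeff_def B_coeff_def vsym[of j i] add.commute[of "?c * \<alpha> j" "?c * \<alpha> i"])
    qed
  qed
  have t: "(\<lambda>n. real n powr (1 - (2 * \<gamma> - 1))) \<longlonglongrightarrow> 1"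
    by (rule tendsto_eventually, rule eventually_sequentiallyI[of 1]) (simp add: eq)
  have T: "(1 * (c\<^sup>2 / (2 * \<gamma> - 1)) * (norm vr)\<^sup>2) *\<^sub>R ones_matrix = Sigma_tilde 1 c V \<iota>"
    by (simp add: Sigma_tilde_def sigma_tilde_sq_def norm_V_\<iota> mult_ac eq)
  show ?thesis
    using normal_limit_of_blocks[OF EL power_tail_sum(1)[OF r_lim range(1)] tail_limit[OF t] r_uniformly_small,
        OF _ _ _ L.cov_ZZ_lim[unfolded ZZ] L.cov_ZN_lim[unfolded ZN] L.cov_NN_lim[unfolded NN]]
    unfolding T by simp
qed

end

end

theorem theorem3p2:
  fixes M :: "'a measure"
    and W :: "real^'n^'n"
    and r a :: "nat \<Rightarrow> real"
    and X Z :: "nat \<Rightarrow> 'n::finite \<Rightarrow> 'a \<Rightarrow> real"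
    and Zinf :: "'a \<Rightarrow> real"
    and Y :: "nat \<Rightarrow> 'a \<Rightarrow> real^('n + 'n)"
    and c q \<gamma> \<nu> \<gamma>0 :: real
    and lam_star :: complex
    and \<iota> :: 'n
    and lam \<alpha> :: "'n \<Rightarrow> complex"
    and U V :: "complex^'n^'n"
  assumes "prob_space M"
    and "CARD('n) \<ge> 2"
    and W_nonneg: "\<And>h j. W $ h $ j \<ge> 0"
    and W_sum: "\<And>j. (\<Sum>h\<in>UNIV. W $ h $ j) = 1"
    and r_range: "\<And>n. 0 < r n \<and> r n < 1"
    and a_pos: "\<And>k. k \<ge> 1 \<Longrightarrow> a k > 0"
    and Z0_meas: "\<And>h. Z 0 h \<in> borel_measurable M"
    and Z0_range: "\<And>h \<omega>. \<omega> \<in> space M \<Longrightarrow> Z 0 h \<omega> \<in> {0..1}"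
    and X_meas: "\<And>n j. n \<ge> 1 \<Longrightarrow> X n j \<in> borel_measurable M"
    and X_range: "\<And>n j \<omega>. n \<ge> 1 \<Longrightarrow> \<omega> \<in> space M \<Longrightarrow> X n j \<omega> \<in> {0, 1}"
    and Z_rec: "\<And>n h \<omega>. n \<ge> 1 \<Longrightarrow> \<omega> \<in> space M \<Longrightarrow>
          Z n h \<omega> = (1 - r (n - 1)) * Z (n - 1) h \<omega> + r (n - 1) * X n h \<omega>"
    and X_indep: "\<And>n. cond_indep_vars M (hist_algebra M (Z 0) X n) borel (X (n + 1)) UNIV"
    and X_prob: "\<And>n j. AE \<omega> in M.
          real_cond_exp M (hist_algebra M (Z 0) X n) (indicator {\<omega> \<in> space M. X (n + 1) j \<omega> = 1}) \<omega>
            = (\<Sum>h\<in>UNIV. W $ h $ j * Z n h \<omega>)"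
    and A1: "irreducible_matrix W" "diagonalizable (cmat W)"
    and A2: "1/2 < \<gamma>" "\<gamma> \<le> 1" "1/2 < \<nu>" "\<nu> \<le> 1" "c > 0" "q > 0"
      "(\<lambda>n. r (n - 1) - c * real n powr (-\<gamma>)) \<in> O(\<lambda>n. real n powr (-2 * \<gamma>))"
      "(\<lambda>n. wgt a n n - q * real n powr (-\<nu>)) \<in> O(\<lambda>n. real n powr (-2 * \<nu>))"
    and A3: "is_eigenvalue (cmat W) lam_star" "lam_star \<noteq> 1"
      "\<And>z. is_eigenvalue (cmat W) z \<Longrightarrow> z \<noteq> 1 \<Longrightarrow> Re z \<le> Re lam_star"
      "\<gamma> = 1 \<Longrightarrow> c > 1 / (2 * (1 - Re lam_star))"
      "\<nu> = 1 \<Longrightarrow> q > 1/2"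
    and A4: "\<And>j. \<nu> = \<gamma> \<Longrightarrow> j \<noteq> \<iota> \<Longrightarrow> complex_of_real q \<noteq> complex_of_real c * \<alpha> j"
    and U_diag: "invertible U"
      "transpose U ** cmat W ** matrix_inv (transpose U) = diag_matrix lam"
    and U_norm: "\<And>j. norm (column j U) = 1"
    and U_orth: "\<And>i j. i \<noteq> j \<Longrightarrow> lam i = lam j \<Longrightarrow>
          (\<Sum>k\<in>UNIV. cnj (column i U $ k) * column j U $ k) = 0"
    and U_first: "lam \<iota> = 1" "column \<iota> U = vec (complex_of_real (1 / sqrt (real CARD('n))))"
    and V_def: "V = matrix_inv (transpose U)"
    and \<alpha>_def: "\<alpha> = (\<lambda>j. 1 - lam j)"
    and Zinf_meas: "Zinf \<in> borel_measurable M"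
    and Zinf_range: "\<And>\<omega>. \<omega> \<in> space M \<Longrightarrow> Zinf \<omega> \<in> {0..1}"
    and Zinf_lim: "AE \<omega> in M. \<forall>h. (\<lambda>n. Z n h \<omega>) \<longlonglongrightarrow> Zinf \<omega>"
    and Y_def: "Y = (\<lambda>n \<omega>. stack (\<chi> j. Z n j \<omega>) (\<chi> j. wgt_mean a X n j \<omega>))"
    and \<gamma>0_def: "\<gamma>0 = max (1/2) (2 * \<gamma> - 1)"
  shows
    "(1/2 < \<nu> \<and> \<nu> < \<gamma>0 \<longrightarrow>
        converges_stably_to_normal M
          (\<lambda>n \<omega>. (real n powr (\<nu> / 2)) *\<^sub>R (Y n \<omega> - vec (Zinf \<omega>)))
          (\<lambda>\<omega>. (Zinf \<omega> * (1 - Zinf \<omega>)) *\<^sub>R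
             block_matrix 0 0 0 (U ** Sq q V ** transpose U)))
   \<and> (\<gamma>0 < \<nu> \<and> \<nu> < 1 \<longrightarrow>
        converges_stably_to_normal M
          (\<lambda>n \<omega>. (real n powr (\<gamma> - 1/2)) *\<^sub>R (Y n \<omega> - vec (Zinf \<omega>)))
          (\<lambda>\<omega>. (Zinf \<omega> * (1 - Zinf \<omega>)) *\<^sub>R Sigma_tilde \<gamma> c V \<iota>))
   \<and> (\<nu> = \<gamma>0 \<and> \<gamma>0 < 1 \<longrightarrow>
        converges_stably_to_normal M
          (\<lambda>n \<omega>. (real n powr (\<gamma> - 1/2)) *\<^sub>R (Y n \<omega> - vec (Zinf \<omega>)))
          (\<lambda>\<omega>. (Zinf \<omega> * (1 - Zinf \<omega>)) *\<^sub>R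
             (Sigma_tilde \<gamma> c V \<iota> + block_matrix 0 0 0 (U ** Sq q V ** transpose U))))
   \<and> (\<nu> = \<gamma>0 \<and> \<gamma>0 = 1 \<longrightarrow>
        converges_stably_to_normal M
          (\<lambda>n \<omega>. sqrt (real n) *\<^sub>R (Y n \<omega> - vec (Zinf \<omega>)))
          (\<lambda>\<omega>. (Zinf \<omega> * (1 - Zinf \<omega>)) *\<^sub>R
             (Sigma_tilde 1 c V \<iota> +
              block_matrix
                (U ** S11 (of_real c) \<alpha> V \<iota> ** transpose U)
                (U ** S12 (of_real c) (of_real q) \<alpha> V \<iota> ** transpose U)
                (U ** transpose (S12 (of_real c) (of_real q) \<alpha> V \<iota>) ** transpose U)
                (U ** S22 (of_real c) (of_real q) \<alpha> V \<iota> ** transpose U))))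
   \<and> (\<gamma>0 < \<nu> \<and> \<nu> = 1 \<longrightarrow>
        converges_stably_to_normal M
          (\<lambda>n \<omega>. (real n powr (\<gamma> - 1/2)) *\<^sub>R (Y n \<omega> - vec (Zinf \<omega>)))
          (\<lambda>\<omega>. (Zinf \<omega> * (1 - Zinf \<omega>)) *\<^sub>R
             (Sigma_tilde \<gamma> c V \<iota> +
              ((norm (column \<iota> V))\<^sup>2 * c\<^sup>2 / (real CARD('n) * (2 * q - (2 * \<gamma> - 1)))) *\<^sub>R
                block_matrix 0 0 0 ones_matrix)))"
proof -
  interpret P: reinforced_processes M W lam U V \<iota> r a X Z Zinf
    by (intro reinforced_processes.intro spectral_data.intro reinforced_processes_axioms.intro; fact assms)
  have Y: "Y = P.Y" unfolding Y_def by (intro ext) (simp add: P.Y_def)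
  have \<alpha>: "\<alpha> = P.\<alpha>" unfolding \<alpha>_def by (intro ext) (simp add: P.\<alpha>_def)
  have r_lim: "(\<lambda>n. r n / real (Suc n) powr (-\<gamma>)) \<longlonglongrightarrow> c"
    using bigo_powr_imp_tendsto[OF A2(7)] A2(1) by simp
  have s_lim: "(\<lambda>n. P.s n / real (Suc n) powr (-\<nu>)) \<longlonglongrightarrow> q"
    using bigo_powr_imp_tendsto[OF A2(8)] A2(3) by (simp add: P.s_def)
  have gap: "1 / 2 < c * Re (P.\<alpha> i)" if "i \<noteq> \<iota>" "\<gamma> = 1" for i
    using P.spectral_gap[OF A3(1,2,3) A3(4)[OF that(2)] that(1)] by (simp add: P.\<alpha>_def)
  note separated = P.normal_limit_separated[OF A2(1-6) r_lim s_lim gap A3(5)]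
  have one: "(\<lambda>n. real n powr 0) \<longlonglongrightarrow> 1" "(\<lambda>n. real (Suc n) powr 0) \<longlonglongrightarrow> 1"
    by (rule tendsto_eventually, rule eventually_sequentiallyI[of 1], simp)+
  have zero: "(\<lambda>n. real n powr x) \<longlonglongrightarrow> 0" if "x < 0" for x
    using that by real_asymp
  have half: "\<gamma> - 1 / 2 = (2 * \<gamma> - 1) / 2" by simp
  have Sq: "(\<chi> i j. of_real (q * q * 1 + (if i = \<iota> \<and> j = \<iota> then c * c * 0 else 0)) * vprod V i j / of_real (2 * q - (if \<nu> = 1 then p else 0))) = Sq q V"
    if "\<nu> \<noteq> 1" for p
    using that A2(6) by (simp add: Sq_def vec_eq_iff)
  \<comment> \<open>Scale \<open>p = \<nu>\<close>: the noise \<open>s n * s n\<close> of the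
    weighted means survives (\<open>B = 1\<close>), while \<open>p\<close> lies below
    \<open>2 * \<gamma> - 1\<close>, so the future is invisible (\<open>t = 0\<close>).\<close>
  have a: "converges_stably_to_normal M (\<lambda>n \<omega>. (real n powr (\<nu> / 2)) *\<^sub>R (P.Y n \<omega> - vec (Zinf \<omega>)))
      (\<lambda>\<omega>. P.v \<omega> *\<^sub>R (block_matrix 0 0 0 (U ** Sq q V ** transpose U)))" if "\<nu> < 2 * \<gamma> - 1"
  proof -
    have "\<nu> \<noteq> 1" using that A2 by simp
    from separated[of \<nu> 1 0 0, unfolded Sq[OF this]] show ?thesis
      using A2 that one Suc_powr_tendsto_0[of "\<nu> - 2 * \<gamma> + \<nu>"] zero[of "\<nu> - (2 * \<gamma> - 1)"] by simp
  qed
  \<comment> \<open>Scale \<open>p = 2 * \<gamma> - 1\<close>, now below \<nu>: the noise of the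
    means vanishes (\<open>B = C = 0\<close>) and the future alone remains
    (\<open>t = 1\<close>).\<close>
  have b: "converges_stably_to_normal M (\<lambda>n \<omega>. (real n powr (\<gamma> - 1 / 2)) *\<^sub>R (P.Y n \<omega> - vec (Zinf \<omega>)))
      (\<lambda>\<omega>. P.v \<omega> *\<^sub>R Sigma_tilde \<gamma> c V \<iota>)" if "2 * \<gamma> - 1 < \<nu>" "\<nu> < 1"
  proof -
    have "(\<chi> i j. of_real (q * q * 0 + (if i = \<iota> \<and> j = \<iota> then c * c * 0 else 0)) * vprod V i j / of_real (2 * q - (if \<nu> = 1 then 2 * \<gamma> - 1 else 0))) = (0 :: complex^'n^'n)"
      by (simp add: vec_eq_iff)
    moreover have "block_matrix 0 0 0 (U ** 0 ** transpose U) = (0 :: complex^('n + 'n)^('n + 'n))"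
      by (simp add: vec_eq_iff block_matrix_def stack_def matrix_matrix_mult_def split: sum.split)
    moreover have "min \<gamma> \<nu> < 1" using that by simp
    ultimately show ?thesis unfolding half
      using separated[of "2 * \<gamma> - 1" 0 0 1] A2 that one Suc_powr_tendsto_0[of "2 * \<gamma> - 1 - \<nu>"] Suc_powr_tendsto_0[of "\<nu> - 1"] by simp
  qed
  \<comment> \<open>The two scales coincide, so both contributions survive
    (\<open>B = t = 1\<close>).\<close>
  have cc: "converges_stably_to_normal M (\<lambda>n \<omega>. (real n powr (\<gamma> - 1 / 2)) *\<^sub>R (P.Y n \<omega> - vec (Zinf \<omega>)))
      (\<lambda>\<omega>. P.v \<omega> *\<^sub>R (Sigma_tilde \<gamma> c V \<iota> + block_matrix 0 0 0 (U ** Sq q V ** transpose U)))" if "\<nu> = 2 * \<gamma> - 1" "\<nu> < 1"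
  proof -
    have "\<nu> \<noteq> 1" using that by simp
    from separated[of "2 * \<gamma> - 1" 1 0 1, unfolded Sq[OF this]] show ?thesis unfolding half
      using A2 that one Suc_powr_tendsto_0[of "\<nu> - 1"] by (simp add: add.commute)
  qed
  have d: "converges_stably_to_normal M (\<lambda>n \<omega>. sqrt (real n) *\<^sub>R (P.Y n \<omega> - vec (Zinf \<omega>)))
          (\<lambda>\<omega>. P.v \<omega> *\<^sub>R
             (Sigma_tilde 1 c V \<iota> +
              block_matrix
                (U ** S11 (of_real c) P.\<alpha> V \<iota> ** transpose U)
                (U ** S12 (of_real c) (of_real q) P.\<alpha> V \<iota> ** transpose U)
                (U ** transpose (S12 (of_real c) (of_real q) P.\<alpha> V \<iota>) ** transpose U)
                (U ** S22 (of_real c) (of_real q) P.\<alpha> V \<iota> ** transpose U)))" if "\<gamma> = 1" "\<nu> = 1"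
    using P.normal_limit_critical[OF A2(1-6) r_lim s_lim gap A3(5) that] by (simp add: powr_half_sqrt add.commute)
  \<comment> \<open>With \<open>\<nu> = 1\<close> the exponent
    \<open>p - 2 * \<gamma> + \<nu>\<close> belonging to \<open>C\<close> is zero: the lag of the
    weighted means behind the common martingale stays visible, with net rate
    \<open>2 * q - p\<close>.\<close>
  have e: "converges_stably_to_normal M
          (\<lambda>n \<omega>. (real n powr (\<gamma> - 1/2)) *\<^sub>R (P.Y n \<omega> - vec (Zinf \<omega>)))
          (\<lambda>\<omega>. P.v \<omega> *\<^sub>R
             (Sigma_tilde \<gamma> c V \<iota> +
              ((norm (column \<iota> V))\<^sup>2 * c\<^sup>2 / (real CARD('n) * (2 * q - (2 * \<gamma> - 1)))) *\<^sub>R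
                block_matrix 0 0 0 ones_matrix))" if "2 * \<gamma> - 1 < \<nu>" "\<nu> = 1"
  proof -
    have "(if \<nu> = 1 then 2 * \<gamma> - 1 else 0) = 2 * \<gamma> - 1" using that by simp
    from separated[of "2 * \<gamma> - 1" 0 1 1, unfolded this P.first_block] show ?thesis unfolding half
      using A2 that one Suc_powr_tendsto_0[of "2 * \<gamma> - 1 - \<nu>"] Suc_powr_tendsto_0[of "\<gamma> - 1"] by (simp add: add.commute)
  qed
  \<comment> \<open>Because \<open>1/2 < \<nu>\<close>, each comparison of \<nu> with
    \<open>\<gamma>0\<close> becomes one with \<open>2 * \<gamma> - 1\<close>.\<close>
  show ?thesis using a b cc d e A2(3) unfolding Y \<alpha> P.v_def by (auto simp: \<gamma>0_def max_def split: if_splits)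
qed

end
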